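(* Let $\{Y_n; n\ge 1\}$ be a sequence of independent and identically distributed random variables in a sub-linear expectation space $(\Omega,\mathscr{H},\widehat{\mathbb E})$, and let $\mathbb V$ be a capacity associated with $\widehat{\mathbb E}$ (as defined in the context). Let $p>2$, $t_j=\sqrt{2\log\log j}$, and $b_j=\alpha_j\sqrt{j}/\sqrt{2\log\log j}$, where $\alpha_j>0$ are such that $\alpha_j\to0$, $b_j\nearrow\infty$ and $\alpha_j^{1-p}t_j^{-2}\to0$. Let $V_n\ge 0$ be given by $V_n^2=\sum_{j=1}^n(Y_j^2\wedge b_j^2)$. Suppose there is a family $\mathscr{P}$ of probability measures on $(\Omega,\sigma(\mathscr{H}))$ such that $$\widehat{\mathbb E}[X]=\sup_{P\in\mathscr{P}}P[X]\quad\text{for all bounded }X\in\mathscr{H},\qquad P[X]:=\int X\,dP.$$ Assume that $$C_{\mathbb V}\left[\frac{Y_1^2}{\log\log|Y_1|}\right]<\infty,$$ that the limits $\breve{\mathbb E}[Y_1]$ and $\breve{\mathbb E}[-Y_1]$ exist with $\breve{\mathbb E}[Y_1]=\breve{\mathbb E}[-Y_1]=0$, and that $\underline{\sigma}^2>0$ and $\overline{\sigma}^2<\infty$, where $\overline{\sigma}^2=\lim_{c\to\infty}\widehat{\mathbb E}[Y_1^2\wedge c]$ and $\underline{\sigma}^2=\lim_{c\to\infty}\widehat{\mathcal E}[Y_1^2\wedge c]$. Then $$\mathcal V^{\mathscr{P}}\left(C\left\{\frac{\sum_{i=1}^nY_i}{V_n\sqrt{2\log\log n}}\right\}=[-1,1]\right)=1,$$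 where $C\{x_n\}$ denotes the cluster set of a sequence $\{x_n\}$ in $\mathbb R$.
   Context: Sub-linear expectation space. $(\Omega,\mathcal F)$ is a measurable space and $\mathscr{H}$ is a linear space of real measurable functions on $(\Omega,\mathcal F)$ (called random variables) such that $X_1,\ldots,X_n\in\mathscr{H}$ implies $\varphi(X_1,\ldots,X_n)\in\mathscr{H}$ for each $\varphi\in C_{l,Lip}(\mathbb R^n)$, where $C_{l,Lip}(\mathbb R^n)$ is the linear space of functions $\varphi$ with $|\varphi(\boldsymbol x)-\varphi(\boldsymbol y)|\le C(1+|\boldsymbol x|^m+|\boldsymbol y|^m)|\boldsymbol x-\boldsymbol y|$ for all $\boldsymbol x,\boldsymbol y\in\mathbb R^n$, for some $C>0$, $m\in\mathbb N$ depending on $\varphi$. $C_{b,Lip}(\mathbb R^n)$ is the space of bounded Lipschitz functions. A sub-linear expectation is a function $\widehat{\mathbb E}:\mathscr{H}\to[-\infty,\infty]$ such that for all $X,Y\in\mathscr{H}$: (a) $X\ge Y$ implies $\widehat{\mathbb E}[X]\ge\widehat{\mathbb E}[Y]$; (b) $\widehat{\mathbb E}[c]=c$ for constants $c$; (c) $\widehat{\mathbb E}[X+Y]\le\widehat{\mathbb E}[X]+\widehat{\mathbb E}[Y]$ whenever the right side is not of the form $+\infty-\infty$ or $-\infty+\infty$; (d) $\widehat{\mathbb E}[\lambda X]=\lambda\widehat{\mathbb E}[X]$ for $\lambda\ge0$ (with $0\cdot\infty=0$). The conjugate expectation is $\widehat{\mathcal E}[X]:=-\widehat{\mathbb E}[-X]$.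 Independence and identical distribution. $\boldsymbol X_1\overset{d}{=}\boldsymbol X_2$ ($n$-dimensional random vectors in possibly different sub-linear expectation spaces) means $\widehat{\mathbb E}_1[\varphi(\boldsymbol X_1)]=\widehat{\mathbb E}_2[\varphi(\boldsymbol X_2)]$ for all $\varphi\in C_{b,Lip}(\mathbb R^n)$; $\{X_n\}$ is identically distributed if $X_i\overset{d}{=}X_1$ for each $i$. A random vector $\boldsymbol Y\in\mathscr{H}^n$ is independent to $\boldsymbol X\in\mathscr{H}^m$ if $\widehat{\mathbb E}[\varphi(\boldsymbol X,\boldsymbol Y)]=\widehat{\mathbb E}\big[\widehat{\mathbb E}[\varphi(\boldsymbol x,\boldsymbol Y)]\big|_{\boldsymbol x=\boldsymbol X}\big]$ for all $\varphi\in C_{b,Lip}(\mathbb R^m\times\mathbb R^n)$. A sequence $\{X_n;n\ge1\}$ is independent if $X_{i+1}$ is independent to $(X_1,\ldots,X_i)$ for each $i\ge1$. Capacities. $\mathbb V:\mathcal F\to[0,1]$ denotes a capacity associated with $\widehat{\mathbb E}$, meaning: $\widehat{\mathbb E}[f]\le\mathbb V(A)\le\widehat{\mathbb E}[g]$ whenever $f\le I_A\le g$, $f,g\in\mathscr{H}$, $A\in\mathcal F$, and $\mathbb V(A\cup B)\le\mathbb V(A)+\mathbb V(B)$ for all $A,B\in\mathcal F$. The Choquet integral is $C_{\mathbb V}[X]=\int_0^\infty\mathbb V(X\ge t)\,dt+\int_{-\infty}^0[\mathbb V(X\ge t)-1]\,dt$ (for $X\in\mathscr{H}$ it does not depend on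 the choice of such $\mathbb V$). Further, $\mathbb V^{\mathscr{P}}(A)=\sup_{P\in\mathscr{P}}P(A)$ and $\mathcal V^{\mathscr{P}}(A)=1-\mathbb V^{\mathscr{P}}(A^c)=\inf_{P\in\mathscr{P}}P(A)$. Notation. $x\wedge y=\min(x,y)$, $x\vee y=\max(x,y)$, $\log x=\ln\max(e,x)$ (so $\log\log x=\ln\max(e,\ln\max(e,x))$). $X^{(c)}=(-c)\vee X\wedge c$ for $c>0$, and $\breve{\mathbb E}[X]=\lim_{c\to\infty}\widehat{\mathbb E}[X^{(c)}]$ if the limit exists. *)

theory Defs
  imports "HOL-Probability.Probability"
begin

text \<open>
  The dimension \<open>n\<close> of \<open>\<real>\<^sup>n\<close> varies inside the definitions below (independence of a sequence
  involves every dimension), so a point of \<open>\<real>\<^sup>n\<close> is given by the coordinates \<open>x 0, \<dots>, x (n - 1)\<close>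
  of a function \<open>x :: nat \<Rightarrow> real\<close>, with Euclidean norm \<open>L2_set x {..<n}\<close>.  Both regularity
  conditions force \<open>\<phi> x = \<phi> y\<close> when \<open>x\<close> and \<open>y\<close> agree on \<open>{..<n}\<close>, so the functions
  \<open>\<phi> :: (nat \<Rightarrow> real) \<Rightarrow> real\<close> satisfying them are exactly the corresponding functions on \<open>\<real>\<^sup>n\<close>.
\<close>

definition C_l_Lip :: "nat \<Rightarrow> ((nat \<Rightarrow> real) \<Rightarrow> real) set" where
  "C_l_Lip n = {\<phi>. \<exists>C>0. \<exists>m::nat. \<forall>x y.
     \<bar>\<phi> x - \<phi> y\<bar> \<le> C * (1 + L2_set x {..<n} ^ m + L2_set y {..<n} ^ m) * L2_set (\<lambda>i. x i - y i) {..<n}}"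

definition C_b_Lip :: "nat \<Rightarrow> ((nat \<Rightarrow> real) \<Rightarrow> real) set" where
  "C_b_Lip n = {\<phi>. (\<exists>B. \<forall>x. \<bar>\<phi> x\<bar> \<le> B) \<and>
     (\<exists>L. \<forall>x y. \<bar>\<phi> x - \<phi> y\<bar> \<le> L * L2_set (\<lambda>i. x i - y i) {..<n})}"

text \<open>
  Only the underlying measurable space of \<open>M\<close> matters.  Elements of \<open>H\<close> are functions on
  \<open>space M\<close>; their values elsewhere are irrelevant, since monotonicity makes \<open>E\<close> insensitive
  to them.  In \<open>ereal\<close>, \<open>0 * \<infinity> = 0\<close>.
\<close>

locale sublinear_expectation_space =
  fixes M :: "'a measure" and H :: "('a \<Rightarrow> real) set" and E :: "('a \<Rightarrow> real) \<Rightarrow> ereal"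
  assumes H_measurable: "H \<subseteq> borel_measurable M"
    and H_zero: "(\<lambda>\<omega>. 0) \<in> H"
    and H_add: "\<And>X Y. X \<in> H \<Longrightarrow> Y \<in> H \<Longrightarrow> (\<lambda>\<omega>. X \<omega> + Y \<omega>) \<in> H"
    and H_scale: "\<And>X c. X \<in> H \<Longrightarrow> (\<lambda>\<omega>. c * X \<omega>) \<in> H"
    and H_comp: "\<And>n X \<phi>. (\<And>i. i < n \<Longrightarrow> X i \<in> H) \<Longrightarrow> \<phi> \<in> C_l_Lip n \<Longrightarrow> (\<lambda>\<omega>. \<phi> (\<lambda>i. X i \<omega>)) \<in> H"
    and E_mono: "\<And>X Y. X \<in> H \<Longrightarrow> Y \<in> H \<Longrightarrow> (\<And>\<omega>. \<omega> \<in> space M \<Longrightarrow> Y \<omega> \<le> X \<omega>) \<Longrightarrow> E Y \<le> E X"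
    and E_const: "\<And>c. E (\<lambda>\<omega>. c) = ereal c"
    and E_subadd: "\<And>X Y. X \<in> H \<Longrightarrow> Y \<in> H \<Longrightarrow> \<not> (E X = \<infinity> \<and> E Y = - \<infinity>) \<Longrightarrow> \<not> (E X = - \<infinity> \<and> E Y = \<infinity>)
       \<Longrightarrow> E (\<lambda>\<omega>. X \<omega> + Y \<omega>) \<le> E X + E Y"
    and E_scale: "\<And>X c. X \<in> H \<Longrightarrow> 0 \<le> c \<Longrightarrow> E (\<lambda>\<omega>. c * X \<omega>) = ereal c * E X"

definition conjugate_expectation :: "(('a \<Rightarrow> real) \<Rightarrow> ereal) \<Rightarrow> ('a \<Rightarrow> real) \<Rightarrow> ereal" where
  "conjugate_expectation E X = - E (\<lambda>\<omega>. - X \<omega>)"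

definition identically_distributed ::
  "nat \<Rightarrow> (('a \<Rightarrow> real) \<Rightarrow> ereal) \<Rightarrow> (nat \<Rightarrow> 'a \<Rightarrow> real) \<Rightarrow>
   (('b \<Rightarrow> real) \<Rightarrow> ereal) \<Rightarrow> (nat \<Rightarrow> 'b \<Rightarrow> real) \<Rightarrow> bool" where
  "identically_distributed n E1 X1 E2 X2 \<longleftrightarrow>
     (\<forall>\<phi>\<in>C_b_Lip n. E1 (\<lambda>\<omega>. \<phi> (\<lambda>i. X1 i \<omega>)) = E2 (\<lambda>\<omega>. \<phi> (\<lambda>i. X2 i \<omega>)))"

definition vec_append :: "nat \<Rightarrow> (nat \<Rightarrow> real) \<Rightarrow> (nat \<Rightarrow> real) \<Rightarrow> nat \<Rightarrow> real" where
  "vec_append m x y = (\<lambda>i. if i < m then x i else y (i - m))"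

text \<open>
  The \<open>n\<close>-dimensional \<open>Y\<close> is independent to the \<open>m\<close>-dimensional \<open>X\<close>.  The inner expectation is
  finite because \<open>\<phi>\<close> is bounded, so \<open>real_of_ereal\<close> loses nothing.
\<close>

definition independent_to ::
  "(('a \<Rightarrow> real) \<Rightarrow> ereal) \<Rightarrow> nat \<Rightarrow> (nat \<Rightarrow> 'a \<Rightarrow> real) \<Rightarrow> nat \<Rightarrow> (nat \<Rightarrow> 'a \<Rightarrow> real) \<Rightarrow> bool" where
  "independent_to E n Y m X \<longleftrightarrow>
     (\<forall>\<phi>\<in>C_b_Lip (m + n).
        E (\<lambda>\<omega>. \<phi> (vec_append m (\<lambda>i. X i \<omega>) (\<lambda>i. Y i \<omega>))) =
        E (\<lambda>\<omega>. real_of_ereal (E (\<lambda>\<omega>'. \<phi> (vec_append m (\<lambda>i. X i \<omega>) (\<lambda>i. Y i \<omega>'))))))"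

text \<open>
  Sequences \<open>X 1, X 2, \<dots>\<close> are indexed from \<open>1\<close>; the value \<open>X 0\<close> is never used.  A single random
  variable is the one-dimensional vector \<open>\<lambda>_. X i\<close>, and \<open>\<lambda>k. X (Suc k)\<close> in dimension \<open>i\<close> is
  \<open>(X 1, \<dots>, X i)\<close>.
\<close>

definition iid_sequence :: "('a \<Rightarrow> real) set \<Rightarrow> (('a \<Rightarrow> real) \<Rightarrow> ereal) \<Rightarrow> (nat \<Rightarrow> 'a \<Rightarrow> real) \<Rightarrow> bool" where
  "iid_sequence H E X \<longleftrightarrow>
     (\<forall>i\<ge>1. X i \<in> H) \<and>
     (\<forall>i\<ge>1. independent_to E 1 (\<lambda>_. X (Suc i)) i (\<lambda>k. X (Suc k))) \<and>
     (\<forall>i\<ge>1. identically_distributed 1 E (\<lambda>_. X i) E (\<lambda>_. X 1))"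

definition associated_capacity ::
  "'a measure \<Rightarrow> ('a \<Rightarrow> real) set \<Rightarrow> (('a \<Rightarrow> real) \<Rightarrow> ereal) \<Rightarrow> ('a set \<Rightarrow> real) \<Rightarrow> bool" where
  "associated_capacity M H E V \<longleftrightarrow>
     (\<forall>A\<in>sets M. 0 \<le> V A \<and> V A \<le> 1) \<and>
     (\<forall>A\<in>sets M. \<forall>f\<in>H. \<forall>g\<in>H.
        (\<forall>\<omega>\<in>space M. f \<omega> \<le> indicator A \<omega> \<and> indicator A \<omega> \<le> g \<omega>) \<longrightarrow> E f \<le> ereal (V A) \<and> ereal (V A) \<le> E g) \<and>
     (\<forall>A\<in>sets M. \<forall>B\<in>sets M. V (A \<union> B) \<le> V A + V B)"

text \<open>
  The second integrand of the Choquet integral, \<open>V (X \<ge> t) - 1\<close>, is nonpositive, so its integral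
  is minus that of \<open>1 - V (X \<ge> t)\<close>.  For an associated capacity and \<open>X \<in> H\<close> the map
  \<open>t \<mapsto> V (X \<ge> t)\<close> is nonincreasing, hence Borel.
\<close>

definition choquet_integral :: "'a measure \<Rightarrow> ('a set \<Rightarrow> real) \<Rightarrow> ('a \<Rightarrow> real) \<Rightarrow> ereal" where
  "choquet_integral M V X =
     enn2ereal (\<integral>\<^sup>+t\<in>{0..}. ennreal (V {\<omega>\<in>space M. X \<omega> \<ge> t}) \<partial>lborel) -
     enn2ereal (\<integral>\<^sup>+t\<in>{..0}. ennreal (1 - V {\<omega>\<in>space M. X \<omega> \<ge> t}) \<partial>lborel)"

definition log_e :: "real \<Rightarrow> real" where
  "log_e x = ln (max (exp 1) x)"

definition truncate_rv :: "real \<Rightarrow> ('a \<Rightarrow> real) \<Rightarrow> 'a \<Rightarrow> real" where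
  "truncate_rv c X = (\<lambda>\<omega>. max (- c) (min (X \<omega>) c))"

text \<open>The limit \<open>lim E[X\<^sup>(\<^sup>c\<^sup>)]\<close> as \<open>c \<rightarrow> \<infinity>\<close> exists and equals \<open>l\<close>.\<close>

definition has_breve_expectation :: "(('a \<Rightarrow> real) \<Rightarrow> ereal) \<Rightarrow> ('a \<Rightarrow> real) \<Rightarrow> ereal \<Rightarrow> bool" where
  "has_breve_expectation E X l \<longleftrightarrow> ((\<lambda>c. E (truncate_rv c X)) \<longlongrightarrow> l) at_top"

text \<open>The next two limits always exist in \<open>[0, \<infinity>]\<close> for \<open>X \<in> H\<close>, by monotonicity in \<open>c\<close>.\<close>

definition upper_variance :: "(('a \<Rightarrow> real) \<Rightarrow> ereal) \<Rightarrow> ('a \<Rightarrow> real) \<Rightarrow> ereal" where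
  "upper_variance E X = Lim at_top (\<lambda>c::real. E (\<lambda>\<omega>. min ((X \<omega>)\<^sup>2) c))"

definition lower_variance :: "(('a \<Rightarrow> real) \<Rightarrow> ereal) \<Rightarrow> ('a \<Rightarrow> real) \<Rightarrow> ereal" where
  "lower_variance E X = Lim at_top (\<lambda>c::real. conjugate_expectation E (\<lambda>\<omega>. min ((X \<omega>)\<^sup>2) c))"

definition generated_sigma :: "'a measure \<Rightarrow> ('a \<Rightarrow> real) set \<Rightarrow> 'a measure" where
  "generated_sigma M H = sigma (space M) {X -` B \<inter> space M | X B. X \<in> H \<and> B \<in> sets borel}"

definition represents_on_bounded ::
  "'a measure \<Rightarrow> ('a \<Rightarrow> real) set \<Rightarrow> (('a \<Rightarrow> real) \<Rightarrow> ereal) \<Rightarrow> 'a measure set \<Rightarrow> bool" where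
  "represents_on_bounded M H E \<P> \<longleftrightarrow>
     (\<forall>P\<in>\<P>. prob_space P \<and> space P = space M \<and> sets P = sets (generated_sigma M H)) \<and>
     (\<forall>X\<in>H. (\<exists>K. \<forall>\<omega>\<in>space M. \<bar>X \<omega>\<bar> \<le> K) \<longrightarrow> E X = (SUP P\<in>\<P>. ereal (\<integral>\<omega>. X \<omega> \<partial>P)))"

text \<open>
  On events this is \<open>1 - sup P(A\<^sup>c)\<close>.  As \<open>measure P A = 0\<close> for a non-measurable \<open>A\<close>, the value \<open>1\<close>
  on a nonempty family of probability measures also entails that \<open>A\<close> is an event.
\<close>

definition lower_capacity :: "'a measure set \<Rightarrow> 'a set \<Rightarrow> real" where
  "lower_capacity \<P> A = (INF P\<in>\<P>. measure P A)"

definition cluster_set :: "(nat \<Rightarrow> real) \<Rightarrow> real set" where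
  "cluster_set x = {l. \<exists>r::nat \<Rightarrow> nat. strict_mono r \<and> (x \<circ> r) \<longlonglongrightarrow> l}"

end

theory Submission
  imports Defs "HOL-Real_Asymp.Real_Asymp"
begin

text \<open>
  Fix a representing measure \<open>P\<close>, with \<open>\<F>\<^sub>n\<close> generated by \<open>Y 1, \<dots>, Y n\<close>.  If \<open>\<phi>\<close> is bounded and Lipschitz
  and \<open>g \<ge> 0\<close> is a function of the past, sublinear independence gives
  \<open>P[g (\<phi> (Y (n + 1)) - E \<phi>)] \<le> 0\<close>, so under \<open>P\<close> the conditional expectation of \<open>\<phi> (Y (n + 1))\<close> given
  \<open>\<F>\<^sub>n\<close> is at most \<open>E \<phi>\<close>.  The problem thus becomes one about martingales under \<open>P\<close>.

  Truncating \<open>Y j\<close> at \<open>b j\<close> and centring conditionally yields bounded martingale differences \<open>d j\<close> whose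
  conditional variances stay between two positive constants.  For them a self-normalised law of the
  iterated logarithm holds, with normalisation \<open>\<Sum> (d j)\<^sup>2\<close>: the upper half follows from the maximal
  inequality for \<open>exp (\<theta> D - a \<theta>\<^sup>2 Q)\<close>, the lower half from a lower exponential bound over geometric
  blocks, stopped at a fixed value of the quadratic variation, and a conditional Borel-Cantelli argument.

  The part of \<open>Y j\<close> between \<open>b j\<close> and \<open>sqrt j * t j\<close>, conditionally centred, is negligible: its blockwise
  fourth moments are summable by the Choquet condition.  Its conditional mean need not be small by
  itself, but it cancels the one removed from the truncation at \<open>b j\<close>, because truncation at
  \<open>sqrt j * t j\<close> leaves a mean of order \<open>1 / (sqrt j * t j)\<close>.  Beyond \<open>sqrt j * t j\<close> only finitely many
  \<open>Y j\<close> occur.  Finally the normalised sums have increments tending to \<open>0\<close>, so their cluster set is the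
  whole interval between the two extreme limits.
\<close>

section \<open>Iterated logarithms and cluster sets\<close>

text \<open>Under a fixed \<open>P\<close> the law of \<open>Y (n + 1)\<close> given the past may
  change with the past, within what the bounded Lipschitz test functions allow. The quadratic
  variation therefore need not be asymptotically linear; only linear bounds from both sides are
  available. This is why finitely many windows are used in the upper half and stopping in the lower
  half: inside a window, or at the stopping time, the quadratic variation is known up to a factor
  near 1, and one \<open>\<theta>\<close> is nearly optimal. The growth condition on
  \<open>\<alpha>\<close> enters as \<open>1 \<le> \<alpha> j * (tt j)\<^sup>2\<close> for large
  \<open>j\<close>, that is \<open>b j \<ge> sqrt j / tt j ^ 3\<close>. So b and
  \<open>sqrt j * tt j\<close> are separated by a number of dyadic sizes of order
  \<open>ln (tt j)\<close>. Second moments would give block probabilities with weight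
  \<open>1 / tt ^ 2\<close>, all of which is spent on the factor \<open>1 / LL\<close> in the
  Choquet condition, and nothing would be left for that multiplicity. Fourth moments give
  \<open>1 / tt ^ 4\<close>; the second half of the weight dominates a geometric sum over the blocks
  in which a given size occurs.\<close>

abbreviation LL :: "real \<Rightarrow> real" where
  "LL x \<equiv> log_e (log_e x)"

lemma log_e_ge_1: "1 \<le> log_e x"
  unfolding log_e_def by (subst ln_ge_iff) (auto simp: less_max_iff_disj)

lemma log_e_mono: "x \<le> y \<Longrightarrow> log_e x \<le> log_e y"
  unfolding log_e_def by (auto simp: less_max_iff_disj)

text \<open>That is, \<open>log_e x / x\<close> is nonincreasing. Above \<open>exp 1\<close> this is
  \<open>ln (y / x) \<le> y / x - 1\<close> combined with \<open>ln x \<ge> 1\<close>; below it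
  \<open>log_e\<close> is constant. Applied twice, it compares \<open>LL\<close> at neighbouring
  scales without asymptotics.\<close>

lemma log_e_ratio:
  assumes "0 < x" "x \<le> y"
  shows "log_e y \<le> y / x * log_e x"
proof (cases "exp 1 \<le> x")
  case True
  have "ln y = ln x + ln (y / x)"
    using assms by (simp add: ln_div)
  also have "ln (y / x) \<le> y / x - 1"
    using assms by (intro ln_le_minus_one) auto
  also have "y / x - 1 \<le> (y / x - 1) * ln x"
    using assms True mult_left_mono[of 1 "ln x" "y / x - 1"] by (auto simp: ln_ge_iff)
  finally show ?thesis
    using True assms by (simp add: log_e_def max_def algebra_simps)
next
  case False
  then have x: "log_e x = 1" by (simp add: log_e_def max_def)
  show ?thesis
  proof (cases "exp 1 \<le> y")
    case True
    have "ln y = 1 + ln (y / exp 1)"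
      using assms by (simp add: ln_div)
    also have "\<dots> \<le> y / exp 1"
      using assms ln_le_minus_one[of "y / exp 1"] by simp
    also have "\<dots> \<le> y / x"
      using False assms by (intro divide_left_mono) auto
    finally show ?thesis using x True by (simp add: log_e_def max_def)
  qed (use x assms in \<open>auto simp: log_e_def max_def\<close>)
qed

lemma LL_ge_1: "1 \<le> LL x"
  by (rule log_e_ge_1)

lemma LL_pos: "0 < LL x"
  using LL_ge_1[of x] by linarith

lemma LL_mono: "x \<le> y \<Longrightarrow> LL x \<le> LL y"
  by (intro log_e_mono)

lemma LL_ratio:
  assumes "0 < x" "x \<le> y"
  shows "LL y \<le> y / x * LL x"
proof -
  have "0 < log_e x" using log_e_ge_1[of x] by linarith
  then have "LL y \<le> log_e y / log_e x * LL x"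
    using assms by (intro log_e_ratio log_e_mono) auto
  also have "\<dots> \<le> y / x * LL x"
    using log_e_ratio[OF assms] \<open>0 < log_e x\<close> LL_pos[of x] assms
    by (intro mult_right_mono) (auto simp: field_simps)
  finally show ?thesis .
qed

lemma LL_le: "1 \<le> x \<Longrightarrow> LL x \<le> x"
  using LL_ratio[of 1 x] by (simp add: log_e_def max_def)

lemma LL_at_top: "filterlim (\<lambda>n. LL (real n)) at_top sequentially"
proof (rule filterlim_at_top_mono)
  show "filterlim (\<lambda>n. ln (ln (real n))) at_top sequentially" by real_asymp
  show "\<forall>\<^sub>F n in sequentially. ln (ln (real n)) \<le> LL (real n)"
    unfolding eventually_sequentially
  proof (intro exI allI impI)
    fix n :: nat assume "3 \<le> n"
    then have "0 < ln (real n)" by simp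
    moreover have "ln (real n) \<le> log_e (real n)" using \<open>3 \<le> n\<close> by (simp add: log_e_def)
    ultimately have "0 < log_e (real n)" by linarith
    have "ln (ln (real n)) \<le> ln (log_e (real n))"
      using \<open>ln (real n) \<le> log_e (real n)\<close> \<open>0 < ln (real n)\<close> by simp
    also have "\<dots> \<le> LL (real n)"
      using \<open>0 < log_e (real n)\<close> by (simp add: log_e_def)
    finally show "ln (ln (real n)) \<le> LL (real n)" .
  qed
qed

definition tt :: "nat \<Rightarrow> real" where
  "tt n = sqrt (2 * LL (real n))"

lemma tt_sq: "(tt n)\<^sup>2 = 2 * LL (real n)"
  using LL_pos[of "real n"] by (simp add: tt_def)

lemma tt_ge_1: "1 \<le> tt n"
  using LL_ge_1[of "real n"] by (simp add: tt_def)

lemma tt_pos: "0 < tt n"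
  using tt_ge_1[of n] by linarith

lemma tt_mono: "m \<le> n \<Longrightarrow> tt m \<le> tt n"
  by (simp add: tt_def LL_mono)

lemma tt_at_top: "filterlim tt at_top sequentially"
  unfolding tt_def[abs_def]
  by (intro filterlim_compose[OF sqrt_at_top] filterlim_tendsto_pos_mult_at_top[OF tendsto_const] LL_at_top) auto

lemma exp_minus_LL_le:
  assumes "0 < K" "1 < x"
  shows "exp (- K * LL x) \<le> (ln x) powr (- K)"
proof -
  have "0 < ln x" using assms by simp
  have "ln x \<le> log_e x" using assms by (simp add: log_e_def)
  moreover have "0 < log_e x" using log_e_ge_1[of x] by linarith
  ultimately have "ln (ln x) \<le> LL x"
    using \<open>0 < ln x\<close> log_e_def[of "log_e x"] by (smt (verit) ln_mono)
  then have "exp (- K * LL x) \<le> exp (- K * ln (ln x))"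
    using assms by simp
  also have "\<dots> = (ln x) powr (- K)"
    using \<open>0 < ln x\<close> by (simp add: powr_def)
  finally show ?thesis .
qed

text \<open>Along the powers of \<open>L\<close> the logarithm is linear in \<open>k\<close>, so the
  terms are dominated by a multiple of \<open>k powr (- K)\<close>. The exponential tail bounds
  below all end here, with \<open>K\<close> strictly above the critical value
  \<open>1\<close>.\<close>

lemma summable_exp_LL:
  assumes "1 < K" "2 \<le> (L::nat)"
  shows "summable (\<lambda>k. exp (- K * LL (real (L ^ k))))"
proof (rule summable_comparison_test')
  have "summable (\<lambda>k. real k powr (- K))"
    using assms by (simp add: summable_real_powr_iff)
  then show "summable (\<lambda>k. (ln (real L)) powr (- K) * real k powr (- K))"
    by (rule summable_mult)
  fix k :: nat assume "1 \<le> k"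
  then have "1 < L ^ k" using assms by (intro one_less_power) auto
  then have "1 < real (L ^ k)" by linarith
  then have "exp (- K * LL (real (L ^ k))) \<le> (ln (real (L ^ k))) powr (- K)"
    using assms by (intro exp_minus_LL_le) auto
  also have "ln (real (L ^ k)) = ln (real L) * real k"
    using assms by (simp add: ln_realpow)
  also have "\<dots> powr (- K) = (ln (real L)) powr (- K) * real k powr (- K)"
    by (rule powr_mult)
  finally show "norm (exp (- K * LL (real (L ^ k)))) \<le> (ln (real L)) powr (- K) * real k powr (- K)"
    by simp
qed

text \<open>At the critical exponent \<open>1\<close> the terms are eventually those of a harmonic
  series. The divergence feeds the conditional Borel-Cantelli argument, so the block probabilities
  of the lower bound must reach this size up to a constant factor.\<close>

lemma not_summable_exp_LL:
  assumes "2 \<le> (L::nat)"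
  shows "\<not> summable (\<lambda>k. exp (- LL (real (L ^ Suc k))))"
proof
  assume "summable (\<lambda>k. exp (- LL (real (L ^ Suc k))))"
  moreover have "eventually (\<lambda>k. norm (1 / (ln (real L) * real (Suc k))) \<le> exp (- LL (real (L ^ Suc k)))) sequentially"
  proof -
    have "filterlim (\<lambda>k. ln (real L) * real (Suc k)) at_top sequentially"
      using assms by real_asymp
    then have "eventually (\<lambda>k. ln (real L) * real (Suc k) \<ge> exp 1) sequentially"
      by (simp add: filterlim_at_top)
    then show ?thesis
    proof eventually_elim
      case (elim k)
      have 1: "ln (real (L ^ Suc k)) = ln (real L) * real (Suc k)"
        using assms by (subst of_nat_power, subst ln_realpow) auto
      have pos: "ln (real (L ^ Suc k)) > 0" using 1 elim exp_gt_zero[of "1::real"] by linarith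
      have "1 \<le> ln (real (L ^ Suc k))"
        using elim 1 exp_ge_add_one_self[of "1::real"] by linarith
      then have "log_e (real (L ^ Suc k)) = ln (real (L ^ Suc k))"
        using assms ln_ge_iff[of "real (L ^ Suc k)" 1] by (simp add: log_e_def max_def)
      then have "exp (- LL (real (L ^ Suc k))) = 1 / ln (real (L ^ Suc k))"
        using elim 1 pos by (simp add: log_e_def[of "ln (real L) * (1 + real k)"] max_def exp_minus inverse_eq_divide)
      then show ?case using 1 pos by (simp del: power_Suc of_nat_power)
    qed
  qed
  ultimately have "summable (\<lambda>k. 1 / (ln (real L) * real (Suc k)))"
    by (rule summable_comparison_test_ev[rotated])
  then have "summable (\<lambda>k. ln (real L) * (1 / (ln (real L) * real (Suc k))))"
    by (rule summable_mult)
  moreover have "ln (real L) > 0" using assms by simp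
  then have "(\<lambda>k. ln (real L) * (1 / (ln (real L) * real (Suc k)))) = (\<lambda>k. inverse (real (Suc k)))"
    by (intro ext) (simp add: inverse_eq_divide del: of_nat_Suc)
  ultimately have "summable (\<lambda>k. inverse (real (Suc k)))" by simp
  then have "summable (\<lambda>k. inverse (real k))"
    by (subst (asm) summable_Suc_iff) assumption
  then show False
    using not_summable_harmonic by blast
qed

text \<open>
  Keeping \<open>x\<^sup>2\<close> in the exponent is what makes the law of the iterated logarithm self-normalised:
  with \<open>a\<close> slightly above (below) \<open>1/2\<close> the exponential of \<open>x - a x\<^sup>2\<close> lies below (above) \<open>1 + x\<close>,
  whose conditional mean is \<open>1\<close>, so no conditional variance enters.
\<close>

lemma exp_quadratic_bounds:
  fixes a \<eta> :: real
  assumes "\<eta> > 0"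
  shows "\<exists>\<delta>>0. \<forall>x. \<bar>x\<bar> \<le> \<delta> \<longrightarrow>
    exp (x - a * x\<^sup>2) \<le> 1 + x - (a - 1/2 - \<eta>) * x\<^sup>2 \<and>
    1 + x + (1/2 - a - \<eta>) * x\<^sup>2 \<le> exp (x - a * x\<^sup>2)"
proof -
  have "((\<lambda>x. (exp (x - a * x\<^sup>2) - 1 - x) / x\<^sup>2) \<longlongrightarrow> 1/2 - a) (at 0)"
    by real_asymp
  then have "eventually (\<lambda>x. dist ((exp (x - a * x\<^sup>2) - 1 - x) / x\<^sup>2) (1/2 - a) < \<eta>) (at 0)"
    using assms by (rule tendstoD)
  then obtain e where e: "e > 0" "\<And>x. x \<noteq> 0 \<Longrightarrow> \<bar>x\<bar> < e \<Longrightarrow> \<bar>(exp (x - a * x\<^sup>2) - 1 - x) / x\<^sup>2 - (1/2 - a)\<bar> < \<eta>"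
    by (auto simp: eventually_at dist_real_def)
  show ?thesis
  proof (intro exI[of _ "e / 2"] conjI allI impI)
    show "e / 2 > 0" using e by simp
  next
    fix x assume "\<bar>x\<bar> \<le> e/2"
    show "exp (x - a * x\<^sup>2) \<le> 1 + x - (a - 1/2 - \<eta>) * x\<^sup>2"
    proof (cases "x = 0")
      case False
      then have "(exp (x - a * x\<^sup>2) - 1 - x) / x\<^sup>2 \<le> 1/2 - a + \<eta>"
        using e(1) e(2)[of x] \<open>\<bar>x\<bar> \<le> e/2\<close> by linarith
      then show ?thesis using False by (simp add: field_simps)
    qed simp
  next
    fix x assume "\<bar>x\<bar> \<le> e/2"
    show "1 + x + (1/2 - a - \<eta>) * x\<^sup>2 \<le> exp (x - a * x\<^sup>2)"
    proof (cases "x = 0")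
      case False
      then have "(exp (x - a * x\<^sup>2) - 1 - x) / x\<^sup>2 \<ge> 1/2 - a - \<eta>"
        using e(1) e(2)[of x] \<open>\<bar>x\<bar> \<le> e/2\<close> by linarith
      then show ?thesis using False by (simp add: field_simps)
    qed simp
  qed
qed

section \<open>Cluster sets of real sequences\<close>

lemma cluster_set_iff:
  "l \<in> cluster_set x \<longleftrightarrow> (\<forall>e>0. \<exists>\<^sub>\<infinity>n. \<bar>x n - l\<bar> < e)"
proof
  assume "l \<in> cluster_set x"
  then obtain r :: "nat \<Rightarrow> nat" where r: "strict_mono r" "(x \<circ> r) \<longlonglongrightarrow> l"
    by (auto simp: cluster_set_def)
  show "\<forall>e>0. \<exists>\<^sub>\<infinity>n. \<bar>x n - l\<bar> < e"
  proof (intro allI impI)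
    fix e :: real assume "e > 0"
    then obtain N where N: "\<And>n. n \<ge> N \<Longrightarrow> \<bar>x (r n) - l\<bar> < e"
      using LIMSEQ_D[OF r(2), of e] by auto
    show "\<exists>\<^sub>\<infinity>n. \<bar>x n - l\<bar> < e"
      unfolding INFM_nat_le
    proof
      fix m
      have "m \<le> r (max m N)"
        using seq_suble[OF r(1), of "max m N"] by linarith
      then show "\<exists>n\<ge>m. \<bar>x n - l\<bar> < e" using N[of "max m N"] by auto
    qed
  qed
next
  assume *: "\<forall>e>0. \<exists>\<^sub>\<infinity>n. \<bar>x n - l\<bar> < e"
  have "\<exists>r::nat\<Rightarrow>nat. \<forall>n. \<bar>x (r n) - l\<bar> < 1 / Suc n \<and> r n < r (Suc n)"
  proof (rule dependent_nat_choice)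
    show "\<exists>m. \<bar>x m - l\<bar> < 1 / Suc 0"
      using *[rule_format, of 1] by (auto dest: INFM_EX)
    fix m n :: nat
    show "\<exists>k. \<bar>x k - l\<bar> < 1 / Suc (Suc n) \<and> m < k"
      using *[rule_format, of "1 / Suc (Suc n)"] by (auto simp: INFM_nat)
  qed
  then obtain r :: "nat \<Rightarrow> nat" where r: "\<And>n. \<bar>x (r n) - l\<bar> < 1 / Suc n" "\<And>n. r n < r (Suc n)"
    by blast
  have "(\<lambda>n. x (r n) - l) \<longlonglongrightarrow> 0"
  proof (rule Lim_null_comparison)
    show "(\<lambda>n. 1 / real (Suc n)) \<longlonglongrightarrow> 0" by real_asymp
    show "\<forall>\<^sub>F n in sequentially. norm (x (r n) - l) \<le> 1 / real (Suc n)"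
      using r(1) by (intro always_eventually allI) (simp only: real_norm_def less_imp_le)
  qed
  then have "(x \<circ> r) \<longlonglongrightarrow> l" by (simp add: LIM_zero_iff o_def)
  moreover have "strict_mono r" using r(2) by (simp add: strict_mono_Suc_iff)
  ultimately show "l \<in> cluster_set x" by (auto simp: cluster_set_def)
qed

text \<open>A discrete intermediate value argument. If \<open>l\<close> is not a cluster point, the
  sequence eventually avoids \<open>(l - e, l + e)\<close>, a gap that steps smaller than
  \<open>e\<close> cannot cross. It then stays on one side, against the infinitely many visits near
  \<open>1\<close> or near \<open>- 1\<close>.\<close>

lemma cluster_set_eq_interval:
  fixes x :: "nat \<Rightarrow> real"
  assumes up: "\<And>e. e > 0 \<Longrightarrow> \<forall>\<^sub>\<infinity>n. \<bar>x n\<bar> \<le> 1 + e"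
    and hi: "\<And>e. e > 0 \<Longrightarrow> \<exists>\<^sub>\<infinity>n. x n \<ge> 1 - e"
    and lo: "\<And>e. e > 0 \<Longrightarrow> \<exists>\<^sub>\<infinity>n. x n \<le> - 1 + e"
    and step: "(\<lambda>n. x (Suc n) - x n) \<longlonglongrightarrow> 0"
  shows "cluster_set x = {-1..1}"
proof (intro set_eqI iffI)
  fix l assume l: "l \<in> cluster_set x"
  show "l \<in> {-1..1}"
  proof (rule ccontr)
    assume "l \<notin> {-1..1}"
    then have e: "(\<bar>l\<bar> - 1) / 2 > 0" by auto
    then have "\<exists>\<^sub>\<infinity>n. \<bar>x n - l\<bar> < (\<bar>l\<bar> - 1) / 2"
      using l unfolding cluster_set_iff by blast
    then have "\<exists>\<^sub>\<infinity>n. \<bar>x n - l\<bar> < (\<bar>l\<bar> - 1) / 2 \<and> \<bar>x n\<bar> \<le> 1 + (\<bar>l\<bar> - 1) / 2"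
      using up[OF e] by (rule INFM_conjI)
    then obtain n where "\<bar>x n - l\<bar> < (\<bar>l\<bar> - 1) / 2" "\<bar>x n\<bar> \<le> 1 + (\<bar>l\<bar> - 1) / 2"
      by (auto dest: INFM_EX)
    then show False by (simp only: abs_le_iff field_simps) argo
  qed
next
  fix l :: real assume l: "l \<in> {-1..1}"
  show "l \<in> cluster_set x"
    unfolding cluster_set_iff
  proof (intro allI impI, rule ccontr)
    fix e :: real assume e: "e > 0" and "\<not> (\<exists>\<^sub>\<infinity>n. \<bar>x n - l\<bar> < e)"
    then obtain N1 where N1: "\<And>n. n \<ge> N1 \<Longrightarrow> \<bar>x n - l\<bar> \<ge> e"
      by (auto simp: INFM_nat_le not_less)
    from LIMSEQ_D[OF step e] obtain N2 where N2: "\<And>n. n \<ge> N2 \<Longrightarrow> \<bar>x (Suc n) - x n\<bar> < e"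
      by auto
    define N where "N = max N1 N2"
    have e2: "e / 2 > 0" using e by simp
    have "x N \<ge> l + e \<or> x N \<le> l - e"
      using N1[of N] unfolding N_def by linarith
    then show False
    proof
      assume *: "x N \<ge> l + e"
      have "x n \<ge> l + e" if "n \<ge> N" for n
        using that
      proof (induction n rule: dec_induct)
        case (step n)
        then show ?case using N1[of "Suc n"] N2[of n] e unfolding N_def by linarith
      qed (rule *)
      moreover obtain n where "n \<ge> N" "x n \<le> - 1 + e / 2"
        using lo[OF e2] by (auto simp: INFM_nat_le)
      ultimately show False using l e by force
    next
      assume *: "x N \<le> l - e"
      have "x n \<le> l - e" if "n \<ge> N" for n
        using that
      proof (induction n rule: dec_induct)
        case (step n)
        then show ?case using N1[of "Suc n"] N2[of n] e unfolding N_def by linarith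
      qed (rule *)
      moreover obtain n where "n \<ge> N" "x n \<ge> 1 - e / 2"
        using hi[OF e2] by (auto simp: INFM_nat_le)
      ultimately show False using l e by force
    qed
  qed
qed

section \<open>Exponential supermartingales\<close>

text \<open>The bound is required at every point, also outside \<open>space N\<close>, so that
  products, exponentials and pointwise estimates carry no almost-everywhere or membership
  conditions.\<close>

definition bmeas :: "'a measure \<Rightarrow> ('a \<Rightarrow> real) set" where
  "bmeas N = {G \<in> borel_measurable N. \<exists>B. \<forall>\<omega>. \<bar>G \<omega>\<bar> \<le> B}"

lemma bmeasI: "G \<in> borel_measurable N \<Longrightarrow> (\<And>\<omega>. \<bar>G \<omega>\<bar> \<le> B) \<Longrightarrow> G \<in> bmeas N"
  by (auto simp: bmeas_def)

lemma bmeas_measurable: "G \<in> bmeas N \<Longrightarrow> G \<in> borel_measurable N"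
  by (auto simp: bmeas_def)

lemma bmeas_bound: "G \<in> bmeas N \<Longrightarrow> \<exists>B. \<forall>\<omega>. \<bar>G \<omega>\<bar> \<le> B"
  by (auto simp: bmeas_def)

lemma bmeas_const [intro, simp]: "(\<lambda>_. c) \<in> bmeas N"
  by (rule bmeasI[of _ _ "\<bar>c\<bar>"]) auto

lemma bmeas_indicator [intro, simp]: "A \<in> sets N \<Longrightarrow> indicator A \<in> bmeas N"
  by (rule bmeasI[of _ _ 1]) (auto simp: indicator_def)

lemma bmeas_mult [intro]:
  assumes "f \<in> bmeas N" "g \<in> bmeas N"
  shows "(\<lambda>\<omega>. f \<omega> * g \<omega>) \<in> bmeas N"
proof -
  obtain A B where "\<And>\<omega>. \<bar>f \<omega>\<bar> \<le> A" "\<And>\<omega>. \<bar>g \<omega>\<bar> \<le> B"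
    using bmeas_bound assms by metis
  then have "\<bar>f \<omega> * g \<omega>\<bar> \<le> A * B" for \<omega>
    unfolding abs_mult by (meson abs_ge_zero mult_mono order_trans)
  then show ?thesis using assms[THEN bmeas_measurable] by (intro bmeasI) measurable
qed

lemma bmeas_add [intro]:
  assumes "f \<in> bmeas N" "g \<in> bmeas N"
  shows "(\<lambda>\<omega>. f \<omega> + g \<omega>) \<in> bmeas N"
proof -
  obtain A B where "\<And>\<omega>. \<bar>f \<omega>\<bar> \<le> A" "\<And>\<omega>. \<bar>g \<omega>\<bar> \<le> B"
    using bmeas_bound assms by metis
  then have "\<bar>f \<omega> + g \<omega>\<bar> \<le> A + B" for \<omega>
    by (meson abs_triangle_ineq add_mono order_trans)
  then show ?thesis using assms[THEN bmeas_measurable] by (intro bmeasI) measurable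
qed

lemma bmeas_cmult [intro]: "f \<in> bmeas N \<Longrightarrow> (\<lambda>\<omega>. c * f \<omega>) \<in> bmeas N"
  by (intro bmeas_mult bmeas_const)

lemma bmeas_uminus [intro]: "f \<in> bmeas N \<Longrightarrow> (\<lambda>\<omega>. - f \<omega>) \<in> bmeas N"
  using bmeas_cmult[of f N "-1"] by simp

lemma bmeas_diff [intro]:
  "f \<in> bmeas N \<Longrightarrow> g \<in> bmeas N \<Longrightarrow> (\<lambda>\<omega>. f \<omega> - g \<omega>) \<in> bmeas N"
  using bmeas_add[of f N "\<lambda>\<omega>. - g \<omega>"] bmeas_uminus[of g N] by simp

lemma bmeas_power [intro]: "f \<in> bmeas N \<Longrightarrow> (\<lambda>\<omega>. f \<omega> ^ k) \<in> bmeas N"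
  by (induction k) auto

lemma bmeas_sum [intro]: "(\<And>i. i \<in> I \<Longrightarrow> f i \<in> bmeas N) \<Longrightarrow> (\<lambda>\<omega>. \<Sum>i\<in>I. f i \<omega>) \<in> bmeas N"
  by (induction I rule: infinite_finite_induct) auto

lemma bmeas_prod [intro]: "(\<And>i. i \<in> I \<Longrightarrow> f i \<in> bmeas N) \<Longrightarrow> (\<lambda>\<omega>. \<Prod>i\<in>I. f i \<omega>) \<in> bmeas N"
  by (induction I rule: infinite_finite_induct) auto

lemma bmeas_exp [intro]:
  assumes "f \<in> bmeas N"
  shows "(\<lambda>\<omega>. exp (f \<omega>)) \<in> bmeas N"
proof -
  obtain A where "\<And>\<omega>. \<bar>f \<omega>\<bar> \<le> A" using bmeas_bound assms by metis
  then have "\<bar>exp (f \<omega>)\<bar> \<le> exp A" for \<omega> using abs_le_D1 by auto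
  then show ?thesis using assms[THEN bmeas_measurable] by (intro bmeasI) measurable
qed

lemma bmeas_if [intro]:
  assumes "f \<in> bmeas N" "g \<in> bmeas N" "{\<omega> \<in> space N. P \<omega>} \<in> sets N"
  shows "(\<lambda>\<omega>. if P \<omega> then f \<omega> else g \<omega>) \<in> bmeas N"
proof -
  obtain A B where "\<And>\<omega>. \<bar>f \<omega>\<bar> \<le> A" "\<And>\<omega>. \<bar>g \<omega>\<bar> \<le> B"
    using bmeas_bound assms by metis
  then have "\<bar>if P \<omega> then f \<omega> else g \<omega>\<bar> \<le> max A B" for \<omega>
    by (simp add: le_max_iff_disj)
  moreover have "(\<lambda>\<omega>. if P \<omega> then f \<omega> else g \<omega>) \<in> borel_measurable N"
    using assms by (intro measurable_If) (auto dest: bmeas_measurable)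
  ultimately show ?thesis by (rule bmeasI[rotated])
qed

locale filtered_prob_space = prob_space M for M :: "'a measure" +
  fixes F :: "nat \<Rightarrow> 'a measure"
  assumes subalg: "\<And>n. subalgebra M (F n)"
    and F_Suc: "\<And>n. sets (F n) \<subseteq> sets (F (Suc n))"
begin

lemma space_F [simp]: "space (F n) = space M"
  using subalg[of n] by (simp add: subalgebra_def)

lemma F_mono: "m \<le> n \<Longrightarrow> sets (F m) \<subseteq> sets (F n)"
  by (rule lift_Suc_mono_le[of "\<lambda>n. sets (F n)"]) (rule F_Suc)

lemma measurable_F_mono: "m \<le> n \<Longrightarrow> f \<in> borel_measurable (F m) \<Longrightarrow> f \<in> borel_measurable (F n)"
  using F_mono[of m n] by (auto simp: measurable_def)

lemma measurable_F_M: "f \<in> borel_measurable (F n) \<Longrightarrow> f \<in> borel_measurable M"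
  by (rule measurable_from_subalg[OF subalg])

lemma sets_F_M: "A \<in> sets (F n) \<Longrightarrow> A \<in> sets M"
  using subalg[of n] by (auto simp: subalgebra_def)

lemma bmeas_F_mono: "m \<le> n \<Longrightarrow> f \<in> bmeas (F m) \<Longrightarrow> f \<in> bmeas (F n)"
  using measurable_F_mono by (auto simp: bmeas_def)

lemma bmeas_F_M: "f \<in> bmeas (F n) \<Longrightarrow> f \<in> bmeas M"
  using measurable_F_M by (auto simp: bmeas_def)

lemma bmeas_integrable:
  assumes "f \<in> bmeas M"
  shows "integrable M f"
proof -
  obtain B where "\<And>\<omega>. \<bar>f \<omega>\<bar> \<le> B" using bmeas_bound assms by metis
  then show ?thesis
    using bmeas_measurable[OF assms] by (intro integrable_const_bound[of _ B]) auto
qed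

lemma bmeas_F_integrable: "f \<in> bmeas (F n) \<Longrightarrow> integrable M f"
  by (intro bmeas_integrable bmeas_F_M)

text \<open>The conditional mean given \<open>F n\<close> is at most \<open>1\<close> (for
  \<open>sub_factor\<close>: at least \<open>1\<close>), expressed by testing against weights from
  the past. A product of such factors over consecutive indices is a supermartingale
  (submartingale).\<close>

definition sup_factor :: "nat \<Rightarrow> ('a \<Rightarrow> real) \<Rightarrow> bool" where
  "sup_factor n f \<longleftrightarrow> f \<in> bmeas (F (Suc n)) \<and> (\<forall>\<omega>. 0 \<le> f \<omega>) \<and>
     (\<forall>G\<in>bmeas (F n). (\<forall>\<omega>. 0 \<le> G \<omega>) \<longrightarrow> (\<integral>\<omega>. G \<omega> * f \<omega> \<partial>M) \<le> (\<integral>\<omega>. G \<omega> \<partial>M))"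

definition sub_factor :: "nat \<Rightarrow> ('a \<Rightarrow> real) \<Rightarrow> bool" where
  "sub_factor n f \<longleftrightarrow> f \<in> bmeas (F (Suc n)) \<and> (\<forall>\<omega>. 0 \<le> f \<omega>) \<and>
     (\<forall>G\<in>bmeas (F n). (\<forall>\<omega>. 0 \<le> G \<omega>) \<longrightarrow> (\<integral>\<omega>. G \<omega> \<partial>M) \<le> (\<integral>\<omega>. G \<omega> * f \<omega> \<partial>M))"

lemma factor_if_aux:
  assumes f: "f \<in> bmeas (F (Suc n))" and A: "{\<omega> \<in> space M. P \<omega>} \<in> sets (F n)" and G: "G \<in> bmeas (F n)"
  defines "G' \<equiv> \<lambda>\<omega>. if P \<omega> then 0 else G \<omega>"
  shows "(\<lambda>\<omega>. if P \<omega> then 1 else f \<omega>) \<in> bmeas (F (Suc n))" "G' \<in> bmeas (F n)"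
    "(\<integral>\<omega>. G \<omega> * (if P \<omega> then 1 else f \<omega>) \<partial>M) = (\<integral>\<omega>. G \<omega> \<partial>M) - (\<integral>\<omega>. G' \<omega> \<partial>M) + (\<integral>\<omega>. G' \<omega> * f \<omega> \<partial>M)"
proof -
  show "(\<lambda>\<omega>. if P \<omega> then 1 else f \<omega>) \<in> bmeas (F (Suc n))"
    using f A F_Suc[of n] by (intro bmeas_if) auto
  show G': "G' \<in> bmeas (F n)" unfolding G'_def using A G by auto
  then have "integrable M (\<lambda>\<omega>. G' \<omega> * f \<omega>)"
    using f by (intro bmeas_F_integrable[of _ "Suc n"] bmeas_mult) (auto intro: bmeas_F_mono[of n])
  moreover have "G \<omega> * (if P \<omega> then 1 else f \<omega>) = G \<omega> - G' \<omega> + G' \<omega> * f \<omega>" for \<omega>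
    by (simp add: G'_def)
  ultimately show "(\<integral>\<omega>. G \<omega> * (if P \<omega> then 1 else f \<omega>) \<partial>M)
      = (\<integral>\<omega>. G \<omega> \<partial>M) - (\<integral>\<omega>. G' \<omega> \<partial>M) + (\<integral>\<omega>. G' \<omega> * f \<omega> \<partial>M)"
    using G G' by (simp add: bmeas_F_integrable)
qed

text \<open>Setting the factor to \<open>1\<close> on an event of the past is stopping: the product
  no longer moves there. All stopping arguments for products take this form.\<close>

lemma sup_factor_if:
  assumes f: "sup_factor n f" and A: "{\<omega> \<in> space M. P \<omega>} \<in> sets (F n)"
  shows "sup_factor n (\<lambda>\<omega>. if P \<omega> then 1 else f \<omega>)"
  unfolding sup_factor_def
proof (intro conjI ballI impI)
  have f': "f \<in> bmeas (F (Suc n))" using f by (simp add: sup_factor_def)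
  show "(\<lambda>\<omega>. if P \<omega> then 1 else f \<omega>) \<in> bmeas (F (Suc n))"
    by (rule factor_if_aux[OF f' A bmeas_const])
  show "\<forall>\<omega>. 0 \<le> (if P \<omega> then 1 else f \<omega>)" using f by (simp add: sup_factor_def)
  fix G assume G: "G \<in> bmeas (F n)" "\<forall>\<omega>. 0 \<le> G \<omega>"
  have "(\<integral>\<omega>. (if P \<omega> then 0 else G \<omega>) * f \<omega> \<partial>M) \<le> (\<integral>\<omega>. (if P \<omega> then 0 else G \<omega>) \<partial>M)"
    using f G factor_if_aux(2)[OF f' A G(1)] unfolding sup_factor_def by (auto)
  then show "(\<integral>\<omega>. G \<omega> * (if P \<omega> then 1 else f \<omega>) \<partial>M) \<le> (\<integral>\<omega>. G \<omega> \<partial>M)"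
    unfolding factor_if_aux(3)[OF f' A G(1)] by simp
qed

lemma sub_factor_if:
  assumes f: "sub_factor n f" and A: "{\<omega> \<in> space M. P \<omega>} \<in> sets (F n)"
  shows "sub_factor n (\<lambda>\<omega>. if P \<omega> then 1 else f \<omega>)"
  unfolding sub_factor_def
proof (intro conjI ballI impI)
  have f': "f \<in> bmeas (F (Suc n))" using f by (simp add: sub_factor_def)
  show "(\<lambda>\<omega>. if P \<omega> then 1 else f \<omega>) \<in> bmeas (F (Suc n))"
    by (rule factor_if_aux[OF f' A bmeas_const])
  show "\<forall>\<omega>. 0 \<le> (if P \<omega> then 1 else f \<omega>)" using f by (simp add: sub_factor_def)
  fix G assume G: "G \<in> bmeas (F n)" "\<forall>\<omega>. 0 \<le> G \<omega>"
  have "(\<integral>\<omega>. (if P \<omega> then 0 else G \<omega>) \<partial>M) \<le> (\<integral>\<omega>. (if P \<omega> then 0 else G \<omega>) * f \<omega> \<partial>M)"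
    using f G factor_if_aux(2)[OF f' A G(1)] unfolding sub_factor_def by (auto)
  then show "(\<integral>\<omega>. G \<omega> \<partial>M) \<le> (\<integral>\<omega>. G \<omega> * (if P \<omega> then 1 else f \<omega>) \<partial>M)"
    unfolding factor_if_aux(3)[OF f' A G(1)] by simp
qed

lemma bmeas_prod_adapted:
  assumes "\<And>i. N \<le> i \<Longrightarrow> i < n \<Longrightarrow> f i \<in> bmeas (F (Suc i))"
  shows "(\<lambda>\<omega>. \<Prod>i\<in>{N..<n}. f i \<omega>) \<in> bmeas (F n)"
  using assms by (intro bmeas_prod) (auto intro: bmeas_F_mono[OF Suc_leI])

text \<open>The weight \<open>G\<close> keeps the estimate conditional on \<open>F N\<close>. The
  block bounds use it with the indicator of an event decided before the block begins.\<close>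

lemma integral_prod_sup_factor:
  assumes "N \<le> n" "\<And>i. N \<le> i \<Longrightarrow> i < n \<Longrightarrow> sup_factor i (f i)"
    and G: "G \<in> bmeas (F N)" "\<And>\<omega>. 0 \<le> G \<omega>"
  shows "(\<integral>\<omega>. G \<omega> * (\<Prod>i\<in>{N..<n}. f i \<omega>) \<partial>M) \<le> (\<integral>\<omega>. G \<omega> \<partial>M)"
  using assms(1,2)
proof (induction n rule: dec_induct)
  case (step n)
  let ?G = "\<lambda>\<omega>. G \<omega> * (\<Prod>i\<in>{N..<n}. f i \<omega>)"
  have f: "sup_factor i (f i)" if "N \<le> i" "i \<le> n" for i
    using step that by auto
  have "?G \<in> bmeas (F n)"
    using G f step(1) by (intro bmeas_mult bmeas_prod_adapted) (auto intro: bmeas_F_mono simp: sup_factor_def)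
  moreover have "0 \<le> ?G \<omega>" for \<omega>
    using G f by (intro mult_nonneg_nonneg prod_nonneg) (auto simp: sup_factor_def)
  ultimately have "(\<integral>\<omega>. ?G \<omega> * f n \<omega> \<partial>M) \<le> (\<integral>\<omega>. ?G \<omega> \<partial>M)"
    using f[of n] step(1) by (simp add: sup_factor_def)
  also have "\<dots> \<le> (\<integral>\<omega>. G \<omega> \<partial>M)" using step by auto
  also have "(\<integral>\<omega>. ?G \<omega> * f n \<omega> \<partial>M) = (\<integral>\<omega>. G \<omega> * (\<Prod>i\<in>{N..<Suc n}. f i \<omega>) \<partial>M)"
    using step(1) by (simp add: prod.atLeastLessThan_Suc mult.assoc)
  finally show ?case .
qed simp

lemma integral_prod_sub_factor:
  assumes "N \<le> n" "\<And>i. N \<le> i \<Longrightarrow> i < n \<Longrightarrow> sub_factor i (f i)"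
    and G: "G \<in> bmeas (F N)" "\<And>\<omega>. 0 \<le> G \<omega>"
  shows "(\<integral>\<omega>. G \<omega> \<partial>M) \<le> (\<integral>\<omega>. G \<omega> * (\<Prod>i\<in>{N..<n}. f i \<omega>) \<partial>M)"
  using assms(1,2)
proof (induction n rule: dec_induct)
  case (step n)
  let ?G = "\<lambda>\<omega>. G \<omega> * (\<Prod>i\<in>{N..<n}. f i \<omega>)"
  have f: "sub_factor i (f i)" if "N \<le> i" "i \<le> n" for i
    using step that by auto
  have "?G \<in> bmeas (F n)"
    using G f step(1) by (intro bmeas_mult bmeas_prod_adapted) (auto intro: bmeas_F_mono simp: sub_factor_def)
  moreover have "0 \<le> ?G \<omega>" for \<omega>
    using G f by (intro mult_nonneg_nonneg prod_nonneg) (auto simp: sub_factor_def)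
  ultimately have "(\<integral>\<omega>. ?G \<omega> \<partial>M) \<le> (\<integral>\<omega>. ?G \<omega> * f n \<omega> \<partial>M)"
    using f[of n] step(1) by (simp add: sub_factor_def)
  moreover have "(\<integral>\<omega>. G \<omega> \<partial>M) \<le> (\<integral>\<omega>. ?G \<omega> \<partial>M)" using step by auto
  moreover have "(\<integral>\<omega>. ?G \<omega> * f n \<omega> \<partial>M) = (\<integral>\<omega>. G \<omega> * (\<Prod>i\<in>{N..<Suc n}. f i \<omega>) \<partial>M)"
    using step(1) by (simp add: prod.atLeastLessThan_Suc mult.assoc)
  ultimately show ?case by linarith
qed simp

lemma markov_bmeas:
  assumes "f \<in> bmeas M" "\<And>\<omega>. 0 \<le> f \<omega>" "0 < a"
    and "A \<subseteq> space M" "\<And>\<omega>. \<omega> \<in> A \<Longrightarrow> a \<le> f \<omega>"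
  shows "prob A \<le> (\<integral>\<omega>. f \<omega> \<partial>M) / a"
proof -
  have [measurable]: "f \<in> borel_measurable M" using assms by (simp add: bmeas_measurable)
  have "prob A \<le> prob {\<omega>\<in>space M. a \<le> f \<omega>}"
    using assms by (intro finite_measure_mono) auto
  also have "\<dots> \<le> (\<integral>\<omega>. f \<omega> \<partial>M) / a"
    using integral_Markov_inequality_measure[of M f "{}" a] assms
    by (auto intro: bmeas_integrable)
  finally show ?thesis .
qed

lemma sup_factor_maximal:
  assumes "N \<le> n" "\<And>i. N \<le> i \<Longrightarrow> i < n \<Longrightarrow> sup_factor i (f i)" "0 < a"
  shows "prob {\<omega> \<in> space M. \<exists>m\<in>{N..<n}. a \<le> (\<Prod>i\<in>{N..<m}. f i \<omega>)} \<le> 1 / a"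
proof -
  define T where "T m \<omega> = (\<Prod>i\<in>{N..<m}. f i \<omega>)" for m \<omega>
  define P where "P m \<omega> \<longleftrightarrow> (\<exists>k\<in>{N..<m}. a \<le> T k \<omega>)" for m \<omega>
  \<comment> \<open>\<open>P (Suc i)\<close> inspects the partial products up to index
    \<open>i\<close>, all of them measurable for \<open>F i\<close>, so the decision to freeze is
    made before the factor \<open>f i\<close> is seen.\<close>
  define g where "g i \<omega> = (if P (Suc i) \<omega> then 1 else f i \<omega>)" for i \<omega>
  have T: "T m \<in> bmeas (F m)" if "m \<le> n" for m
    unfolding T_def using assms that by (intro bmeas_prod_adapted) (auto simp: sup_factor_def)
  have g: "sup_factor i (g i)" if i: "N \<le> i" "i < n" for i
    unfolding g_def
  proof (rule sup_factor_if)
    show "sup_factor i (f i)" using assms i by simp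
    have "{\<omega> \<in> space M. a \<le> T k \<omega>} \<in> sets (F i)" if "k \<in> {N..<Suc i}" for k
    proof -
      have [measurable]: "T k \<in> borel_measurable (F i)"
        using T[of k] that i by (intro measurable_F_mono[of k i]) (auto dest: bmeas_measurable)
      have "{\<omega> \<in> space (F i). a \<le> T k \<omega>} \<in> sets (F i)" by measurable
      then show ?thesis by simp
    qed
    then have "(\<Union>k\<in>{N..<Suc i}. {\<omega> \<in> space M. a \<le> T k \<omega>}) \<in> sets (F i)"
      by auto
    also have "(\<Union>k\<in>{N..<Suc i}. {\<omega> \<in> space M. a \<le> T k \<omega>}) = {\<omega> \<in> space M. P (Suc i) \<omega>}"
      by (auto simp: P_def)
    finally show "{\<omega> \<in> space M. P (Suc i) \<omega>} \<in> sets (F i)" .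
  qed
  have key: "(\<not> P m \<omega> \<longrightarrow> (\<Prod>i\<in>{N..<m}. g i \<omega>) = T m \<omega>) \<and> (P m \<omega> \<longrightarrow> a \<le> (\<Prod>i\<in>{N..<m}. g i \<omega>))"
    if "N \<le> m" for m \<omega>
    using that
  proof (induction m rule: dec_induct)
    case base
    then show ?case by (simp add: P_def T_def)
  next
    case (step m)
    have P: "P (Suc m) \<omega> \<longleftrightarrow> P m \<omega> \<or> a \<le> T m \<omega>"
      using step(1) by (auto simp: P_def less_Suc_eq)
    show ?case using step P
      by (auto simp: prod.atLeastLessThan_Suc g_def T_def)
  qed
  have gb: "(\<lambda>\<omega>. \<Prod>i\<in>{N..<n}. g i \<omega>) \<in> bmeas M"
    using g by (intro bmeas_F_M[of _ n] bmeas_prod_adapted) (auto simp: sup_factor_def)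
  have "prob {\<omega> \<in> space M. P n \<omega>} \<le> (\<integral>\<omega>. (\<Prod>i\<in>{N..<n}. g i \<omega>) \<partial>M) / a"
    using key[of n] assms g gb
    by (intro markov_bmeas) (auto intro!: prod_nonneg simp: sup_factor_def)
  also have "(\<integral>\<omega>. (\<Prod>i\<in>{N..<n}. g i \<omega>) \<partial>M) \<le> 1"
    using integral_prod_sup_factor[of N n g "\<lambda>_. 1"] assms g by (simp add: prob_space)
  finally show ?thesis
    using assms by (simp add: P_def T_def divide_right_mono)
qed

end

text \<open>Note the index: \<open>d n\<close> is known at time \<open>Suc n\<close> and centred
  given \<open>F n\<close>. Centring is tested against bounded functions of the past, so no version
  of a conditional expectation has to be chosen.\<close>

locale martingale_differences = filtered_prob_space +
  fixes d :: "nat \<Rightarrow> 'a \<Rightarrow> real"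
  assumes d_bmeas: "\<And>n. d n \<in> bmeas (F (Suc n))"
    and d_centered: "\<And>n G. G \<in> bmeas (F n) \<Longrightarrow> (\<integral>\<omega>. G \<omega> * d n \<omega> \<partial>M) = 0"
begin

definition cond_sq_ge :: "nat \<Rightarrow> real \<Rightarrow> bool" where
  "cond_sq_ge n c \<longleftrightarrow> (\<forall>G\<in>bmeas (F n). (\<forall>\<omega>. 0 \<le> G \<omega>) \<longrightarrow> c * (\<integral>\<omega>. G \<omega> \<partial>M) \<le> (\<integral>\<omega>. G \<omega> * (d n \<omega>)\<^sup>2 \<partial>M))"

definition cond_sq_le :: "nat \<Rightarrow> real \<Rightarrow> bool" where
  "cond_sq_le n C \<longleftrightarrow> (\<forall>G\<in>bmeas (F n). (\<forall>\<omega>. 0 \<le> G \<omega>) \<longrightarrow> (\<integral>\<omega>. G \<omega> * (d n \<omega>)\<^sup>2 \<partial>M) \<le> C * (\<integral>\<omega>. G \<omega> \<partial>M))"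

lemma integral_affine_factor:
  assumes "G \<in> bmeas (F n)"
  shows "(\<integral>\<omega>. G \<omega> * (1 + x * d n \<omega> + y * (d n \<omega>)\<^sup>2) \<partial>M) = (\<integral>\<omega>. G \<omega> \<partial>M) + y * (\<integral>\<omega>. G \<omega> * (d n \<omega>)\<^sup>2 \<partial>M)"
proof -
  have G: "G \<in> bmeas (F (Suc n))" using assms by (rule bmeas_F_mono[rotated]) simp
  have [simp]: "integrable M G" "integrable M (\<lambda>\<omega>. G \<omega> * d n \<omega>)" "integrable M (\<lambda>\<omega>. G \<omega> * (d n \<omega>)\<^sup>2)"
    using G d_bmeas[of n] by (auto intro!: bmeas_F_integrable[of _ "Suc n"])
  have "(\<integral>\<omega>. G \<omega> * (1 + x * d n \<omega> + y * (d n \<omega>)\<^sup>2) \<partial>M)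
      = (\<integral>\<omega>. G \<omega> + x * (G \<omega> * d n \<omega>) + y * (G \<omega> * (d n \<omega>)\<^sup>2) \<partial>M)"
    by (intro Bochner_Integration.integral_cong) (auto simp: algebra_simps)
  also have "\<dots> = (\<integral>\<omega>. G \<omega> \<partial>M) + x * (\<integral>\<omega>. G \<omega> * d n \<omega> \<partial>M) + y * (\<integral>\<omega>. G \<omega> * (d n \<omega>)\<^sup>2 \<partial>M)"
    by simp
  finally show ?thesis using d_centered[OF assms] by simp
qed

text \<open>Under a majorant quadratic in \<open>d n\<close> the linear term disappears by centring,
  and only the conditional second moment is left. The constant \<open>r\<close> carries a
  deterministic compensator.\<close>

lemma sup_factorI:
  assumes f: "f \<in> bmeas (F (Suc n))" "\<And>\<omega>. 0 \<le> f \<omega>"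
    and le: "\<And>\<omega>. f \<omega> \<le> r * (1 + x * d n \<omega> + y * (d n \<omega>)\<^sup>2)" and "0 \<le> r"
    and y: "\<And>G. G \<in> bmeas (F n) \<Longrightarrow> (\<And>\<omega>. 0 \<le> G \<omega>) \<Longrightarrow>
      r * ((\<integral>\<omega>. G \<omega> \<partial>M) + y * (\<integral>\<omega>. G \<omega> * (d n \<omega>)\<^sup>2 \<partial>M)) \<le> (\<integral>\<omega>. G \<omega> \<partial>M)"
  shows "sup_factor n f"
  unfolding sup_factor_def
proof (intro conjI ballI impI allI f)
  fix G assume G: "G \<in> bmeas (F n)" "\<forall>\<omega>. 0 \<le> G \<omega>"
  have G': "G \<in> bmeas (F (Suc n))" using G(1) by (rule bmeas_F_mono[rotated]) simp
  have i1: "integrable M (\<lambda>\<omega>. G \<omega> * f \<omega>)"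
    using G' f by (intro bmeas_F_integrable[of _ "Suc n"] bmeas_mult)
  have i2: "integrable M (\<lambda>\<omega>. r * (G \<omega> * (1 + x * d n \<omega> + y * (d n \<omega>)\<^sup>2)))"
    using G' d_bmeas[of n] by (intro bmeas_F_integrable[of _ "Suc n"] bmeas_mult bmeas_add bmeas_power bmeas_const)
  have "(\<integral>\<omega>. G \<omega> * f \<omega> \<partial>M) \<le> (\<integral>\<omega>. r * (G \<omega> * (1 + x * d n \<omega> + y * (d n \<omega>)\<^sup>2)) \<partial>M)"
    using i1 i2
  proof (rule integral_mono)
    fix \<omega>
    show "G \<omega> * f \<omega> \<le> r * (G \<omega> * (1 + x * d n \<omega> + y * (d n \<omega>)\<^sup>2))"
      using mult_left_mono[OF le[of \<omega>], of "G \<omega>"] G by (simp add: algebra_simps)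
  qed
  also have "\<dots> = r * ((\<integral>\<omega>. G \<omega> \<partial>M) + y * (\<integral>\<omega>. G \<omega> * (d n \<omega>)\<^sup>2 \<partial>M))"
    by (simp add: integral_affine_factor[OF G(1)])
  also have "\<dots> \<le> (\<integral>\<omega>. G \<omega> \<partial>M)" using G by (intro y) auto
  finally show "(\<integral>\<omega>. G \<omega> * f \<omega> \<partial>M) \<le> (\<integral>\<omega>. G \<omega> \<partial>M)" .
qed

lemma exp_times_le:
  fixes s I J :: real
  assumes "0 \<le> I" "J \<le> (1 - s) * I"
  shows "exp s * J \<le> I"
proof -
  have "exp s * J \<le> exp s * ((1 - s) * I)" using assms by simp
  also have "\<dots> \<le> exp s * (exp (- s) * I)"
    using assms exp_ge_add_one_self[of "- s"] by (intro mult_left_mono mult_right_mono) auto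
  also have "\<dots> = I" by (simp add: exp_minus)
  finally show ?thesis .
qed

text \<open>For \<open>K = 0\<close> no conditional variance enters. For \<open>K > 0\<close> the
  surplus \<open>K * x\<^sup>2\<close> in the expansion is turned by the lower variance bound into a
  deterministic gain \<open>exp (K * c * \<theta>\<^sup>2)\<close> per step, through
  \<open>1 - s \<le> exp (- s)\<close>.\<close>

lemma sup_factor_exp:
  fixes \<theta> K :: real
  assumes \<delta>: "\<And>x. \<bar>x\<bar> \<le> \<delta> \<Longrightarrow> exp (x - a * x\<^sup>2) \<le> 1 + x - K * x\<^sup>2"
    and small: "\<And>\<omega>. \<bar>\<theta> * d n \<omega>\<bar> \<le> \<delta>" and "0 \<le> K" and c: "cond_sq_ge n c"
  shows "sup_factor n (\<lambda>\<omega>. exp (\<theta> * d n \<omega> - a * \<theta>\<^sup>2 * (d n \<omega>)\<^sup>2 + K * c * \<theta>\<^sup>2))"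
proof (rule sup_factorI)
  show "(\<lambda>\<omega>. exp (\<theta> * d n \<omega> - a * \<theta>\<^sup>2 * (d n \<omega>)\<^sup>2 + K * c * \<theta>\<^sup>2)) \<in> bmeas (F (Suc n))"
    using d_bmeas[of n] by (intro bmeas_exp bmeas_add bmeas_diff bmeas_mult bmeas_power bmeas_const)
  show "exp (\<theta> * d n \<omega> - a * \<theta>\<^sup>2 * (d n \<omega>)\<^sup>2 + K * c * \<theta>\<^sup>2)
      \<le> exp (K * c * \<theta>\<^sup>2) * (1 + \<theta> * d n \<omega> + (- K * \<theta>\<^sup>2) * (d n \<omega>)\<^sup>2)" for \<omega>
    using mult_left_mono[OF \<delta>[OF small[of \<omega>]], of "exp (K * c * \<theta>\<^sup>2)"]
    by (simp add: exp_add power_mult_distrib mult_ac)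
  fix G assume G: "G \<in> bmeas (F n)" "\<And>\<omega>. 0 \<le> G \<omega>"
  have "K * \<theta>\<^sup>2 * (c * (\<integral>\<omega>. G \<omega> \<partial>M)) \<le> K * \<theta>\<^sup>2 * (\<integral>\<omega>. G \<omega> * (d n \<omega>)\<^sup>2 \<partial>M)"
    using c G \<open>0 \<le> K\<close> unfolding cond_sq_ge_def by (intro mult_left_mono) auto
  moreover have "0 \<le> (\<integral>\<omega>. G \<omega> \<partial>M)" using G by simp
  ultimately show "exp (K * c * \<theta>\<^sup>2) * ((\<integral>\<omega>. G \<omega> \<partial>M) + (- K * \<theta>\<^sup>2) * (\<integral>\<omega>. G \<omega> * (d n \<omega>)\<^sup>2 \<partial>M)) \<le> (\<integral>\<omega>. G \<omega> \<partial>M)"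
    by (intro exp_times_le) (simp_all add: algebra_simps)
qed auto

lemma cond_sq_ge_0: "cond_sq_ge n 0"
  by (simp add: cond_sq_ge_def)

lemma sub_factor_exp:
  fixes \<theta> :: real
  assumes \<delta>: "\<And>x. \<bar>x\<bar> \<le> \<delta> \<Longrightarrow> 1 + x \<le> exp (x - a * x\<^sup>2)"
    and small: "\<And>\<omega>. \<bar>\<theta> * d n \<omega>\<bar> \<le> \<delta>"
  shows "sub_factor n (\<lambda>\<omega>. exp (\<theta> * d n \<omega> - a * \<theta>\<^sup>2 * (d n \<omega>)\<^sup>2))"
  unfolding sub_factor_def
proof (intro conjI ballI impI allI)
  let ?f = "\<lambda>\<omega>. exp (\<theta> * d n \<omega> - a * \<theta>\<^sup>2 * (d n \<omega>)\<^sup>2)"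
  show f: "?f \<in> bmeas (F (Suc n))"
    using d_bmeas[of n] by (intro bmeas_exp bmeas_add bmeas_diff bmeas_mult bmeas_power bmeas_const)
  fix G assume G: "G \<in> bmeas (F n)" "\<forall>\<omega>. 0 \<le> G \<omega>"
  have G': "G \<in> bmeas (F (Suc n))" using G(1) by (rule bmeas_F_mono[rotated]) simp
  have i1: "integrable M (\<lambda>\<omega>. G \<omega> * ?f \<omega>)"
    using G' f by (intro bmeas_F_integrable[of _ "Suc n"] bmeas_mult)
  have i2: "integrable M (\<lambda>\<omega>. G \<omega> * (1 + \<theta> * d n \<omega> + 0 * (d n \<omega>)\<^sup>2))"
    using G' d_bmeas[of n] by (intro bmeas_F_integrable[of _ "Suc n"] bmeas_mult bmeas_add bmeas_power bmeas_const)
  have "(\<integral>\<omega>. G \<omega> \<partial>M) = (\<integral>\<omega>. G \<omega> * (1 + \<theta> * d n \<omega> + 0 * (d n \<omega>)\<^sup>2) \<partial>M)"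
    by (subst integral_affine_factor[OF G(1)]) simp
  also have "\<dots> \<le> (\<integral>\<omega>. G \<omega> * ?f \<omega> \<partial>M)"
    using i2 i1
  proof (rule integral_mono)
    fix \<omega>
    have "1 + \<theta> * d n \<omega> \<le> ?f \<omega>"
      using \<delta>[OF small[of \<omega>]] by (simp add: power_mult_distrib mult.assoc)
    then show "G \<omega> * (1 + \<theta> * d n \<omega> + 0 * (d n \<omega>)\<^sup>2) \<le> G \<omega> * ?f \<omega>"
      using G by (intro mult_left_mono) auto
  qed
  finally show "(\<integral>\<omega>. G \<omega> \<partial>M) \<le> (\<integral>\<omega>. G \<omega> * ?f \<omega> \<partial>M)" .
qed auto

text \<open>On \<open>[0, 1]\<close> one has \<open>exp (- y) \<le> 1 - y / 2\<close>, and for the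
  opposite direction in \<open>sup_factor_exp_sq_upper\<close> \<open>exp y \<le> 1 + 2 * y\<close>.
  The lost factors of \<open>2\<close> are harmless, because the quadratic variation is wanted only
  up to constants.\<close>

lemma sup_factor_exp_sq_lower:
  assumes "0 \<le> \<mu>" "\<And>\<omega>. \<mu> * (d n \<omega>)\<^sup>2 \<le> 1" and c: "cond_sq_ge n c"
  shows "sup_factor n (\<lambda>\<omega>. exp (- \<mu> * (d n \<omega>)\<^sup>2 + \<mu> * c / 2))"
proof (rule sup_factorI[where x = 0 and y = "- \<mu> / 2" and r = "exp (\<mu> * c / 2)"])
  show "(\<lambda>\<omega>. exp (- \<mu> * (d n \<omega>)\<^sup>2 + \<mu> * c / 2)) \<in> bmeas (F (Suc n))"
    using d_bmeas[of n] by (intro bmeas_exp bmeas_add bmeas_mult bmeas_power bmeas_const)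
  have "exp (- y) \<le> 1 - y / 2" if "0 \<le> y" "y \<le> 1" for y :: real
  proof -
    have "exp y * (1 - y / 2) \<ge> (1 + y) * (1 - y / 2)"
      using that by (intro mult_right_mono exp_ge_add_one_self) auto
    also have "(1 + y) * (1 - y / 2) = 1 + y * (1 - y) / 2" by (simp add: field_simps)
    moreover have "0 \<le> y * (1 - y) / 2" using that by simp
    ultimately have "exp y * (1 - y / 2) \<ge> 1" by linarith
    then show ?thesis by (simp add: exp_minus field_simps)
  qed
  then have "exp (\<mu> * c / 2) * exp (- (\<mu> * (d n \<omega>)\<^sup>2)) \<le> exp (\<mu> * c / 2) * (1 - \<mu> * (d n \<omega>)\<^sup>2 / 2)" for \<omega>
    using assms by (intro mult_left_mono) auto
  moreover have "exp (- \<mu> * (d n \<omega>)\<^sup>2 + \<mu> * c / 2) = exp (\<mu> * c / 2) * exp (- (\<mu> * (d n \<omega>)\<^sup>2))" for \<omega>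
    by (simp flip: exp_add)
  ultimately show "exp (- \<mu> * (d n \<omega>)\<^sup>2 + \<mu> * c / 2) \<le> exp (\<mu> * c / 2) * (1 + 0 * d n \<omega> + (- \<mu> / 2) * (d n \<omega>)\<^sup>2)" for \<omega>
    by simp
  fix G assume G: "G \<in> bmeas (F n)" "\<And>\<omega>. 0 \<le> G \<omega>"
  have "\<mu> / 2 * (c * (\<integral>\<omega>. G \<omega> \<partial>M)) \<le> \<mu> / 2 * (\<integral>\<omega>. G \<omega> * (d n \<omega>)\<^sup>2 \<partial>M)"
    using c G \<open>0 \<le> \<mu>\<close> unfolding cond_sq_ge_def by (intro mult_left_mono) auto
  moreover have "0 \<le> (\<integral>\<omega>. G \<omega> \<partial>M)" using G by simp
  ultimately show "exp (\<mu> * c / 2) * ((\<integral>\<omega>. G \<omega> \<partial>M) + (- \<mu> / 2) * (\<integral>\<omega>. G \<omega> * (d n \<omega>)\<^sup>2 \<partial>M)) \<le> (\<integral>\<omega>. G \<omega> \<partial>M)"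
    by (intro exp_times_le) (simp_all add: algebra_simps)
qed auto

lemma sup_factor_exp_sq_upper:
  assumes "0 \<le> \<mu>" "\<And>\<omega>. \<mu> * (d n \<omega>)\<^sup>2 \<le> 1" and C: "cond_sq_le n C"
  shows "sup_factor n (\<lambda>\<omega>. exp (\<mu> * (d n \<omega>)\<^sup>2 - 2 * \<mu> * C))"
proof (rule sup_factorI[where x = 0 and y = "2 * \<mu>" and r = "exp (- 2 * \<mu> * C)"])
  show "(\<lambda>\<omega>. exp (\<mu> * (d n \<omega>)\<^sup>2 - 2 * \<mu> * C)) \<in> bmeas (F (Suc n))"
    using d_bmeas[of n] by (intro bmeas_exp bmeas_diff bmeas_mult bmeas_power bmeas_const)
  have "exp y \<le> 1 + 2 * y" if "0 \<le> y" "y \<le> 1" for y :: real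
  proof -
    have "exp y \<le> 1 + y + y\<^sup>2" using that by (intro exp_bound) auto
    also have "y\<^sup>2 \<le> y" using that by (simp add: power2_eq_square mult_left_le)
    finally show ?thesis by simp
  qed
  then have "exp (- 2 * \<mu> * C) * exp (\<mu> * (d n \<omega>)\<^sup>2) \<le> exp (- 2 * \<mu> * C) * (1 + 2 * (\<mu> * (d n \<omega>)\<^sup>2))" for \<omega>
    using assms by (intro mult_left_mono) auto
  then show "exp (\<mu> * (d n \<omega>)\<^sup>2 - 2 * \<mu> * C) \<le> exp (- 2 * \<mu> * C) * (1 + 0 * d n \<omega> + (2 * \<mu>) * (d n \<omega>)\<^sup>2)" for \<omega>
    by (simp add: exp_diff exp_minus field_simps)
  fix G assume G: "G \<in> bmeas (F n)" "\<And>\<omega>. 0 \<le> G \<omega>"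
  have "2 * \<mu> * (\<integral>\<omega>. G \<omega> * (d n \<omega>)\<^sup>2 \<partial>M) \<le> 2 * \<mu> * (C * (\<integral>\<omega>. G \<omega> \<partial>M))"
    using C G \<open>0 \<le> \<mu>\<close> unfolding cond_sq_le_def by (intro mult_left_mono) auto
  moreover have "0 \<le> (\<integral>\<omega>. G \<omega> \<partial>M)" using G by simp
  ultimately show "exp (- 2 * \<mu> * C) * ((\<integral>\<omega>. G \<omega> \<partial>M) + (2 * \<mu>) * (\<integral>\<omega>. G \<omega> * (d n \<omega>)\<^sup>2 \<partial>M)) \<le> (\<integral>\<omega>. G \<omega> \<partial>M)"
    by (intro exp_times_le) (simp_all add: algebra_simps)
qed auto

definition D :: "nat \<Rightarrow> 'a \<Rightarrow> real" where
  "D n \<omega> = (\<Sum>i<n. d i \<omega>)"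

definition Q :: "nat \<Rightarrow> 'a \<Rightarrow> real" where
  "Q n \<omega> = (\<Sum>i<n. (d i \<omega>)\<^sup>2)"

lemma D_diff: "N \<le> n \<Longrightarrow> D n \<omega> - D N \<omega> = (\<Sum>i\<in>{N..<n}. d i \<omega>)"
  using sum_diff_nat_ivl[of 0 N n "\<lambda>i. d i \<omega>"] by (simp add: D_def lessThan_atLeast0)

lemma Q_diff: "N \<le> n \<Longrightarrow> Q n \<omega> - Q N \<omega> = (\<Sum>i\<in>{N..<n}. (d i \<omega>)\<^sup>2)"
  using sum_diff_nat_ivl[of 0 N n "\<lambda>i. (d i \<omega>)\<^sup>2"] by (simp add: Q_def lessThan_atLeast0)

lemma Q_mono: "N \<le> n \<Longrightarrow> Q N \<omega> \<le> Q n \<omega>"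
  unfolding Q_def by (intro sum_mono2) auto

lemma Q_nonneg: "0 \<le> Q n \<omega>"
  unfolding Q_def by (intro sum_nonneg) auto

lemma D_bmeas: "D n \<in> bmeas (F n)"
  unfolding D_def[abs_def] by (intro bmeas_sum) (auto intro!: bmeas_F_mono[OF _ d_bmeas])

lemma Q_bmeas: "Q n \<in> bmeas (F n)"
  unfolding Q_def[abs_def] by (intro bmeas_sum) (auto intro!: bmeas_F_mono[OF _ d_bmeas])

lemma D_measurable [measurable]: "D n \<in> borel_measurable M"
  using D_bmeas by (intro measurable_F_M) (auto dest: bmeas_measurable)

lemma Q_measurable [measurable]: "Q n \<in> borel_measurable M"
  using Q_bmeas by (intro measurable_F_M) (auto dest: bmeas_measurable)

end

section \<open>Upper bound in the law of the iterated logarithm\<close>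

lemma eventually_between_powers:
  fixes L :: nat
  assumes L: "2 \<le> L" and ev: "\<forall>\<^sub>F k in sequentially. \<forall>n. L ^ k \<le> n \<longrightarrow> n < L ^ Suc k \<longrightarrow> P n"
  shows "\<forall>\<^sub>F n in sequentially. P n"
proof -
  obtain k0 where k0: "\<And>k n. k0 \<le> k \<Longrightarrow> L ^ k \<le> n \<Longrightarrow> n < L ^ Suc k \<Longrightarrow> P n"
    using ev by (auto simp: eventually_sequentially)
  show ?thesis
    unfolding eventually_sequentially
  proof (intro exI allI impI)
    fix n assume n: "L ^ k0 \<le> n"
    have "n < L ^ n" using L by (intro power_gt_expt) auto
    then have ex: "\<exists>m. n < L ^ m" by blast
    define m where "m = (LEAST m. n < L ^ m)"
    have m: "n < L ^ m" unfolding m_def using ex by (rule LeastI_ex)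
    have "k0 < m"
    proof (rule ccontr)
      assume "\<not> k0 < m"
      then have "L ^ m \<le> L ^ k0" using L by (intro power_increasing) auto
      then show False using m n by linarith
    qed
    then obtain k where k: "m = Suc k" "k0 \<le> k" by (cases m) auto
    have "\<not> n < L ^ k" using not_less_Least[of k "\<lambda>m. n < L ^ m"] k by (simp add: m_def)
    then show "P n" using k m k0[of k n] by auto
  qed
qed

lemma filterlim_pow: "2 \<le> (L::nat) \<Longrightarrow> filterlim (\<lambda>k. L ^ k) sequentially sequentially"
  by (rule filterlim_subseq) (auto intro!: strict_monoI power_strict_increasing)

lemma eventually_pow:
  assumes "eventually P sequentially" "2 \<le> (L::nat)"
  shows "\<forall>\<^sub>F k in sequentially. P (L ^ k)"
  using filterlim_pow[OF assms(2)] assms(1) by (auto simp: filterlim_iff)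

lemma eventually_pow_Suc:
  assumes "eventually P sequentially" "2 \<le> (L::nat)"
  shows "\<forall>\<^sub>F k in sequentially. P (L ^ Suc k)"
  using eventually_pow[OF assms] eventually_sequentially_Suc[of "\<lambda>k. P (L ^ k)"] by blast

lemma (in prob_space) AE_eventually_of_summable:
  assumes "\<And>k. {\<omega> \<in> space M. P k \<omega>} \<in> events"
    and "\<forall>\<^sub>F k in sequentially. prob {\<omega> \<in> space M. P k \<omega>} \<le> f k" "summable f"
  shows "AE \<omega> in M. \<forall>\<^sub>F k in sequentially. \<not> P k \<omega>"
proof -
  have "AE \<omega> in M. \<forall>\<^sub>F k in sequentially. \<omega> \<in> space M - {\<omega> \<in> space M. P k \<omega>}"
  proof (rule borel_cantelli_AE1)
    show "summable (\<lambda>k. prob {\<omega> \<in> space M. P k \<omega>})"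
      using assms(2,3) by (auto intro!: summable_comparison_test_ev[of _ f])
  qed (use assms in \<open>auto simp: emeasure_eq_measure\<close>)
  then show ?thesis by (auto elim!: eventually_mono)
qed

text \<open>\<open>\<beta>_small\<close> is Kolmogorov's condition in a form uniform over the past:
  for \<open>\<theta>\<close> of order \<open>tt N / sqrt N\<close> all
  \<open>\<theta> * d i\<close> with \<open>i < N\<close> become small, so the quadratic expansion
  of the exponential applies to each of them. The variance is bounded below only from
  \<open>n0\<close> on, when the truncation level has become large.\<close>

locale bounded_martingale_differences = martingale_differences +
  fixes \<beta> :: "nat \<Rightarrow> real" and c C :: real and n0 :: nat
  assumes c_pos: "0 < c"
    and sq_ge: "\<And>n. n0 \<le> n \<Longrightarrow> cond_sq_ge n c"
    and sq_le: "\<And>n. cond_sq_le n C"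
    and \<beta>: "\<And>n \<omega>. \<bar>d n \<omega>\<bar> \<le> \<beta> n"
    and \<beta>_small: "\<And>\<delta>. \<delta> > 0 \<Longrightarrow> \<forall>\<^sub>F N in sequentially. \<forall>i<N. \<beta> i * tt N \<le> \<delta> * sqrt (real N)"
begin

lemma c_le_C: "c \<le> C"
proof -
  have "c \<le> (\<integral>\<omega>. (d n0 \<omega>)\<^sup>2 \<partial>M)"
    using bspec[OF sq_ge[OF order_refl, unfolded cond_sq_ge_def] bmeas_const[of 1]] by (simp add: prob_space)
  also have "\<dots> \<le> C"
    using bspec[OF sq_le[of n0, unfolded cond_sq_le_def] bmeas_const[of 1]] by (simp add: prob_space)
  finally show ?thesis .
qed

lemma C_pos: "0 < C"
  using c_pos c_le_C by linarith

lemma small_increments: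
  assumes "0 \<le> R" "0 < \<delta>"
  shows "\<forall>\<^sub>F N in sequentially. \<forall>i<N. \<forall>\<omega>. \<bar>R * tt N / sqrt (real N) * d i \<omega>\<bar> \<le> \<delta>"
proof -
  have "\<delta> / (R + 1) > 0" using assms by simp
  from \<beta>_small[OF this] eventually_gt_at_top[of 0] show ?thesis
  proof eventually_elim
    case (elim N)
    show ?case
    proof (intro allI impI)
      fix i \<omega> assume "i < N"
      have "\<bar>R * tt N / sqrt (real N) * d i \<omega>\<bar> = R * (tt N * \<bar>d i \<omega>\<bar>) / sqrt (real N)"
        using assms tt_pos[of N] by (simp add: abs_mult)
      also have "\<dots> \<le> R * (tt N * \<beta> i) / sqrt (real N)"
        using assms tt_pos[of N] \<beta> by (intro divide_right_mono mult_left_mono) auto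
      also have "\<dots> \<le> R * (\<delta> / (R + 1) * sqrt (real N)) / sqrt (real N)"
        using assms elim \<open>i < N\<close> by (intro divide_right_mono mult_left_mono) (auto simp: mult.commute)
      also have "\<dots> = R * \<delta> / (R + 1)" using elim by simp
      also have "\<dots> \<le> \<delta>" using assms by (simp add: field_simps)
      finally show "\<bar>R * tt N / sqrt (real N) * d i \<omega>\<bar> \<le> \<delta>" .
    qed
  qed
qed

lemma small_increments_sq:
  assumes "0 \<le> R" "0 < \<delta>"
  shows "\<forall>\<^sub>F N in sequentially. \<forall>i<N. \<forall>\<omega>. R * (tt N)\<^sup>2 / real N * (d i \<omega>)\<^sup>2 \<le> \<delta>"
proof -
  have "0 \<le> sqrt R" "0 < sqrt \<delta>" using assms by auto
  from small_increments[OF this] show ?thesis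
  proof eventually_elim
    case (elim N)
    show ?case
    proof (intro allI impI)
      fix i \<omega> assume "i < N"
      then have "\<bar>sqrt R * tt N / sqrt (real N) * d i \<omega>\<bar>\<^sup>2 \<le> (sqrt \<delta>)\<^sup>2"
        using elim by (intro power_mono) auto
      then show "R * (tt N)\<^sup>2 / real N * (d i \<omega>)\<^sup>2 \<le> \<delta>"
        using assms by (simp add: power_mult_distrib power_divide)
    qed
  qed
qed

text \<open>A Chernoff bound over dyadic blocks with rate of order \<open>LL N / N\<close>. This
  rate is small enough for \<open>\<mu> * (d i \<omega>)\<^sup>2 \<le> 1\<close> and large enough to
  give summable probabilities.\<close>

lemma Q_lower:
  "AE \<omega> in M. \<forall>\<^sub>F n in sequentially. c / 16 * real n \<le> Q n \<omega>"
proof -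
  \<comment> \<open>Chosen so that the exponent \<open>\<mu> * c / 4 * N\<close> equals
    \<open>2 * LL (2 * N)\<close>, twice the critical one.\<close>
  define K where "K = 8 / c"
  have K: "0 < K" using c_pos by (simp add: K_def)
  define P where "P k \<omega> \<longleftrightarrow> Q (2 ^ Suc k) \<omega> - Q (2 ^ k) \<omega> < c / 4 * 2 ^ k" for k \<omega>
  have AE: "AE \<omega> in M. \<forall>\<^sub>F k in sequentially. \<not> P k \<omega>"
  proof (rule AE_eventually_of_summable)
    show "{\<omega> \<in> space M. P k \<omega>} \<in> events" for k
      unfolding P_def by measurable
    show "summable (\<lambda>k. exp (- 2 * LL (real (2 ^ k))))"
      using summable_exp_LL[of 2 2] by simp
    have "\<forall>\<^sub>F k in sequentially. \<forall>i<2 ^ Suc k. \<forall>\<omega>. K * (tt (2 ^ Suc k))\<^sup>2 / real (2 ^ Suc k) * (d i \<omega>)\<^sup>2 \<le> 1"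
      using eventually_pow_Suc[OF small_increments_sq[of K 1], of 2] K by simp
    moreover have "\<forall>\<^sub>F k in sequentially. n0 \<le> 2 ^ k"
      using filterlim_pow[of 2] by (simp add: filterlim_at_top)
    ultimately show "\<forall>\<^sub>F k in sequentially. prob {\<omega> \<in> space M. P k \<omega>} \<le> exp (- 2 * LL (real (2 ^ k)))"
    proof eventually_elim
      case (elim k)
      define N where "N = (2::nat) ^ k"
      have N2: "2 ^ Suc k = 2 * N" by (simp add: N_def)
      have N: "0 < N" by (simp add: N_def)
      define \<mu> where "\<mu> = K * (tt (2 * N))\<^sup>2 / real (2 * N)"
      have \<mu>: "0 \<le> \<mu>" "\<And>i \<omega>. i < 2 * N \<Longrightarrow> \<mu> * (d i \<omega>)\<^sup>2 \<le> 1"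
        using K elim by (auto simp: \<mu>_def N_def)
      define f where "f i \<omega> = exp (- \<mu> * (d i \<omega>)\<^sup>2 + \<mu> * c / 2)" for i \<omega>
      have f: "sup_factor i (f i)" if "N \<le> i" "i < 2 * N" for i
        unfolding f_def using \<mu> that elim sq_ge by (intro sup_factor_exp_sq_lower) (auto simp: N_def)
      have prod: "(\<Prod>i\<in>{N..<2 * N}. f i \<omega>) = exp (- \<mu> * (Q (2 * N) \<omega> - Q N \<omega>) + N * (\<mu> * c / 2))" for \<omega>
        by (simp add: f_def Q_diff exp_sum[symmetric] sum.distrib sum_distrib_left sum_subtractf sum_negf)
      have "prob {\<omega> \<in> space M. P k \<omega>} \<le> (\<integral>\<omega>. (\<Prod>i\<in>{N..<2 * N}. f i \<omega>) \<partial>M) / exp (\<mu> * c / 4 * N)"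
      proof (rule markov_bmeas)
        show "(\<lambda>\<omega>. \<Prod>i\<in>{N..<2 * N}. f i \<omega>) \<in> bmeas M"
          using f by (intro bmeas_F_M[of _ "2 * N"] bmeas_prod_adapted) (auto simp: sup_factor_def)
        fix \<omega> assume "\<omega> \<in> {\<omega> \<in> space M. P k \<omega>}"
        then have "Q (2 * N) \<omega> - Q N \<omega> \<le> c / 4 * N"
          by (simp add: P_def N_def)
        then have "\<mu> * (Q (2 * N) \<omega> - Q N \<omega>) \<le> \<mu> * (c / 4 * N)" using \<mu> by (intro mult_left_mono)
        then show "exp (\<mu> * c / 4 * N) \<le> (\<Prod>i\<in>{N..<2 * N}. f i \<omega>)"
          unfolding prod by (simp add: algebra_simps)
      qed (auto simp: prod)
      also have "\<dots> \<le> 1 / exp (\<mu> * c / 4 * N)"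
        using integral_prod_sup_factor[of N "2 * N" f "\<lambda>_. 1"] f
        by (intro divide_right_mono) (auto simp: prob_space)
      also have "\<dots> = exp (- (\<mu> * c / 4 * N))" by (simp add: exp_minus inverse_eq_divide)
      also have "\<mu> * c / 4 * N = 2 * LL (real (2 * N))"
        using N c_pos by (simp add: \<mu>_def K_def tt_sq)
      also have "exp (- (2 * LL (real (2 * N)))) \<le> exp (- 2 * LL (real N))"
        using LL_mono[of "real N" "real (2 * N)"] by simp
      finally show ?case by (simp add: N_def)
    qed
  qed
  then show ?thesis
  proof eventually_elim
    case (elim \<omega>)
    then obtain k0 where k0: "\<And>k. k0 \<le> k \<Longrightarrow> c / 4 * 2 ^ k \<le> Q (2 ^ Suc k) \<omega> - Q (2 ^ k) \<omega>"
      by (auto simp: eventually_sequentially P_def not_less)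
    show ?case
    proof (rule eventually_between_powers[of 2])
      show "\<forall>\<^sub>F k in sequentially. \<forall>n. 2 ^ k \<le> n \<longrightarrow> n < 2 ^ Suc k \<longrightarrow> c / 16 * real n \<le> Q n \<omega>"
        unfolding eventually_sequentially
      proof (intro exI allI impI)
        fix k n :: nat assume k: "Suc k0 \<le> k" and n: "2 ^ k \<le> n" "n < 2 ^ Suc k"
        \<comment> \<open>The last complete block before \<open>n\<close> starts at
          \<open>2 ^ l\<close>, and \<open>n < 4 * 2 ^ l\<close>; this turns the constant
          \<open>c / 4\<close> into \<open>c / 16\<close>.\<close>
        then obtain l where l: "k = Suc l" "k0 \<le> l" by (cases k) auto
        have "real n < real (2 ^ Suc k)" using n by (simp only: of_nat_less_iff)
        then have "real n \<le> 4 * 2 ^ l" using l by simp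
        then have "c / 16 * real n \<le> c / 4 * 2 ^ l" using c_pos by simp
        also have "\<dots> \<le> Q (2 ^ k) \<omega>" using k0[of l] l Q_nonneg[of "2 ^ l" \<omega>] by simp
        also have "\<dots> \<le> Q n \<omega>" using n by (intro Q_mono)
        finally show "c / 16 * real n \<le> Q n \<omega>" .
      qed
    qed simp
  qed
qed

lemma Q_upper:
  "AE \<omega> in M. \<forall>\<^sub>F n in sequentially. Q n \<omega> \<le> 8 * C * real n"
proof -
  \<comment> \<open>Makes the exponent \<open>2 * \<mu> * C * N\<close> equal to
    \<open>4 * LL N\<close>.\<close>
  define K where "K = 1 / C"
  have K: "0 < K" using C_pos by (simp add: K_def)
  define P where "P k \<omega> \<longleftrightarrow> 4 * C * 2 ^ k < Q (2 ^ k) \<omega>" for k \<omega>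
  have AE: "AE \<omega> in M. \<forall>\<^sub>F k in sequentially. \<not> P k \<omega>"
  proof (rule AE_eventually_of_summable)
    show "{\<omega> \<in> space M. P k \<omega>} \<in> events" for k
      unfolding P_def by measurable
    show "summable (\<lambda>k. exp (- 4 * LL (real (2 ^ k))))"
      using summable_exp_LL[of 4 2] by simp
    have "\<forall>\<^sub>F k in sequentially. \<forall>i<2 ^ k. \<forall>\<omega>. K * (tt (2 ^ k))\<^sup>2 / real (2 ^ k) * (d i \<omega>)\<^sup>2 \<le> 1"
      using eventually_pow[OF small_increments_sq[of K 1], of 2] K by simp
    then show "\<forall>\<^sub>F k in sequentially. prob {\<omega> \<in> space M. P k \<omega>} \<le> exp (- 4 * LL (real (2 ^ k)))"
    proof eventually_elim
      case (elim k)
      define N where "N = (2::nat) ^ k"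
      have N: "0 < N" by (simp add: N_def)
      define \<mu> where "\<mu> = K * (tt N)\<^sup>2 / real N"
      have \<mu>: "0 \<le> \<mu>" "\<And>i \<omega>. i < N \<Longrightarrow> \<mu> * (d i \<omega>)\<^sup>2 \<le> 1"
        using K elim by (auto simp: \<mu>_def N_def)
      define f where "f i \<omega> = exp (\<mu> * (d i \<omega>)\<^sup>2 - 2 * \<mu> * C)" for i \<omega>
      have f: "sup_factor i (f i)" if "i < N" for i
        unfolding f_def using \<mu> that sq_le by (intro sup_factor_exp_sq_upper) auto
      have prod: "(\<Prod>i\<in>{0..<N}. f i \<omega>) = exp (\<mu> * Q N \<omega> - N * (2 * \<mu> * C))" for \<omega>
        by (simp add: f_def Q_def lessThan_atLeast0 exp_sum[symmetric] sum_distrib_left sum_subtractf)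
      have "prob {\<omega> \<in> space M. P k \<omega>} \<le> (\<integral>\<omega>. (\<Prod>i\<in>{0..<N}. f i \<omega>) \<partial>M) / exp (2 * \<mu> * C * N)"
      proof (rule markov_bmeas)
        show "(\<lambda>\<omega>. \<Prod>i\<in>{0..<N}. f i \<omega>) \<in> bmeas M"
          using f by (intro bmeas_F_M[of _ N] bmeas_prod_adapted) (auto simp: sup_factor_def)
        fix \<omega> assume "\<omega> \<in> {\<omega> \<in> space M. P k \<omega>}"
        then have "4 * C * N \<le> Q N \<omega>"
          by (simp add: P_def N_def)
        then have "\<mu> * (4 * C * N) \<le> \<mu> * Q N \<omega>" using \<mu> by (intro mult_left_mono)
        then show "exp (2 * \<mu> * C * N) \<le> (\<Prod>i\<in>{0..<N}. f i \<omega>)"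
          unfolding prod by (simp add: algebra_simps)
      qed (auto simp: prod)
      also have "\<dots> \<le> 1 / exp (2 * \<mu> * C * N)"
        using integral_prod_sup_factor[of 0 N f "\<lambda>_. 1"] f
        by (intro divide_right_mono) (auto simp: prob_space)
      also have "\<dots> = exp (- (2 * \<mu> * C * N))" by (simp add: exp_minus inverse_eq_divide)
      also have "2 * \<mu> * C * N = 4 * LL (real N)"
        using N C_pos by (simp add: \<mu>_def K_def tt_sq)
      finally show ?case by (simp add: N_def)
    qed
  qed
  then show ?thesis
  proof eventually_elim
    case (elim \<omega>)
    then obtain k0 where k0: "\<And>k. k0 \<le> k \<Longrightarrow> Q (2 ^ k) \<omega> \<le> 4 * C * 2 ^ k"
      by (auto simp: eventually_sequentially P_def not_less)
    show ?case
    proof (rule eventually_between_powers[of 2])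
      show "\<forall>\<^sub>F k in sequentially. \<forall>n. 2 ^ k \<le> n \<longrightarrow> n < 2 ^ Suc k \<longrightarrow> Q n \<omega> \<le> 8 * C * real n"
        unfolding eventually_sequentially
      proof (intro exI allI impI)
        fix k n :: nat assume k: "k0 \<le> k" and n: "2 ^ k \<le> n" "n < 2 ^ Suc k"
        have "Q n \<omega> \<le> Q (2 ^ Suc k) \<omega>" using n by (intro Q_mono) auto
        also have "\<dots> \<le> 4 * C * 2 ^ Suc k" using k by (intro k0) auto
        also have "\<dots> = 8 * C * 2 ^ k" by simp
        also have "\<dots> \<le> 8 * C * real n"
          using n C_pos by (intro mult_left_mono) (auto simp flip: of_nat_le_iff)
        finally show "Q n \<omega> \<le> 8 * C * real n" .
      qed
    qed simp
  qed
qed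

text \<open>
  In the block \<open>[2\<^sup>k, 2\<^sup>k\<^sup>+\<^sup>1)\<close> and on the event that the quadratic variation lies in a narrow
  window, a single \<open>\<theta>\<close> in the exponential supermartingale is nearly optimal.
\<close>

lemma upper_window:
  assumes \<epsilon>: "0 < \<epsilon>" "\<epsilon> \<le> 1" and \<kappa>: "0 < \<kappa>"
  shows "AE \<omega> in M. \<forall>\<^sub>F k in sequentially. \<forall>n. 2 ^ k \<le> n \<longrightarrow> n < 2 ^ Suc k \<longrightarrow>
    \<kappa> * 2 ^ k \<le> Q n \<omega> \<longrightarrow> Q n \<omega> \<le> (1 + \<epsilon> / 4) * \<kappa> * 2 ^ k \<longrightarrow> D n \<omega> < (1 + \<epsilon>) * tt n * sqrt (Q n \<omega>)"
proof -
  \<comment> \<open>The excess over \<open>1 / 2\<close> absorbs the error of the expansion, which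
    leaves the coefficient \<open>0\<close> in front of the square.\<close>
  define a where "a = 1 / 2 + \<epsilon> / 8"
  obtain \<delta> where \<delta>: "\<delta> > 0" "\<And>x. \<bar>x\<bar> \<le> \<delta> \<Longrightarrow> exp (x - a * x\<^sup>2) \<le> 1 + x - (a - 1/2 - \<epsilon> / 8) * x\<^sup>2"
    using exp_quadratic_bounds[of "\<epsilon> / 8" a] \<epsilon> by (metis zero_less_divide_iff zero_less_numeral)
  have \<delta>': "exp (x - a * x\<^sup>2) \<le> 1 + x - 0 * x\<^sup>2" if "\<bar>x\<bar> \<le> \<delta>" for x
    using \<delta>(2)[OF that] by (simp add: a_def)
  \<comment> \<open>The quadratic term, at the upper edge of the window, costs
    \<open>1 / 2 + \<epsilon> / 2\<close> out of \<open>1 + \<epsilon>\<close>, in units of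
    \<open>(tt N)\<^sup>2 = 2 * LL N\<close>. What remains is the exponent
    \<open>(1 + \<epsilon>) * LL N\<close>, just above the critical one.\<close>
  have a2: "a * (1 + \<epsilon> / 4) \<le> 1 / 2 + \<epsilon> / 2"
  proof -
    have "\<epsilon> * \<epsilon> \<le> \<epsilon>" using \<epsilon> by (simp add: mult_left_le)
    then show ?thesis using \<epsilon> by (simp add: a_def field_simps)
  qed
  define P where "P k \<omega> \<longleftrightarrow> (\<exists>n\<in>{2 ^ k..<2 ^ Suc k}. \<kappa> * 2 ^ k \<le> Q n \<omega> \<and> Q n \<omega> \<le> (1 + \<epsilon> / 4) * \<kappa> * 2 ^ k \<and>
    (1 + \<epsilon>) * tt n * sqrt (Q n \<omega>) \<le> D n \<omega>)" for k \<omega>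
  have "AE \<omega> in M. \<forall>\<^sub>F k in sequentially. \<not> P k \<omega>"
  proof (rule AE_eventually_of_summable)
    show "{\<omega> \<in> space M. P k \<omega>} \<in> events" for k
      unfolding P_def by measurable
    show "summable (\<lambda>k. exp (- (1 + \<epsilon>) * LL (real (2 ^ k))))"
      using summable_exp_LL[of "1 + \<epsilon>" 2] \<epsilon> by simp
    have "\<forall>\<^sub>F k in sequentially. \<forall>i<2 ^ Suc k. \<forall>\<omega>. \<bar>sqrt (2 / \<kappa>) * tt (2 ^ Suc k) / sqrt (real (2 ^ Suc k)) * d i \<omega>\<bar> \<le> \<delta>"
      using eventually_pow_Suc[OF small_increments[of "sqrt (2 / \<kappa>)" \<delta>], of 2] \<kappa> \<delta>(1) by simp
    then show "\<forall>\<^sub>F k in sequentially. prob {\<omega> \<in> space M. P k \<omega>} \<le> exp (- (1 + \<epsilon>) * LL (real (2 ^ k)))"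
    proof eventually_elim
      case (elim k)
      define N where "N = (2::nat) ^ k"
      have N: "0 < N" by (simp add: N_def)
      have N2: "2 ^ Suc k = 2 * N" by (simp add: N_def)
      \<comment> \<open>The maximiser of \<open>\<theta> * D - \<theta>\<^sup>2 * Q / 2\<close> at
        \<open>Q = \<kappa> * N\<close> and \<open>D = tt N * sqrt Q\<close>.\<close>
      define \<theta> where "\<theta> = tt N / sqrt (\<kappa> * N)"
      have \<theta>_pos: "0 < \<theta>" using \<kappa> N tt_pos by (simp add: \<theta>_def)
      have \<theta>2: "\<theta>\<^sup>2 * (\<kappa> * N) = (tt N)\<^sup>2" "\<theta> * sqrt (\<kappa> * N) = tt N"
        using \<kappa> N by (auto simp: \<theta>_def power_divide)
      have \<theta>_le: "\<theta> \<le> sqrt (2 / \<kappa>) * tt (2 ^ Suc k) / sqrt (real (2 ^ Suc k))"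
      proof -
        have "sqrt (2 / \<kappa>) / sqrt (real (2 * N)) = 1 / sqrt (\<kappa> * N)"
          using \<kappa> N by (simp add: real_sqrt_divide real_sqrt_mult)
        then have "sqrt (2 / \<kappa>) * tt (2 * N) / sqrt (real (2 * N)) = tt (2 * N) / sqrt (\<kappa> * N)"
          by (metis mult.commute times_divide_eq_right mult.right_neutral)
        also have "\<theta> \<le> \<dots>"
          unfolding \<theta>_def using \<kappa> by (intro divide_right_mono tt_mono) auto
        finally show ?thesis by (simp only: N2)
      qed
      define f where "f i \<omega> = exp (\<theta> * d i \<omega> - a * \<theta>\<^sup>2 * (d i \<omega>)\<^sup>2 + 0 * 0 * \<theta>\<^sup>2)" for i \<omega>
      have f: "sup_factor i (f i)" if "i < 2 * N" for i
        unfolding f_def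
      proof (rule sup_factor_exp[OF \<delta>'])
        fix \<omega>
        have "\<bar>\<theta> * d i \<omega>\<bar> \<le> \<bar>sqrt (2 / \<kappa>) * tt (2 ^ Suc k) / sqrt (real (2 ^ Suc k)) * d i \<omega>\<bar>"
          unfolding abs_mult[of _ "d i \<omega>"] using \<theta>_le \<theta>_pos by (intro mult_right_mono) (linarith, simp)
        also have "\<dots> \<le> \<delta>" using elim that N2 by auto
        finally show "\<bar>\<theta> * d i \<omega>\<bar> \<le> \<delta>" .
      qed (auto simp: cond_sq_ge_0)
      have prod: "(\<Prod>i\<in>{0..<m}. f i \<omega>) = exp (\<theta> * D m \<omega> - a * \<theta>\<^sup>2 * Q m \<omega>)" for m \<omega>
        by (simp add: f_def Q_def D_def lessThan_atLeast0 exp_sum[symmetric] sum_distrib_left sum_subtractf)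
      define s where "s = (tt N)\<^sup>2 * (1 / 2 + \<epsilon> / 2)"
      have "{\<omega> \<in> space M. P k \<omega>} \<subseteq> {\<omega> \<in> space M. \<exists>m\<in>{0..<2 * N}. exp s \<le> (\<Prod>i\<in>{0..<m}. f i \<omega>)}"
      proof safe
        fix \<omega> assume "P k \<omega>"
        then obtain n where n: "N \<le> n" "n < 2 * N" "\<kappa> * N \<le> Q n \<omega>" "Q n \<omega> \<le> (1 + \<epsilon> / 4) * \<kappa> * N"
          "(1 + \<epsilon>) * tt n * sqrt (Q n \<omega>) \<le> D n \<omega>"
          unfolding P_def N2 by (auto simp: N_def)
        have "(1 + \<epsilon>) * tt N * sqrt (\<kappa> * N) \<le> (1 + \<epsilon>) * tt n * sqrt (Q n \<omega>)"
          using n \<epsilon> \<kappa> tt_pos[of n] tt_pos[of N] by (intro mult_mono tt_mono mult_nonneg_nonneg) auto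
        then have "\<theta> * ((1 + \<epsilon>) * tt N * sqrt (\<kappa> * N)) \<le> \<theta> * D n \<omega>"
          using n \<theta>_pos by (intro mult_left_mono) auto
        then have 1: "(1 + \<epsilon>) * (tt N)\<^sup>2 \<le> \<theta> * D n \<omega>"
        proof -
          have "\<theta> * ((1 + \<epsilon>) * tt N * sqrt (\<kappa> * N)) = (1 + \<epsilon>) * tt N * (\<theta> * sqrt (\<kappa> * N))"
            by (simp only: mult_ac)
          then have "\<theta> * ((1 + \<epsilon>) * tt N * sqrt (\<kappa> * N)) = (1 + \<epsilon>) * (tt N)\<^sup>2"
            unfolding \<theta>2(2) by (simp add: power2_eq_square)
          with \<open>_ \<le> \<theta> * D n \<omega>\<close> show ?thesis by simp
        qed
        have "a * \<theta>\<^sup>2 * Q n \<omega> \<le> a * \<theta>\<^sup>2 * ((1 + \<epsilon> / 4) * \<kappa> * N)"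
          using n \<epsilon> by (intro mult_left_mono) (auto simp: a_def)
        also have "\<dots> = a * (1 + \<epsilon> / 4) * (\<theta>\<^sup>2 * (\<kappa> * N))" by (simp only: mult_ac)
        also have "\<dots> \<le> (1 / 2 + \<epsilon> / 2) * (tt N)\<^sup>2"
          unfolding \<theta>2(1) using a2 by (intro mult_right_mono) auto
        finally have "s \<le> \<theta> * D n \<omega> - a * \<theta>\<^sup>2 * Q n \<omega>"
          using 1 by (simp add: s_def algebra_simps)
        then show "\<exists>m\<in>{0..<2 * N}. exp s \<le> (\<Prod>i\<in>{0..<m}. f i \<omega>)"
          using n by (intro bexI[of _ n]) (auto simp: prod)
      qed
      moreover have "{\<omega> \<in> space M. \<exists>m\<in>{0..<2 * N}. exp s \<le> (\<Prod>i\<in>{0..<m}. f i \<omega>)} \<in> events"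
        unfolding prod by measurable
      ultimately have "prob {\<omega> \<in> space M. P k \<omega>} \<le> prob {\<omega> \<in> space M. \<exists>m\<in>{0..<2 * N}. exp s \<le> (\<Prod>i\<in>{0..<m}. f i \<omega>)}"
        by (intro finite_measure_mono)
      also have "\<dots> \<le> 1 / exp s"
        using f by (intro sup_factor_maximal) auto
      also have "\<dots> = exp (- s)" by (simp add: exp_minus inverse_eq_divide)
      also have "- s = - (1 + \<epsilon>) * LL (real N)"
        by (simp add: s_def tt_sq algebra_simps)
      finally show ?case by (simp add: N_def)
    qed
  qed
  then show ?thesis
  proof eventually_elim
    case (elim \<omega>)
    then show ?case
    proof eventually_elim
      case (elim k)
      show ?case
      proof (intro allI impI)
        fix n :: nat
        assume "2 ^ k \<le> n" "n < 2 ^ Suc k" "\<kappa> * 2 ^ k \<le> Q n \<omega>" "Q n \<omega> \<le> (1 + \<epsilon> / 4) * \<kappa> * 2 ^ k"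
        then show "D n \<omega> < (1 + \<epsilon>) * tt n * sqrt (Q n \<omega>)"
          using elim unfolding P_def by (meson atLeastLessThan_iff not_le)
      qed
    qed
  qed
qed

lemma upper_LIL:
  assumes \<epsilon>: "0 < \<epsilon>" "\<epsilon> \<le> 1"
  shows "AE \<omega> in M. \<forall>\<^sub>F n in sequentially. D n \<omega> \<le> (1 + \<epsilon>) * tt n * sqrt (Q n \<omega>)"
proof -
  define r where "r = 1 + \<epsilon> / 4"
  define \<kappa> where "\<kappa> i = c / 16 * r ^ i" for i :: nat
  have r: "1 < r" using \<epsilon> by (simp add: r_def)
  have \<kappa>: "0 < \<kappa> i" for i using c_pos r by (simp add: \<kappa>_def)
  have "AE \<omega> in M. \<forall>i. \<forall>\<^sub>F k in sequentially. \<forall>n. 2 ^ k \<le> n \<longrightarrow> n < 2 ^ Suc k \<longrightarrow>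
    \<kappa> i * 2 ^ k \<le> Q n \<omega> \<longrightarrow> Q n \<omega> \<le> r * \<kappa> i * 2 ^ k \<longrightarrow> D n \<omega> < (1 + \<epsilon>) * tt n * sqrt (Q n \<omega>)"
    unfolding AE_all_countable r_def using upper_window[OF \<epsilon> \<kappa>] by blast
  with Q_lower Q_upper show ?thesis
  proof eventually_elim
    case (elim \<omega>)
    \<comment> \<open>In a late block \<open>Q n\<close> lies between \<open>c / 16 * 2 ^ k\<close>
      and \<open>16 * C * 2 ^ k\<close>, so the windows with index up to \<open>m\<close> cover all
      values. As \<open>m\<close> is the same for every block, the finitely many eventual statements
      can be combined.\<close>
    obtain m where m: "16 * C / (c / 16) < r ^ m"
      using real_arch_pow[OF r] by blast
    have "\<forall>\<^sub>F k in sequentially. \<forall>i\<in>{..m}. \<forall>n. 2 ^ k \<le> n \<longrightarrow> n < 2 ^ Suc k \<longrightarrow>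
      \<kappa> i * 2 ^ k \<le> Q n \<omega> \<longrightarrow> Q n \<omega> \<le> r * \<kappa> i * 2 ^ k \<longrightarrow> D n \<omega> < (1 + \<epsilon>) * tt n * sqrt (Q n \<omega>)"
      using elim(3) by (intro eventually_ball_finite) auto
    moreover have "\<forall>\<^sub>F k in sequentially. \<forall>n\<ge>2 ^ k. c / 16 * real n \<le> Q n \<omega> \<and> Q n \<omega> \<le> 8 * C * real n"
      using eventually_pow[OF eventually_all_ge_at_top[OF eventually_conj[OF elim(1,2)]], of 2] by simp
    ultimately have "\<forall>\<^sub>F k in sequentially. \<forall>n. 2 ^ k \<le> n \<longrightarrow> n < 2 ^ Suc k \<longrightarrow> D n \<omega> \<le> (1 + \<epsilon>) * tt n * sqrt (Q n \<omega>)"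
    proof eventually_elim
      case (elim k)
      show ?case
      proof (intro allI impI)
        fix n :: nat assume n: "2 ^ k \<le> n" "n < 2 ^ Suc k"
        have "real (2 ^ k) \<le> real n" "real n < real (2 ^ Suc k)"
          using n by (simp_all only: of_nat_le_iff of_nat_less_iff)
        then have n': "2 ^ k \<le> real n" "real n < 2 * 2 ^ k" by simp_all
        define q where "q = Q n \<omega> / (c / 16 * 2 ^ k)"
        have "c / 16 * 2 ^ k \<le> c / 16 * real n" using n' c_pos by simp
        also have "\<dots> \<le> Q n \<omega>" using elim n by auto
        finally have q1: "1 \<le> q" using c_pos by (simp add: q_def)
        have "Q n \<omega> \<le> 8 * C * real n" using elim n by auto
        also have "\<dots> \<le> 8 * C * (2 * 2 ^ k)" using n' C_pos by (intro mult_left_mono) auto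
        finally have "q \<le> 16 * C / (c / 16)" using c_pos by (simp add: q_def field_simps)
        then have qm: "q < r ^ m" using m by linarith
        define i where "i = (LEAST i. q < r ^ Suc i)"
        have "q < r ^ Suc m" using qm r power_strict_increasing[of m "Suc m" r] by linarith
        then have i: "q < r ^ Suc i" "i \<le> m" unfolding i_def by (rule LeastI) (rule Least_le, fact)
        have "r ^ i \<le> q"
        proof (cases i)
          case (Suc j)
          then have "\<not> q < r ^ Suc j" using not_less_Least[of j "\<lambda>i. q < r ^ Suc i"] by (simp add: i_def)
          then show ?thesis using Suc by simp
        qed (use q1 in simp)
        then have "\<kappa> i * 2 ^ k \<le> Q n \<omega>" "Q n \<omega> \<le> r * \<kappa> i * 2 ^ k"
          using i(1) c_pos by (simp_all add: q_def \<kappa>_def field_simps)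
        then show "D n \<omega> \<le> (1 + \<epsilon>) * tt n * sqrt (Q n \<omega>)"
          using elim(1) i(2) n by (intro less_imp_le) auto
      qed
    qed
    then show ?case by (rule eventually_between_powers[rotated]) simp
  qed
qed

end

section \<open>Lower bound in the law of the iterated logarithm\<close>

text \<open>Multiplying \<open>1 - p k \<le> exp (- p k)\<close> over the blocks bounds the
  probability of missing all events between \<open>m\<close> and \<open>n\<close> by
  \<open>exp\<close> of minus the sum of \<open>p\<close>. Were the limit positive, its logarithm
  would bound the partial sums of \<open>p\<close>.\<close>

lemma (in filtered_prob_space) AE_frequently_of_conditional:
  assumes E: "\<And>k. E k \<in> sets (F (r (Suc k)))" and r: "mono r"
    and p: "\<And>k A. k0 \<le> k \<Longrightarrow> A \<in> sets (F (r k)) \<Longrightarrow> p k * prob A \<le> prob (A \<inter> E k)"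
    and p_nonneg: "\<And>k. 0 \<le> p k" and p_sum: "\<not> summable p"
  shows "AE \<omega> in M. \<exists>\<^sub>\<infinity>k. \<omega> \<in> E k"
proof -
  have E_M: "E k \<in> events" for k using E sets_F_M by blast
  define B where "B m n = space M - (\<Union>k\<in>{m..<n}. E k)" for m n
  have B: "B m n \<in> sets (F (r n))" for m n
  proof -
    have "E k \<in> sets (F (r n))" if "k < n" for k
      using E[of k] F_mono[of "r (Suc k)" "r n"] monoD[OF r, of "Suc k" n] that by auto
    then have "(\<Union>k\<in>{m..<n}. E k) \<in> sets (F (r n))" by (intro sets.finite_UN) auto
    from sets.compl_sets[OF this] show ?thesis by (simp add: B_def)
  qed
  have le: "prob (B m n) \<le> exp (- (\<Sum>k\<in>{m..<n}. p k))" if "k0 \<le> m" "m \<le> n" for m n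
    using that(2)
  proof (induction n rule: dec_induct)
    case (step n)
    have eq: "B m (Suc n) = B m n - (B m n \<inter> E n)"
      using step(1) by (auto simp: B_def less_Suc_eq)
    have "prob (B m (Suc n)) = prob (B m n) - prob (B m n \<inter> E n)"
      unfolding eq using B E_M sets_F_M by (intro finite_measure_Diff) auto
    also have "\<dots> \<le> prob (B m n) - p n * prob (B m n)"
      using p[of n "B m n"] B that step(1) by simp
    also have "\<dots> = (1 - p n) * prob (B m n)" by (simp add: algebra_simps)
    also have "\<dots> \<le> exp (- p n) * prob (B m n)"
      using exp_ge_add_one_self[of "- p n"] by (intro mult_right_mono) auto
    also have "\<dots> \<le> exp (- p n) * exp (- (\<Sum>k\<in>{m..<n}. p k))"
      using step by (intro mult_left_mono) auto
    also have "\<dots> = exp (- (\<Sum>k\<in>{m..<Suc n}. p k))"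
      using step(1) by (simp flip: exp_add add: sum.atLeastLessThan_Suc)
    finally show ?case .
  qed simp
  have "prob (\<Inter>n. B m n) = 0" if "k0 \<le> m" for m
  proof (rule ccontr)
    assume "prob (\<Inter>n. B m n) \<noteq> 0"
    then have pos: "0 < prob (\<Inter>n. B m n)" by (simp add: zero_less_measure_iff)
    define S where "S = - ln (prob (\<Inter>n. B m n)) + (\<Sum>k<m. p k)"
    have "(\<Sum>k<n. p k) \<le> S" for n
    proof -
      let ?n = "max m n"
      have "prob (\<Inter>n. B m n) \<le> prob (B m ?n)"
        using B sets_F_M by (intro finite_measure_mono) auto
      also have "\<dots> \<le> exp (- (\<Sum>k\<in>{m..<?n}. p k))" by (rule le) (use that in auto)
      finally have "ln (prob (\<Inter>n. B m n)) \<le> - (\<Sum>k\<in>{m..<?n}. p k)"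
        using pos by (subst (asm) ln_le_cancel_iff[symmetric]) auto
      moreover have "(\<Sum>k<?n. p k) = (\<Sum>k<m. p k) + (\<Sum>k\<in>{m..<?n}. p k)"
        by (simp add: lessThan_atLeast0 sum.atLeastLessThan_concat)
      moreover have "(\<Sum>k<n. p k) \<le> (\<Sum>k<?n. p k)"
        using p_nonneg by (intro sum_mono2) auto
      ultimately show ?thesis by (simp add: S_def)
    qed
    then have "sum p {..n} \<le> S" for n by (metis lessThan_Suc_atMost)
    then have "summable p" using p_nonneg by (intro bounded_imp_summable[of p S])
    then show False using p_sum by simp
  qed
  then have "(\<Inter>n. B m n) \<in> null_sets M" if "k0 \<le> m" for m
    using that B sets_F_M by (auto simp: null_sets_def emeasure_eq_measure)
  then have "AE \<omega> in M. \<omega> \<notin> (\<Inter>n. B (max m k0) n)" for m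
    by (intro AE_not_in) auto
  then have "AE \<omega> in M. \<forall>m. \<omega> \<notin> (\<Inter>n. B (max m k0) n)"
    by (simp add: AE_all_countable)
  with AE_space show ?thesis
  proof eventually_elim
    case (elim \<omega>)
    show ?case
      unfolding INFM_nat_le
    proof
      fix m
      obtain n where "\<omega> \<notin> B (max m k0) n" using elim by auto
      then show "\<exists>k\<ge>m. \<omega> \<in> E k" using elim by (auto simp: B_def)
    qed
  qed
qed

context bounded_martingale_differences
begin

text \<open>The test is made before step \<open>i\<close>, hence is an event of \<open>F i\<close>.
  The step that crosses \<open>q\<close> is still counted in \<open>DS\<close> and
  \<open>QS\<close>, so \<open>QS\<close> overshoots \<open>q\<close> by less than that one
  square.\<close>

definition stopped :: "nat \<Rightarrow> real \<Rightarrow> nat \<Rightarrow> 'a \<Rightarrow> bool" where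
  "stopped N q i \<omega> \<longleftrightarrow> q \<le> Q i \<omega> - Q N \<omega>"

definition DS :: "nat \<Rightarrow> real \<Rightarrow> nat \<Rightarrow> 'a \<Rightarrow> real" where
  "DS N q n \<omega> = (\<Sum>i\<in>{N..<n}. if stopped N q i \<omega> then 0 else d i \<omega>)"

definition QS :: "nat \<Rightarrow> real \<Rightarrow> nat \<Rightarrow> 'a \<Rightarrow> real" where
  "QS N q n \<omega> = (\<Sum>i\<in>{N..<n}. if stopped N q i \<omega> then 0 else (d i \<omega>)\<^sup>2)"

lemma stopped_sets:
  assumes "N \<le> i"
  shows "{\<omega> \<in> space M. stopped N q i \<omega>} \<in> sets (F i)"
proof -
  have [measurable]: "Q i \<in> borel_measurable (F i)" "Q N \<in> borel_measurable (F i)"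
    using assms bmeas_measurable[OF Q_bmeas] measurable_F_mono by blast+
  have "{\<omega> \<in> space (F i). q \<le> Q i \<omega> - Q N \<omega>} \<in> sets (F i)" by measurable
  then show ?thesis by (simp add: stopped_def)
qed

lemma DS_QS_bmeas:
  shows "DS N q n \<in> bmeas (F n)" "QS N q n \<in> bmeas (F n)"
proof -
  have "(\<lambda>\<omega>. if stopped N q i \<omega> then 0 else d i \<omega>) \<in> bmeas (F n)"
    "(\<lambda>\<omega>. if stopped N q i \<omega> then 0 else (d i \<omega>)\<^sup>2) \<in> bmeas (F n)" if "i \<in> {N..<n}" for i
    using that stopped_sets[of N i q] F_mono[of i n] d_bmeas[of i] bmeas_F_mono[of "Suc i" n "d i"]
    by (auto intro!: bmeas_if)
  then show "DS N q n \<in> bmeas (F n)" "QS N q n \<in> bmeas (F n)"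
    unfolding DS_def[abs_def] QS_def[abs_def] by (auto intro!: bmeas_sum)
qed

text \<open>The stopping time appears only pathwise, as a witness that the stopped sums are ordinary
  increments up to some \<open>\<tau>\<close>. This lets the law of the iterated logarithm be read
  off at a genuine index, and it bounds the overshoot.\<close>

lemma stopped_char:
  assumes "N \<le> n" "0 < q" "\<And>i. i < n \<Longrightarrow> (d i \<omega>)\<^sup>2 \<le> B" "0 \<le> B"
  shows "\<exists>\<tau>\<in>{N..n}. DS N q n \<omega> = D \<tau> \<omega> - D N \<omega> \<and> QS N q n \<omega> = Q \<tau> \<omega> - Q N \<omega> \<and>
    (QS N q n \<omega> < q \<longrightarrow> \<tau> = n) \<and> QS N q n \<omega> \<le> q + B"
  using assms(1,3)
proof (induction n rule: dec_induct)
  case base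
  show ?case using assms by (intro bexI[of _ N]) (auto simp: DS_def QS_def)
next
  case (step n)
  have "\<exists>\<tau>\<in>{N..n}. DS N q n \<omega> = D \<tau> \<omega> - D N \<omega> \<and> QS N q n \<omega> = Q \<tau> \<omega> - Q N \<omega> \<and>
    (QS N q n \<omega> < q \<longrightarrow> \<tau> = n) \<and> QS N q n \<omega> \<le> q + B"
    by (rule step.IH) (use step.prems in auto)
  then obtain \<tau> where \<tau>: "\<tau> \<in> {N..n}" "DS N q n \<omega> = D \<tau> \<omega> - D N \<omega>" "QS N q n \<omega> = Q \<tau> \<omega> - Q N \<omega>"
    "QS N q n \<omega> < q \<Longrightarrow> \<tau> = n" "QS N q n \<omega> \<le> q + B"
    by blast
  have Suc: "DS N q (Suc n) \<omega> = DS N q n \<omega> + (if stopped N q n \<omega> then 0 else d n \<omega>)"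
    "QS N q (Suc n) \<omega> = QS N q n \<omega> + (if stopped N q n \<omega> then 0 else (d n \<omega>)\<^sup>2)"
    using step(1) by (simp_all add: DS_def QS_def sum.atLeastLessThan_Suc)
  show ?case
  proof (cases "stopped N q n \<omega>")
    case True
    then have "\<not> QS N q n \<omega> < q"
      using \<tau> by (auto simp: stopped_def)
    then show ?thesis using \<tau> True Suc by (intro bexI[of _ \<tau>]) auto
  next
    case False
    then have "QS N q n \<omega> < q"
      using \<tau> Q_mono[of \<tau> n \<omega>] by (auto simp: stopped_def)
    then have "\<tau> = n" using \<tau> by auto
    moreover have "D (Suc n) \<omega> = D n \<omega> + d n \<omega>" "Q (Suc n) \<omega> = Q n \<omega> + (d n \<omega>)\<^sup>2"
      by (simp_all add: D_def Q_def)
    ultimately show ?thesis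
      using \<tau> False Suc step.prems[of n] \<open>QS N q n \<omega> < q\<close> step(1)
      by (intro bexI[of _ "Suc n"]) auto
  qed
qed

lemma prod_stopped:
  "(\<Prod>i\<in>{N..<n}. if stopped N q i \<omega> then 1 else exp (x * d i \<omega> - y * (d i \<omega>)\<^sup>2))
    = exp (x * DS N q n \<omega> - y * QS N q n \<omega>)"
proof -
  have "(\<Prod>i\<in>{N..<n}. if stopped N q i \<omega> then 1 else exp (x * d i \<omega> - y * (d i \<omega>)\<^sup>2))
    = (\<Prod>i\<in>{N..<n}. exp (x * (if stopped N q i \<omega> then 0 else d i \<omega>) - y * (if stopped N q i \<omega> then 0 else (d i \<omega>)\<^sup>2)))"
    by (intro prod.cong) auto
  then show ?thesis
    by (simp add: DS_def QS_def exp_sum[symmetric] sum_subtractf sum_distrib_left)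
qed

text \<open>
  Lower exponential bound in a block.  The submartingale \<open>T\<close> has mean at least \<open>1\<close> and is
  negligible off the event in question, where it is compared with three supermartingales.
\<close>

lemma block_lower_bound:
  fixes \<epsilon> \<theta> q :: real and N n :: nat
  defines "\<eta> \<equiv> \<epsilon>\<^sup>2 / 48" and "u \<equiv> \<theta>\<^sup>2 * q"
  assumes \<epsilon>: "0 < \<epsilon>" "\<epsilon> \<le> 1/2" and N: "n0 \<le> N" "N \<le> n" and \<theta>: "0 < \<theta>"
    and q: "q = c * (real n - real N) / 2" "0 < q"
    and \<delta>: "\<And>x. \<bar>x\<bar> \<le> \<delta> \<Longrightarrow> exp (x - (1/2 + \<eta>) * x\<^sup>2) \<le> 1 + x"
      "\<And>x. \<bar>x\<bar> \<le> \<delta> \<Longrightarrow> exp (x - (3/2 + \<eta>) * x\<^sup>2) \<le> 1 + x - x\<^sup>2"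
      "\<And>x. \<bar>x\<bar> \<le> \<delta> \<Longrightarrow> 1 + x \<le> exp (x - (1/2 - \<eta>) * x\<^sup>2)"
    and small: "\<And>i \<omega>. i < n \<Longrightarrow> \<bar>2 * \<theta> * d i \<omega>\<bar> \<le> \<delta>" "\<And>i \<omega>. i < n \<Longrightarrow> (d i \<omega>)\<^sup>2 \<le> \<eta> * q"
    and u: "3 * exp (- u * (\<epsilon>\<^sup>2 / 4)) \<le> 1/2"
    and A: "A \<in> sets (F N)"
  shows "exp (- u * (1/2 + \<epsilon> + \<eta>)) / 2 * prob A
    \<le> prob (A \<inter> {\<omega> \<in> space M. q \<le> QS N q n \<omega> \<and> (1 - \<epsilon>) * \<theta> * q \<le> DS N q n \<omega>})"
proof -
  \<comment> \<open>All errors below are counted in units of \<open>\<eta>\<close>. Moving the tilt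
    by a factor \<open>1 + \<epsilon>\<close> or \<open>1 - \<epsilon>\<close> gains
    \<open>\<epsilon>\<^sup>2 = 48 * \<eta>\<close>; the errors use up at most
    \<open>36 * \<eta>\<close>, and the remaining
    \<open>12 * \<eta> = \<epsilon>\<^sup>2 / 4\<close> is the exponent in the assumption
    \<open>u\<close>.\<close>
  have \<eta>: "0 < \<eta>" "\<eta> \<le> 1/192" "\<epsilon>\<^sup>2 = 48 * \<eta>"
    using \<epsilon> power_mono[of \<epsilon> "1/2" 2] by (auto simp: \<eta>_def power2_eq_square)
  have prods: "\<epsilon> * \<eta> \<le> 1/2 * \<eta>" "0 \<le> \<epsilon> * \<eta>" "\<eta> * \<eta> \<le> 1/192 * \<eta>"
    "\<epsilon> * (\<eta> * \<eta>) \<le> 1 / 192 * \<eta>" "\<eta> * (\<eta> * \<eta>) \<le> 1/192 * \<eta>"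
  proof -
    show 1: "\<epsilon> * \<eta> \<le> 1/2 * \<eta>" and 2: "0 \<le> \<epsilon> * \<eta>" and 3: "\<eta> * \<eta> \<le> 1/192 * \<eta>"
      using \<epsilon> \<eta> by (auto intro!: mult_right_mono)
    have "\<epsilon> * (\<eta> * \<eta>) \<le> 1 * (\<eta> * \<eta>)" "\<eta> * (\<eta> * \<eta>) \<le> 1 * (\<eta> * \<eta>)"
      using \<epsilon> \<eta> by (intro mult_right_mono; simp)+
    with 3 show "\<epsilon> * (\<eta> * \<eta>) \<le> 1 / 192 * \<eta>" "\<eta> * (\<eta> * \<eta>) \<le> 1/192 * \<eta>" by linarith+
  qed
  have u0: "0 < u" using \<theta> q by (simp add: u_def)
  define T where "T x y \<omega> = exp (x * DS N q n \<omega> - y * QS N q n \<omega>)" for x y \<omega>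
  have T_bmeas: "T x y \<in> bmeas (F n)" for x y
    unfolding T_def[abs_def] by (intro bmeas_exp bmeas_diff bmeas_cmult DS_QS_bmeas)
  have A': "indicator A \<in> bmeas (F N)" "indicator A \<in> bmeas (F n)" "A \<in> events"
    using A N F_mono[of N n] sets_F_M by auto
  have TA: "integrable M (\<lambda>\<omega>. indicator A \<omega> * T x y \<omega>)" for x y
    using A'(2) T_bmeas by (intro bmeas_F_integrable[of _ n] bmeas_mult)
  have small': "\<bar>x * d i \<omega>\<bar> \<le> \<delta>" if "\<bar>x\<bar> \<le> 2 * \<theta>" "i < n" for x i \<omega>
  proof -
    have "\<bar>x * d i \<omega>\<bar> \<le> \<bar>2 * \<theta> * d i \<omega>\<bar>"
      unfolding abs_mult[of _ "d i \<omega>"] using that \<theta> by (intro mult_right_mono) auto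
    then show ?thesis using small(1)[OF that(2), of \<omega>] by linarith
  qed
  have sup1: "(\<integral>\<omega>. indicator A \<omega> * T x ((1/2 + \<eta>) * x\<^sup>2) \<omega> \<partial>M) \<le> prob A" if x: "\<bar>x\<bar> \<le> 2 * \<theta>" for x
  proof -
    have "sup_factor i (\<lambda>\<omega>. if stopped N q i \<omega> then 1 else exp (x * d i \<omega> - (1/2 + \<eta>) * x\<^sup>2 * (d i \<omega>)\<^sup>2))"
      if "N \<le> i" "i < n" for i
      using sup_factor_exp[of \<delta> "1/2 + \<eta>" 0 x i 0] \<delta>(1) small'[OF x] that
      by (intro sup_factor_if stopped_sets) (auto simp: cond_sq_ge_0)
    from integral_prod_sup_factor[OF N(2) this A'(1)] show ?thesis
      using A' by (simp add: prod_stopped T_def)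
  qed
  \<comment> \<open>The coefficient \<open>3/2 + \<eta>\<close> leaves a surplus square in the
    expansion, hence a factor \<open>exp (c * \<theta>\<^sup>2)\<close> per step. If the block ends
    before stopping, these factors multiply to \<open>exp (2 * u)\<close>, since \<open>q\<close> is
    half of \<open>c * (n - N)\<close>; this makes a small quadratic variation improbable.\<close>
  have sup2: "(\<integral>\<omega>. indicator A \<omega> * (\<Prod>i\<in>{N..<n}. if stopped N q i \<omega> then 1
      else exp (\<theta> * d i \<omega> - (3/2 + \<eta>) * \<theta>\<^sup>2 * (d i \<omega>)\<^sup>2 + 1 * c * \<theta>\<^sup>2)) \<partial>M) \<le> prob A"
  proof -
    have "sup_factor i (\<lambda>\<omega>. if stopped N q i \<omega> then 1 else exp (\<theta> * d i \<omega> - (3/2 + \<eta>) * \<theta>\<^sup>2 * (d i \<omega>)\<^sup>2 + 1 * c * \<theta>\<^sup>2))"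
      if "N \<le> i" "i < n" for i
      using \<delta>(2) small'[of \<theta>] that \<theta> N sq_ge[of i]
      by (intro sup_factor_if stopped_sets sup_factor_exp) auto
    from integral_prod_sup_factor[OF N(2) this A'(1)] show ?thesis
      using A' by simp
  qed
  define T0 where "T0 \<omega> = (\<Prod>i\<in>{N..<n}. if stopped N q i \<omega> then 1
      else exp (\<theta> * d i \<omega> - (3/2 + \<eta>) * \<theta>\<^sup>2 * (d i \<omega>)\<^sup>2 + 1 * c * \<theta>\<^sup>2))" for \<omega>
  have T0_bmeas: "T0 \<in> bmeas (F n)"
    unfolding T0_def[abs_def]
  proof (intro bmeas_prod_adapted bmeas_if)
    fix i assume "N \<le> i" "i < n"
    then show "{\<omega> \<in> space (F (Suc i)). stopped N q i \<omega>} \<in> sets (F (Suc i))"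
      using stopped_sets[of N i q] F_Suc[of i] by auto
    show "(\<lambda>\<omega>. exp (\<theta> * d i \<omega> - (3/2 + \<eta>) * \<theta>\<^sup>2 * (d i \<omega>)\<^sup>2 + 1 * c * \<theta>\<^sup>2)) \<in> bmeas (F (Suc i))"
      by (intro bmeas_exp bmeas_add bmeas_diff bmeas_cmult bmeas_power d_bmeas bmeas_const)
  qed auto
  have T0A: "integrable M (\<lambda>\<omega>. indicator A \<omega> * T0 \<omega>)"
    using A'(2) T0_bmeas by (intro bmeas_F_integrable[of _ n] bmeas_mult)
  have sub: "prob A \<le> (\<integral>\<omega>. indicator A \<omega> * T \<theta> ((1/2 - \<eta>) * \<theta>\<^sup>2) \<omega> \<partial>M)"
  proof -
    have "sub_factor i (\<lambda>\<omega>. if stopped N q i \<omega> then 1 else exp (\<theta> * d i \<omega> - (1/2 - \<eta>) * \<theta>\<^sup>2 * (d i \<omega>)\<^sup>2))"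
      if "N \<le> i" "i < n" for i
      using \<delta>(3) small'[of \<theta>] that \<theta>
      by (intro sub_factor_if stopped_sets sub_factor_exp) auto
    from integral_prod_sub_factor[OF N(2) this A'(1)] show ?thesis
      using A' by (simp add: prod_stopped T_def)
  qed
  define E where "E = {\<omega> \<in> space M. q \<le> QS N q n \<omega> \<and> (1 - \<epsilon>) * \<theta> * q \<le> DS N q n \<omega>}"
  have [measurable]: "DS N q n \<in> borel_measurable M" "QS N q n \<in> borel_measurable M"
    using DS_QS_bmeas[of N q n] by (auto intro: measurable_F_M dest: bmeas_measurable)
  have E: "E \<in> events" unfolding E_def by measurable
  \<comment> \<open>Tilts slightly above and below \<open>\<theta>\<close>. They dominate the tilt
    \<open>\<theta>\<close> where the stopped sum is too large or too small, respectively.\<close>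
  define x2 x3 y2 y3 where xy: "x2 = (1 + \<epsilon>) * \<theta>" "x3 = (1 - \<epsilon>) * \<theta>"
    "y2 = (1/2 + \<eta>) * x2\<^sup>2" "y3 = (1/2 + \<eta>) * x3\<^sup>2"
  define e where "e = exp (- u * (\<epsilon>\<^sup>2 / 4))"
  have key: "T \<theta> ((1/2 - \<eta>) * \<theta>\<^sup>2) \<omega> \<le> e * T0 \<omega> + e * T x2 y2 \<omega> + e * T x3 y3 \<omega>
      + exp (u * (1/2 + \<epsilon> + \<eta>)) * indicator E \<omega>" if \<omega>: "\<omega> \<in> space M" for \<omega>
  proof -
    define X where "X = \<theta> * DS N q n \<omega>"
    define Z where "Z = \<theta>\<^sup>2 * QS N q n \<omega>"
    have "\<exists>\<tau>\<in>{N..n}. DS N q n \<omega> = D \<tau> \<omega> - D N \<omega> \<and> QS N q n \<omega> = Q \<tau> \<omega> - Q N \<omega> \<and>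
      (QS N q n \<omega> < q \<longrightarrow> \<tau> = n) \<and> QS N q n \<omega> \<le> q + \<eta> * q"
      using small(2) N q(2) \<eta> by (intro stopped_char) auto
    then obtain \<tau> where \<tau>: "\<tau> \<in> {N..n}" "QS N q n \<omega> = Q \<tau> \<omega> - Q N \<omega>"
      "QS N q n \<omega> < q \<Longrightarrow> \<tau> = n" "QS N q n \<omega> \<le> q + \<eta> * q"
      by blast
    have "\<theta>\<^sup>2 * QS N q n \<omega> \<le> \<theta>\<^sup>2 * (q + \<eta> * q)" using \<tau>(4) by (intro mult_left_mono) auto
    then have Z_le: "Z \<le> (1 + \<eta>) * u" by (simp add: Z_def u_def algebra_simps)
    have T_eq: "T \<theta> ((1/2 - \<eta>) * \<theta>\<^sup>2) \<omega> = exp (X - (1/2 - \<eta>) * Z)"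
      "T x2 y2 \<omega> = exp ((1 + \<epsilon>) * X - (1/2 + \<eta>) * (1 + \<epsilon>)\<^sup>2 * Z)"
      "T x3 y3 \<omega> = exp ((1 - \<epsilon>) * X - (1/2 + \<eta>) * (1 - \<epsilon>)\<^sup>2 * Z)"
      by (simp_all add: T_def X_def Z_def xy power_mult_distrib mult_ac)
    have nonneg: "0 \<le> e * T0 \<omega>" "0 \<le> e * T x2 y2 \<omega>" "0 \<le> e * T x3 y3 \<omega>"
      "0 \<le> exp (u * (1/2 + \<epsilon> + \<eta>)) * indicator E \<omega>"
      by (auto simp: e_def T0_def T_def intro!: mult_nonneg_nonneg prod_nonneg)
    \<comment> \<open>In (a) the threshold is not reached and \<open>T0\<close> dominates; in (b)
      and (c) the sum misses the range aimed at and a neighbouring tilt dominates. In (d) the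
      submartingale is bounded by a constant, and this is the only case that contributes
      substantially.\<close>
    consider (a) "QS N q n \<omega> < q" | (b) "q \<le> QS N q n \<omega>" "(1 + \<epsilon>) * \<theta> * q < DS N q n \<omega>"
      | (c) "q \<le> QS N q n \<omega>" "DS N q n \<omega> < (1 - \<epsilon>) * \<theta> * q" | (d) "\<omega> \<in> E" "DS N q n \<omega> \<le> (1 + \<epsilon>) * \<theta> * q"
      using \<omega> unfolding E_def mem_Collect_eq by (meson not_le)
    then show ?thesis
    proof cases
      case a
      then have "\<tau> = n" using \<tau> by auto
      then have ns: "\<not> stopped N q i \<omega>" if "i \<in> {N..<n}" for i
        using a \<tau> Q_mono[of i n \<omega>] that by (auto simp: stopped_def)
      have "T0 \<omega> = (\<Prod>i\<in>{N..<n}. (if stopped N q i \<omega> then 1 else exp (\<theta> * d i \<omega> - (3/2 + \<eta>) * \<theta>\<^sup>2 * (d i \<omega>)\<^sup>2)) * exp (c * \<theta>\<^sup>2))"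
        unfolding T0_def using ns by (intro prod.cong) (auto simp flip: exp_add)
      also have "\<dots> = exp (\<theta> * DS N q n \<omega> - (3/2 + \<eta>) * \<theta>\<^sup>2 * QS N q n \<omega>) * exp (real (n - N) * (c * \<theta>\<^sup>2))"
        unfolding prod.distrib prod_stopped by (simp add: exp_of_nat_mult)
      also have "real (n - N) * (c * \<theta>\<^sup>2) = (c * (real n - real N)) * \<theta>\<^sup>2"
        using N by (simp add: of_nat_diff)
      also have "c * (real n - real N) = 2 * q" using q(1) by simp
      also have "exp (\<theta> * DS N q n \<omega> - (3/2 + \<eta>) * \<theta>\<^sup>2 * QS N q n \<omega>) * exp (2 * q * \<theta>\<^sup>2)
          = exp (X - (3/2 + \<eta>) * Z + 2 * u)"
        by (simp add: X_def Z_def u_def mult_ac flip: exp_add)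
      finally have T0: "T0 \<omega> = exp (X - (3/2 + \<eta>) * Z + 2 * u)" .
      have "\<theta>\<^sup>2 * QS N q n \<omega> \<le> \<theta>\<^sup>2 * q" using a by (intro mult_left_mono) auto
      then have "Z \<le> u" by (simp add: Z_def u_def)
      then have "(1 + 2 * \<eta>) * Z \<le> (1 + 2 * \<eta>) * u" using \<eta> by (intro mult_left_mono) auto
      moreover have "u * (12 * \<eta> + 2 * \<eta>) \<le> u * 1" using \<eta> u0 by (intro mult_left_mono) auto
      ultimately have "X - (1/2 - \<eta>) * Z \<le> - u * (\<epsilon>\<^sup>2 / 4) + (X - (3/2 + \<eta>) * Z + 2 * u)"
        unfolding \<eta>(3) by (simp add: algebra_simps)
      then have "T \<theta> ((1/2 - \<eta>) * \<theta>\<^sup>2) \<omega> \<le> e * T0 \<omega>"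
        unfolding T_eq T0 e_def by (simp flip: exp_add)
      then show ?thesis using nonneg by linarith
    next
      case b
      have "\<theta> * ((1 + \<epsilon>) * \<theta> * q) \<le> \<theta> * DS N q n \<omega>" using b \<theta> by (intro mult_left_mono) auto
      then have X: "(1 + \<epsilon>) * u \<le> X" by (simp add: X_def u_def power2_eq_square mult_ac)
      \<comment> \<open>\<open>g * Z\<close> is the price of raising the tilt,
        \<open>\<epsilon> * X\<close> the gain. As \<open>Z\<close> may exceed \<open>u\<close> by
        the factor \<open>1 + \<eta>\<close>, the squares of the increments had to be bounded by
        \<open>\<eta> * q\<close>.\<close>
      define g where "g = (1/2 + \<eta>) * (1 + \<epsilon>)\<^sup>2 - (1/2 - \<eta>)"

      have "g = (1/2 + \<eta>) * (1 + 2 * \<epsilon> + \<epsilon>\<^sup>2) - (1/2 - \<eta>)"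
        by (simp add: g_def power2_eq_square algebra_simps)
      then have g_eq: "g = \<epsilon> + 26 * \<eta> + 2 * (\<epsilon> * \<eta>) + 48 * (\<eta> * \<eta>)"
        unfolding \<eta>(3) by (simp add: algebra_simps)
      then have g0: "0 \<le> g" using \<epsilon> \<eta> by simp
      have "(1 + \<eta>) * g = g + \<epsilon> * \<eta> + 26 * (\<eta> * \<eta>) + 2 * (\<epsilon> * (\<eta> * \<eta>)) + 48 * (\<eta> * (\<eta> * \<eta>))"
        unfolding g_eq by (simp add: algebra_simps)
      then have g_le: "(1 + \<eta>) * g \<le> \<epsilon> + 36 * \<eta>"
        using g_eq prods \<eta> by linarith
      have "g * Z \<le> g * ((1 + \<eta>) * u)" using g0 Z_le by (intro mult_left_mono)
      also have "\<dots> = ((1 + \<eta>) * g) * u" by simp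
      also have "\<dots> \<le> (\<epsilon> + 36 * \<eta>) * u" using g_le u0 by (intro mult_right_mono) auto
      finally have 1: "g * Z \<le> (\<epsilon> + 36 * \<eta>) * u" .
      have "\<epsilon> * ((1 + \<epsilon>) * u) \<le> \<epsilon> * X" using X \<epsilon> by (intro mult_left_mono) auto
      also have "\<epsilon> * ((1 + \<epsilon>) * u) = \<epsilon> * u + 48 * \<eta> * u"
        unfolding \<eta>(3)[symmetric] by (simp add: algebra_simps power2_eq_square)
      finally have "12 * \<eta> * u \<le> \<epsilon> * X - g * Z" using 1 by (simp add: algebra_simps)
      then have "X - (1/2 - \<eta>) * Z \<le> - u * (\<epsilon>\<^sup>2 / 4) + ((1 + \<epsilon>) * X - (1/2 + \<eta>) * (1 + \<epsilon>)\<^sup>2 * Z)"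
        unfolding g_def \<eta>(3) by (simp add: algebra_simps)
      then have "T \<theta> ((1/2 - \<eta>) * \<theta>\<^sup>2) \<omega> \<le> e * T x2 y2 \<omega>"
        unfolding T_eq e_def by (simp flip: exp_add)
      then show ?thesis using nonneg by linarith
    next
      case c
      have "\<theta> * DS N q n \<omega> \<le> \<theta> * ((1 - \<epsilon>) * \<theta> * q)" using c \<theta> by (intro mult_left_mono) auto
      then have X: "X \<le> (1 - \<epsilon>) * u" by (simp add: X_def u_def power2_eq_square mult_ac)
      have "\<theta>\<^sup>2 * q \<le> \<theta>\<^sup>2 * QS N q n \<omega>" using c by (intro mult_left_mono) auto
      then have Z: "u \<le> Z" by (simp add: Z_def u_def)
      define h where "h = (1/2 - \<eta>) - (1/2 + \<eta>) * (1 - \<epsilon>)\<^sup>2"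
      have "h = (1/2 - \<eta>) - (1/2 + \<eta>) * (1 - 2 * \<epsilon> + \<epsilon>\<^sup>2)"
        by (simp add: h_def power2_eq_square algebra_simps)
      then have "h = \<epsilon> - 26 * \<eta> + 2 * (\<epsilon> * \<eta>) - 48 * (\<eta> * \<eta>)"
        unfolding \<eta>(3) by (simp add: algebra_simps)
      then have h_ge: "\<epsilon> - 27 * \<eta> \<le> h" using prods \<eta> by linarith
      have "48 * \<eta> \<le> \<epsilon> * (1/2)" unfolding \<eta>(3)[symmetric] power2_eq_square using \<epsilon> by (intro mult_left_mono) auto
      then have h0: "0 \<le> h" using h_ge \<eta> by linarith
      have "(\<epsilon> - 27 * \<eta>) * u \<le> h * u" using h_ge u0 by (intro mult_right_mono) auto
      also have "\<dots> \<le> h * Z" using h0 Z by (intro mult_left_mono)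
      finally have 1: "(\<epsilon> - 27 * \<eta>) * u \<le> h * Z" .
      have "\<epsilon> * X \<le> \<epsilon> * ((1 - \<epsilon>) * u)" using X \<epsilon> by (intro mult_left_mono) auto
      also have "\<epsilon> * ((1 - \<epsilon>) * u) = \<epsilon> * u - 48 * \<eta> * u"
        unfolding \<eta>(3)[symmetric] by (simp add: algebra_simps power2_eq_square)
      finally have "\<epsilon> * X \<le> \<epsilon> * u - 48 * (\<eta> * u)" by (simp only: mult.assoc)
      moreover have "\<epsilon> * u - 27 * (\<eta> * u) \<le> h * Z" using 1 by (simp only: left_diff_distrib mult.assoc)
      moreover have "0 < \<eta> * u" using \<eta> u0 by simp
      ultimately have "12 * (\<eta> * u) \<le> h * Z - \<epsilon> * X" by linarith
      then have "X - (1/2 - \<eta>) * Z \<le> - u * (\<epsilon>\<^sup>2 / 4) + ((1 - \<epsilon>) * X - (1/2 + \<eta>) * (1 - \<epsilon>)\<^sup>2 * Z)"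
        unfolding h_def \<eta>(3) by (simp add: algebra_simps)
      then have "T \<theta> ((1/2 - \<eta>) * \<theta>\<^sup>2) \<omega> \<le> e * T x3 y3 \<omega>"
        unfolding T_eq e_def by (simp flip: exp_add)
      then show ?thesis using nonneg by linarith
    next
      case d
      have "\<theta> * DS N q n \<omega> \<le> \<theta> * ((1 + \<epsilon>) * \<theta> * q)" using d \<theta> by (intro mult_left_mono) auto
      then have X: "X \<le> (1 + \<epsilon>) * u" by (simp add: X_def u_def power2_eq_square mult_ac)
      have "\<theta>\<^sup>2 * q \<le> \<theta>\<^sup>2 * QS N q n \<omega>" using d by (intro mult_left_mono) (auto simp: E_def)
      then have "u \<le> Z" by (simp add: Z_def u_def)
      then have "(1/2 - \<eta>) * u \<le> (1/2 - \<eta>) * Z" using \<eta> by (intro mult_left_mono) auto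
      then have "X - (1/2 - \<eta>) * Z \<le> u * (1/2 + \<epsilon> + \<eta>)" using X by (simp add: algebra_simps)
      then have "T \<theta> ((1/2 - \<eta>) * \<theta>\<^sup>2) \<omega> \<le> exp (u * (1/2 + \<epsilon> + \<eta>)) * indicator E \<omega>"
        unfolding T_eq using d by simp
      then show ?thesis using nonneg by linarith
    qed
  qed
  define K where "K = exp (u * (1/2 + \<epsilon> + \<eta>))"
  have EA: "integrable M (\<lambda>\<omega>. indicator A \<omega> * indicator E \<omega> :: real)"
    using A' E by (intro bmeas_integrable bmeas_mult bmeas_indicator) auto
  \<comment> \<open>Integrated over \<open>A\<close>, the left side of \<open>key\<close> has mass
    at least \<open>prob A\<close> while the three supermartingales supply at most half of it. The
    rest must come from \<open>E\<close>, where the integrand is at most \<open>K\<close>.\<close>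
  note sub
  also have "(\<integral>\<omega>. indicator A \<omega> * T \<theta> ((1/2 - \<eta>) * \<theta>\<^sup>2) \<omega> \<partial>M)
    \<le> (\<integral>\<omega>. e * (indicator A \<omega> * T0 \<omega>) + e * (indicator A \<omega> * T x2 y2 \<omega>) + e * (indicator A \<omega> * T x3 y3 \<omega>)
        + K * (indicator A \<omega> * indicator E \<omega>) \<partial>M)"
  proof (rule integral_mono)
    fix \<omega> assume "\<omega> \<in> space M"
    from mult_left_mono[OF key[OF this], of "indicator A \<omega>"]
    show "indicator A \<omega> * T \<theta> ((1/2 - \<eta>) * \<theta>\<^sup>2) \<omega> \<le> e * (indicator A \<omega> * T0 \<omega>) + e * (indicator A \<omega> * T x2 y2 \<omega>)
        + e * (indicator A \<omega> * T x3 y3 \<omega>) + K * (indicator A \<omega> * indicator E \<omega>)"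
      by (simp add: K_def algebra_simps)
  qed (use TA T0A EA in auto)
  also have "\<dots> = e * (\<integral>\<omega>. indicator A \<omega> * T0 \<omega> \<partial>M) + e * (\<integral>\<omega>. indicator A \<omega> * T x2 y2 \<omega> \<partial>M)
      + e * (\<integral>\<omega>. indicator A \<omega> * T x3 y3 \<omega> \<partial>M) + K * (\<integral>\<omega>. indicator A \<omega> * indicator E \<omega> \<partial>M)"
    using TA T0A EA by simp
  also have "(\<integral>\<omega>. indicator A \<omega> * indicator E \<omega> \<partial>M) = prob (A \<inter> E)"
    using A' E by (simp add: indicator_inter_arith[symmetric])
  also have "e * (\<integral>\<omega>. indicator A \<omega> * T0 \<omega> \<partial>M) + e * (\<integral>\<omega>. indicator A \<omega> * T x2 y2 \<omega> \<partial>M)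
      + e * (\<integral>\<omega>. indicator A \<omega> * T x3 y3 \<omega> \<partial>M) + K * prob (A \<inter> E)
    \<le> e * prob A + e * prob A + e * prob A + K * prob (A \<inter> E)"
    using sup2 sup1[of x2] sup1[of x3] \<epsilon> \<theta>
    by (intro add_mono mult_left_mono) (auto simp: T0_def e_def xy abs_mult K_def)
  also have "\<dots> = 3 * e * prob A + K * prob (A \<inter> E)" by simp
  also have "\<dots> \<le> 1/2 * prob A + K * prob (A \<inter> E)"
    using u by (intro add_mono mult_right_mono) (auto simp: e_def)
  finally have "prob A / 2 \<le> K * prob (A \<inter> E)" by simp
  moreover have "0 < K" by (simp add: K_def)
  ultimately have le: "1 / K / 2 * prob A \<le> prob (A \<inter> E)" by (simp add: field_simps)
  have "exp (- u * (1/2 + \<epsilon> + \<eta>)) = 1 / K"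
    by (simp add: K_def exp_minus inverse_eq_divide)
  with le show ?thesis unfolding E_def[symmetric] by simp
qed

lemma uminus_differences: "bounded_martingale_differences M F (\<lambda>n \<omega>. - d n \<omega>) \<beta> c C n0"
proof (unfold_locales)
  show "(\<lambda>\<omega>. - d n \<omega>) \<in> bmeas (F (Suc n))" for n
    using d_bmeas by auto
  show "(\<integral>\<omega>. G \<omega> * - d n \<omega> \<partial>M) = 0" if "G \<in> bmeas (F n)" for n G
    using d_centered[OF that] by simp
  have "martingale_differences M F (\<lambda>n \<omega>. - d n \<omega>)"
    using d_bmeas d_centered by unfold_locales auto
  then interpret neg: martingale_differences M F "\<lambda>n \<omega>. - d n \<omega>" .
  show "neg.cond_sq_ge n c" if "n0 \<le> n" for n
    using sq_ge[OF that] by (simp add: cond_sq_ge_def neg.cond_sq_ge_def)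
  show "neg.cond_sq_le n C" for n
    using sq_le[of n] by (simp add: cond_sq_le_def neg.cond_sq_le_def)
qed (use c_pos \<beta> \<beta>_small in auto)

lemma upper_LIL_abs:
  assumes \<epsilon>: "0 < \<epsilon>" "\<epsilon> \<le> 1"
  shows "AE \<omega> in M. \<forall>\<^sub>F n in sequentially. \<bar>D n \<omega>\<bar> \<le> (1 + \<epsilon>) * tt n * sqrt (Q n \<omega>)"
proof -
  interpret neg: bounded_martingale_differences M F "\<lambda>n \<omega>. - d n \<omega>" \<beta> c C n0
    by (rule uminus_differences)
  have eq: "neg.D n \<omega> = - D n \<omega>" "neg.Q n \<omega> = Q n \<omega>" for n \<omega>
    by (simp_all add: neg.D_def neg.Q_def D_def Q_def sum_negf)
  from upper_LIL[OF \<epsilon>] neg.upper_LIL[OF \<epsilon>] show ?thesis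
  proof eventually_elim
    case (elim \<omega>)
    from elim show ?case
      unfolding eq by eventually_elim (simp add: abs_le_iff)
  qed
qed

text \<open>The blocks grow by a factor \<open>L\<close> so large that everything before a block is
  negligible against the block itself. The slack \<open>1 - \<epsilon>\<close> in
  \<open>\<theta>\<close> pushes the block probabilities up to the divergent series, and the sum is
  evaluated at the stopping index, where the quadratic variation is close to
  \<open>q\<close>.\<close>

lemma lower_LIL_aux:
  assumes \<epsilon>: "0 < \<epsilon>" "\<epsilon> \<le> 1/8"
  shows "AE \<omega> in M. \<exists>\<^sub>\<infinity>n. (1 - 6 * \<epsilon>) * tt n * sqrt (Q n \<omega>) \<le> D n \<omega>"
proof -
  \<comment> \<open>Gives \<open>Q (N k) \<le> 8 * C * N k \<le> \<epsilon>\<^sup>2 * q k\<close>,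
    because \<open>q k\<close> is at least \<open>c * L * N k / 4\<close>.\<close>
  obtain L :: nat where L: "max 2 (32 * C / (c * \<epsilon>\<^sup>2)) \<le> real L"
    using real_arch_simple by blast
  then have L2: "2 \<le> L" by linarith
  have LC: "32 * C \<le> \<epsilon>\<^sup>2 * c * real L"
    using L c_pos \<epsilon> by (simp add: field_simps)
  define N where "N k = L ^ k" for k
  define q where "q k = c * (real (N (Suc k)) - real (N k)) / 2" for k
  \<comment> \<open>With this choice \<open>u = (1 - \<epsilon>)\<^sup>2 * 2 * LL\<close>, so the
    exponent \<open>u * (1/2 + \<epsilon> + \<eta>)\<close> of the block bound does not exceed
    \<open>LL (N (Suc k))\<close>: the factor \<open>(1 - \<epsilon>)\<^sup>2\<close> compensates
    \<open>1 + 2 * \<epsilon> + 2 * \<eta>\<close>.\<close>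
  define \<theta> where "\<theta> k = (1 - \<epsilon>) * tt (N (Suc k)) / sqrt (q k)" for k
  define \<eta> where "\<eta> = \<epsilon>\<^sup>2 / 48"
  have \<eta>: "0 < \<eta>" using \<epsilon> by (simp add: \<eta>_def)
  have N_pos: "0 < N k" for k using L2 by (simp add: N_def)
  have N_Suc: "real (N (Suc k)) = real L * real (N k)" for k by (simp add: N_def)
  have q_ge: "c * real (N (Suc k)) / 4 \<le> q k" for k
  proof -
    have "2 * real (N k) \<le> real (N (Suc k))"
      unfolding N_Suc using L2 by (intro mult_right_mono) auto
    then have "c * (real (N (Suc k)) / 2) \<le> c * (real (N (Suc k)) - real (N k))"
      using c_pos by (intro mult_left_mono) auto
    then show ?thesis by (simp add: q_def)
  qed
  have q_pos: "0 < q k" for k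
    using q_ge[of k] c_pos N_pos[of "Suc k"] by (intro less_le_trans[OF _ q_ge]) auto
  have \<theta>_pos: "0 < \<theta> k" for k
    using \<epsilon> q_pos[of k] tt_pos by (simp add: \<theta>_def)
  have u: "(\<theta> k)\<^sup>2 * q k = (1 - \<epsilon>)\<^sup>2 * (2 * LL (real (N (Suc k))))" for k
    using q_pos[of k] by (simp add: \<theta>_def power_divide power_mult_distrib tt_sq)
  have "\<exists>\<delta>>0. \<forall>x. \<bar>x\<bar> \<le> \<delta> \<longrightarrow> exp (x - (1/2 + \<eta>) * x\<^sup>2) \<le> 1 + x \<and>
      exp (x - (3/2 + \<eta>) * x\<^sup>2) \<le> 1 + x - x\<^sup>2 \<and> 1 + x \<le> exp (x - (1/2 - \<eta>) * x\<^sup>2)"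
  proof -
    obtain d1 d2 d3 where d: "d1 > 0" "d2 > 0" "d3 > 0"
      "\<And>x. \<bar>x\<bar> \<le> d1 \<Longrightarrow> exp (x - (1/2 + \<eta>) * x\<^sup>2) \<le> 1 + x - (1/2 + \<eta> - 1/2 - \<eta>) * x\<^sup>2"
      "\<And>x. \<bar>x\<bar> \<le> d2 \<Longrightarrow> exp (x - (3/2 + \<eta>) * x\<^sup>2) \<le> 1 + x - (3/2 + \<eta> - 1/2 - \<eta>) * x\<^sup>2"
      "\<And>x. \<bar>x\<bar> \<le> d3 \<Longrightarrow> 1 + x + (1/2 - (1/2 - \<eta>) - \<eta>) * x\<^sup>2 \<le> exp (x - (1/2 - \<eta>) * x\<^sup>2)"
      using exp_quadratic_bounds[OF \<eta>, of "1/2 + \<eta>"] exp_quadratic_bounds[OF \<eta>, of "3/2 + \<eta>"]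
        exp_quadratic_bounds[OF \<eta>, of "1/2 - \<eta>"] by metis
    show ?thesis
      using d by (intro exI[of _ "min d1 (min d2 d3)"]) simp
  qed
  then obtain \<delta> where \<delta>: "\<delta> > 0"
    "\<And>x. \<bar>x\<bar> \<le> \<delta> \<Longrightarrow> exp (x - (1/2 + \<eta>) * x\<^sup>2) \<le> 1 + x"
    "\<And>x. \<bar>x\<bar> \<le> \<delta> \<Longrightarrow> exp (x - (3/2 + \<eta>) * x\<^sup>2) \<le> 1 + x - x\<^sup>2"
    "\<And>x. \<bar>x\<bar> \<le> \<delta> \<Longrightarrow> 1 + x \<le> exp (x - (1/2 - \<eta>) * x\<^sup>2)"
    by blast
  define E where "E k = {\<omega> \<in> space M. q k \<le> QS (N k) (q k) (N (Suc k)) \<omega> \<and>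
    (1 - \<epsilon>) * \<theta> k * q k \<le> DS (N k) (q k) (N (Suc k)) \<omega>}" for k
  define p where "p k = exp (- LL (real (L ^ Suc k))) / 2" for k
  have ev_sq: "\<forall>\<^sub>F k in sequentially. \<forall>i<N (Suc k). \<forall>\<omega>. (d i \<omega>)\<^sup>2 \<le> \<eta> * q k"
  proof -
    have "0 < \<eta> * c / 4" using \<eta> c_pos by simp
    from eventually_pow_Suc[OF small_increments_sq[OF _ this, of 1] L2]
    have "\<forall>\<^sub>F k in sequentially. \<forall>i<N (Suc k). \<forall>\<omega>.
        1 * (tt (N (Suc k)))\<^sup>2 / real (N (Suc k)) * (d i \<omega>)\<^sup>2 \<le> \<eta> * c / 4"
      by (simp only: N_def zero_le_one)
    then show ?thesis
    proof eventually_elim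
      case (elim k)
      show ?case
      proof (intro allI impI)
        fix i \<omega> assume i: "i < N (Suc k)"
        have "1 * (d i \<omega>)\<^sup>2 \<le> (tt (N (Suc k)))\<^sup>2 * (d i \<omega>)\<^sup>2"
          using one_le_power[OF tt_ge_1, of "N (Suc k)" 2] by (intro mult_right_mono) auto
        also have "\<dots> \<le> \<eta> * c / 4 * real (N (Suc k))"
          using elim i N_pos[of "Suc k"] by (auto simp: field_simps)
        also have "\<dots> \<le> \<eta> * q k"
          using mult_left_mono[OF q_ge[of k], of \<eta>] \<eta> by simp
        finally show "(d i \<omega>)\<^sup>2 \<le> \<eta> * q k" by simp
      qed
    qed
  qed
  have ev_p: "\<forall>\<^sub>F k in sequentially. \<forall>A\<in>sets (F (N k)). p k * prob A \<le> prob (A \<inter> E k)"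
  proof -
    have "\<forall>\<^sub>F k in sequentially. \<forall>i<N (Suc k). \<forall>\<omega>. \<bar>4 / sqrt c * tt (N (Suc k)) / sqrt (real (N (Suc k))) * d i \<omega>\<bar> \<le> \<delta>"
      using eventually_pow_Suc[OF small_increments[OF _ \<delta>(1), of "4 / sqrt c"] L2] c_pos
      by (simp only: N_def) simp
    moreover have "\<forall>\<^sub>F k in sequentially. n0 \<le> N k"
      using eventually_pow[OF eventually_ge_at_top[of n0] L2] by (simp add: N_def)
    \<comment> \<open>Since \<open>u\<close> is at least \<open>LL / 2\<close>, this yields
      \<open>exp (- u * (\<epsilon>\<^sup>2 / 4)) \<le> 1 / 6\<close>, the smallness that the block
      bound asks for.\<close>
    moreover have "\<forall>\<^sub>F k in sequentially. 8 * ln 6 / \<epsilon>\<^sup>2 \<le> LL (real (N (Suc k)))"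
      using LL_at_top eventually_pow_Suc[OF _ L2, of "\<lambda>n. 8 * ln 6 / \<epsilon>\<^sup>2 \<le> LL (real n)"]
      by (simp only: filterlim_at_top N_def)
    ultimately show ?thesis
      using ev_sq
    proof eventually_elim
      case (elim k)
      let ?u = "(\<theta> k)\<^sup>2 * q k"
      show ?case
      proof
        fix A assume A: "A \<in> sets (F (N k))"
        have "exp (- ?u * (1/2 + \<epsilon> + \<eta>)) / 2 * prob A \<le> prob (A \<inter> E k)"
          unfolding E_def \<eta>_def
        proof (rule block_lower_bound[of _ _ _ _ _ \<delta>])
          show "N k \<le> N (Suc k)" using N_Suc[of k] L2 by (simp add: N_def)
          fix i \<omega> assume i: "i < N (Suc k)"
          have "sqrt (c * real (N (Suc k)) / 4) \<le> sqrt (q k)" using q_ge by simp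
          then have "sqrt c * sqrt (real (N (Suc k))) / 2 \<le> sqrt (q k)"
            by (simp add: real_sqrt_mult real_sqrt_divide)
          then have "\<theta> k \<le> 1 * tt (N (Suc k)) / (sqrt c * sqrt (real (N (Suc k))) / 2)"
            unfolding \<theta>_def using \<epsilon> c_pos N_pos[of "Suc k"] tt_pos[of "N (Suc k)"]
            by (intro frac_le mult_right_mono) auto
          then have "2 * \<theta> k \<le> 2 * (1 * tt (N (Suc k)) / (sqrt c * sqrt (real (N (Suc k))) / 2))"
            by simp
          also have "\<dots> = 4 / sqrt c * tt (N (Suc k)) / sqrt (real (N (Suc k)))"
            by simp
          finally have "2 * \<theta> k \<le> 4 / sqrt c * tt (N (Suc k)) / sqrt (real (N (Suc k)))" .
          then have "\<bar>2 * \<theta> k * d i \<omega>\<bar> \<le> \<bar>4 / sqrt c * tt (N (Suc k)) / sqrt (real (N (Suc k))) * d i \<omega>\<bar>"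
            unfolding abs_mult[of _ "d i \<omega>"] using \<theta>_pos[of k] by (intro mult_right_mono) (linarith, simp)
          also have "\<dots> \<le> \<delta>" using elim i by blast
          finally show "\<bar>2 * \<theta> k * d i \<omega>\<bar> \<le> \<delta>" .
        next
          have "8 * ln 6 \<le> LL (real (N (Suc k))) * \<epsilon>\<^sup>2"
            using elim \<epsilon> by (simp add: field_simps)
          also have "LL (real (N (Suc k))) \<le> 2 * ?u"
          proof -
            have "(1/2)\<^sup>2 \<le> (1 - \<epsilon>)\<^sup>2" using \<epsilon> by (intro power_mono) auto
            then have "1/4 * (2 * LL (real (N (Suc k)))) \<le> ?u"
              unfolding u using LL_pos[of "real (N (Suc k))"] by (intro mult_right_mono) (auto simp: power2_eq_square)
            then show ?thesis by simp
          qed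
          finally have "ln 6 \<le> ?u * (\<epsilon>\<^sup>2 / 4)" by (simp add: mult_right_mono mult_ac)
          then have "exp (- ?u * (\<epsilon>\<^sup>2 / 4)) \<le> exp (- ln 6)" by simp
          then show "3 * exp (- ?u * (\<epsilon>\<^sup>2 / 4)) \<le> 1 / 2" by (simp add: exp_minus)
        qed (use \<epsilon> elim \<theta>_pos q_pos A \<delta> in \<open>auto simp: q_def \<eta>_def\<close>)
        moreover have "p k \<le> exp (- ?u * (1/2 + \<epsilon> + \<eta>)) / 2"
        proof -
          have "\<epsilon>\<^sup>2 * \<epsilon> \<le> \<epsilon>\<^sup>2 * (1/8)" using \<epsilon> by (intro mult_left_mono) auto
          moreover define g where "g = (1 - \<epsilon>)\<^sup>2 * \<epsilon>\<^sup>2"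
          moreover have "g \<le> 1 * \<epsilon>\<^sup>2"
            unfolding g_def using \<epsilon> by (intro mult_right_mono power_le_one) auto
          moreover have "(1 - \<epsilon>)\<^sup>2 * (1 + 2 * \<epsilon> + 2 * \<eta>) = 1 - 3 * \<epsilon>\<^sup>2 + 2 * (\<epsilon>\<^sup>2 * \<epsilon>) + g / 24"
            by (simp add: g_def \<eta>_def power2_eq_square field_simps)
          moreover have "0 \<le> \<epsilon>\<^sup>2" by simp
          ultimately have "(1 - \<epsilon>)\<^sup>2 * (1 + 2 * \<epsilon> + 2 * \<eta>) \<le> 1" by linarith
          then have "(1 - \<epsilon>)\<^sup>2 * (1 + 2 * \<epsilon> + 2 * \<eta>) * LL (real (N (Suc k))) \<le> 1 * LL (real (N (Suc k)))"
            using LL_pos[of "real (N (Suc k))"] by (intro mult_right_mono) auto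
          then have "?u * (1/2 + \<epsilon> + \<eta>) \<le> LL (real (N (Suc k)))"
            unfolding u by (simp add: algebra_simps)
          then show ?thesis by (simp add: p_def N_def)
        qed
        ultimately show "p k * prob A \<le> prob (A \<inter> E k)"
          using mult_right_mono[of "p k" _ "prob A"] by (meson measure_nonneg order_trans)
      qed
    qed
  qed
  then obtain k0 where k0: "\<And>k A. k0 \<le> k \<Longrightarrow> A \<in> sets (F (N k)) \<Longrightarrow> p k * prob A \<le> prob (A \<inter> E k)"
    unfolding eventually_sequentially by blast
  have freq: "AE \<omega> in M. \<exists>\<^sub>\<infinity>k. \<omega> \<in> E k"
  proof (rule AE_frequently_of_conditional[of E N k0 p])
    show "E k \<in> sets (F (N (Suc k)))" for k
    proof -
      have [measurable]: "DS (N k) (q k) (N (Suc k)) \<in> borel_measurable (F (N (Suc k)))"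
        "QS (N k) (q k) (N (Suc k)) \<in> borel_measurable (F (N (Suc k)))"
        by (rule bmeas_measurable, rule DS_QS_bmeas)+
      have "{\<omega> \<in> space (F (N (Suc k))). q k \<le> QS (N k) (q k) (N (Suc k)) \<omega> \<and>
        (1 - \<epsilon>) * \<theta> k * q k \<le> DS (N k) (q k) (N (Suc k)) \<omega>} \<in> sets (F (N (Suc k)))"
        by measurable
      then show ?thesis by (simp add: E_def)
    qed
    show "mono N" unfolding N_def using L2 by (intro monoI power_increasing) auto
    show "\<not> summable p"
      using not_summable_exp_LL[OF L2] summable_mult[of p 2] by (auto simp: p_def)
  qed (use k0 in \<open>auto simp: p_def\<close>)
  \<comment> \<open>The upper half, used crudely with the constant \<open>2\<close>, controls the
    sum before the block.\<close>
  have "AE \<omega> in M. \<forall>\<^sub>F n in sequentially. \<bar>D n \<omega>\<bar> \<le> (1 + 1) * tt n * sqrt (Q n \<omega>)"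
    by (rule upper_LIL_abs) auto
  with freq Q_upper show ?thesis
  proof eventually_elim
    case (elim \<omega>)
    have "\<forall>\<^sub>F k in sequentially. Q (N k) \<omega> \<le> 8 * C * real (N k)"
      using eventually_pow[OF elim(2) L2] by (simp add: N_def)
    moreover have "\<forall>\<^sub>F k in sequentially. \<bar>D (N k) \<omega>\<bar> \<le> (1 + 1) * tt (N k) * sqrt (Q (N k) \<omega>)"
      using eventually_pow[OF elim(3) L2] by (simp add: N_def)
    ultimately have ev: "\<forall>\<^sub>F k in sequentially. Q (N k) \<omega> \<le> 8 * C * real (N k) \<and>
        \<bar>D (N k) \<omega>\<bar> \<le> 2 * tt (N k) * sqrt (Q (N k) \<omega>) \<and> (\<forall>i<N (Suc k). \<forall>\<omega>. (d i \<omega>)\<^sup>2 \<le> \<eta> * q k)"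
      using ev_sq by eventually_elim simp
    show ?case
      unfolding INFM_nat_le
    proof (rule allI)
      fix m
      have "\<exists>\<^sub>\<infinity>k. \<omega> \<in> E k \<and> (Q (N k) \<omega> \<le> 8 * C * real (N k) \<and>
        \<bar>D (N k) \<omega>\<bar> \<le> 2 * tt (N k) * sqrt (Q (N k) \<omega>) \<and> (\<forall>i<N (Suc k). \<forall>\<omega>. (d i \<omega>)\<^sup>2 \<le> \<eta> * q k))"
        using elim(1) ev by (intro INFM_conjI) (simp_all add: cofinite_eq_sequentially)
      then obtain k where k: "m \<le> k" "\<omega> \<in> E k" "Q (N k) \<omega> \<le> 8 * C * real (N k)"
        "\<bar>D (N k) \<omega>\<bar> \<le> 2 * tt (N k) * sqrt (Q (N k) \<omega>)" "\<And>i. i < N (Suc k) \<Longrightarrow> (d i \<omega>)\<^sup>2 \<le> \<eta> * q k"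
        unfolding INFM_nat_le by blast
      have "N k \<le> N (Suc k)" unfolding N_def using L2 by (intro power_increasing) auto
      then have "\<exists>\<tau>\<in>{N k..N (Suc k)}. DS (N k) (q k) (N (Suc k)) \<omega> = D \<tau> \<omega> - D (N k) \<omega> \<and>
          QS (N k) (q k) (N (Suc k)) \<omega> = Q \<tau> \<omega> - Q (N k) \<omega> \<and>
          (QS (N k) (q k) (N (Suc k)) \<omega> < q k \<longrightarrow> \<tau> = N (Suc k)) \<and>
          QS (N k) (q k) (N (Suc k)) \<omega> \<le> q k + \<eta> * q k"
        using k(5) q_pos[of k] \<eta> by (intro stopped_char) auto
      \<comment> \<open>The witness is the stopping index, not the end of the block. It lies beyond
        \<open>N k > k\<close>, so infinitely many blocks give infinitely many indices.\<close>
      then obtain \<tau> where \<tau>: "N k \<le> \<tau>" "\<tau> \<le> N (Suc k)"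
        "DS (N k) (q k) (N (Suc k)) \<omega> = D \<tau> \<omega> - D (N k) \<omega>"
        "Q \<tau> \<omega> - Q (N k) \<omega> \<le> q k + \<eta> * q k"
        by auto
      define s where "s = tt (N (Suc k)) * sqrt (q k)"
      have s_pos: "0 < s" using q_pos[of k] tt_pos by (simp add: s_def)
      have "32 * C * real (N k) \<le> \<epsilon>\<^sup>2 * (c * real (N (Suc k)))"
        using mult_right_mono[OF LC, of "real (N k)"] by (simp add: N_Suc mult_ac)
      moreover have "\<epsilon>\<^sup>2 * (c * real (N (Suc k))) \<le> \<epsilon>\<^sup>2 * (4 * q k)"
        using q_ge[of k] by (intro mult_left_mono) auto
      ultimately have Q_N: "Q (N k) \<omega> \<le> \<epsilon>\<^sup>2 * q k" using k(3) by linarith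
      then have "sqrt (Q (N k) \<omega>) \<le> sqrt (\<epsilon>\<^sup>2 * q k)" by simp
      then have sq: "sqrt (Q (N k) \<omega>) \<le> \<epsilon> * sqrt (q k)" using \<epsilon> by (simp add: real_sqrt_mult)
      have "tt (N k) * sqrt (Q (N k) \<omega>) \<le> tt (N (Suc k)) * (\<epsilon> * sqrt (q k))"
        using sq \<open>N k \<le> N (Suc k)\<close> tt_pos[of "N (Suc k)"] Q_nonneg by (intro mult_mono tt_mono) auto
      then have D_N: "\<bar>D (N k) \<omega>\<bar> \<le> 2 * \<epsilon> * s"
        using k(4) by (simp add: s_def mult_ac)
      have "(1 - \<epsilon>) * \<theta> k * q k \<le> D \<tau> \<omega> - D (N k) \<omega>"
        using k(2) \<tau>(3) by (simp add: E_def)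
      moreover have "\<theta> k * q k = (1 - \<epsilon>) * s"
        using q_pos[of k] by (simp add: \<theta>_def s_def real_div_sqrt mult_ac)
          (metis less_imp_le nonzero_mult_div_cancel_right order_less_irrefl real_sqrt_gt_0_iff real_sqrt_mult_self abs_of_pos times_divide_eq_right mult.commute)
      ultimately have "(1 - \<epsilon>) * ((1 - \<epsilon>) * s) \<le> D \<tau> \<omega> + 2 * \<epsilon> * s"
        using D_N by (simp add: mult.assoc)
      then have "(1 - 4 * \<epsilon> + \<epsilon>\<^sup>2) * s \<le> D \<tau> \<omega>" by (simp add: algebra_simps power2_eq_square)
      moreover have "0 \<le> \<epsilon>\<^sup>2 * s" using s_pos by simp
      ultimately have D_ge: "(1 - 4 * \<epsilon>) * s \<le> D \<tau> \<omega>" by (simp add: algebra_simps)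
      have "Q \<tau> \<omega> \<le> q k * (1 + \<eta> + \<epsilon>\<^sup>2)" using \<tau>(4) Q_N by (simp add: algebra_simps)
      also have "\<dots> \<le> q k * (1 + \<epsilon>)\<^sup>2"
      proof (intro mult_left_mono)
        have "\<epsilon> * \<epsilon> \<le> \<epsilon> * 1" using \<epsilon> by (intro mult_left_mono) auto
        then show "1 + \<eta> + \<epsilon>\<^sup>2 \<le> (1 + \<epsilon>)\<^sup>2"
          using \<epsilon> by (simp add: \<eta>_def power2_eq_square algebra_simps)
      qed (use q_pos[of k] in simp)
      finally have "sqrt (Q \<tau> \<omega>) \<le> sqrt (q k * (1 + \<epsilon>)\<^sup>2)" by simp
      then have sqQ: "sqrt (Q \<tau> \<omega>) \<le> (1 + \<epsilon>) * sqrt (q k)" using \<epsilon> by (simp add: real_sqrt_mult mult.commute)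
      have "tt \<tau> * sqrt (Q \<tau> \<omega>) \<le> tt (N (Suc k)) * ((1 + \<epsilon>) * sqrt (q k))"
        using sqQ \<tau>(2) tt_pos[of "N (Suc k)"] Q_nonneg by (intro mult_mono tt_mono) auto
      \<comment> \<open>The budget: \<open>2 * \<epsilon>\<close> from the two factors
        \<open>1 - \<epsilon>\<close> in \<open>\<theta>\<close> and in \<open>E\<close>,
        \<open>2 * \<epsilon>\<close> for the sum before the block, and a factor
        \<open>1 + \<epsilon>\<close> in the normalisation.\<close>
      then have "(1 - 6 * \<epsilon>) * (tt \<tau> * sqrt (Q \<tau> \<omega>)) \<le> (1 - 6 * \<epsilon>) * ((1 + \<epsilon>) * s)"
        using \<epsilon> by (intro mult_left_mono) (auto simp: s_def mult_ac)
      also have "\<dots> \<le> (1 - 4 * \<epsilon>) * s"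
      proof -
        have "(1 - 6 * \<epsilon>) * (1 + \<epsilon>) \<le> 1 - 4 * \<epsilon>" using \<epsilon> by (simp add: algebra_simps)
        then show ?thesis using s_pos by (metis mult.assoc mult_right_mono less_imp_le)
      qed
      finally have "(1 - 6 * \<epsilon>) * tt \<tau> * sqrt (Q \<tau> \<omega>) \<le> D \<tau> \<omega>"
        using D_ge by (simp add: mult.assoc)
      moreover have "m \<le> \<tau>"
      proof -
        have "k < N k" unfolding N_def using L2 by (intro power_gt_expt) auto
        then show ?thesis using k(1) \<tau>(1) by linarith
      qed
      ultimately show "\<exists>n\<ge>m. (1 - 6 * \<epsilon>) * tt n * sqrt (Q n \<omega>) \<le> D n \<omega>" by blast
    qed
  qed
qed

lemma lower_LIL:
  assumes \<epsilon>: "0 < \<epsilon>" "\<epsilon> \<le> 1/2"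
  shows "AE \<omega> in M. \<exists>\<^sub>\<infinity>n. (1 - \<epsilon>) * tt n * sqrt (Q n \<omega>) \<le> D n \<omega>"
  using lower_LIL_aux[of "\<epsilon> / 6"] \<epsilon> by simp

lemma lower_LIL_neg:
  assumes \<epsilon>: "0 < \<epsilon>" "\<epsilon> \<le> 1/2"
  shows "AE \<omega> in M. \<exists>\<^sub>\<infinity>n. D n \<omega> \<le> - ((1 - \<epsilon>) * tt n * sqrt (Q n \<omega>))"
proof -
  interpret neg: bounded_martingale_differences M F "\<lambda>n \<omega>. - d n \<omega>" \<beta> c C n0
    by (rule uminus_differences)
  have "neg.D n \<omega> = - D n \<omega>" "neg.Q n \<omega> = Q n \<omega>" for n \<omega>
    by (simp_all add: neg.D_def neg.Q_def D_def Q_def sum_negf)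
  moreover have "x \<le> - y \<longleftrightarrow> y \<le> - x" for x y :: real by linarith
  ultimately show ?thesis
    using neg.lower_LIL[OF \<epsilon>] by simp
qed

end

section \<open>Fourth moments and conditional expectations\<close>

context martingale_differences
begin

lemma D_Suc: "D (Suc n) \<omega> = D n \<omega> + d n \<omega>"
  by (simp add: D_def)

lemma second_moment:
  assumes "N \<le> n" "\<And>i. N \<le> i \<Longrightarrow> i < n \<Longrightarrow> cond_sq_le i v"
  shows "(\<integral>\<omega>. (D n \<omega> - D N \<omega>)\<^sup>2 \<partial>M) \<le> v * real (n - N)"
  using assms
proof (induction n rule: dec_induct)
  case (step n)
  let ?M = "\<lambda>\<omega>. D n \<omega> - D N \<omega>"
  have Mn: "?M \<in> bmeas (F n)" using step(1) by (intro bmeas_diff D_bmeas bmeas_F_mono[OF _ D_bmeas]) auto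
  then have Ms: "?M \<in> bmeas (F (Suc n))" by (rule bmeas_F_mono[rotated]) simp
  have i: "integrable M (\<lambda>\<omega>. (?M \<omega>)\<^sup>2)" "integrable M (\<lambda>\<omega>. ?M \<omega> * d n \<omega>)" "integrable M (\<lambda>\<omega>. (d n \<omega>)\<^sup>2)"
    using Ms d_bmeas[of n]
    by (auto intro!: bmeas_F_integrable[of _ "Suc n"])
  have "(\<integral>\<omega>. (D (Suc n) \<omega> - D N \<omega>)\<^sup>2 \<partial>M) = (\<integral>\<omega>. (?M \<omega>)\<^sup>2 + 2 * (?M \<omega> * d n \<omega>) + (d n \<omega>)\<^sup>2 \<partial>M)"
    by (intro Bochner_Integration.integral_cong) (auto simp: D_Suc power2_eq_square algebra_simps)
  also have "\<dots> = (\<integral>\<omega>. (?M \<omega>)\<^sup>2 \<partial>M) + 2 * (\<integral>\<omega>. ?M \<omega> * d n \<omega> \<partial>M) + (\<integral>\<omega>. 1 * (d n \<omega>)\<^sup>2 \<partial>M)"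
    using i by simp
  also have "(\<integral>\<omega>. ?M \<omega> * d n \<omega> \<partial>M) = 0" by (rule d_centered[OF Mn])
  also have "(\<integral>\<omega>. 1 * (d n \<omega>)\<^sup>2 \<partial>M) \<le> v * (\<integral>\<omega>. 1 \<partial>M)"
  proof -
    have "cond_sq_le n v" using step by auto
    from bspec[OF this[unfolded cond_sq_le_def] bmeas_const[of 1]] show ?thesis by simp
  qed
  also have "(\<integral>\<omega>. (?M \<omega>)\<^sup>2 \<partial>M) \<le> v * real (n - N)" using step by auto
  also have "v * real (n - N) + 2 * 0 + v * (\<integral>\<omega>. 1 \<partial>M) = v * real (Suc n - N)"
    using step(1) by (simp add: prob_space Suc_diff_le algebra_simps)
  finally show ?case by simp
qed simp

text \<open>A Rosenthal type bound by induction. The term cubic in the sum vanishes by centring, and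
  the term linear in the sum is absorbed by Young's inequality, so only the conditional second and
  the plain fourth moments of the differences enter.\<close>

lemma fourth_moment:
  assumes "N \<le> n" "\<And>i. N \<le> i \<Longrightarrow> i < n \<Longrightarrow> cond_sq_le i v" "0 \<le> v"
    and "\<And>i. N \<le> i \<Longrightarrow> i < n \<Longrightarrow> (\<integral>\<omega>. (d i \<omega>) ^ 4 \<partial>M) \<le> w"
  shows "(\<integral>\<omega>. (D n \<omega> - D N \<omega>) ^ 4 \<partial>M) \<le> 8 * v\<^sup>2 * (real (n - N))\<^sup>2 + 3 * w * real (n - N)"
  using assms
proof (induction n rule: dec_induct)
  case (step n)
  let ?M = "\<lambda>\<omega>. D n \<omega> - D N \<omega>"
  have Mn: "?M \<in> bmeas (F n)" using step(1) by (intro bmeas_diff D_bmeas bmeas_F_mono[OF _ D_bmeas]) auto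
  then have Ms: "?M \<in> bmeas (F (Suc n))" by (rule bmeas_F_mono[rotated]) simp
  have i: "integrable M (\<lambda>\<omega>. (?M \<omega>) ^ 4)" "integrable M (\<lambda>\<omega>. (?M \<omega>) ^ 3 * d n \<omega>)"
    "integrable M (\<lambda>\<omega>. (?M \<omega>)\<^sup>2 * (d n \<omega>)\<^sup>2)" "integrable M (\<lambda>\<omega>. (d n \<omega>) ^ 4)"
    "integrable M (\<lambda>\<omega>. (?M \<omega> + d n \<omega>) ^ 4)"
    using Ms d_bmeas[of n]
    by (auto intro!: bmeas_F_integrable[of _ "Suc n"] simp del: add_diff_cancel)
  have pw: "(x + y) ^ 4 \<le> x ^ 4 + 4 * (x ^ 3 * y) + 8 * (x\<^sup>2 * y\<^sup>2) + 3 * y ^ 4" for x y :: real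
  proof -
    have "0 \<le> 2 * y\<^sup>2 * (x - y)\<^sup>2" by simp
    then show ?thesis by (simp add: power2_eq_square power4_eq_xxxx power3_eq_cube algebra_simps)
  qed
  have "(\<integral>\<omega>. (D (Suc n) \<omega> - D N \<omega>) ^ 4 \<partial>M) = (\<integral>\<omega>. (?M \<omega> + d n \<omega>) ^ 4 \<partial>M)"
    by (intro Bochner_Integration.integral_cong) (auto simp: D_Suc algebra_simps)
  also have "\<dots> \<le> (\<integral>\<omega>. (?M \<omega>) ^ 4 + 4 * ((?M \<omega>) ^ 3 * d n \<omega>) + 8 * ((?M \<omega>)\<^sup>2 * (d n \<omega>)\<^sup>2) + 3 * (d n \<omega>) ^ 4 \<partial>M)"
    using i by (intro integral_mono pw) auto
  also have "\<dots> = (\<integral>\<omega>. (?M \<omega>) ^ 4 \<partial>M) + 4 * (\<integral>\<omega>. (?M \<omega>) ^ 3 * d n \<omega> \<partial>M)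
      + 8 * (\<integral>\<omega>. (?M \<omega>)\<^sup>2 * (d n \<omega>)\<^sup>2 \<partial>M) + 3 * (\<integral>\<omega>. (d n \<omega>) ^ 4 \<partial>M)"
    using i by simp
  also have "(\<integral>\<omega>. (?M \<omega>) ^ 3 * d n \<omega> \<partial>M) = 0"
    using Mn by (intro d_centered bmeas_power)
  also have "(\<integral>\<omega>. (?M \<omega>)\<^sup>2 * (d n \<omega>)\<^sup>2 \<partial>M) \<le> v * (v * real (n - N))"
  proof -
    have "(\<integral>\<omega>. (?M \<omega>)\<^sup>2 * (d n \<omega>)\<^sup>2 \<partial>M) \<le> v * (\<integral>\<omega>. (?M \<omega>)\<^sup>2 \<partial>M)"
      using step.prems(1)[of n] step(1) bmeas_power[OF Mn, of 2] unfolding cond_sq_le_def by simp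
    also have "\<dots> \<le> v * (v * real (n - N))"
      using step by (intro mult_left_mono second_moment) auto
    finally show ?thesis .
  qed
  also have "(\<integral>\<omega>. (?M \<omega>) ^ 4 \<partial>M) \<le> 8 * v\<^sup>2 * (real (n - N))\<^sup>2 + 3 * w * real (n - N)"
    using step by auto
  also have "(\<integral>\<omega>. (d n \<omega>) ^ 4 \<partial>M) \<le> w" using step by auto
  also have "8 * v\<^sup>2 * (real (n - N))\<^sup>2 + 3 * w * real (n - N) + 4 * 0 + 8 * (v * (v * real (n - N))) + 3 * w
    \<le> 8 * v\<^sup>2 * (real (Suc n - N))\<^sup>2 + 3 * w * real (Suc n - N)"
  proof -
    define m where "m = real (n - N)"
    have m: "real (Suc n - N) = m + 1" using step(1) by (simp add: m_def Suc_diff_le)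
    have "0 \<le> m" by (simp add: m_def)
    then have "0 \<le> v * (v * (m * 8)) + 8 * (v * v)" by simp
    then show ?thesis
      unfolding m m_def[symmetric] by (simp add: power2_eq_square algebra_simps)
  qed
  finally show ?case by simp
qed simp

text \<open>The differences are set to \<open>0\<close> after the first passage over
  \<open>x\<close>. The stopped sums are again a martingale with the same moment bounds, and their
  final value records the passage, so Markov's inequality at the end point suffices.\<close>

lemma maximal_fourth:
  assumes "N \<le> n" "0 < x" "\<And>i. N \<le> i \<Longrightarrow> i < n \<Longrightarrow> cond_sq_le i v" "0 \<le> v"
    and "\<And>i. N \<le> i \<Longrightarrow> i < n \<Longrightarrow> (\<integral>\<omega>. (d i \<omega>) ^ 4 \<partial>M) \<le> w"
  shows "prob {\<omega> \<in> space M. \<exists>m\<in>{N..n}. x \<le> \<bar>D m \<omega> - D N \<omega>\<bar>}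
    \<le> (8 * v\<^sup>2 * (real (n - N))\<^sup>2 + 3 * w * real (n - N)) / x ^ 4"
proof -
  define P where "P i \<omega> \<longleftrightarrow> (\<exists>k\<in>{N..<i}. x \<le> \<bar>D k \<omega> - D N \<omega>\<bar>)" for i \<omega>
  define e where "e i \<omega> = (if P (Suc i) \<omega> then 0 else d i \<omega>)" for i \<omega>
  have P_sets: "{\<omega> \<in> space M. P (Suc i) \<omega>} \<in> sets (F i)" for i
  proof -
    have "{\<omega> \<in> space M. x \<le> \<bar>D k \<omega> - D N \<omega>\<bar>} \<in> sets (F i)" if "k \<in> {N..<Suc i}" for k
    proof -
      have [measurable]: "D k \<in> borel_measurable (F i)" "D N \<in> borel_measurable (F i)"
        using that bmeas_measurable[OF D_bmeas, of k] bmeas_measurable[OF D_bmeas, of N]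
        by (auto intro: measurable_F_mono[of k i] measurable_F_mono[of N i])
      have "{\<omega> \<in> space (F i). x \<le> \<bar>D k \<omega> - D N \<omega>\<bar>} \<in> sets (F i)" by measurable
      then show ?thesis by simp
    qed
    then have "(\<Union>k\<in>{N..<Suc i}. {\<omega> \<in> space M. x \<le> \<bar>D k \<omega> - D N \<omega>\<bar>}) \<in> sets (F i)" by auto
    also have "(\<Union>k\<in>{N..<Suc i}. {\<omega> \<in> space M. x \<le> \<bar>D k \<omega> - D N \<omega>\<bar>}) = {\<omega> \<in> space M. P (Suc i) \<omega>}"
      by (auto simp: P_def)
    finally show ?thesis .
  qed
  have e_bmeas: "e i \<in> bmeas (F (Suc i))" for i
    unfolding e_def[abs_def] using P_sets[of i] F_Suc[of i] d_bmeas[of i] by (intro bmeas_if) auto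
  have G': "(\<lambda>\<omega>. if P (Suc i) \<omega> then 0 else G \<omega>) \<in> bmeas (F i)" if "G \<in> bmeas (F i)" for i G
    using P_sets[of i] that by (intro bmeas_if) auto
  interpret e: martingale_differences M F e
  proof (unfold_locales, rule e_bmeas)
    fix i G assume "G \<in> bmeas (F i)"
    have "(\<integral>\<omega>. G \<omega> * e i \<omega> \<partial>M) = (\<integral>\<omega>. (if P (Suc i) \<omega> then 0 else G \<omega>) * d i \<omega> \<partial>M)"
      by (intro Bochner_Integration.integral_cong) (auto simp: e_def)
    then show "(\<integral>\<omega>. G \<omega> * e i \<omega> \<partial>M) = 0"
      using d_centered[OF G'[OF \<open>G \<in> bmeas (F i)\<close>]] by simp
  qed
  have e_sq: "e.cond_sq_le i v" if "N \<le> i" "i < n" for i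
    unfolding e.cond_sq_le_def
  proof (intro ballI impI)
    fix G assume G: "G \<in> bmeas (F i)" "\<forall>\<omega>. 0 \<le> G \<omega>"
    have "(\<integral>\<omega>. G \<omega> * (e i \<omega>)\<^sup>2 \<partial>M) = (\<integral>\<omega>. (if P (Suc i) \<omega> then 0 else G \<omega>) * (d i \<omega>)\<^sup>2 \<partial>M)"
      by (intro Bochner_Integration.integral_cong) (auto simp: e_def)
    also have "\<dots> \<le> v * (\<integral>\<omega>. (if P (Suc i) \<omega> then 0 else G \<omega>) \<partial>M)"
      using assms(3)[OF that] G'[OF G(1)] G(2) unfolding cond_sq_le_def by auto
    also have "\<dots> \<le> v * (\<integral>\<omega>. G \<omega> \<partial>M)"
      using assms(4) G G'[OF G(1)] by (intro mult_left_mono integral_mono bmeas_F_integrable) auto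
    finally show "(\<integral>\<omega>. G \<omega> * (e i \<omega>)\<^sup>2 \<partial>M) \<le> v * (\<integral>\<omega>. G \<omega> \<partial>M)" .
  qed
  have e4: "(\<integral>\<omega>. (e i \<omega>) ^ 4 \<partial>M) \<le> w" if "N \<le> i" "i < n" for i
  proof -
    have "(\<integral>\<omega>. (e i \<omega>) ^ 4 \<partial>M) \<le> (\<integral>\<omega>. (d i \<omega>) ^ 4 \<partial>M)"
    proof (intro integral_mono bmeas_F_integrable[of _ "Suc i"] bmeas_power e_bmeas d_bmeas)
      show "e i \<omega> ^ 4 \<le> d i \<omega> ^ 4" for \<omega> by (simp add: e_def)
    qed
    then show ?thesis using assms(5)[OF that] by simp
  qed
  have eD: "e.D m \<omega> - e.D N \<omega> = (\<Sum>i\<in>{N..<m}. e i \<omega>)" if "N \<le> m" for m \<omega>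
    using that by (rule e.D_diff)
  have key: "(\<not> P m \<omega> \<longrightarrow> e.D m \<omega> - e.D N \<omega> = D m \<omega> - D N \<omega>) \<and> (P m \<omega> \<longrightarrow> x \<le> \<bar>e.D m \<omega> - e.D N \<omega>\<bar>)"
    if "N \<le> m" for m \<omega>
    using that
  proof (induction m rule: dec_induct)
    case (step m)
    have "P (Suc m) \<omega> \<longleftrightarrow> P m \<omega> \<or> x \<le> \<bar>D m \<omega> - D N \<omega>\<bar>"
      using step(1) by (auto simp: P_def less_Suc_eq)
    moreover have "e m \<omega> = (if P (Suc m) \<omega> then 0 else d m \<omega>)" by (simp add: e_def)
    ultimately show ?case using step(3) by (auto simp: e.D_Suc D_Suc)
  qed (simp add: P_def)
  have "prob {\<omega> \<in> space M. \<exists>m\<in>{N..n}. x \<le> \<bar>D m \<omega> - D N \<omega>\<bar>}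
      \<le> (\<integral>\<omega>. (e.D n \<omega> - e.D N \<omega>) ^ 4 \<partial>M) / x ^ 4"
  proof (rule markov_bmeas)
    show "(\<lambda>\<omega>. (e.D n \<omega> - e.D N \<omega>) ^ 4) \<in> bmeas M"
      by (intro bmeas_power bmeas_diff bmeas_F_M[OF e.D_bmeas])
    fix \<omega> assume "\<omega> \<in> {\<omega> \<in> space M. \<exists>m\<in>{N..n}. x \<le> \<bar>D m \<omega> - D N \<omega>\<bar>}"
    then have "P n \<omega> \<or> x \<le> \<bar>D n \<omega> - D N \<omega>\<bar>" by (auto simp: P_def le_less)
    then have "x \<le> \<bar>e.D n \<omega> - e.D N \<omega>\<bar>" using key[OF assms(1), of \<omega>] by auto
    then have "x ^ 4 \<le> \<bar>e.D n \<omega> - e.D N \<omega>\<bar> ^ 4" using assms by (intro power_mono) auto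
    then show "x ^ 4 \<le> (e.D n \<omega> - e.D N \<omega>) ^ 4" by simp
  qed (use assms in auto)
  also have "\<dots> \<le> (8 * v\<^sup>2 * (real (n - N))\<^sup>2 + 3 * w * real (n - N)) / x ^ 4"
    using assms e_sq e4 by (intro divide_right_mono e.fourth_moment) auto
  finally show ?thesis .
qed

text \<open>In a block of length \<open>3 * 4 ^ k\<close> the fourth moment inequality gives
  \<open>v\<^sup>2 / \<tau> ^ 4\<close> and \<open>w / (4 ^ k * \<tau> ^ 4)\<close> up to constants.
  The uniform bound \<open>C\<close> replaces \<open>v\<^sup>2\<close> by \<open>C * v\<close>, so
  that the hypotheses are linear in the tail probabilities, as the Choquet condition is.\<close>

lemma negligible_sum:
  fixes v w :: "nat \<Rightarrow> real"
  assumes v: "\<And>k i. K \<le> k \<Longrightarrow> 4 ^ k \<le> i \<Longrightarrow> i < 4 ^ Suc k \<Longrightarrow> cond_sq_le i (v k)"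
    "\<And>k. K \<le> k \<Longrightarrow> 0 \<le> v k" "\<And>k. K \<le> k \<Longrightarrow> v k \<le> C"
    and w: "\<And>k i. K \<le> k \<Longrightarrow> 4 ^ k \<le> i \<Longrightarrow> i < 4 ^ Suc k \<Longrightarrow> (\<integral>\<omega>. (d i \<omega>) ^ 4 \<partial>M) \<le> w k"
    and sv: "summable (\<lambda>k. v k / tt (4 ^ k) ^ 4)"
    and sw: "summable (\<lambda>k. w k / (4 ^ k * tt (4 ^ k) ^ 4))"
    and \<epsilon>: "0 < \<epsilon>"
  shows "AE \<omega> in M. \<forall>\<^sub>F n in sequentially. \<bar>D n \<omega>\<bar> \<le> \<epsilon> * (sqrt (real n) * tt n)"
proof -
  define \<epsilon>' where "\<epsilon>' = \<epsilon> / 3"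
  have \<epsilon>': "0 < \<epsilon>'" using \<epsilon> by (simp add: \<epsilon>'_def)
  define x where "x k = \<epsilon>' * (2 ^ k * tt (4 ^ k))" for k
  have x_pos: "0 < x k" for k using \<epsilon>' tt_pos by (simp add: x_def)
  define P where "P k \<omega> \<longleftrightarrow> (\<exists>m\<in>{4 ^ k..4 ^ Suc k}. x k \<le> \<bar>D m \<omega> - D (4 ^ k) \<omega>\<bar>)" for k \<omega>
  have "AE \<omega> in M. \<forall>\<^sub>F k in sequentially. \<not> P k \<omega>"
  proof (rule AE_eventually_of_summable)
    show "{\<omega> \<in> space M. P k \<omega>} \<in> events" for k
      unfolding P_def by measurable
    show "summable (\<lambda>k. 72 * C / \<epsilon>' ^ 4 * (v k / tt (4 ^ k) ^ 4) + 9 / \<epsilon>' ^ 4 * (w k / (4 ^ k * tt (4 ^ k) ^ 4)))"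
      using sv sw by (intro summable_add summable_mult)
    show "\<forall>\<^sub>F k in sequentially. prob {\<omega> \<in> space M. P k \<omega>}
        \<le> 72 * C / \<epsilon>' ^ 4 * (v k / tt (4 ^ k) ^ 4) + 9 / \<epsilon>' ^ 4 * (w k / (4 ^ k * tt (4 ^ k) ^ 4))"
      using eventually_ge_at_top[of K]
    proof eventually_elim
      case (elim k)
      have m: "real (4 ^ Suc k - 4 ^ k) = 3 * 4 ^ k" by (simp add: of_nat_diff)
      have "prob {\<omega> \<in> space M. P k \<omega>}
          \<le> (8 * (v k)\<^sup>2 * (real (4 ^ Suc k - 4 ^ k))\<^sup>2 + 3 * w k * real (4 ^ Suc k - 4 ^ k)) / x k ^ 4"
        unfolding P_def using v w elim x_pos by (intro maximal_fourth) (auto simp del: power_Suc)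
      also have "\<dots> = (72 * (v k)\<^sup>2 * 4 ^ k * 4 ^ k + 9 * w k * 4 ^ k) / x k ^ 4"
        unfolding m by (simp add: power2_eq_square)
      also have "\<dots> \<le> (72 * (C * v k) * 4 ^ k * 4 ^ k + 9 * w k * 4 ^ k) / x k ^ 4"
      proof -
        have "(v k)\<^sup>2 \<le> C * v k" using v elim by (simp add: power2_eq_square mult_right_mono)
        then have "(v k)\<^sup>2 * (4 ^ k * 4 ^ k) \<le> C * v k * (4 ^ k * 4 ^ k)" by (intro mult_right_mono) auto
        then show ?thesis using x_pos[of k] by (intro divide_right_mono) (auto simp: mult_ac)
      qed
      also have "x k ^ 4 = \<epsilon>' ^ 4 * (4 ^ k * 4 ^ k * tt (4 ^ k) ^ 4)"
      proof -
        have "((2::real) ^ k) ^ 4 = 4 ^ k * 4 ^ k"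
          by (simp flip: power_mult_distrib power_mult add: mult.commute[of k] power_mult)
        then show ?thesis by (simp add: x_def power_mult_distrib)
      qed
      also have "(72 * (C * v k) * 4 ^ k * 4 ^ k + 9 * w k * 4 ^ k) / (\<epsilon>' ^ 4 * (4 ^ k * 4 ^ k * tt (4 ^ k) ^ 4))
        = 72 * C / \<epsilon>' ^ 4 * (v k / tt (4 ^ k) ^ 4) + 9 / \<epsilon>' ^ 4 * (w k / (4 ^ k * tt (4 ^ k) ^ 4))"
        using \<epsilon>' tt_pos[of "4 ^ k"] by (simp add: add_divide_distrib)
      finally show ?case .
    qed
  qed
  then show ?thesis
  proof eventually_elim
    case (elim \<omega>)
    then obtain k1 where k1: "\<And>k m. k1 \<le> k \<Longrightarrow> 4 ^ k \<le> m \<Longrightarrow> m \<le> 4 ^ Suc k \<Longrightarrow> \<bar>D m \<omega> - D (4 ^ k) \<omega>\<bar> < x k"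
      unfolding eventually_sequentially P_def by (metis atLeastAtMost_iff not_le)
    define A where "A = \<bar>D (4 ^ k1) \<omega>\<bar>"
    \<comment> \<open>Blocks grow by the factor \<open>4\<close>, so the admissible fluctuation at
      least doubles: \<open>2 * x k \<le> x (Suc k)\<close>. The fluctuations of all earlier blocks
      thus fit into one further \<open>x k\<close>; with \<open>A\<close> this uses up the three
      thirds of \<open>\<epsilon>\<close>.\<close>
    have Dk: "\<bar>D (4 ^ k) \<omega>\<bar> \<le> A + x k" if "k1 \<le> k" for k
      using that
    proof (induction k rule: dec_induct)
      case base
      then show ?case using x_pos[of k1] by (simp add: A_def)
    next
      case (step k)
      have "\<bar>D (4 ^ Suc k) \<omega> - D (4 ^ k) \<omega>\<bar> < x k" using step by (intro k1) auto
      then have "\<bar>D (4 ^ Suc k) \<omega>\<bar> \<le> A + 2 * x k" using step by linarith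
      also have "2 * x k \<le> x (Suc k)"
        unfolding x_def using \<epsilon>' tt_mono[of "4 ^ k" "4 ^ Suc k"] by simp
      finally show ?case by simp
    qed
    have lim: "filterlim (\<lambda>n. sqrt (real n) * tt n) at_top sequentially"
      by (intro filterlim_at_top_mult_at_top tt_at_top filterlim_compose[OF sqrt_at_top filterlim_real_sequentially])
    show ?case
    proof (rule eventually_between_powers[of 4])
      have "\<forall>\<^sub>F k in sequentially. \<forall>n\<ge>4 ^ k. A / \<epsilon>' \<le> sqrt (real n) * tt n"
        using lim by (intro eventually_pow[OF eventually_all_ge_at_top]) (auto simp: filterlim_at_top)
      then show "\<forall>\<^sub>F k in sequentially. \<forall>n. 4 ^ k \<le> n \<longrightarrow> n < 4 ^ Suc k \<longrightarrow> \<bar>D n \<omega>\<bar> \<le> \<epsilon> * (sqrt (real n) * tt n)"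
        using eventually_ge_at_top[of k1]
      proof eventually_elim
        case (elim k)
        show ?case
        proof (intro allI impI)
          fix n :: nat assume n: "4 ^ k \<le> n" "n < 4 ^ Suc k"
          have "\<bar>D n \<omega> - D (4 ^ k) \<omega>\<bar> < x k" using elim n by (intro k1) auto
          then have 1: "\<bar>D n \<omega>\<bar> \<le> A + 2 * x k" using Dk[of k] elim by linarith
          have "(2::real) ^ k = sqrt (4 ^ k)" by (metis real_sqrt_four real_sqrt_power)
          also have "\<dots> \<le> sqrt (real n)" using n(1) by (metis of_nat_le_iff of_nat_numeral of_nat_power real_sqrt_le_iff)
          finally have "2 ^ k * tt (4 ^ k) \<le> sqrt (real n) * tt n"
            using n tt_mono[of "4 ^ k" n] tt_pos[of "4 ^ k"] by (intro mult_mono) auto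
          then have "x k \<le> \<epsilon>' * (sqrt (real n) * tt n)" using \<epsilon>' by (simp add: x_def)
          moreover have "A \<le> \<epsilon>' * (sqrt (real n) * tt n)" using elim n \<epsilon>' by (auto simp: field_simps)
          ultimately show "\<bar>D n \<omega>\<bar> \<le> \<epsilon> * (sqrt (real n) * tt n)"
            using 1 by (simp add: \<epsilon>'_def)
        qed
      qed
    qed simp
  qed
qed

end

section \<open>Conditional expectations bounded at every point\<close>

lemma (in filtered_prob_space) AE_le_of_integral_le:
  assumes Z: "Z \<in> borel_measurable (F n)" "integrable M Z"
    and le: "\<And>A. A \<in> sets (F n) \<Longrightarrow> (\<integral>\<omega>. indicator A \<omega> * Z \<omega> \<partial>M) \<le> h * prob A"
  shows "AE \<omega> in M. Z \<omega> \<le> h"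
proof -
  define A where "A = {\<omega> \<in> space M. h < Z \<omega>}"
  note [measurable] = Z(1)
  have "{\<omega> \<in> space (F n). h < Z \<omega>} \<in> sets (F n)" by measurable
  then have A: "A \<in> sets (F n)" by (simp add: A_def)
  then have A': "A \<in> events" by (rule sets_F_M)
  have i: "integrable M (\<lambda>\<omega>. indicator A \<omega> * Z \<omega>)"
    using integrable_mult_indicator[OF A' Z(2)] by simp
  have iA: "integrable M (\<lambda>\<omega>. h * indicator A \<omega>)" using A' by (simp add: emeasure_eq_measure)
  have "(\<integral>\<omega>. indicator A \<omega> * (Z \<omega> - h) \<partial>M) = (\<integral>\<omega>. indicator A \<omega> * Z \<omega> - h * indicator A \<omega> \<partial>M)"
    by (intro Bochner_Integration.integral_cong) (auto simp: algebra_simps)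
  also have "\<dots> = (\<integral>\<omega>. indicator A \<omega> * Z \<omega> \<partial>M) - (\<integral>\<omega>. h * indicator A \<omega> \<partial>M)"
    using i iA by (rule Bochner_Integration.integral_diff)
  also have "\<dots> \<le> 0" using le[OF A] A' by simp
  finally have "(\<integral>\<omega>. indicator A \<omega> * (Z \<omega> - h) \<partial>M) \<le> 0" .
  moreover have nonneg: "AE \<omega> in M. 0 \<le> indicator A \<omega> * (Z \<omega> - h)"
    by (intro AE_I2) (auto simp: indicator_def A_def)
  then have "0 \<le> (\<integral>\<omega>. indicator A \<omega> * (Z \<omega> - h) \<partial>M)"
    by (rule integral_nonneg_AE)
  ultimately have "(\<integral>\<omega>. indicator A \<omega> * (Z \<omega> - h) \<partial>M) = 0" by simp
  moreover have "integrable M (\<lambda>\<omega>. indicator A \<omega> * (Z \<omega> - h))"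
    using Bochner_Integration.integrable_diff[OF i iA] by (simp add: algebra_simps)
  ultimately have "AE \<omega> in M. indicator A \<omega> * (Z \<omega> - h) = 0"
    using integral_nonneg_eq_0_iff_AE[of M "\<lambda>\<omega>. indicator A \<omega> * (Z \<omega> - h)"] nonneg by blast
  with AE_space show ?thesis
    by eventually_elim (auto simp: indicator_def A_def split: if_splits)
qed

text \<open>Some version of the conditional expectation is clamped to the interval from
  \<open>lo\<close> to \<open>hi\<close>, which changes it on a null set only. The bounds then hold
  everywhere, so that \<open>\<mu>\<close> is in \<open>bmeas\<close> and may occur in pointwise
  estimates.\<close>

lemma (in filtered_prob_space) bounded_conditional_expectation:
  assumes X: "X \<in> bmeas M"
    and lo: "\<And>A. A \<in> sets (F n) \<Longrightarrow> lo * prob A \<le> (\<integral>\<omega>. indicator A \<omega> * X \<omega> \<partial>M)"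
    and hi: "\<And>A. A \<in> sets (F n) \<Longrightarrow> (\<integral>\<omega>. indicator A \<omega> * X \<omega> \<partial>M) \<le> hi * prob A"
  shows "\<exists>\<mu>\<in>bmeas (F n). (\<forall>\<omega>. lo \<le> \<mu> \<omega> \<and> \<mu> \<omega> \<le> hi) \<and>
    (\<forall>G\<in>bmeas (F n). (\<integral>\<omega>. G \<omega> * \<mu> \<omega> \<partial>M) = (\<integral>\<omega>. G \<omega> * X \<omega> \<partial>M))"
proof -
  interpret S: finite_measure_subalgebra M "F n"
    by unfold_locales (rule subalg)
  have X_int: "integrable M X" using X by (rule bmeas_integrable)
  let ?Z = "real_cond_exp M (F n) X"
  have Z_int: "integrable M ?Z" using X_int by (rule S.real_cond_exp_int)
  have Z_meas [measurable]: "?Z \<in> borel_measurable (F n)" by simp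
  have Z_meas' [measurable]: "?Z \<in> borel_measurable M" using Z_meas by (rule measurable_F_M)
  have Z: "(\<integral>\<omega>. G \<omega> * ?Z \<omega> \<partial>M) = (\<integral>\<omega>. G \<omega> * X \<omega> \<partial>M)" if G: "G \<in> bmeas (F n)" for G
    using bmeas_mult[OF bmeas_F_M[OF G] X] G X
    by (intro S.real_cond_exp_intg) (auto intro: bmeas_integrable dest: bmeas_measurable)
  have "lo \<le> hi"
    using lo[of "space M"] hi[of "space M"] sets.top[of "F n"] by (simp add: prob_space)
  have AE_le: "AE \<omega> in M. ?Z \<omega> \<le> hi"
    using Z_meas Z_int by (rule AE_le_of_integral_le) (simp add: Z hi)
  have "AE \<omega> in M. - ?Z \<omega> \<le> - lo"
  proof (rule AE_le_of_integral_le)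
    fix A assume A: "A \<in> sets (F n)"
    then show "(\<integral>\<omega>. indicator A \<omega> * - ?Z \<omega> \<partial>M) \<le> - lo * prob A"
      using Z[of "indicator A"] lo[OF A] by simp
  qed (use Z_int in auto)
  then have AE_ge: "AE \<omega> in M. lo \<le> ?Z \<omega>" by simp
  define \<mu> where "\<mu> \<omega> = max lo (min hi (?Z \<omega>))" for \<omega>
  have \<mu>_bd: "lo \<le> \<mu> \<omega>" "\<mu> \<omega> \<le> hi" for \<omega> using \<open>lo \<le> hi\<close> by (auto simp: \<mu>_def)
  have \<mu>_meas: "\<mu> \<in> borel_measurable (F n)" unfolding \<mu>_def by measurable
  have \<mu>: "\<mu> \<in> bmeas (F n)"
    using \<mu>_meas by (rule bmeasI[of _ _ "max \<bar>lo\<bar> \<bar>hi\<bar>"]) (use \<mu>_bd in \<open>smt (verit)\<close>)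
  have [measurable]: "\<mu> \<in> borel_measurable M" using \<mu>_meas by (rule measurable_F_M)
  have eq: "AE \<omega> in M. \<mu> \<omega> = ?Z \<omega>"
    using AE_le AE_ge by eventually_elim (simp add: \<mu>_def)
  have "(\<integral>\<omega>. G \<omega> * \<mu> \<omega> \<partial>M) = (\<integral>\<omega>. G \<omega> * X \<omega> \<partial>M)" if G: "G \<in> bmeas (F n)" for G
  proof -
    have [measurable]: "G \<in> borel_measurable M" using bmeas_F_M[OF G] by (rule bmeas_measurable)
    have "(\<integral>\<omega>. G \<omega> * \<mu> \<omega> \<partial>M) = (\<integral>\<omega>. G \<omega> * ?Z \<omega> \<partial>M)"
      using eq by (intro integral_cong_AE) auto
    then show ?thesis using Z[OF G] by simp
  qed
  then show ?thesis using \<mu> \<mu>_bd by blast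
qed

section \<open>Bounded Lipschitz functions and upper expectations\<close>

definition blip :: "(real \<Rightarrow> real) \<Rightarrow> bool" where
  "blip \<phi> \<longleftrightarrow> (\<exists>B. \<forall>x. \<bar>\<phi> x\<bar> \<le> B) \<and> (\<exists>L\<ge>0. \<forall>x y. \<bar>\<phi> x - \<phi> y\<bar> \<le> L * \<bar>x - y\<bar>)"

lemma blipI:
  assumes "\<And>x. \<bar>\<phi> x\<bar> \<le> B" "0 \<le> L" "\<And>x y. \<bar>\<phi> x - \<phi> y\<bar> \<le> L * \<bar>x - y\<bar>"
  shows "blip \<phi>"
  using assms by (auto simp: blip_def)

lemma blip_const [simp]: "blip (\<lambda>_. c)"
  by (rule blipI[of _ "\<bar>c\<bar>" 0]) auto

lemma blip_add:
  assumes "blip \<phi>" "blip \<psi>"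
  shows "blip (\<lambda>x. \<phi> x + \<psi> x)"
proof -
  obtain B1 L1 B2 L2 where 1: "\<And>x. \<bar>\<phi> x\<bar> \<le> B1" "0 \<le> L1" "\<And>x y. \<bar>\<phi> x - \<phi> y\<bar> \<le> L1 * \<bar>x - y\<bar>"
    and 2: "\<And>x. \<bar>\<psi> x\<bar> \<le> B2" "0 \<le> L2" "\<And>x y. \<bar>\<psi> x - \<psi> y\<bar> \<le> L2 * \<bar>x - y\<bar>"
    using assms unfolding blip_def by metis
  show ?thesis
  proof (rule blipI[of _ "B1 + B2" "L1 + L2"])
    fix x y
    show "\<bar>\<phi> x + \<psi> x\<bar> \<le> B1 + B2" using 1(1)[of x] 2(1)[of x] by linarith
    show "\<bar>\<phi> x + \<psi> x - (\<phi> y + \<psi> y)\<bar> \<le> (L1 + L2) * \<bar>x - y\<bar>"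
      using 1(3)[of x y] 2(3)[of x y] unfolding distrib_right by linarith
  qed (use 1 2 in auto)
qed

lemma blip_cmult:
  assumes "blip \<phi>"
  shows "blip (\<lambda>x. c * \<phi> x)"
proof -
  obtain B L where 1: "\<And>x. \<bar>\<phi> x\<bar> \<le> B" "0 \<le> L" "\<And>x y. \<bar>\<phi> x - \<phi> y\<bar> \<le> L * \<bar>x - y\<bar>"
    using assms unfolding blip_def by metis
  show ?thesis
  proof (rule blipI[of _ "\<bar>c\<bar> * B" "\<bar>c\<bar> * L"])
    fix x y
    show "\<bar>c * \<phi> x\<bar> \<le> \<bar>c\<bar> * B" using 1(1) by (simp add: abs_mult mult_left_mono)
    have "\<bar>c * \<phi> x - c * \<phi> y\<bar> = \<bar>c\<bar> * \<bar>\<phi> x - \<phi> y\<bar>" by (simp flip: abs_mult right_diff_distrib)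
    also have "\<dots> \<le> \<bar>c\<bar> * (L * \<bar>x - y\<bar>)" by (intro mult_left_mono 1) auto
    finally show "\<bar>c * \<phi> x - c * \<phi> y\<bar> \<le> \<bar>c\<bar> * L * \<bar>x - y\<bar>" by (simp add: mult.assoc)
  qed (use 1 in auto)
qed

lemma blip_uminus: "blip \<phi> \<Longrightarrow> blip (\<lambda>x. - \<phi> x)"
  using blip_cmult[of \<phi> "-1"] by simp

lemma blip_diff: "blip \<phi> \<Longrightarrow> blip \<psi> \<Longrightarrow> blip (\<lambda>x. \<phi> x - \<psi> x)"
  using blip_add[of \<phi> "\<lambda>x. - \<psi> x"] blip_uminus[of \<psi>] by simp

lemma blip_mult:
  assumes "blip \<phi>" "blip \<psi>"
  shows "blip (\<lambda>x. \<phi> x * \<psi> x)"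
proof -
  obtain B1 L1 B2 L2 where 1: "\<And>x. \<bar>\<phi> x\<bar> \<le> B1" "0 \<le> L1" "\<And>x y. \<bar>\<phi> x - \<phi> y\<bar> \<le> L1 * \<bar>x - y\<bar>"
    and 2: "\<And>x. \<bar>\<psi> x\<bar> \<le> B2" "0 \<le> L2" "\<And>x y. \<bar>\<psi> x - \<psi> y\<bar> \<le> L2 * \<bar>x - y\<bar>"
    using assms unfolding blip_def by metis
  have B: "0 \<le> B1" "0 \<le> B2" using 1(1)[of 0] 2(1)[of 0] by linarith+
  show ?thesis
  proof (rule blipI[of _ "B1 * B2" "B1 * L2 + B2 * L1"])
    fix x y
    show "\<bar>\<phi> x * \<psi> x\<bar> \<le> B1 * B2" unfolding abs_mult using 1 2 B by (intro mult_mono) auto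
    have "\<phi> x * \<psi> x - \<phi> y * \<psi> y = \<phi> x * (\<psi> x - \<psi> y) + \<psi> y * (\<phi> x - \<phi> y)"
      by (simp add: algebra_simps)
    then have "\<bar>\<phi> x * \<psi> x - \<phi> y * \<psi> y\<bar> \<le> \<bar>\<phi> x\<bar> * \<bar>\<psi> x - \<psi> y\<bar> + \<bar>\<psi> y\<bar> * \<bar>\<phi> x - \<phi> y\<bar>"
      by (simp add: abs_mult[symmetric] abs_triangle_ineq)
    also have "\<dots> \<le> B1 * (L2 * \<bar>x - y\<bar>) + B2 * (L1 * \<bar>x - y\<bar>)"
      using 1 2 B by (intro add_mono mult_mono) auto
    finally show "\<bar>\<phi> x * \<psi> x - \<phi> y * \<psi> y\<bar> \<le> (B1 * L2 + B2 * L1) * \<bar>x - y\<bar>"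
      by (simp add: algebra_simps)
  qed (use 1 2 B in auto)
qed

lemma blip_measurable:
  assumes "blip \<phi>"
  shows "\<phi> \<in> borel_measurable borel"
proof -
  obtain L where "0 \<le> L" "\<And>x y. \<bar>\<phi> x - \<phi> y\<bar> \<le> L * \<bar>x - y\<bar>"
    using assms by (auto simp: blip_def)
  then have "L-lipschitz_on UNIV \<phi>" by (auto simp: lipschitz_on_def dist_real_def)
  then have "continuous_on UNIV \<phi>" by (rule lipschitz_on_continuous_on)
  then show ?thesis by (rule borel_measurable_continuous_onI)
qed

definition clip :: "real \<Rightarrow> real \<Rightarrow> real" where
  "clip c x = max (- c) (min x c)"

lemma clip_lipschitz: "\<bar>clip c x - clip c y\<bar> \<le> \<bar>x - y\<bar>"
  by (auto simp: clip_def)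

lemma abs_clip_le: "0 \<le> c \<Longrightarrow> \<bar>clip c x\<bar> \<le> c"
  by (auto simp: clip_def)

lemma abs_clip: "0 \<le> c \<Longrightarrow> \<bar>clip c x\<bar> = min \<bar>x\<bar> c"
  by (auto simp: clip_def)

lemma clip_minus: "0 \<le> c \<Longrightarrow> clip c (- x) = - clip c x"
  by (auto simp: clip_def)

lemma blip_clip: "0 \<le> c \<Longrightarrow> blip (clip c)"
  using clip_lipschitz abs_clip_le by (intro blipI[of _ c 1]) auto

lemma clip_sq: "0 \<le> c \<Longrightarrow> (clip c x)\<^sup>2 = min (x\<^sup>2) (c\<^sup>2)"
proof -
  assume c: "0 \<le> c"
  have "(clip c x)\<^sup>2 = (min \<bar>x\<bar> c)\<^sup>2" using abs_clip[OF c, of x] by (metis power2_abs)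
  then show ?thesis
    using c power_mono[of "\<bar>x\<bar>" c 2] power_mono[of c "\<bar>x\<bar>" 2] by (auto simp: min_def)
qed

lemma blip_clip_sq: "0 \<le> c \<Longrightarrow> blip (\<lambda>x. (clip c x)\<^sup>2)"
  unfolding power2_eq_square by (intro blip_mult blip_clip)

text \<open>A Lipschitz substitute for the indicator of large values, which is not an admissible
  test function: \<open>0\<close> up to \<open>2 ^ i\<close> and \<open>1\<close> from
  \<open>2 ^ Suc i\<close> on. The gap of one dyadic step costs only constants.\<close>

definition ramp :: "nat \<Rightarrow> real \<Rightarrow> real" where
  "ramp i x = min 1 (max 0 (\<bar>x\<bar> / 2 ^ i - 1))"

lemma ramp_nonneg: "0 \<le> ramp i x" and ramp_le_1: "ramp i x \<le> 1"
  by (auto simp: ramp_def)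

lemma ramp_eq_1: "2 ^ Suc i \<le> \<bar>x\<bar> \<Longrightarrow> ramp i x = 1"
  by (auto simp: ramp_def min_def max_def field_simps)

lemma ramp_eq_0: "\<bar>x\<bar> \<le> 2 ^ i \<Longrightarrow> ramp i x = 0"
  by (auto simp: ramp_def min_def max_def field_simps)

lemma blip_ramp: "blip (ramp i)"
proof (rule blipI[of _ 1 1])
  fix x y
  have "\<bar>ramp i x - ramp i y\<bar> \<le> \<bar>\<bar>x\<bar> / 2 ^ i - \<bar>y\<bar> / 2 ^ i\<bar>"
    unfolding ramp_def by linarith
  also have "\<dots> = \<bar>\<bar>x\<bar> - \<bar>y\<bar>\<bar> / 2 ^ i" by (simp add: diff_divide_distrib[symmetric])
  also have "\<dots> \<le> \<bar>\<bar>x\<bar> - \<bar>y\<bar>\<bar> / 1" by (intro divide_left_mono) auto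
  also have "\<dots> \<le> \<bar>x - y\<bar>" by simp
  finally show "\<bar>ramp i x - ramp i y\<bar> \<le> 1 * \<bar>x - y\<bar>" by simp
qed (auto simp: ramp_def)

section \<open>Lipschitz functions of finitely many coordinates\<close>

lemma C_b_Lip_subset_C_l_Lip: "C_b_Lip n \<subseteq> C_l_Lip n"
proof
  fix \<phi> assume "\<phi> \<in> C_b_Lip n"
  then obtain L where L: "\<And>x y. \<bar>\<phi> x - \<phi> y\<bar> \<le> L * L2_set (\<lambda>i. x i - y i) {..<n}"
    by (auto simp: C_b_Lip_def)
  have "\<bar>\<phi> x - \<phi> y\<bar> \<le> (\<bar>L\<bar> + 1) * (1 + L2_set x {..<n} ^ 0 + L2_set y {..<n} ^ 0) * L2_set (\<lambda>i. x i - y i) {..<n}" for x y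
  proof -
    have "L * L2_set (\<lambda>i. x i - y i) {..<n} \<le> ((\<bar>L\<bar> + 1) * 3) * L2_set (\<lambda>i. x i - y i) {..<n}"
    proof (intro mult_right_mono L2_set_nonneg)
      show "L \<le> (\<bar>L\<bar> + 1) * 3" using abs_ge_self[of L] abs_ge_zero[of L] by (simp only: distrib_right)
    qed
    then show ?thesis using L[of x y] by simp
  qed
  moreover have "\<bar>L\<bar> + 1 > 0" by linarith
  ultimately show "\<phi> \<in> C_l_Lip n" unfolding C_l_Lip_def by blast
qed

lemma L2_set_abs: "L2_set (\<lambda>i. \<bar>f i\<bar>) A = L2_set f A"
  by (simp add: L2_set_def)

lemma L2_set_1: "L2_set f {..<Suc 0} = \<bar>f 0\<bar>"
  by (simp add: L2_set_def)

lemma blip_C_b_Lip: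
  assumes "blip \<phi>"
  shows "(\<lambda>x. \<phi> (x 0)) \<in> C_b_Lip 1"
  using assms by (auto simp: C_b_Lip_def blip_def L2_set_1)

text \<open>Vectors of every length become points of one metric space; the zeros make the image
  depend on the first \<open>n\<close> coordinates alone.\<close>

definition pad :: "nat \<Rightarrow> (nat \<Rightarrow> real) \<Rightarrow> nat \<Rightarrow> real" where
  "pad n x i = (if i < n then x i else 0)"

text \<open>Each coordinate distance is at most the Euclidean norm, and the weights
  \<open>(1 / 2) ^ k\<close> of the product metric sum to \<open>2\<close>. Functions that are
  Lipschitz for the product metric are therefore Lipschitz in the sense of
  \<open>C_b_Lip\<close>.\<close>

lemma dist_pad_le: "dist (pad n x) (pad n y) \<le> 2 * L2_set (\<lambda>i. x i - y i) {..<n}"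
proof -
  let ?S = "L2_set (\<lambda>i. x i - y i) {..<n}"
  have s: "summable (\<lambda>k. (1 / 2 :: real) ^ k)" by (rule summable_geometric) simp
  have le: "(1 / 2) ^ k * min (dist (pad n x (from_nat k)) (pad n y (from_nat k))) 1 \<le> (1 / 2) ^ k * ?S" for k
  proof (intro mult_left_mono)
    have "dist (pad n x i) (pad n y i) \<le> ?S" for i
      using member_le_L2_set[of "{..<n}" i "\<lambda>i. \<bar>x i - y i\<bar>"] L2_set_nonneg[of "\<lambda>i. x i - y i" "{..<n}"]
      by (simp add: pad_def dist_real_def L2_set_abs)
    then show "min (dist (pad n x (from_nat k)) (pad n y (from_nat k))) 1 \<le> ?S"
      by (meson min.cobounded1 order_trans)
  qed simp
  have "dist (pad n x) (pad n y) \<le> (\<Sum>k. (1 / 2) ^ k * ?S)"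
    unfolding dist_fun_def
  proof (rule suminf_le[OF le])
    show "summable (\<lambda>k. (1 / 2) ^ k * min (dist (pad n x (from_nat k)) (pad n y (from_nat k))) 1)"
      by (rule summable_comparison_test'[OF s, of 0]) (auto simp: abs_mult intro!: mult_left_le)
    show "summable (\<lambda>k. (1 / 2) ^ k * ?S)" using s by (rule summable_mult2)
  qed
  also have "\<dots> = 2 * ?S"
    using suminf_mult2[OF s, of ?S] suminf_geometric[of "1/2 :: real"] by simp
  finally show ?thesis .
qed

text \<open>The shape of test function to which independence is applied: a Lipschitz weight of the
  past times a function of the next variable, which is coordinate \<open>n\<close> when counting
  from \<open>0\<close>.\<close>

lemma C_b_Lip_pad_times:
  assumes g: "\<And>x. \<bar>g x\<bar> \<le> B" "\<And>x y. \<bar>g x - g y\<bar> \<le> K * dist x y" "0 \<le> K"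
    and \<psi>: "blip \<psi>"
  shows "(\<lambda>z. g (pad n z) * \<psi> (z n)) \<in> C_b_Lip (n + 1)"
proof -
  obtain B2 L2 where 2: "\<And>x. \<bar>\<psi> x\<bar> \<le> B2" "0 \<le> L2" "\<And>x y. \<bar>\<psi> x - \<psi> y\<bar> \<le> L2 * \<bar>x - y\<bar>"
    using \<psi> unfolding blip_def by metis
  have B: "0 \<le> B" "0 \<le> B2" using g(1)[of undefined] 2(1)[of 0] by linarith+
  have "\<bar>g (pad n x) * \<psi> (x n) - g (pad n y) * \<psi> (y n)\<bar> \<le> (B * L2 + B2 * (K * 2)) * L2_set (\<lambda>i. x i - y i) {..<n + 1}" for x y
  proof -
    let ?S = "L2_set (\<lambda>i. x i - y i) {..<n + 1}"
    have n: "\<bar>x n - y n\<bar> \<le> ?S"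
      using member_le_L2_set[of "{..<n+1}" n "\<lambda>i. \<bar>x i - y i\<bar>"] by (simp add: L2_set_abs)
    have "L2_set (\<lambda>i. x i - y i) {..<n} \<le> ?S"
      unfolding L2_set_def by (intro real_sqrt_le_mono sum_mono2) auto
    then have "K * dist (pad n x) (pad n y) \<le> K * (2 * ?S)"
      using dist_pad_le[of n x y] g(3) by (intro mult_left_mono) auto
    then have d: "\<bar>g (pad n x) - g (pad n y)\<bar> \<le> K * (2 * ?S)"
      using g(2)[of "pad n x" "pad n y"] by linarith
    have "L2 * \<bar>x n - y n\<bar> \<le> L2 * ?S" using n 2 by (intro mult_left_mono)
    then have e: "\<bar>\<psi> (x n) - \<psi> (y n)\<bar> \<le> L2 * ?S" using 2(3)[of "x n" "y n"] by linarith
    have "g (pad n x) * \<psi> (x n) - g (pad n y) * \<psi> (y n)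
      = g (pad n x) * (\<psi> (x n) - \<psi> (y n)) + \<psi> (y n) * (g (pad n x) - g (pad n y))"
      by (simp add: algebra_simps)
    then have "\<bar>g (pad n x) * \<psi> (x n) - g (pad n y) * \<psi> (y n)\<bar>
      \<le> \<bar>g (pad n x)\<bar> * \<bar>\<psi> (x n) - \<psi> (y n)\<bar> + \<bar>\<psi> (y n)\<bar> * \<bar>g (pad n x) - g (pad n y)\<bar>"
      by (simp add: abs_mult[symmetric] abs_triangle_ineq)
    also have "\<dots> \<le> B * (L2 * ?S) + B2 * (K * (2 * ?S))"
      using g 2 B d e by (intro add_mono mult_mono) auto
    finally show ?thesis by (simp add: algebra_simps)
  qed
  moreover have "\<bar>g (pad n x) * \<psi> (x n)\<bar> \<le> B * B2" for x
    unfolding abs_mult using g 2 B by (intro mult_mono) auto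
  ultimately show ?thesis unfolding C_b_Lip_def by blast
qed

context sublinear_expectation_space
begin

lemma H_const: "(\<lambda>\<omega>. c) \<in> H"
proof -
  have "(\<lambda>x. c) \<in> C_l_Lip 0" by (auto simp: C_l_Lip_def intro: exI[of _ 1])
  then show ?thesis using H_comp[of 0 undefined "\<lambda>x. c"] by simp
qed

lemma H_C_b_Lip:
  "(\<And>i. i < n \<Longrightarrow> X i \<in> H) \<Longrightarrow> \<phi> \<in> C_b_Lip n \<Longrightarrow> (\<lambda>\<omega>. \<phi> (\<lambda>i. X i \<omega>)) \<in> H"
  by (rule H_comp[of n X \<phi>]) (auto dest: subsetD[OF C_b_Lip_subset_C_l_Lip])

lemma H_blip: "X \<in> H \<Longrightarrow> blip \<phi> \<Longrightarrow> (\<lambda>\<omega>. \<phi> (X \<omega>)) \<in> H"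
  using H_C_b_Lip[of 1 "\<lambda>_. X" "\<lambda>x. \<phi> (x 0)"] blip_C_b_Lip by auto

lemma E_bounds:
  assumes "X \<in> H" "\<And>\<omega>. \<omega> \<in> space M \<Longrightarrow> lo \<le> X \<omega>" "\<And>\<omega>. \<omega> \<in> space M \<Longrightarrow> X \<omega> \<le> hi"
  shows "ereal lo \<le> E X" "E X \<le> ereal hi"
  using E_mono[OF assms(1) H_const[of lo]] E_mono[OF H_const[of hi] assms(1)] assms(2,3)
  by (simp_all add: E_const)

lemma E_finite:
  assumes "X \<in> H" "\<And>\<omega>. \<bar>X \<omega>\<bar> \<le> B"
  shows "\<bar>E X\<bar> \<noteq> \<infinity>"
proof -
  have "- B \<le> X \<omega>" "X \<omega> \<le> B" for \<omega> using assms(2)[of \<omega>] by linarith+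
  then have "ereal (- B) \<le> E X" "E X \<le> ereal B"
    using E_bounds[OF assms(1), of "- B" B] by auto
  then show ?thesis by auto
qed

lemma E_add_const:
  assumes X: "X \<in> H" and fin: "\<bar>E X\<bar> \<noteq> \<infinity>"
  shows "E (\<lambda>\<omega>. X \<omega> + c) = E X + ereal c"
proof (rule antisym)
  have Xc: "(\<lambda>\<omega>. X \<omega> + c) \<in> H" using H_add[OF X H_const[of c]] .
  show le: "E (\<lambda>\<omega>. X \<omega> + c) \<le> E X + ereal c"
    using E_subadd[OF X H_const[of c]] fin by (auto simp: E_const)
  have "E (\<lambda>\<omega>. (X \<omega> + c) + (- c)) \<le> E (\<lambda>\<omega>. X \<omega> + c) + E (\<lambda>\<omega>. - c)"
    by (rule E_subadd[OF Xc H_const]) (auto simp: E_const)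
  then have "E X \<le> E (\<lambda>\<omega>. X \<omega> + c) + ereal (- c)" by (simp add: E_const)
  then show "E X + ereal c \<le> E (\<lambda>\<omega>. X \<omega> + c)"
    using fin le by (cases "E X"; cases "E (\<lambda>\<omega>. X \<omega> + c)") auto
qed

definition upper :: "('a \<Rightarrow> real) \<Rightarrow> (real \<Rightarrow> real) \<Rightarrow> real" where
  "upper X \<phi> = real_of_ereal (E (\<lambda>\<omega>. \<phi> (X \<omega>)))"

lemma upper:
  assumes "X \<in> H" "blip \<phi>"
  shows "E (\<lambda>\<omega>. \<phi> (X \<omega>)) = ereal (upper X \<phi>)"
proof -
  obtain B where "\<And>x. \<bar>\<phi> x\<bar> \<le> B" using assms by (auto simp: blip_def)
  then have "\<bar>E (\<lambda>\<omega>. \<phi> (X \<omega>))\<bar> \<noteq> \<infinity>"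
    by (intro E_finite[of "\<lambda>\<omega>. \<phi> (X \<omega>)" B] H_blip[OF assms])
  then show ?thesis by (simp add: upper_def ereal_real)
qed

lemma upper_mono:
  assumes "X \<in> H" "blip \<phi>" "blip \<psi>" "\<And>x. \<phi> x \<le> \<psi> x"
  shows "upper X \<phi> \<le> upper X \<psi>"
  using E_mono[OF H_blip[OF assms(1,3)] H_blip[OF assms(1,2)]] assms by (simp add: upper)

lemma upper_add:
  assumes "X \<in> H" "blip \<phi>" "blip \<psi>"
  shows "upper X (\<lambda>x. \<phi> x + \<psi> x) \<le> upper X \<phi> + upper X \<psi>"
  using E_subadd[OF H_blip[OF assms(1,2)] H_blip[OF assms(1,3)]] assms upper[OF assms(1) blip_add[OF assms(2,3)]]
  by (simp add: upper)

lemma upper_cmult: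
  assumes "X \<in> H" "blip \<phi>" "0 \<le> c"
  shows "upper X (\<lambda>x. c * \<phi> x) = c * upper X \<phi>"
  using E_scale[OF H_blip[OF assms(1,2)] assms(3)] assms upper[OF assms(1) blip_cmult[OF assms(2), of c]]
  by (simp add: upper)

lemma upper_const: "upper X (\<lambda>_. c) = c"
  by (simp add: upper_def E_const)

lemma upper_nonneg:
  assumes "X \<in> H" "blip \<phi>" "\<And>x. 0 \<le> \<phi> x"
  shows "0 \<le> upper X \<phi>"
  using upper_mono[OF assms(1) blip_const[of 0] assms(2)] assms(3) by (simp add: upper_const)

end

section \<open>From sublinear independence to conditional bounds\<close>

text \<open>Generated by a single map, so that every event of the past is the preimage of one Borel
  set of \<open>nat \<Rightarrow> real\<close>, to which regularity of measures applies.\<close>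

definition history :: "'a measure \<Rightarrow> (nat \<Rightarrow> 'a \<Rightarrow> real) \<Rightarrow> nat \<Rightarrow> 'a measure" where
  "history M Y n = vimage_algebra (space M) (\<lambda>\<omega>. pad n (\<lambda>i. Y (Suc i) \<omega>)) borel"

lemma space_history [simp]: "space (history M Y n) = space M"
  by (simp add: history_def)

lemma sets_history: "sets (history M Y n) = {(\<lambda>\<omega>. pad n (\<lambda>i. Y (Suc i) \<omega>)) -` B \<inter> space M | B. B \<in> sets borel}"
  unfolding history_def by (subst sets_vimage_algebra2) auto

lemma borel_measurable_pad [measurable]:
  assumes "\<And>i. i < n \<Longrightarrow> (\<lambda>\<omega>. x \<omega> i) \<in> borel_measurable N"
  shows "(\<lambda>\<omega>. pad n (x \<omega>)) \<in> borel_measurable N"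
proof (rule measurable_coordinatewise_then_product)
  fix i
  show "(\<lambda>\<omega>. pad n (x \<omega>) i) \<in> borel_measurable N"
    using assms[of i] by (cases "i < n") (simp_all add: pad_def)
qed

lemma history_coordinate:
  assumes "i < n"
  shows "Y (Suc i) \<in> borel_measurable (history M Y n)"
proof -
  have "(\<lambda>\<omega>. pad n (\<lambda>i. Y (Suc i) \<omega>)) \<in> measurable (history M Y n) borel"
    unfolding history_def by (rule measurable_vimage_algebra1) auto
  from measurable_compose[OF this measurable_product_coordinates[of i]]
  have "(\<lambda>\<omega>. pad n (\<lambda>i. Y (Suc i) \<omega>) i) \<in> borel_measurable (history M Y n)" .
  then show ?thesis using assms by (simp add: pad_def)
qed

lemma history_Suc: "sets (history M Y n) \<subseteq> sets (history M Y (Suc n))"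
proof
  fix A assume "A \<in> sets (history M Y n)"
  then obtain B where B: "A = (\<lambda>\<omega>. pad n (\<lambda>i. Y (Suc i) \<omega>)) -` B \<inter> space M" "B \<in> sets borel"
    by (auto simp: sets_history)
  have "(\<lambda>\<omega>. pad n (\<lambda>i. Y (Suc i) \<omega>)) \<in> borel_measurable (history M Y (Suc n))"
    by (intro borel_measurable_pad history_coordinate) simp
  from measurable_sets[OF this B(2)] show "A \<in> sets (history M Y (Suc n))" using B by simp
qed

context sublinear_expectation_space
begin

context
  fixes \<P> :: "'a measure set" and P :: "'a measure" and Y :: "nat \<Rightarrow> 'a \<Rightarrow> real"
  assumes rep: "represents_on_bounded M H E \<P>" and P: "P \<in> \<P>" and iid: "iid_sequence H E Y"
begin

lemma prob_space_P: "prob_space P" and space_P [simp]: "space P = space M"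
  and sets_P: "sets P = sets (generated_sigma M H)"
  using rep P by (auto simp: represents_on_bounded_def)

interpretation P: prob_space P by (rule prob_space_P)

lemma H_measurable_P:
  assumes "X \<in> H"
  shows "X \<in> borel_measurable P"
proof (rule measurableI)
  fix B :: "real set" assume "B \<in> sets borel"
  then have "X -` B \<inter> space M \<in> {X -` B \<inter> space M | X B. X \<in> H \<and> B \<in> sets borel}"
    using assms by auto
  then have "X -` B \<inter> space M \<in> sigma_sets (space M) {X -` B \<inter> space M | X B. X \<in> H \<and> B \<in> sets borel}"
    by (rule sigma_sets.Basic)
  then show "X -` B \<inter> space P \<in> sets P"
    unfolding sets_P generated_sigma_def by (subst sets_measure_of) auto
qed simp

lemma integral_le_E:
  assumes "X \<in> H" "\<And>\<omega>. \<omega> \<in> space M \<Longrightarrow> \<bar>X \<omega>\<bar> \<le> B"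
  shows "ereal (\<integral>\<omega>. X \<omega> \<partial>P) \<le> E X"
proof -
  have "E X = (SUP P\<in>\<P>. ereal (\<integral>\<omega>. X \<omega> \<partial>P))"
    using rep assms unfolding represents_on_bounded_def by blast
  then show ?thesis using P by (auto intro: SUP_upper)
qed

lemma Y_H: "Y (Suc i) \<in> H"
  using iid by (simp add: iid_sequence_def)

lemma Y_measurable [measurable]: "Y (Suc i) \<in> borel_measurable P"
  by (rule H_measurable_P[OF Y_H])

lemma E_Y_Suc:
  assumes "blip \<phi>"
  shows "E (\<lambda>\<omega>. \<phi> (Y (Suc n) \<omega>)) = ereal (upper (Y 1) \<phi>)"
proof -
  have "identically_distributed 1 E (\<lambda>_. Y (Suc n)) E (\<lambda>_. Y 1)"
    using iid by (simp add: iid_sequence_def)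
  then have "E (\<lambda>\<omega>. \<phi> (Y (Suc n) \<omega>)) = E (\<lambda>\<omega>. \<phi> (Y 1 \<omega>))"
    using blip_C_b_Lip[OF assms] unfolding identically_distributed_def by auto
  also have "\<dots> = ereal (upper (Y 1) \<phi>)"
    using Y_H[of 0] assms by (simp add: upper)
  finally show ?thesis .
qed

abbreviation (input) past :: "nat \<Rightarrow> 'a \<Rightarrow> nat \<Rightarrow> real" where
  "past n \<omega> \<equiv> pad n (\<lambda>i. Y (Suc i) \<omega>)"

lemma past_measurable [measurable]: "past n \<in> borel_measurable P"
  by (intro borel_measurable_pad Y_measurable)

text \<open>
  As the centred variable has upper expectation \<open>0\<close>, so does its product with any nonnegative
  function of the past; this is where sublinear independence becomes a statement about \<open>P\<close>.
\<close>

lemma integral_centered_le_0: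
  assumes \<phi>: "blip \<phi>" and g: "\<And>x. 0 \<le> g x" "\<And>x. g x \<le> B" "\<And>x y. \<bar>g x - g y\<bar> \<le> K * dist x y" "0 \<le> K"
  shows "(\<integral>\<omega>. g (past n \<omega>) * (\<phi> (Y (Suc n) \<omega>) - upper (Y 1) \<phi>) \<partial>P) \<le> 0"
proof -
  define u where "u = upper (Y 1) \<phi>"
  define \<psi> where "\<psi> x = \<phi> x - u" for x
  have \<psi>: "blip \<psi>" unfolding \<psi>_def using \<phi> by (intro blip_diff) auto
  have E\<psi>: "E (\<lambda>\<omega>. \<psi> (Y (Suc n) \<omega>)) = 0"
  proof -
    have "E (\<lambda>\<omega>. \<phi> (Y (Suc n) \<omega>) + - u) = E (\<lambda>\<omega>. \<phi> (Y (Suc n) \<omega>)) + ereal (- u)"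
      by (rule E_add_const[OF H_blip[OF Y_H \<phi>]]) (simp add: E_Y_Suc[OF \<phi>])
    then show ?thesis by (simp add: \<psi>_def E_Y_Suc[OF \<phi>] u_def)
  qed
  \<comment> \<open>Homogeneity is available for nonnegative factors only, hence the sign condition
    on the weight \<open>g\<close>.\<close>
  have E0: "E (\<lambda>\<omega>. c * \<psi> (Y (Suc n) \<omega>)) = 0" if "0 \<le> c" for c
    using E_scale[OF H_blip[OF Y_H \<psi>] that, of n] E\<psi> by simp
  define f where "f z = g (pad n z) * \<psi> (z n)" for z
  have f: "f \<in> C_b_Lip (n + 1)"
    unfolding f_def using g \<psi> by (intro C_b_Lip_pad_times[of g B K]) auto
  have fY: "f (\<lambda>i. Y (Suc i) \<omega>) = g (past n \<omega>) * \<psi> (Y (Suc n) \<omega>)" for \<omega>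
    by (simp add: f_def)
  have f_append: "f (vec_append n (\<lambda>i. Y (Suc i) \<omega>) (\<lambda>_. y)) = g (past n \<omega>) * \<psi> y" for \<omega> y
  proof -
    have "pad n (vec_append n (\<lambda>i. Y (Suc i) \<omega>) (\<lambda>_. y)) = past n \<omega>"
      by (auto simp: pad_def vec_append_def)
    then show ?thesis by (simp add: f_def vec_append_def)
  qed
  \<comment> \<open>The inner expectation in the definition of independence is \<open>E0\<close>
    with \<open>c\<close> the value of \<open>g\<close> at the past, so it is \<open>0\<close> at
    every point. Independence is stated for a nonempty past; for \<open>n = 0\<close> the weight is
    constant and \<open>E0\<close> applies directly.\<close>
  have le0: "E (\<lambda>\<omega>. g (past n \<omega>) * \<psi> (Y (Suc n) \<omega>)) = 0"
  proof (cases "n = 0")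
    case True
    then have "past n \<omega> = (\<lambda>_. 0)" for \<omega> by (auto simp: pad_def)
    then show ?thesis using E0[of "g (\<lambda>_. 0)"] g by simp
  next
    case False
    then have "independent_to E 1 (\<lambda>_. Y (Suc n)) n (\<lambda>k. Y (Suc k))"
      using iid by (simp add: iid_sequence_def)
    then have "E (\<lambda>\<omega>. f (vec_append n (\<lambda>i. Y (Suc i) \<omega>) (\<lambda>_. Y (Suc n) \<omega>)))
      = E (\<lambda>\<omega>. real_of_ereal (E (\<lambda>\<omega>'. f (vec_append n (\<lambda>i. Y (Suc i) \<omega>) (\<lambda>_. Y (Suc n) \<omega>')))))"
      using f unfolding independent_to_def by blast
    then show ?thesis
      by (simp add: f_append E0 g E_const)
  qed
  have fH: "(\<lambda>\<omega>. g (past n \<omega>) * \<psi> (Y (Suc n) \<omega>)) \<in> H"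
    using H_C_b_Lip[of "n + 1" "\<lambda>i. Y (Suc i)", OF Y_H f] unfolding fY .
  obtain B' where B': "\<And>x. \<bar>f x\<bar> \<le> B'" using f by (auto simp: C_b_Lip_def)
  then have "\<bar>g (past n \<omega>) * \<psi> (Y (Suc n) \<omega>)\<bar> \<le> B'" for \<omega> by (simp flip: fY)
  from integral_le_E[OF fH this] show ?thesis
    unfolding le0 by (simp add: \<psi>_def u_def)
qed

lemma filtered_P: "filtered_prob_space P (history M Y)"
proof
  fix n
  have "sets (history M Y n) \<subseteq> sets P"
  proof
    fix A assume "A \<in> sets (history M Y n)"
    then obtain B where "A = past n -` B \<inter> space M" "B \<in> sets borel" by (auto simp: sets_history)
    then show "A \<in> sets P" using measurable_sets[OF past_measurable] by fastforce
  qed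
  then show "subalgebra P (history M Y n)" by (simp add: subalgebra_def)
  show "sets (history M Y n) \<subseteq> sets (history M Y (Suc n))" by (rule history_Suc)
qed

text \<open>The Lipschitz weights \<open>1 - m * infdist\<close>, cut off at \<open>0\<close>,
  decrease to the indicator of the closed set, and dominated convergence carries the inequality
  over.\<close>

lemma integral_closed_le_0:
  fixes C :: "(nat \<Rightarrow> real) set"
  assumes \<phi>: "blip \<phi>" and C: "closed C"
  shows "(\<integral>\<omega>. indicator C (past n \<omega>) * (\<phi> (Y (Suc n) \<omega>) - upper (Y 1) \<phi>) \<partial>P) \<le> 0"
\<comment> \<open>The distance to the empty set is \<open>0\<close> by convention, so the
  approximating weights would be constantly \<open>1\<close> there.\<close>
proof (cases "C = {}")
  case False
  define g where "g m x = max 0 (1 - real m * infdist x C)" for m x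
  obtain B where B: "\<And>x. \<bar>\<phi> x - upper (Y 1) \<phi>\<bar> \<le> B"
    using blip_diff[OF \<phi> blip_const[of "upper (Y 1) \<phi>"]] unfolding blip_def by blast
  note [measurable] = blip_measurable[OF \<phi>]
  have C_meas [measurable]: "C \<in> sets borel" using C by simp
  have [measurable]: "(\<lambda>x. g m x) \<in> borel_measurable borel" for m
    unfolding g_def by (intro borel_measurable_continuous_onI continuous_intros)
  have g01: "0 \<le> g m x" "g m x \<le> 1" for m x
    by (auto simp: g_def infdist_nonneg)
  have le: "(\<integral>\<omega>. g m (past n \<omega>) * (\<phi> (Y (Suc n) \<omega>) - upper (Y 1) \<phi>) \<partial>P) \<le> 0" for m
  proof (rule integral_centered_le_0[OF \<phi>, of _ 1 "real m"])
    fix x y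
    have "\<bar>g m x - g m y\<bar> \<le> \<bar>real m * infdist x C - real m * infdist y C\<bar>" unfolding g_def by linarith
    also have "\<dots> = real m * \<bar>infdist x C - infdist y C\<bar>" by (simp add: abs_mult flip: right_diff_distrib)
    also have "\<dots> \<le> real m * dist x y" by (intro mult_left_mono infdist_triangle_abs) auto
    finally show "\<bar>g m x - g m y\<bar> \<le> real m * dist x y" .
  qed (use g01 in auto)
  have lim: "(\<lambda>m. g m x) \<longlonglongrightarrow> indicator C x" for x
  proof (cases "x \<in> C")
    case True
    then show ?thesis by (simp add: g_def)
  next
    case nx: False
    then have pos: "0 < infdist x C" using in_closed_iff_infdist_zero[OF C False] infdist_nonneg[of x C] by (auto simp: less_le)
    obtain m0 where m0: "1 / infdist x C < real m0" using reals_Archimedean2 by blast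
    have "\<forall>\<^sub>F m in sequentially. g m x = 0"
      using eventually_ge_at_top[of m0]
    proof eventually_elim
      case (elim m)
      have "1 \<le> real m0 * infdist x C" using m0 pos by (simp add: field_simps)
      also have "\<dots> \<le> real m * infdist x C" using elim pos by (intro mult_right_mono) auto
      finally show ?case by (simp add: g_def)
    qed
    then show ?thesis using nx by (simp add: tendsto_eventually)
  qed
  have "(\<lambda>m. \<integral>\<omega>. g m (past n \<omega>) * (\<phi> (Y (Suc n) \<omega>) - upper (Y 1) \<phi>) \<partial>P)
    \<longlonglongrightarrow> (\<integral>\<omega>. indicator C (past n \<omega>) * (\<phi> (Y (Suc n) \<omega>) - upper (Y 1) \<phi>) \<partial>P)"
  proof (rule integral_dominated_convergence[where w = "\<lambda>_. B"])
    show "AE \<omega> in P. (\<lambda>m. g m (past n \<omega>) * (\<phi> (Y (Suc n) \<omega>) - upper (Y 1) \<phi>))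
        \<longlonglongrightarrow> indicator C (past n \<omega>) * (\<phi> (Y (Suc n) \<omega>) - upper (Y 1) \<phi>)"
      by (intro AE_I2 tendsto_intros lim)
    show "AE \<omega> in P. norm (g m (past n \<omega>) * (\<phi> (Y (Suc n) \<omega>) - upper (Y 1) \<phi>)) \<le> B" for m
    proof (intro AE_I2)
      fix \<omega>
      have "norm (g m (past n \<omega>) * (\<phi> (Y (Suc n) \<omega>) - upper (Y 1) \<phi>)) \<le> 1 * B"
        unfolding norm_mult using g01 B by (intro mult_mono) auto
      then show "norm (g m (past n \<omega>) * (\<phi> (Y (Suc n) \<omega>) - upper (Y 1) \<phi>)) \<le> B" by simp
    qed
  qed (auto intro: past_measurable)
  then show ?thesis by (rule LIMSEQ_le_const2) (use le in auto)
qed simp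

text \<open>
  An inequality does not pass through a Dynkin system, so Borel sets are reached from closed sets by
  inner regularity; this is why the past is embedded in the Polish space \<open>nat \<Rightarrow> real\<close>.
\<close>

lemma integral_borel_le_0:
  fixes S :: "(nat \<Rightarrow> real) set"
  assumes \<phi>: "blip \<phi>" and S: "S \<in> sets borel"
  shows "(\<integral>\<omega>. indicator S (past n \<omega>) * (\<phi> (Y (Suc n) \<omega>) - upper (Y 1) \<phi>) \<partial>P) \<le> 0"
proof (rule field_le_epsilon)
  fix \<epsilon> :: real assume \<epsilon>: "0 < \<epsilon>"
  define \<psi> where "\<psi> \<omega> = \<phi> (Y (Suc n) \<omega>) - upper (Y 1) \<phi>" for \<omega>
  obtain B where B: "\<And>\<omega>. \<bar>\<psi> \<omega>\<bar> \<le> B"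
    using blip_diff[OF \<phi> blip_const[of "upper (Y 1) \<phi>"]] unfolding blip_def \<psi>_def by blast
  have B0: "0 \<le> B" using B[of undefined] by linarith
  note [measurable] = blip_measurable[OF \<phi>] S
  have \<psi>_meas [measurable]: "\<psi> \<in> borel_measurable P" unfolding \<psi>_def by measurable
  define \<nu> where "\<nu> = distr P borel (past n)"
  interpret \<nu>: prob_space \<nu> unfolding \<nu>_def by (intro P.prob_space_distr past_measurable)
  have "emeasure \<nu> S = (SUP K\<in>{K. K \<subseteq> S \<and> compact K}. emeasure \<nu> K)"
    by (intro inner_regular) (auto simp: \<nu>_def S \<nu>.emeasure_eq_measure[unfolded \<nu>_def])
  moreover have "\<exists>K. K \<subseteq> S \<and> compact K \<and> measure \<nu> S - \<epsilon> / (B + 1) < measure \<nu> K"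
  proof (cases "measure \<nu> S - \<epsilon> / (B + 1) < 0")
    case True
    then show ?thesis by (intro exI[of _ "{}"]) auto
  next
    case False
    have "0 < \<epsilon> / (B + 1)" using \<epsilon> B0 by simp
    then have "ennreal (measure \<nu> S - \<epsilon> / (B + 1)) < emeasure \<nu> S"
      using False by (simp add: \<nu>.emeasure_eq_measure ennreal_less_iff)
    then obtain K where "K \<subseteq> S" "compact K" "ennreal (measure \<nu> S - \<epsilon> / (B + 1)) < emeasure \<nu> K"
      unfolding calculation by (auto simp: less_SUP_iff)
    then show ?thesis using False by (auto simp: \<nu>.emeasure_eq_measure ennreal_less_iff)
  qed
  ultimately obtain K where K: "K \<subseteq> S" "compact K" "measure \<nu> S - \<epsilon> / (B + 1) < measure \<nu> K" by blast
  have K_closed: "closed K" using K by (simp add: compact_imp_closed)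
  then have [measurable]: "K \<in> sets borel" by simp
  have "S - K \<in> sets borel" using S by simp
  have diff: "P.prob (past n -` (S - K) \<inter> space P) < \<epsilon> / (B + 1)"
  proof -
    have "P.prob (past n -` (S - K) \<inter> space P) = measure \<nu> (S - K)"
      unfolding \<nu>_def using S by (subst measure_distr) auto
    also have "\<dots> = measure \<nu> S - measure \<nu> K"
      using K S by (intro \<nu>.finite_measure_Diff) (auto simp: \<nu>_def)
    finally show ?thesis using K by simp
  qed
  have i: "integrable P (\<lambda>\<omega>. indicator T (past n \<omega>) * \<psi> \<omega>)" if [measurable]: "T \<in> sets borel" for T :: "(nat \<Rightarrow> real) set"
  proof (rule P.integrable_const_bound[of _ B])
    show "AE \<omega> in P. norm (indicator T (past n \<omega>) * \<psi> \<omega>) \<le> B"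
      using B B0 by (intro AE_I2) (auto simp: indicator_def)
  qed measurable
  have iD: "integrable P (\<lambda>\<omega>. B * indicator (past n -` (S - K) \<inter> space P) \<omega>)"
  proof -
    have "past n -` (S - K) \<inter> space P \<in> sets P" by (rule measurable_sets[OF past_measurable]) simp
    then show ?thesis by (simp add: P.emeasure_eq_measure)
  qed
  have "(\<integral>\<omega>. indicator S (past n \<omega>) * \<psi> \<omega> \<partial>P)
      \<le> (\<integral>\<omega>. indicator K (past n \<omega>) * \<psi> \<omega> + B * indicator (past n -` (S - K) \<inter> space P) \<omega> \<partial>P)"
  proof (rule integral_mono)
    fix \<omega> assume "\<omega> \<in> space P"
    then show "indicator S (past n \<omega>) * \<psi> \<omega> \<le> indicator K (past n \<omega>) * \<psi> \<omega> + B * indicator (past n -` (S - K) \<inter> space P) \<omega>"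
      using K(1) abs_le_D1[OF B[of \<omega>]] by (auto simp: indicator_def)
  qed (use i iD S in auto)
  also have "\<dots> = (\<integral>\<omega>. indicator K (past n \<omega>) * \<psi> \<omega> \<partial>P) + B * P.prob (past n -` (S - K) \<inter> space P)"
    using i[of K] iD by (subst Bochner_Integration.integral_add) auto
  also have "(\<integral>\<omega>. indicator K (past n \<omega>) * \<psi> \<omega> \<partial>P) \<le> 0"
    unfolding \<psi>_def using \<phi> K_closed by (rule integral_closed_le_0)
  also have "B * P.prob (past n -` (S - K) \<inter> space P) \<le> B * (\<epsilon> / (B + 1))"
    using diff B0 by (intro mult_left_mono) auto
  also have "\<dots> \<le> \<epsilon>" using B0 \<epsilon> by (simp add: field_simps)
  finally show "(\<integral>\<omega>. indicator S (past n \<omega>) * (\<phi> (Y (Suc n) \<omega>) - upper (Y 1) \<phi>) \<partial>P) \<le> 0 + \<epsilon>"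
    by (simp add: \<psi>_def)
qed

text \<open>Applied to \<open>\<phi>\<close> and to \<open>- \<phi>\<close>, this confines the
  conditional mean of \<open>\<phi> (Y (Suc n))\<close> under \<open>P\<close> to the interval from
  \<open>- upper (- \<phi>)\<close> to \<open>upper \<phi>\<close>. Nothing else about the joint law
  is used in the martingale arguments.\<close>

lemma conditional_upper:
  assumes \<phi>: "blip \<phi>" and A: "A \<in> sets (history M Y n)"
  shows "(\<integral>\<omega>. indicator A \<omega> * \<phi> (Y (Suc n) \<omega>) \<partial>P) \<le> upper (Y 1) \<phi> * measure P A"
proof -
  interpret filtered_prob_space P "history M Y" by (rule filtered_P)
  obtain S where S: "A = past n -` S \<inter> space M" "S \<in> sets borel"
    using A by (auto simp: sets_history)
  have A': "A \<in> sets P" using A by (rule sets_F_M)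
  note [measurable] = blip_measurable[OF \<phi>]
  have \<phi>_b: "(\<lambda>\<omega>. \<phi> (Y (Suc n) \<omega>)) \<in> bmeas P"
  proof -
    obtain B where "\<And>x. \<bar>\<phi> x\<bar> \<le> B" using \<phi> by (auto simp: blip_def)
    then show ?thesis by (intro bmeasI) measurable
  qed
  have i: "integrable P (\<lambda>\<omega>. indicator A \<omega> * \<phi> (Y (Suc n) \<omega>))" "integrable P (\<lambda>\<omega>. indicator A \<omega> * upper (Y 1) \<phi> :: real)"
    using A' \<phi>_b by (auto intro!: bmeas_integrable)
  have "(\<integral>\<omega>. indicator A \<omega> * \<phi> (Y (Suc n) \<omega>) \<partial>P) - upper (Y 1) \<phi> * measure P A
    = (\<integral>\<omega>. indicator A \<omega> * \<phi> (Y (Suc n) \<omega>) - indicator A \<omega> * upper (Y 1) \<phi> \<partial>P)"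
  proof -
    have "(\<integral>\<omega>. indicator A \<omega> * upper (Y 1) \<phi> \<partial>P) = upper (Y 1) \<phi> * measure P A"
      using sets.sets_into_space[OF A'] A' by (simp add: mult.commute Int_absorb2)
    then show ?thesis using i by (subst Bochner_Integration.integral_diff) auto
  qed
  also have "\<dots> = (\<integral>\<omega>. indicator S (past n \<omega>) * (\<phi> (Y (Suc n) \<omega>) - upper (Y 1) \<phi>) \<partial>P)"
    by (intro Bochner_Integration.integral_cong) (auto simp: S indicator_def)
  also have "\<dots> \<le> 0" using \<phi> S(2) by (rule integral_borel_le_0)
  finally show ?thesis by simp
qed

end

end

section \<open>Moments and the Choquet integral\<close>

lemma tendsto_SUP_at_top:
  fixes f :: "real \<Rightarrow> ereal"
  assumes "mono f"
  shows "(f \<longlongrightarrow> (SUP c. f c)) at_top"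
proof (rule increasing_tendsto)
  show "\<forall>\<^sub>F c in at_top. f c \<le> (SUP c. f c)" by (intro always_eventually allI SUP_upper UNIV_I)
  fix x assume "x < (SUP c. f c)"
  then obtain c0 where "x < f c0" by (auto simp: less_SUP_iff)
  show "\<forall>\<^sub>F c in at_top. x < f c"
    using eventually_ge_at_top[of c0]
  proof eventually_elim
    case (elim c)
    then have "f c0 \<le> f c" by (rule monoD[OF assms])
    with \<open>x < f c0\<close> show ?case by (rule less_le_trans)
  qed
qed

lemma Lim_at_top_eq_SUP:
  fixes f :: "real \<Rightarrow> ereal"
  assumes "mono f"
  shows "Lim at_top f = (SUP c. f c)"
  using tendsto_SUP_at_top[OF assms] by (intro tendsto_Lim) auto

lemma min_sq_eq_clip: "0 \<le> c \<Longrightarrow> min (x\<^sup>2) c = (clip (sqrt c) x)\<^sup>2"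
  by (simp add: clip_sq)

lemma min_sq_neg: "c < 0 \<Longrightarrow> min ((x::real)\<^sup>2) c = c"
  using zero_le_power2[of x] by linarith

text \<open>The value at \<open>2\<^sup>i\<close> of the function \<open>x\<^sup>2 / LL x\<close> in the Choquet condition.\<close>

definition level :: "nat \<Rightarrow> real" where
  "level i = 4 ^ i / LL (2 ^ i)"

lemma level_pos: "0 < level i"
  using LL_pos[of "2 ^ i"] by (simp add: level_def)

text \<open>\<open>4 ^ i\<close> grows by the factor \<open>4\<close> and \<open>LL (2 ^ i)\<close>
  at most by \<open>2\<close>. The growth by \<open>2\<close> makes the intervals from
  \<open>level i / 2\<close> to \<open>level i\<close> disjoint, as the estimate of the Choquet
  integral needs.\<close>

lemma level_Suc: "2 * level i \<le> level (Suc i)"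
proof -
  have "LL (2 ^ Suc i) \<le> 2 ^ Suc i / 2 ^ i * LL (2 ^ i)"
    by (rule LL_ratio) auto
  then have "LL (2 ^ Suc i) \<le> 2 * LL (2 ^ i)" by simp
  then show ?thesis using LL_pos[of "2 ^ i"] LL_pos[of "2 ^ Suc i"] by (simp add: level_def field_simps)
qed

lemma level_le: "i < j \<Longrightarrow> 2 * level i \<le> level j"
proof (induction j)
  case (Suc j)
  then show ?case using level_Suc[of j] level_Suc[of i] level_pos[of j] by (cases "i = j") auto
qed simp

text \<open>Of the two factors \<open>\<bar>x\<bar> / 2 ^ i\<close> contained in
  \<open>x\<^sup>2 / 4 ^ i\<close>, one pays for the growth of \<open>LL\<close> and the other is at
  least \<open>1\<close>.\<close>

lemma level_le_of_abs_ge: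
  assumes "2 ^ i \<le> \<bar>x\<bar>"
  shows "level i \<le> x\<^sup>2 / LL \<bar>x\<bar>"
proof -
  have pos: "(0::real) < 2 ^ i" by simp
  have "LL \<bar>x\<bar> \<le> \<bar>x\<bar> / 2 ^ i * LL (2 ^ i)" by (rule LL_ratio[OF pos assms])
  then have "LL \<bar>x\<bar> * (2 ^ i * 2 ^ i) \<le> \<bar>x\<bar> / 2 ^ i * LL (2 ^ i) * (2 ^ i * 2 ^ i)"
    by (rule mult_right_mono) simp
  also have "\<dots> = \<bar>x\<bar> * 2 ^ i * LL (2 ^ i)" by simp
  also have "\<dots> \<le> \<bar>x\<bar> * \<bar>x\<bar> * LL (2 ^ i)"
    using assms LL_pos[of "2 ^ i"] by (intro mult_right_mono mult_left_mono) auto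
  finally have "LL \<bar>x\<bar> * 4 ^ i \<le> x\<^sup>2 * LL (2 ^ i)"
    by (simp add: power2_eq_square flip: power_mult_distrib)
  then show ?thesis using LL_pos[of "2 ^ i"] LL_pos[of "\<bar>x\<bar>"] by (simp add: level_def field_simps)
qed

context sublinear_expectation_space
begin

lemma H_min_sq:
  assumes "X \<in> H"
  shows "(\<lambda>\<omega>. min ((X \<omega>)\<^sup>2) c) \<in> H"
proof (cases "0 \<le> c")
  case True
  then show ?thesis
    using H_blip[OF assms blip_clip_sq[of "sqrt c"]] by (simp add: min_sq_eq_clip)
next
  case False
  then show ?thesis using H_const[of c] by (simp add: min_sq_neg)
qed

lemma upper_variance_bound:
  assumes X: "X \<in> H" and fin: "upper_variance E X < \<infinity>"
  obtains C where "0 < C" "\<And>c. 0 \<le> c \<Longrightarrow> upper X (\<lambda>x. (clip c x)\<^sup>2) \<le> C"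
proof -
  let ?f = "\<lambda>c. E (\<lambda>\<omega>. min ((X \<omega>)\<^sup>2) c)"
  have "mono ?f"
    by (intro monoI E_mono H_min_sq X) (auto simp: min_def)
  then have "upper_variance E X = (SUP c. ?f c)"
    unfolding upper_variance_def by (rule Lim_at_top_eq_SUP)
  then have le: "?f c \<le> upper_variance E X" for c by (auto intro: SUP_upper)
  have eq: "?f (c\<^sup>2) = ereal (upper X (\<lambda>x. (clip c x)\<^sup>2))" if "0 \<le> c" for c
    using upper[OF X blip_clip_sq[OF that]] that by (simp add: min_sq_eq_clip)
  define C where "C = max 1 (real_of_ereal (upper_variance E X))"
  have "upper X (\<lambda>x. (clip c x)\<^sup>2) \<le> C" if "0 \<le> c" for c
  proof -
    have "ereal (upper X (\<lambda>x. (clip c x)\<^sup>2)) \<le> upper_variance E X"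
      using le[of "c\<^sup>2"] eq[OF that] by simp
    then show ?thesis using fin by (cases "upper_variance E X") (auto simp: C_def)
  qed
  then show ?thesis by (intro that[of C]) (auto simp: C_def)
qed

lemma lower_variance_bound:
  assumes X: "X \<in> H" and pos: "0 < lower_variance E X"
  shows "\<exists>c0>0. \<exists>c1. \<forall>c\<ge>c1. c0 \<le> - upper X (\<lambda>x. - (clip c x)\<^sup>2)"
proof -
  let ?f = "\<lambda>c. conjugate_expectation E (\<lambda>\<omega>. min ((X \<omega>)\<^sup>2) c)"
  have mH: "(\<lambda>\<omega>. - min ((X \<omega>)\<^sup>2) c) \<in> H" for c
    using H_scale[OF H_min_sq[OF X, of c], of "-1"] by simp
  have "mono ?f"
  proof (rule monoI)
    fix x y :: real assume "x \<le> y"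
    then have "E (\<lambda>\<omega>. - min ((X \<omega>)\<^sup>2) y) \<le> E (\<lambda>\<omega>. - min ((X \<omega>)\<^sup>2) x)"
      by (intro E_mono mH) (auto simp: min_def)
    then show "?f x \<le> ?f y" by (simp add: conjugate_expectation_def ereal_minus_le_minus)
  qed
  then have "lower_variance E X = (SUP c. ?f c)"
    unfolding lower_variance_def by (rule Lim_at_top_eq_SUP)
  then obtain k where k: "0 < ?f k" using pos by (auto simp: less_SUP_iff)
  have "0 < k"
  proof (rule ccontr)
    assume "\<not> 0 < k"
    then have "min ((X \<omega>)\<^sup>2) k = k" for \<omega> using zero_le_power2[of "X \<omega>"] by linarith
    then have "?f k = ereal k" by (simp add: conjugate_expectation_def E_const)
    then show False using k \<open>\<not> 0 < k\<close> by simp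
  qed
  have eq: "?f (c\<^sup>2) = ereal (- upper X (\<lambda>x. - (clip c x)\<^sup>2))" if "0 \<le> c" for c
    using upper[OF X blip_uminus[OF blip_clip_sq[OF that]]] that
    by (simp add: min_sq_eq_clip conjugate_expectation_def)
  show ?thesis
  proof (rule exI[of _ "- upper X (\<lambda>x. - (clip (sqrt k) x)\<^sup>2)"], intro conjI exI[of _ "sqrt k"] allI impI)
    show "0 < - upper X (\<lambda>x. - (clip (sqrt k) x)\<^sup>2)"
      using k eq[of "sqrt k"] \<open>0 < k\<close> by simp
    fix c assume c: "sqrt k \<le> c"
    then have "0 \<le> c" using \<open>0 < k\<close> by (meson less_imp_le order_trans real_sqrt_ge_zero)
    then have "k \<le> c\<^sup>2" using c by (metis real_sqrt_le_iff real_sqrt_unique)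
    then have "?f k \<le> ?f (c\<^sup>2)" using \<open>mono ?f\<close> by (rule monoD[rotated])
    then show "- upper X (\<lambda>x. - (clip (sqrt k) x)\<^sup>2) \<le> - upper X (\<lambda>x. - (clip c x)\<^sup>2)"
      using eq[of "sqrt k"] eq[OF \<open>0 \<le> c\<close>] \<open>0 < k\<close> by simp
  qed
qed

text \<open>For \<open>c \<le> c'\<close> the two truncations differ by at most
  \<open>(clip c' x)\<^sup>2 / c\<close>. So the mean at level \<open>c\<close> exceeds the one at
  level \<open>c'\<close> by at most \<open>C / c\<close>, and \<open>c'\<close> is sent to
  infinity. This turns the vanishing limit of the means into a rate; \<open>s\<close> is a sign
  covering both tails.\<close>

lemma upper_clip_bound:
  assumes X: "X \<in> H" and lim: "((\<lambda>c. upper X (\<lambda>x. s * clip c x)) \<longlongrightarrow> 0) at_top" and s: "\<bar>s\<bar> = 1"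
    and C: "\<And>c. 0 \<le> c \<Longrightarrow> upper X (\<lambda>x. (clip c x)\<^sup>2) \<le> C" and c: "0 < c"
  shows "upper X (\<lambda>x. s * clip c x) \<le> C / c"
proof -
  have "upper X (\<lambda>x. s * clip c x) - C / c \<le> upper X (\<lambda>x. s * clip c' x)" if c': "c \<le> c'" for c'
  proof -
    have b: "blip (\<lambda>x. s * clip c' x)" "blip (\<lambda>x. 1 / c * (clip c' x)\<^sup>2)" "blip (\<lambda>x. s * clip c x)"
      using c c' by (intro blip_cmult blip_clip blip_clip_sq; simp)+
    have "s * clip c x \<le> s * clip c' x + 1 / c * (clip c' x)\<^sup>2" for x
    proof -
      have "\<bar>clip c x - clip c' x\<bar> \<le> 1 / c * (clip c' x)\<^sup>2"
      proof (cases "\<bar>x\<bar> \<le> c")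
        case True
        then have "clip c x = clip c' x" using c' by (auto simp: clip_def)
        then show ?thesis using c by simp
      next
        case False
        then have z: "c \<le> \<bar>clip c' x\<bar>" using c c' by (simp add: abs_clip)
        have "\<bar>clip c x - clip c' x\<bar> \<le> \<bar>clip c' x\<bar>"
          using c c' False by (auto simp: clip_def min_def max_def)
        also have "\<dots> \<le> \<bar>clip c' x\<bar> * (\<bar>clip c' x\<bar> / c)"
          using z c mult_left_mono[of 1 "\<bar>clip c' x\<bar> / c" "\<bar>clip c' x\<bar>"] by (simp add: field_simps)
        also have "\<dots> = 1 / c * (clip c' x)\<^sup>2" by (simp add: power2_eq_square)
        finally show ?thesis .
      qed
      moreover have "\<bar>s * (clip c x - clip c' x)\<bar> = \<bar>clip c x - clip c' x\<bar>"
        using s by (simp add: abs_mult)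
      then have "s * (clip c x - clip c' x) \<le> \<bar>clip c x - clip c' x\<bar>" by linarith
      ultimately show ?thesis unfolding right_diff_distrib by linarith
    qed
    then have "upper X (\<lambda>x. s * clip c x) \<le> upper X (\<lambda>x. s * clip c' x + 1 / c * (clip c' x)\<^sup>2)"
      using b by (intro upper_mono X blip_add) auto
    also have "\<dots> \<le> upper X (\<lambda>x. s * clip c' x) + upper X (\<lambda>x. 1 / c * (clip c' x)\<^sup>2)"
      using b by (intro upper_add X)
    also have "upper X (\<lambda>x. 1 / c * (clip c' x)\<^sup>2) = 1 / c * upper X (\<lambda>x. (clip c' x)\<^sup>2)"
      using c c' by (intro upper_cmult X blip_clip_sq) auto
    also have "\<dots> \<le> 1 / c * C" using C[of c'] c c' by (intro mult_left_mono) auto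
    finally show ?thesis by simp
  qed
  then have "upper X (\<lambda>x. s * clip c x) - C / c \<le> 0"
    by (intro tendsto_lowerbound[OF lim] eventually_mono[OF eventually_ge_at_top[of c]]) auto
  then show ?thesis by simp
qed

lemma upper_clip_le:
  assumes X: "X \<in> H" and up: "has_breve_expectation E X 0" and lo: "has_breve_expectation E (\<lambda>\<omega>. - X \<omega>) 0"
    and C: "\<And>c. 0 \<le> c \<Longrightarrow> upper X (\<lambda>x. (clip c x)\<^sup>2) \<le> C" and c: "0 < c"
  shows "upper X (clip c) \<le> C / c" "upper X (\<lambda>x. - clip c x) \<le> C / c"
proof -
  have "((\<lambda>c. ereal (upper X (\<lambda>x. 1 * clip c x))) \<longlongrightarrow> 0) at_top"
  proof (rule Lim_transform_eventually)
    show "((\<lambda>c. E (truncate_rv c X)) \<longlongrightarrow> 0) at_top"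
      using up by (simp add: has_breve_expectation_def)
    show "\<forall>\<^sub>F c in at_top. E (truncate_rv c X) = ereal (upper X (\<lambda>x. 1 * clip c x))"
      using eventually_ge_at_top[of 0]
    proof eventually_elim
      case (elim c)
      have "truncate_rv c X = (\<lambda>\<omega>. clip c (X \<omega>))"
        by (simp add: truncate_rv_def clip_def)
      then show ?case using upper[OF X blip_clip[OF elim]] by simp
    qed
  qed
  then have 1: "((\<lambda>c. upper X (\<lambda>x. 1 * clip c x)) \<longlongrightarrow> 0) at_top"
    by (simp only: zero_ereal_def lim_ereal)
  have "((\<lambda>c. ereal (upper X (\<lambda>x. - 1 * clip c x))) \<longlongrightarrow> 0) at_top"
  proof (rule Lim_transform_eventually)
    show "((\<lambda>c. E (truncate_rv c (\<lambda>\<omega>. - X \<omega>))) \<longlongrightarrow> 0) at_top"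
      using lo by (simp add: has_breve_expectation_def)
    show "\<forall>\<^sub>F c in at_top. E (truncate_rv c (\<lambda>\<omega>. - X \<omega>)) = ereal (upper X (\<lambda>x. - 1 * clip c x))"
      using eventually_ge_at_top[of 0]
    proof eventually_elim
      case (elim c)
      have "truncate_rv c (\<lambda>\<omega>. - X \<omega>) = (\<lambda>\<omega>. - clip c (X \<omega>))"
        using elim by (simp add: truncate_rv_def clip_def[symmetric] clip_minus)
      then show ?case using upper[OF X blip_uminus[OF blip_clip[OF elim]]] by simp
    qed
  qed
  then have 2: "((\<lambda>c. upper X (\<lambda>x. - 1 * clip c x)) \<longlongrightarrow> 0) at_top"
    by (simp only: zero_ereal_def lim_ereal)
  show "upper X (clip c) \<le> C / c" "upper X (\<lambda>x. - clip c x) \<le> C / c"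
    using upper_clip_bound[OF X 1 _ C c] upper_clip_bound[OF X 2 _ C c] by simp_all
qed

text \<open>For \<open>t\<close> between \<open>level i / 2\<close> and \<open>level i\<close> the
  event \<open>t \<le> Z\<close> contains the support of \<open>ramp i (X \<omega>)\<close>, so its
  capacity is at least \<open>upper X (ramp i)\<close>. These intervals are disjoint and have length
  \<open>level i / 2\<close>; the integral thus bounds half of the sum.\<close>

lemma choquet_level_sum:
  assumes X: "X \<in> H" and cap: "associated_capacity M H E V"
    and fin: "choquet_integral M V (\<lambda>\<omega>. (X \<omega>)\<^sup>2 / LL \<bar>X \<omega>\<bar>) < \<infinity>"
  obtains S where "\<And>n. (\<Sum>i<n. upper X (ramp i) * level i) \<le> S"
proof -
  define Z where "Z \<omega> = (X \<omega>)\<^sup>2 / LL \<bar>X \<omega>\<bar>" for \<omega>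
  have X_meas [measurable]: "X \<in> borel_measurable M" using X H_measurable by auto
  have Z_meas [measurable]: "Z \<in> borel_measurable M" unfolding Z_def log_e_def by measurable
  define a where "a i = upper X (ramp i)" for i
  have a_nonneg: "0 \<le> a i" for i
    unfolding a_def using X blip_ramp ramp_nonneg by (intro upper_nonneg)
  define f where "f t = ennreal (V {\<omega> \<in> space M. t \<le> Z \<omega>})" for t
  have a_le: "ennreal (a i) \<le> f t" if "t \<le> level i" for i t
  proof -
    let ?A = "{\<omega> \<in> space M. t \<le> Z \<omega>}"
    have A: "?A \<in> sets M" by measurable
    have "ramp i (X \<omega>) \<le> indicator ?A \<omega>" if "\<omega> \<in> space M" for \<omega>
    proof (cases "2 ^ i \<le> \<bar>X \<omega>\<bar>")
      case True
      then have "level i \<le> Z \<omega>" unfolding Z_def by (rule level_le_of_abs_ge)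
      then show ?thesis using that \<open>t \<le> level i\<close> ramp_le_1[of i "X \<omega>"] by (simp add: indicator_def)
    next
      case False
      then show ?thesis by (simp add: ramp_eq_0)
    qed
    moreover have "indicator ?A \<omega> \<le> (1::real)" for \<omega> by (simp add: indicator_def)
    moreover have "(\<lambda>\<omega>. ramp i (X \<omega>)) \<in> H" using X blip_ramp by (rule H_blip)
    ultimately have le: "\<forall>\<omega>\<in>space M. ramp i (X \<omega>) \<le> indicator ?A \<omega> \<and> indicator ?A \<omega> \<le> (1::real)"
      and rH: "(\<lambda>\<omega>. ramp i (X \<omega>)) \<in> H" by blast+
    have "\<forall>A\<in>sets M. \<forall>f\<in>H. \<forall>g\<in>H. (\<forall>\<omega>\<in>space M. f \<omega> \<le> indicator A \<omega> \<and> indicator A \<omega> \<le> g \<omega>)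
        \<longrightarrow> E f \<le> ereal (V A) \<and> ereal (V A) \<le> E g"
      using cap by (simp add: associated_capacity_def)
    then have "E (\<lambda>\<omega>. ramp i (X \<omega>)) \<le> ereal (V ?A)"
      using A rH H_const[of 1] le by (metis (no_types, lifting))
    then have "a i \<le> V ?A" using upper[OF X blip_ramp[of i]] by (simp add: a_def)
    then show ?thesis unfolding f_def by (rule ennreal_leI)
  qed
  define I where "I = (\<integral>\<^sup>+t\<in>{0..}. f t \<partial>lborel)"
  have I_fin: "I < \<infinity>"
  proof (rule ccontr)
    assume "\<not> I < \<infinity>"
    \<comment> \<open>In \<open>ereal\<close> the difference \<open>\<infinity> - y\<close> is
      \<open>\<infinity>\<close> for every \<open>y\<close>, so an infinite first integral alone
      makes the Choquet integral infinite.\<close>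
    then have "I = \<infinity>" by (metis infinity_ennreal_def top.not_eq_extremum)
    then show False
      using fin by (simp add: choquet_integral_def I_def f_def Z_def)
  qed
  have disj: "i = j" if "t \<in> {level i / 2<..level i}" "t \<in> {level j / 2<..level j}" for t i j
    using that level_le[of i j] level_le[of j i] by (cases i j rule: linorder_cases) auto
  have "(\<Sum>i<n. a i * level i) \<le> 2 * enn2real I" for n
  proof -
    have "(\<Sum>i<n. ennreal (a i) * ennreal (level i / 2)) = (\<Sum>i<n. \<integral>\<^sup>+t. ennreal (a i) * indicator {level i / 2<..level i} t \<partial>lborel)"
      using level_pos by (intro sum.cong) (auto simp: nn_integral_cmult_indicator less_imp_le)
    also have "\<dots> = (\<integral>\<^sup>+t. (\<Sum>i<n. ennreal (a i) * indicator {level i / 2<..level i} t) \<partial>lborel)"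
      by (subst nn_integral_sum) auto
    also have "\<dots> \<le> I"
      unfolding I_def
    proof (rule nn_integral_mono)
      fix t :: real
      show "(\<Sum>i<n. ennreal (a i) * indicator {level i / 2<..level i} t) \<le> f t * indicator {0..} t"
      proof (cases "\<exists>k<n. t \<in> {level k / 2<..level k}")
        case True
        then obtain k where k: "k < n" "t \<in> {level k / 2<..level k}" by blast
        have "(\<Sum>i<n. ennreal (a i) * indicator {level i / 2<..level i} t)
          = (\<Sum>i\<in>{k}. ennreal (a i) * indicator {level i / 2<..level i} t)"
        proof (rule sum.mono_neutral_right)
          show "\<forall>i\<in>{..<n} - {k}. ennreal (a i) * indicator {level i / 2<..level i} t = 0"
          proof
            fix i assume "i \<in> {..<n} - {k}"
            then have "t \<notin> {level i / 2<..level i}" using disj[OF _ k(2), of i] by blast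
            then show "ennreal (a i) * indicator {level i / 2<..level i} t = 0" by simp
          qed
        qed (use k in simp_all)
        also have "\<dots> = ennreal (a k)" using k by simp
        also have "\<dots> \<le> f t" using k by (intro a_le) auto
        also have "\<dots> = f t * indicator {0..} t" using k level_pos[of k] by (simp add: indicator_def)
        finally show ?thesis .
      next
        case False
        then have "(\<Sum>i<n. ennreal (a i) * indicator {level i / 2<..level i} t) = 0"
          by (intro sum.neutral) auto
        then show ?thesis by simp
      qed
    qed
    finally have le: "(\<Sum>i<n. ennreal (a i) * ennreal (level i / 2)) \<le> I" .
    have "(\<Sum>i<n. ennreal (a i) * ennreal (level i / 2)) = (\<Sum>i<n. ennreal (a i * (level i / 2)))"
      using a_nonneg level_pos by (intro sum.cong refl ennreal_mult[symmetric]) (simp_all add: less_imp_le)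
    also have "\<dots> = ennreal (\<Sum>i<n. a i * (level i / 2))"
      using a_nonneg level_pos by (intro sum_ennreal) (auto intro!: mult_nonneg_nonneg simp: less_imp_le)
    finally have "ennreal (\<Sum>i<n. a i * (level i / 2)) \<le> I" using le by simp
    then have "(\<Sum>i<n. a i * (level i / 2)) \<le> enn2real I"
    proof -
      have "I = ennreal (enn2real I)" using I_fin by simp
      then show ?thesis
        using \<open>ennreal _ \<le> I\<close> ennreal_le_iff[OF enn2real_nonneg] by metis
    qed
    then show ?thesis by (simp add: sum_divide_distrib[symmetric])
  qed
  then show thesis using that unfolding a_def by blast
qed

end

section \<open>Dyadic sums\<close>

lemma two_power_sq: "((2::real) ^ n)\<^sup>2 = 4 ^ n"
  by (simp add: power2_eq_square flip: power_mult_distrib)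

lemma geometric_sum_le:
  fixes r :: real
  assumes "0 \<le> r" "r < 1" "finite K" "inj_on f K"
  shows "(\<Sum>k\<in>K. r ^ f k) \<le> 1 / (1 - r)"
proof -
  have "(\<Sum>k\<in>K. r ^ f k) = (\<Sum>m\<in>f ` K. r ^ m)" using assms(4) by (simp add: sum.reindex)
  also have "\<dots> \<le> (\<Sum>m. r ^ m)" using assms by (intro sum_le_suminf summable_geometric) auto
  also have "\<dots> = 1 / (1 - r)" using assms by (intro suminf_geometric) auto
  finally show ?thesis .
qed

text \<open>The order of summation is exchanged on finite sections: it suffices that every size
  \<open>i\<close> has total weight at most \<open>R * T i\<close> over all blocks \<open>k\<close>.
  In each application \<open>T\<close> is \<open>level\<close>.\<close>

lemma summable_weighted_double_sum:
  fixes a T :: "nat \<Rightarrow> real" and c :: "nat \<Rightarrow> nat \<Rightarrow> real"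
  assumes a: "\<And>i. 0 \<le> a i" and S: "\<And>n. (\<Sum>i<n. a i * T i) \<le> S" and J: "\<And>k. finite (J k)"
    and c: "\<And>k i. 0 \<le> c k i" and R: "0 \<le> R" "\<And>i n. (\<Sum>k | k < n \<and> i \<in> J k. c k i) \<le> R * T i"
  shows "summable (\<lambda>k. \<Sum>i\<in>J k. c k i * a i)"
proof (rule bounded_imp_summable)
  fix n
  show "0 \<le> (\<Sum>i\<in>J n. c n i * a i)" using a c by (intro sum_nonneg mult_nonneg_nonneg)
  have "finite (\<Union>k\<le>n. J k)" using J by auto
  then obtain m where m: "(\<Union>k\<le>n. J k) \<subseteq> {..<m}" by (rule finite_nat_iff_bounded[THEN iffD1, THEN exE])
  have "(\<Sum>k\<le>n. \<Sum>i\<in>J k. c k i * a i) = (\<Sum>k\<le>n. \<Sum>i<m. if i \<in> J k then c k i * a i else 0)"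
  proof (rule sum.cong)
    fix k assume "k \<in> {..n}"
    then have "{..<m} \<inter> {i. i \<in> J k} = J k" using m by auto
    then show "(\<Sum>i\<in>J k. c k i * a i) = (\<Sum>i<m. if i \<in> J k then c k i * a i else 0)"
      by (subst sum.If_cases) auto
  qed simp
  also have "\<dots> = (\<Sum>i<m. \<Sum>k\<le>n. if i \<in> J k then c k i * a i else 0)" by (rule sum.swap)
  also have "\<dots> = (\<Sum>i<m. (\<Sum>k | k < Suc n \<and> i \<in> J k. c k i) * a i)"
  proof (rule sum.cong)
    fix i
    have "{..n} \<inter> {k. i \<in> J k} = {k. k < Suc n \<and> i \<in> J k}" by auto
    then show "(\<Sum>k\<le>n. if i \<in> J k then c k i * a i else 0) = (\<Sum>k | k < Suc n \<and> i \<in> J k. c k i) * a i"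
      by (subst sum.If_cases) (auto simp: sum_distrib_right)
  qed simp
  also have "\<dots> \<le> (\<Sum>i<m. R * T i * a i)"
    using a R by (intro sum_mono mult_right_mono)
  also have "\<dots> = R * (\<Sum>i<m. a i * T i)" by (simp add: sum_distrib_left mult_ac)
  also have "\<dots> \<le> R * S" using R S by (intro mult_left_mono)
  finally show "(\<Sum>k\<le>n. \<Sum>i\<in>J k. c k i * a i) \<le> R * S" .
qed

abbreviation (input) \<tau> :: "nat \<Rightarrow> real" where
  "\<tau> k \<equiv> tt (4 ^ k)"

lemma LL_4_Suc: "LL (4 ^ Suc k) \<le> 4 * LL (4 ^ k)"
  using LL_ratio[of "4 ^ k" "4 ^ Suc k"] by simp

lemma \<tau>_Suc: "\<tau> (Suc k) \<le> 2 * \<tau> k"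
proof -
  have "sqrt (2 * LL (4 ^ Suc k)) \<le> sqrt (2 * (4 * LL (4 ^ k)))"
    using LL_4_Suc[of k] by (intro real_sqrt_le_mono) simp
  also have "\<dots> = 2 * sqrt (2 * LL (4 ^ k))"
    using real_sqrt_mult[of 4 "2 * LL (4 ^ k)"] by simp
  finally show ?thesis by (simp add: tt_def)
qed

text \<open>
  The dyadic index \<open>i\<close> of the size of a variable never exceeds the scale \<open>sqrt j * tt j\<close> of its
  block \<open>k\<close>, which makes the iterated logarithms comparable.
\<close>

lemma LL_le_\<tau>:
  assumes "2 ^ Suc i \<le> 2 ^ Suc k * \<tau> (Suc k)"
  shows "LL (2 ^ i) \<le> 2 * (\<tau> k)\<^sup>2"
proof -
  have "(\<tau> (Suc k))\<^sup>2 = 2 * LL (4 ^ Suc k)" by (simp add: tt_sq)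
  also have "\<dots> \<le> 2 * 4 ^ Suc k" using LL_le[of "4 ^ Suc k"] one_le_power[of "4::real" "Suc k"] by (simp del: power_Suc)
  also have "\<dots> \<le> (2 ^ Suc (Suc k))\<^sup>2"
    by (simp add: power2_eq_square flip: power_mult_distrib)
  finally have "\<tau> (Suc k) \<le> 2 ^ Suc (Suc k)" by (rule power2_le_imp_le) simp
  then have "2 ^ Suc k * \<tau> (Suc k) \<le> 2 ^ Suc k * 2 ^ Suc (Suc k)" by (intro mult_left_mono) auto
  also have "\<dots> = 2 * 4 ^ Suc k" by (simp flip: power_mult_distrib)
  finally have "(2::real) ^ i \<le> 4 ^ Suc k" using assms by simp
  then have "LL (2 ^ i) \<le> LL (4 ^ Suc k)" by (rule LL_mono)
  also have "\<dots> \<le> 4 * LL (4 ^ k)" by (rule LL_4_Suc)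
  finally show ?thesis by (simp add: tt_sq)
qed

lemma inverse_\<tau>_le:
  assumes "2 ^ Suc i \<le> 2 ^ Suc k * \<tau> (Suc k)"
  shows "1 / (\<tau> k)\<^sup>2 \<le> 2 / LL (2 ^ i)"
  using LL_le_\<tau>[OF assms] LL_pos[of "2 ^ i"] tt_pos[of "4 ^ k"] by (simp add: field_simps)

lemma pow_i_le:
  assumes "2 ^ Suc i \<le> 2 ^ Suc k * \<tau> (Suc k)"
  shows "(2::real) ^ i \<le> 2 * 2 ^ k * \<tau> k"
proof -
  have "(2::real) ^ i \<le> 2 ^ k * \<tau> (Suc k)" using assms by simp
  also have "\<dots> \<le> 2 ^ k * (2 * \<tau> k)" by (intro mult_left_mono \<tau>_Suc) simp
  finally show ?thesis by simp
qed

text \<open>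
  The dyadic sizes between the truncation levels \<open>b\<close> and \<open>sqrt j * tt j\<close> in block \<open>k\<close>.  As \<open>b\<close> is at
  least \<open>sqrt j / tt j ^ 3\<close>, each size lies in few bands: the weight \<open>1 / \<tau> k ^ 4\<close> of the fourth moment
  inequality pays both for this multiplicity and for the factor \<open>1 / LL\<close> in \<open>level\<close>.
\<close>

definition band :: "(nat \<Rightarrow> real) \<Rightarrow> nat \<Rightarrow> nat \<Rightarrow> nat set" where
  "band b k0 k = {i. k0 \<le> k \<and> 2 ^ Suc i \<le> 2 ^ Suc k * \<tau> (Suc k) \<and> b k \<le> 2 ^ (i + 2)}"

lemma finite_power_le: "finite {i::nat. 2 ^ Suc i \<le> (x::real)}"
proof -
  obtain n where n: "x < 2 ^ n" using real_arch_pow[of 2 x] by auto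
  have "i \<le> n" if "2 ^ Suc i \<le> x" for i
  proof (rule ccontr)
    assume "\<not> i \<le> n"
    then have "(2::real) ^ n \<le> 2 ^ Suc i" by (intro power_increasing) auto
    then show False using n that by linarith
  qed
  then show ?thesis by (intro finite_subset[OF _ finite_atMost[of n]]) auto
qed

lemma finite_band: "finite (band b k0 k)"
  by (rule finite_subset[OF _ finite_power_le[of "2 ^ Suc k * \<tau> (Suc k)"]]) (auto simp: band_def)

text \<open>Membership in the band forces the distance \<open>m k\<close> between \<open>i\<close>
  and \<open>k\<close> to satisfy \<open>2 ^ m k \<le> 4 * \<tau> k ^ 3\<close>. One factor
  \<open>1 / (\<tau> k)\<^sup>2\<close> is therefore geometrically small in that distance and can be
  summed over \<open>k\<close>; the other supplies the \<open>1 / LL\<close> of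
  \<open>level i\<close>.\<close>

lemma band_second_moment:
  assumes b: "\<And>k. k0 \<le> k \<Longrightarrow> 2 ^ k \<le> b k * \<tau> k ^ 3"
    and a: "\<And>i. 0 \<le> a i" and S: "\<And>n. (\<Sum>i<n. a i * level i) \<le> S"
  shows "summable (\<lambda>k. (\<Sum>i\<in>band b k0 k. 4 ^ (i + 2) * a i) / \<tau> k ^ 4)"
proof -
  have "summable (\<lambda>k. \<Sum>i\<in>band b k0 k. 4 ^ (i + 2) / \<tau> k ^ 4 * a i)"
  proof (rule summable_weighted_double_sum[OF a S finite_band, of _ 576])
    fix i n
    let ?K = "{k. k < n \<and> i \<in> band b k0 k}"
    define m where "m k = (if k \<le> i then i - k else k - i)" for k
    have "(\<Sum>k\<in>?K. 4 ^ (i + 2) / \<tau> k ^ 4) \<le> (\<Sum>k\<in>?K. 96 * level i * (2/3) ^ m k)"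
    proof (rule sum_mono)
      fix k assume "k \<in> ?K"
      then have k: "k0 \<le> k" "2 ^ Suc i \<le> 2 ^ Suc k * \<tau> (Suc k)" "b k \<le> 2 ^ (i + 2)"
        by (auto simp: band_def)
      have \<tau>1: "1 \<le> \<tau> k" by (rule tt_ge_1)
      have "2 ^ m k \<le> 4 * \<tau> k ^ 3"
      proof (cases "k \<le> i")
        case True
        have "2 ^ k * 2 ^ (i - k) = (2::real) ^ i" using True by (simp flip: power_add)
        then have "2 ^ k * 2 ^ (i - k) \<le> 2 ^ k * (2 * \<tau> k)" using pow_i_le[OF k(2)] by simp
        then have "(2::real) ^ (i - k) \<le> 2 * \<tau> k" by simp
        also have "\<dots> \<le> 2 * \<tau> k ^ 3" using \<tau>1 power_increasing[of 1 3 "\<tau> k"] by simp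
        also have "\<dots> \<le> 4 * \<tau> k ^ 3" using \<tau>1 by simp
        finally show ?thesis using True by (simp add: m_def)
      next
        case False
        have "2 ^ i * 2 ^ (k - i) = (2::real) ^ k" using False by (simp flip: power_add)
        also have "\<dots> \<le> b k * \<tau> k ^ 3" using b k by auto
        also have "\<dots> \<le> 2 ^ (i + 2) * \<tau> k ^ 3" using k \<tau>1 by (intro mult_right_mono) auto
        also have "\<dots> = 2 ^ i * (4 * \<tau> k ^ 3)" by (simp add: power_add)
        finally have "(2::real) ^ (k - i) \<le> 4 * \<tau> k ^ 3" by simp
        then show ?thesis using False by (simp add: m_def)
      qed
      then have "(2 ^ m k)\<^sup>2 \<le> (4 * \<tau> k ^ 3)\<^sup>2" by (intro power_mono) auto
      then have le: "4 ^ m k \<le> 16 * ((\<tau> k)\<^sup>2) ^ 3"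
        by (simp add: power_mult_distrib power_mult[symmetric] mult.commute power2_eq_square)
          (simp add: power_mult_distrib[symmetric] power2_eq_square power3_eq_cube mult_ac)
      \<comment> \<open>Squaring the estimate gives a bound by \<open>\<tau> k ^ 6\<close>, while
        one by \<open>(\<tau> k)\<^sup>2\<close> is wanted. As \<open>27/8 \<le> 4\<close> and
        \<open>16 \<le> 27\<close>, the base \<open>3/2\<close> provides a cube root without
        irrational numbers.\<close>
      have "((3/2) ^ m k) ^ 3 = ((27/8)::real) ^ m k"
        by (simp add: power_mult[symmetric] mult.commute[of _ 3], simp add: power_mult power3_eq_cube)
      also have "\<dots> \<le> 4 ^ m k" by (intro power_mono) auto
      also have "\<dots> \<le> (3 * (\<tau> k)\<^sup>2) ^ 3"
      proof -
        have "(3 * (\<tau> k)\<^sup>2) ^ 3 = 27 * ((\<tau> k)\<^sup>2) ^ 3" by (simp add: power_mult_distrib)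
        moreover have "0 \<le> ((\<tau> k)\<^sup>2) ^ 3" by simp
        ultimately show ?thesis using le by linarith
      qed
      finally have "(3/2) ^ m k \<le> 3 * (\<tau> k)\<^sup>2" by (rule power_mono_iff[THEN iffD1, rotated 3]) auto
      then have 1: "1 / (\<tau> k)\<^sup>2 \<le> 3 * (2/3) ^ m k"
        using \<tau>1 by (simp add: power_divide field_simps)
      have "1 / \<tau> k ^ 4 = 1 / (\<tau> k)\<^sup>2 * (1 / (\<tau> k)\<^sup>2)" by (simp flip: power_add)
      also have "\<dots> \<le> 2 / LL (2 ^ i) * (3 * (2/3) ^ m k)"
        using 1 inverse_\<tau>_le[OF k(2)] LL_pos[of "2 ^ i"] by (intro mult_mono) auto
      finally have "4 ^ (i + 2) * (1 / \<tau> k ^ 4) \<le> 4 ^ (i + 2) * (2 / LL (2 ^ i) * (3 * (2/3) ^ m k))"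
        by (intro mult_left_mono) auto
      then show "4 ^ (i + 2) / \<tau> k ^ 4 \<le> 96 * level i * (2/3) ^ m k"
        by (simp add: level_def power_add)
    qed
    also have "\<dots> = 96 * level i * (\<Sum>k\<in>?K. (2/3) ^ m k)" by (simp add: sum_distrib_left)
    also have "(\<Sum>k\<in>?K. (2/3::real) ^ m k) \<le> 6"
    proof -
      have "(\<Sum>k\<in>?K. (2/3::real) ^ m k) = (\<Sum>k\<in>?K \<inter> {..i}. (2/3) ^ m k) + (\<Sum>k\<in>?K - {..i}. (2/3) ^ m k)"
        by (rule sum.Int_Diff) simp
      also have "(\<Sum>k\<in>?K \<inter> {..i}. (2/3::real) ^ m k) \<le> 1 / (1 - 2/3)"
        by (rule geometric_sum_le) (auto simp: m_def inj_on_def)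
      also have "(\<Sum>k\<in>?K - {..i}. (2/3::real) ^ m k) \<le> 1 / (1 - 2/3)"
        by (rule geometric_sum_le) (auto simp: m_def inj_on_def)
      finally show ?thesis by simp
    qed
    finally show "(\<Sum>k\<in>?K. 4 ^ (i + 2) / \<tau> k ^ 4) \<le> 576 * level i"
      using level_pos[of i] by simp
  qed (auto simp: less_imp_le[OF tt_pos])
  then show ?thesis by (simp add: sum_divide_distrib)
qed

text \<open>For a fixed size the weights decay geometrically in \<open>k\<close>, so the first block
  \<open>m\<close> containing \<open>i\<close> dominates. There \<open>4 ^ i\<close> is at most
  \<open>4 * 4 ^ m * (\<tau> m)\<^sup>2\<close>, which reduces
  \<open>16 ^ i / (4 ^ m * \<tau> m ^ 4)\<close> to a multiple of
  \<open>4 ^ i / (\<tau> m)\<^sup>2\<close>, hence of \<open>level i\<close>.\<close>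

lemma band_fourth_moment:
  assumes a: "\<And>i. 0 \<le> a i" and S: "\<And>n. (\<Sum>i<n. a i * level i) \<le> S"
  shows "summable (\<lambda>k. (\<Sum>i\<in>band b k0 k. 16 ^ (i + 2) * a i) / (4 ^ k * \<tau> k ^ 4))"
proof -
  have "summable (\<lambda>k. \<Sum>i\<in>band b k0 k. 16 ^ (i + 2) / (4 ^ k * \<tau> k ^ 4) * a i)"
  proof (rule summable_weighted_double_sum[OF a S finite_band, of _ 4096])
    fix i n
    let ?K = "{k. k < n \<and> i \<in> band b k0 k}"
    show "(\<Sum>k\<in>?K. 16 ^ (i + 2) / (4 ^ k * \<tau> k ^ 4)) \<le> 4096 * level i"
    proof (cases "?K = {}")
      case True
      then show ?thesis unfolding True using level_pos[of i] by (simp add: less_imp_le)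
    next
      case False
      define m where "m = Min ?K"
      have "m \<in> ?K" unfolding m_def using False by (intro Min_in) auto
      then have m: "2 ^ Suc i \<le> 2 ^ Suc m * \<tau> (Suc m)" by (auto simp: band_def)
      have le_m: "m \<le> k" if "k \<in> ?K" for k unfolding m_def using that by (intro Min_le) auto
      have "(\<Sum>k\<in>?K. 16 ^ (i + 2) / (4 ^ k * \<tau> k ^ 4)) \<le> (\<Sum>k\<in>?K. 16 ^ (i + 2) / (4 ^ m * \<tau> m ^ 4) * (1/4) ^ (k - m))"
      proof (rule sum_mono)
        fix k assume "k \<in> ?K"
        then have k: "m \<le> k" by (rule le_m)
        have "(4::real) ^ k = 4 ^ m * 4 ^ (k - m)" using k by (simp flip: power_add)
        then have "4 ^ m * 4 ^ (k - m) * \<tau> m ^ 4 \<le> 4 ^ k * \<tau> k ^ 4"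
          using k tt_mono[of "4 ^ m" "4 ^ k"] tt_pos[of "4 ^ m"]
          by (intro mult_mono power_mono) auto
        then have "16 ^ (i + 2) / (4 ^ k * \<tau> k ^ 4) \<le> 16 ^ (i + 2) / (4 ^ m * 4 ^ (k - m) * \<tau> m ^ 4)"
          using tt_pos[of "4 ^ m"] tt_pos[of "4 ^ k"] by (intro divide_left_mono) auto
        then show "16 ^ (i + 2) / (4 ^ k * \<tau> k ^ 4) \<le> 16 ^ (i + 2) / (4 ^ m * \<tau> m ^ 4) * (1/4) ^ (k - m)"
          by (simp add: power_divide mult_ac)
      qed
      also have "\<dots> = 16 ^ (i + 2) / (4 ^ m * \<tau> m ^ 4) * (\<Sum>k\<in>?K. (1/4) ^ (k - m))"
        by (simp add: sum_distrib_left)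
      also have "\<dots> \<le> 16 ^ (i + 2) / (4 ^ m * \<tau> m ^ 4) * (1 / (1 - 1/4))"
        using tt_pos[of "4 ^ m"] le_m
        by (intro mult_left_mono geometric_sum_le) (auto simp: inj_on_def le_imp_diff_is_add)
      also have "\<dots> \<le> 16 ^ (i + 2) / (4 ^ m * \<tau> m ^ 4) * 2"
        using tt_pos[of "4 ^ m"] by (intro mult_left_mono) auto
      also have "\<dots> \<le> 4096 * level i"
      proof -
        have "((2::real) ^ i)\<^sup>2 \<le> (2 * 2 ^ m * \<tau> m)\<^sup>2" using pow_i_le[OF m] by (intro power_mono) auto
        then have "(4::real) ^ i \<le> 4 * 4 ^ m * (\<tau> m)\<^sup>2"
          by (simp add: power_mult_distrib two_power_sq)
        then have "4 ^ i * (4 ^ i * LL (2 ^ i)) \<le> (4 * 4 ^ m * (\<tau> m)\<^sup>2) * (4 ^ i * (2 * (\<tau> m)\<^sup>2))"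
          using LL_le_\<tau>[OF m] LL_pos[of "2 ^ i"] tt_pos[of "4 ^ m"] by (intro mult_mono) auto
        also have "(4 * 4 ^ m * (\<tau> m)\<^sup>2) * (4 ^ i * (2 * (\<tau> m)\<^sup>2)) = 8 * 4 ^ i * (4 ^ m * \<tau> m ^ 4)"
          by (simp add: power4_eq_xxxx power2_eq_square)
        also have "4 ^ i * (4 ^ i * LL (2 ^ i)) = 16 ^ i * LL (2 ^ i)"
          by (simp flip: mult.assoc power_mult_distrib)
        finally have "16 ^ i * LL (2 ^ i) \<le> 8 * 4 ^ i * (4 ^ m * \<tau> m ^ 4)" .
        then show ?thesis
          using LL_pos[of "2 ^ i"] tt_pos[of "4 ^ m"] by (simp add: level_def power_add field_simps)
      qed
      finally show ?thesis .
    qed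
  qed (auto simp: less_imp_le[OF tt_pos])
  then show ?thesis by (simp add: sum_divide_distrib)
qed

text \<open>Contains at most one index, the dyadic size of \<open>sqrt j * tt j\<close> at the start
  \<open>j = 4 ^ k\<close> of the block. It is written as a set so that the lemma on weighted double
  sums applies.\<close>

definition tail_index :: "nat \<Rightarrow> nat set" where
  "tail_index k = {i. 2 ^ Suc i \<le> 2 ^ k * \<tau> k \<and> 2 ^ k * \<tau> k < 2 ^ (i + 2)}"

lemma finite_tail_index: "finite (tail_index k)"
  by (rule finite_subset[OF _ finite_power_le[of "2 ^ k * \<tau> k"]]) (auto simp: tail_index_def)

lemma dyadic_size:
  assumes "2 \<le> (x::real)"
  shows "\<exists>i. 2 ^ Suc i \<le> x \<and> x < 2 ^ (i + 2)"
proof -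
  obtain n where n: "x < 2 ^ n" using real_arch_pow[of 2 x] by auto
  define m where "m = (LEAST m. x < 2 ^ m)"
  have m: "x < 2 ^ m" unfolding m_def using n by (rule LeastI)
  have "1 < m"
  proof (rule ccontr)
    assume "\<not> 1 < m"
    then have "(2::real) ^ m \<le> 2 ^ 1" by (intro power_increasing) auto
    then show False using m assms by simp
  qed
  then have i: "m = (m - 2) + 2" by simp
  define i where "i = m - 2"
  have i: "m = i + 2" using i by (simp add: i_def)
  then have "\<not> x < 2 ^ Suc i" using not_less_Least[of "Suc i" "\<lambda>m. x < 2 ^ m"] by (simp add: m_def)
  then show ?thesis using m i by (intro exI[of _ i]) auto
qed

text \<open>The last block \<open>m\<close> whose scale has the size \<open>i\<close> dominates,
  since \<open>4 ^ k\<close> decreases geometrically away from it. For that block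
  \<open>4 ^ m * (\<tau> m)\<^sup>2 \<le> 16 * 4 ^ i\<close>, and \<open>(\<tau> m)\<^sup>2\<close>
  is comparable to \<open>LL (2 ^ i)\<close> from above.\<close>

lemma tail_summable:
  assumes a: "\<And>i. 0 \<le> a i" and S: "\<And>n. (\<Sum>i<n. a i * level i) \<le> S"
  shows "summable (\<lambda>k. 4 ^ k * (\<Sum>i\<in>tail_index k. a i))"
proof -
  have "summable (\<lambda>k. \<Sum>i\<in>tail_index k. 4 ^ k * a i)"
  proof (rule summable_weighted_double_sum[OF a S finite_tail_index, of _ 64])
    fix i n
    let ?K = "{k. k < n \<and> i \<in> tail_index k}"
    show "(\<Sum>k\<in>?K. 4 ^ k) \<le> 64 * level i"
    proof (cases "?K = {}")
      case True
      then show ?thesis unfolding True using level_pos[of i] by (simp add: less_imp_le)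
    next
      case False
      define m where "m = Max ?K"
      have "m \<in> ?K" unfolding m_def using False by (intro Max_in) auto
      then have m: "2 ^ Suc i \<le> 2 ^ m * \<tau> m" "2 ^ m * \<tau> m < 2 ^ (i + 2)" by (auto simp: tail_index_def)
      have le_m: "k \<le> m" if "k \<in> ?K" for k unfolding m_def using that by (intro Max_ge) auto
      have "(\<Sum>k\<in>?K. (4::real) ^ k) = (\<Sum>k\<in>?K. 4 ^ m * (1/4) ^ (m - k))"
      proof (rule sum.cong)
        fix k assume "k \<in> ?K"
        then have "(4::real) ^ m = 4 ^ k * 4 ^ (m - k)" using le_m by (simp flip: power_add)
        then show "(4::real) ^ k = 4 ^ m * (1/4) ^ (m - k)" by (simp add: power_divide)
      qed simp
      also have "\<dots> = 4 ^ m * (\<Sum>k\<in>?K. (1/4) ^ (m - k))" by (simp add: sum_distrib_left)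
      also have "\<dots> \<le> 4 ^ m * (1 / (1 - 1/4))"
        using le_m by (intro mult_left_mono geometric_sum_le) (auto simp: inj_on_def, metis diff_diff_cancel)
      also have "\<dots> \<le> 4 ^ m * 2" by simp
      also have "\<dots> \<le> 64 * level i"
      proof -
        have "(2 ^ m * \<tau> m)\<^sup>2 \<le> (2 ^ (i + 2))\<^sup>2" using m tt_pos[of "4 ^ m"] by (intro power_mono) auto
        then have 1: "4 ^ m * (\<tau> m)\<^sup>2 \<le> 16 * 4 ^ i"
          by (simp add: power_mult_distrib power_add two_power_sq)
        have "2 ^ m * \<tau> m \<le> 2 ^ Suc m * \<tau> (Suc m)"
          using tt_pos[of "4 ^ m"] tt_mono[of "4 ^ m" "4 ^ Suc m"] by (intro mult_mono) auto
        from order_trans[OF m(1) this] have "LL (2 ^ i) \<le> 2 * (\<tau> m)\<^sup>2" by (rule LL_le_\<tau>)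
        then have "4 ^ m * LL (2 ^ i) \<le> 4 ^ m * (2 * (\<tau> m)\<^sup>2)" by (intro mult_left_mono) auto
        also have "\<dots> = 2 * (4 ^ m * (\<tau> m)\<^sup>2)" by simp
        finally have "4 ^ m * LL (2 ^ i) \<le> 32 * 4 ^ i" using 1 by linarith
        then show ?thesis using LL_pos[of "2 ^ i"] by (simp add: level_def field_simps)
      qed
      finally show ?thesis .
    qed
  qed auto
  then show ?thesis by (simp add: sum_distrib_left)
qed

section \<open>Truncation\<close>

lemma tt_over_sqrt: "(\<lambda>n. tt n / sqrt (real n)) \<longlonglongrightarrow> 0"
proof -
  have "(\<lambda>n. LL (real n) / real n) \<longlonglongrightarrow> 0"
  proof (rule Lim_null_comparison)
    show "(\<lambda>n. ln (real n) / real n) \<longlonglongrightarrow> 0" by real_asymp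
    show "\<forall>\<^sub>F n in sequentially. norm (LL (real n) / real n) \<le> ln (real n) / real n"
      using eventually_ge_at_top[of 3]
    proof eventually_elim
      case (elim n)
      have "exp 1 \<le> (3::real)" using exp_le by simp
      then have "log_e (real n) = ln (real n)" using elim by (simp add: log_e_def max_def)
      moreover have "LL (real n) \<le> log_e (real n)"
        using log_e_ratio[of 1 "log_e (real n)"] log_e_ge_1[of "real n"] by (simp add: log_e_def max_def)
      ultimately show ?case using LL_pos[of "real n"] elim by (simp add: divide_right_mono)
    qed
  qed
  then have "(\<lambda>n. sqrt (2 * (LL (real n) / real n))) \<longlonglongrightarrow> sqrt (2 * 0)"
    by (intro tendsto_intros)
  moreover have "sqrt (2 * (LL (real n) / real n)) = tt n / sqrt (real n)" for n
    by (simp add: tt_def real_sqrt_divide real_sqrt_mult)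
  ultimately show ?thesis by simp
qed

lemma (in filtered_prob_space) conditional_variance:
  assumes X: "X \<in> bmeas (F (Suc n))" and \<mu>: "\<mu> \<in> bmeas (F n)"
    and ce: "\<And>G. G \<in> bmeas (F n) \<Longrightarrow> (\<integral>\<omega>. G \<omega> * \<mu> \<omega> \<partial>M) = (\<integral>\<omega>. G \<omega> * X \<omega> \<partial>M)"
    and G: "G \<in> bmeas (F n)"
  shows "(\<integral>\<omega>. G \<omega> * (X \<omega> - \<mu> \<omega>)\<^sup>2 \<partial>M) = (\<integral>\<omega>. G \<omega> * (X \<omega>)\<^sup>2 \<partial>M) - (\<integral>\<omega>. G \<omega> * (\<mu> \<omega>)\<^sup>2 \<partial>M)"
proof -
  have up: "f \<in> bmeas (F (Suc n))" if "f \<in> bmeas (F n)" for f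
    using that by (rule bmeas_F_mono[rotated]) simp
  have i: "integrable M (\<lambda>\<omega>. G \<omega> * (X \<omega>)\<^sup>2)" "integrable M (\<lambda>\<omega>. G \<omega> * \<mu> \<omega> * X \<omega>)"
    "integrable M (\<lambda>\<omega>. G \<omega> * (\<mu> \<omega>)\<^sup>2)"
    using X up[OF \<mu>] up[OF G] by (auto intro!: bmeas_F_integrable[of _ "Suc n"])
  have "(\<integral>\<omega>. G \<omega> * \<mu> \<omega> * X \<omega> \<partial>M) = (\<integral>\<omega>. G \<omega> * (\<mu> \<omega>)\<^sup>2 \<partial>M)"
    using ce[OF bmeas_mult[OF G \<mu>]] by (simp add: power2_eq_square mult.assoc)
  moreover have "(\<integral>\<omega>. G \<omega> * (X \<omega> - \<mu> \<omega>)\<^sup>2 \<partial>M)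
      = (\<integral>\<omega>. G \<omega> * (X \<omega>)\<^sup>2 - 2 * (G \<omega> * \<mu> \<omega> * X \<omega>) + G \<omega> * (\<mu> \<omega>)\<^sup>2 \<partial>M)"
    by (intro Bochner_Integration.integral_cong) (auto simp: power2_eq_square algebra_simps)
  ultimately show ?thesis using i by simp
qed

lemma power4_diff_le: "(x - y) ^ 4 \<le> 8 * (x ^ 4 + y ^ 4)" for x y :: real
proof -
  have "(x - y)\<^sup>2 \<le> 2 * (x\<^sup>2 + y\<^sup>2)"
    using zero_le_power2[of "x + y"] by (simp add: power2_eq_square algebra_simps)
  then have "((x - y)\<^sup>2)\<^sup>2 \<le> (2 * (x\<^sup>2 + y\<^sup>2))\<^sup>2" by (intro power_mono) auto
  also have "\<dots> \<le> 8 * (x ^ 4 + y ^ 4)"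
    using zero_le_power2[of "x\<^sup>2 - y\<^sup>2"] by (simp add: power2_eq_square power4_eq_xxxx algebra_simps)
  finally show ?thesis by (simp flip: power_mult)
qed

lemma power4_young: "y ^ 3 * x \<le> 3 / 4 * y ^ 4 + 1 / 4 * x ^ 4" for x y :: real
proof -
  have "0 \<le> (y - x)\<^sup>2 * ((y + x)\<^sup>2 + 2 * y\<^sup>2)" by simp
  then show ?thesis
    by (simp add: power2_eq_square power3_eq_cube power4_eq_xxxx algebra_simps)
qed

text \<open>Jensen's inequality for the fourth power is obtained from \<open>ce\<close> with the
  weight \<open>\<mu>\<^sup>3\<close> and Young's inequality. The constant is \<open>8\<close> from
  splitting the difference, times \<open>2\<close> for the two equal bounds.\<close>

lemma (in filtered_prob_space) conditional_fourth_moment: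
  assumes X: "X \<in> bmeas (F (Suc n))" and \<mu>: "\<mu> \<in> bmeas (F n)"
    and ce: "\<And>G. G \<in> bmeas (F n) \<Longrightarrow> (\<integral>\<omega>. G \<omega> * \<mu> \<omega> \<partial>M) = (\<integral>\<omega>. G \<omega> * X \<omega> \<partial>M)"
  shows "(\<integral>\<omega>. (X \<omega> - \<mu> \<omega>) ^ 4 \<partial>M) \<le> 16 * (\<integral>\<omega>. (X \<omega>) ^ 4 \<partial>M)"
proof -
  have \<mu>': "\<mu> \<in> bmeas (F (Suc n))" using \<mu> by (rule bmeas_F_mono[rotated]) simp
  have i: "integrable M (\<lambda>\<omega>. (X \<omega>) ^ 4)" "integrable M (\<lambda>\<omega>. (\<mu> \<omega>) ^ 4)"
    "integrable M (\<lambda>\<omega>. (\<mu> \<omega>) ^ 3 * X \<omega>)" "integrable M (\<lambda>\<omega>. (X \<omega> - \<mu> \<omega>) ^ 4)"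
    using X \<mu>' by (auto intro!: bmeas_F_integrable[of _ "Suc n"])
  have "(\<integral>\<omega>. (\<mu> \<omega>) ^ 4 \<partial>M) = (\<integral>\<omega>. (\<mu> \<omega>) ^ 3 * \<mu> \<omega> \<partial>M)"
    by (simp add: power4_eq_xxxx power3_eq_cube mult.assoc)
  also have "\<dots> = (\<integral>\<omega>. (\<mu> \<omega>) ^ 3 * X \<omega> \<partial>M)" using \<mu> by (intro ce bmeas_power)
  also have "\<dots> \<le> (\<integral>\<omega>. 3 / 4 * (\<mu> \<omega>) ^ 4 + 1 / 4 * (X \<omega>) ^ 4 \<partial>M)"
    using i by (intro integral_mono power4_young) auto
  also have "\<dots> = 3 / 4 * (\<integral>\<omega>. (\<mu> \<omega>) ^ 4 \<partial>M) + 1 / 4 * (\<integral>\<omega>. (X \<omega>) ^ 4 \<partial>M)" using i by simp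
  finally have jensen: "(\<integral>\<omega>. (\<mu> \<omega>) ^ 4 \<partial>M) \<le> (\<integral>\<omega>. (X \<omega>) ^ 4 \<partial>M)" by simp
  have "(\<integral>\<omega>. (X \<omega> - \<mu> \<omega>) ^ 4 \<partial>M) \<le> (\<integral>\<omega>. 8 * ((X \<omega>) ^ 4 + (\<mu> \<omega>) ^ 4) \<partial>M)"
    using i by (intro integral_mono power4_diff_le) auto
  also have "\<dots> = 8 * ((\<integral>\<omega>. (X \<omega>) ^ 4 \<partial>M) + (\<integral>\<omega>. (\<mu> \<omega>) ^ 4 \<partial>M))" using i by simp
  also have "\<dots> \<le> 8 * ((\<integral>\<omega>. (X \<omega>) ^ 4 \<partial>M) + (\<integral>\<omega>. (X \<omega>) ^ 4 \<partial>M))"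
    using jensen by (intro mult_left_mono add_left_mono) auto
  finally show ?thesis by simp
qed

text \<open>\<open>U \<phi>\<close> stands for the upper expectation of \<open>\<phi> (Y 1)\<close>, and \<open>Z i\<close> for \<open>Y (Suc i)\<close>.\<close>

locale lil_sequence = filtered_prob_space M F for M :: "'a measure" and F +
  fixes Z :: "nat \<Rightarrow> 'a \<Rightarrow> real" and U :: "(real \<Rightarrow> real) \<Rightarrow> real"
    and C0 c0 c1 S :: real and \<alpha> b :: "nat \<Rightarrow> real"
  assumes Z_meas: "\<And>i. Z i \<in> borel_measurable (F (Suc i))"
    and cond_le: "\<And>\<phi> i A. blip \<phi> \<Longrightarrow> A \<in> sets (F i) \<Longrightarrow> (\<integral>\<omega>. indicator A \<omega> * \<phi> (Z i \<omega>) \<partial>M) \<le> U \<phi> * prob A"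
    and C0: "0 < C0" "\<And>c. 0 \<le> c \<Longrightarrow> U (\<lambda>x. (clip c x)\<^sup>2) \<le> C0"
    and c0: "0 < c0" "\<And>c. c1 \<le> c \<Longrightarrow> c0 \<le> - U (\<lambda>x. - (clip c x)\<^sup>2)"
    and mean: "\<And>c. 0 < c \<Longrightarrow> U (clip c) \<le> C0 / c" "\<And>c. 0 < c \<Longrightarrow> U (\<lambda>x. - clip c x) \<le> C0 / c"
    and ramp: "\<And>i. 0 \<le> U (ramp i)" "\<And>n. (\<Sum>i<n. U (ramp i) * level i) \<le> S"
    and b: "\<And>j. b j = \<alpha> j * sqrt (real j) / tt j" and \<alpha>_pos: "\<And>j. 1 \<le> j \<Longrightarrow> 0 < \<alpha> j"
    and \<alpha>_lim: "\<alpha> \<longlonglongrightarrow> 0" and b_mono: "mono_on {1..} b" and b_lim: "filterlim b at_top sequentially"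
    and \<alpha>_ge: "\<forall>\<^sub>F j in sequentially. 1 \<le> \<alpha> j * (tt j)\<^sup>2"
begin

definition \<gamma> :: "nat \<Rightarrow> real" where
  "\<gamma> j = sqrt (real j) * tt j"

lemma b_pos: "0 < b (Suc i)"
  using \<alpha>_pos[of "Suc i"] tt_pos[of "Suc i"] by (simp add: b)

lemma \<gamma>_pos: "0 < \<gamma> (Suc i)"
  using tt_pos[of "Suc i"] by (simp add: \<gamma>_def)

lemma \<gamma>_mono: "i \<le> j \<Longrightarrow> \<gamma> i \<le> \<gamma> j"
  unfolding \<gamma>_def using tt_pos[of i] by (intro mult_mono tt_mono) auto

lemma b_le: "1 \<le> i \<Longrightarrow> i \<le> j \<Longrightarrow> b i \<le> b j"
  using b_mono by (auto simp: mono_on_def)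

lemma blip_bmeas: "blip \<phi> \<Longrightarrow> (\<lambda>\<omega>. \<phi> (Z i \<omega>)) \<in> bmeas (F (Suc i))"
proof -
  assume \<phi>: "blip \<phi>"
  then obtain B where "\<And>x. \<bar>\<phi> x\<bar> \<le> B" by (auto simp: blip_def)
  then show ?thesis
    using measurable_compose[OF Z_meas blip_measurable[OF \<phi>]] by (intro bmeasI)
qed

lemma conditional_expectation:
  assumes \<phi>: "blip \<phi>" and lo: "U (\<lambda>x. - \<phi> x) \<le> - lo" and hi: "U \<phi> \<le> hi"
  shows "\<exists>\<mu>\<in>bmeas (F i). (\<forall>\<omega>. lo \<le> \<mu> \<omega> \<and> \<mu> \<omega> \<le> hi) \<and>
    (\<forall>G\<in>bmeas (F i). (\<integral>\<omega>. G \<omega> * \<mu> \<omega> \<partial>M) = (\<integral>\<omega>. G \<omega> * \<phi> (Z i \<omega>) \<partial>M))"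
proof (rule bounded_conditional_expectation)
  show "(\<lambda>\<omega>. \<phi> (Z i \<omega>)) \<in> bmeas M" using blip_bmeas[OF \<phi>] by (rule bmeas_F_M)
  fix A assume A: "A \<in> sets (F i)"
  have "(\<integral>\<omega>. indicator A \<omega> * - \<phi> (Z i \<omega>) \<partial>M) \<le> U (\<lambda>x. - \<phi> x) * prob A"
    by (rule cond_le[OF blip_uminus[OF \<phi>] A])
  also have "\<dots> \<le> - lo * prob A" using lo by (intro mult_right_mono) auto
  finally show "lo * prob A \<le> (\<integral>\<omega>. indicator A \<omega> * \<phi> (Z i \<omega>) \<partial>M)" by simp
  have "(\<integral>\<omega>. indicator A \<omega> * \<phi> (Z i \<omega>) \<partial>M) \<le> U \<phi> * prob A" by (rule cond_le[OF \<phi> A])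
  also have "\<dots> \<le> hi * prob A" using hi by (intro mult_right_mono) auto
  finally show "(\<integral>\<omega>. indicator A \<omega> * \<phi> (Z i \<omega>) \<partial>M) \<le> hi * prob A" .
qed

text \<open>Passing through the bounded conditional expectation extends \<open>cond_le\<close> from
  indicators to all nonnegative bounded weights.\<close>

lemma weighted_le:
  assumes \<phi>: "blip \<phi>" and G: "G \<in> bmeas (F i)" "\<And>\<omega>. 0 \<le> G \<omega>"
  shows "(\<integral>\<omega>. G \<omega> * \<phi> (Z i \<omega>) \<partial>M) \<le> U \<phi> * (\<integral>\<omega>. G \<omega> \<partial>M)"
proof -
  obtain \<mu> where \<mu>: "\<mu> \<in> bmeas (F i)" "\<And>\<omega>. \<mu> \<omega> \<le> U \<phi>"
    "(\<integral>\<omega>. G \<omega> * \<mu> \<omega> \<partial>M) = (\<integral>\<omega>. G \<omega> * \<phi> (Z i \<omega>) \<partial>M)"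
    using conditional_expectation[OF \<phi>, of "- U (\<lambda>x. - \<phi> x)" "U \<phi>" i] G(1) by auto
  have "(\<integral>\<omega>. G \<omega> * \<mu> \<omega> \<partial>M) \<le> (\<integral>\<omega>. G \<omega> * U \<phi> \<partial>M)"
    using G \<mu> by (intro integral_mono bmeas_F_integrable[of _ i] bmeas_mult mult_left_mono) auto
  also have "\<dots> = U \<phi> * (\<integral>\<omega>. G \<omega> \<partial>M)" by simp
  finally show ?thesis using \<mu>(3) by simp
qed

definition \<beta> :: "nat \<Rightarrow> real" where
  "\<beta> i = b (Suc i) + C0 / b (Suc i)"

text \<open>Monotonicity of \<open>b\<close> bounds \<open>\<beta> i\<close> by
  \<open>b N + C0 / b 1\<close> for all \<open>i < N\<close> at once. Then
  \<open>b N * tt N = \<alpha> N * sqrt N\<close> is small because \<open>\<alpha>\<close> tends to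
  \<open>0\<close>, and the constant part because \<open>tt N / sqrt N\<close> does.\<close>

lemma \<beta>_small:
  assumes "0 < \<delta>"
  shows "\<forall>\<^sub>F N in sequentially. \<forall>i<N. \<beta> i * tt N \<le> \<delta> * sqrt (real N)"
proof -
  have "0 < \<delta> / 2" "0 < \<delta> / 2 / (C0 / b 1)" using assms C0(1) b_pos[of 0] by auto
  then have "\<forall>\<^sub>F N in sequentially. \<alpha> N < \<delta> / 2"
    "\<forall>\<^sub>F N in sequentially. tt N / sqrt (real N) < \<delta> / 2 / (C0 / b 1)"
    using order_tendstoD(2)[OF \<alpha>_lim] order_tendstoD(2)[OF tt_over_sqrt] by blast+
  then show ?thesis using eventually_gt_at_top[of 0]
  proof eventually_elim
    case (elim N)
    show ?case
    proof (intro allI impI)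
      fix i assume "i < N"
      then have "\<beta> i \<le> b N + C0 / b 1"
        unfolding \<beta>_def using C0(1) b_pos[of 0] b_le[of 1 "Suc i"]
        by (intro add_mono b_le divide_left_mono mult_pos_pos b_pos) auto
      then have "\<beta> i * tt N \<le> (b N + C0 / b 1) * tt N"
        using tt_pos[of N] by (intro mult_right_mono) auto
      also have "\<dots> = \<alpha> N * sqrt (real N) + C0 / b 1 * tt N"
        using tt_pos[of N] by (simp add: b[of N] distrib_right)
      also have "\<dots> \<le> \<delta> / 2 * sqrt (real N) + \<delta> / 2 * sqrt (real N)"
      proof (intro add_mono mult_right_mono)
        have "0 < C0 / b 1" using C0(1) b_pos[of 0] by simp
        then have "C0 / b 1 * (tt N / sqrt (real N)) \<le> C0 / b 1 * (\<delta> / 2 / (C0 / b 1))"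
          using elim by (intro mult_left_mono) auto
        also have "\<dots> = \<delta> / 2" using \<open>0 < C0 / b 1\<close> by (metis less_irrefl nonzero_mult_div_cancel_left times_divide_eq_right)
        finally have "C0 / b 1 * tt N / sqrt (real N) \<le> \<delta> / 2" by simp
        then show "C0 / b 1 * tt N \<le> \<delta> / 2 * sqrt (real N)"
          using elim by (simp only: pos_divide_le_eq[of "sqrt (real N)"] real_sqrt_gt_0_iff of_nat_0_less_iff)
      qed (use elim in auto)
      finally show "\<beta> i * tt N \<le> \<delta> * sqrt (real N)" by simp
    qed
  qed
qed

lemma C0_over_b_lim: "(\<lambda>i. C0 / b (Suc i)) \<longlonglongrightarrow> 0"
  by (intro tendsto_divide_0[OF tendsto_const] filterlim_at_top_imp_at_infinity
      filterlim_compose[OF b_lim filterlim_Suc])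

end

text \<open>
  \<open>\<mu> i\<close> and \<open>\<kappa> i\<close> are the conditional means of the variable truncated at \<open>b\<close> and at \<open>\<gamma>\<close>.
  The truncation at \<open>b\<close> gives the martingale differences \<open>d\<close> that carry the law of the iterated
  logarithm; the part between \<open>b\<close> and \<open>\<gamma>\<close>, centred, gives the negligible differences \<open>r\<close>.
\<close>

locale lil_decomposition = lil_sequence +
  fixes \<mu> \<kappa> :: "nat \<Rightarrow> 'a \<Rightarrow> real"
  assumes \<mu>_bmeas: "\<And>i. \<mu> i \<in> bmeas (F i)" and \<kappa>_bmeas: "\<And>i. \<kappa> i \<in> bmeas (F i)"
    and \<mu>_le: "\<And>i \<omega>. \<bar>\<mu> i \<omega>\<bar> \<le> C0 / b (Suc i)" and \<kappa>_le: "\<And>i \<omega>. \<bar>\<kappa> i \<omega>\<bar> \<le> C0 / \<gamma> (Suc i)"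
    and \<mu>: "\<And>i G. G \<in> bmeas (F i) \<Longrightarrow> (\<integral>\<omega>. G \<omega> * \<mu> i \<omega> \<partial>M) = (\<integral>\<omega>. G \<omega> * clip (b (Suc i)) (Z i \<omega>) \<partial>M)"
    and \<kappa>: "\<And>i G. G \<in> bmeas (F i) \<Longrightarrow> (\<integral>\<omega>. G \<omega> * \<kappa> i \<omega> \<partial>M) = (\<integral>\<omega>. G \<omega> * clip (\<gamma> (Suc i)) (Z i \<omega>) \<partial>M)"
begin

definition X :: "nat \<Rightarrow> 'a \<Rightarrow> real" where
  "X i \<omega> = clip (b (Suc i)) (Z i \<omega>)"

definition d :: "nat \<Rightarrow> 'a \<Rightarrow> real" where
  "d i \<omega> = X i \<omega> - \<mu> i \<omega>"

definition \<rho> :: "nat \<Rightarrow> real \<Rightarrow> real" where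
  "\<rho> i x = clip (\<gamma> (Suc i)) x - clip (b (Suc i)) x"

definition r :: "nat \<Rightarrow> 'a \<Rightarrow> real" where
  "r i \<omega> = \<rho> i (Z i \<omega>) - (\<kappa> i \<omega> - \<mu> i \<omega>)"

lemma blip_X: "blip (clip (b (Suc i)))" and blip_\<gamma>: "blip (clip (\<gamma> (Suc i)))"
  using b_pos \<gamma>_pos by (auto intro!: blip_clip less_imp_le)

lemma blip_\<rho>: "blip (\<rho> i)"
  unfolding \<rho>_def[abs_def] by (intro blip_diff blip_X blip_\<gamma>)

lemma X_bmeas: "X i \<in> bmeas (F (Suc i))"
  unfolding X_def[abs_def] by (rule blip_bmeas[OF blip_X])

lemma \<mu>_bmeas_Suc: "\<mu> i \<in> bmeas (F (Suc i))" and \<kappa>_bmeas_Suc: "\<kappa> i \<in> bmeas (F (Suc i))"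
  using \<mu>_bmeas \<kappa>_bmeas by (auto intro: bmeas_F_mono[of i "Suc i"])

sublocale d: martingale_differences M F d
proof
  fix i
  show "d i \<in> bmeas (F (Suc i))"
    unfolding d_def[abs_def] by (intro bmeas_diff X_bmeas \<mu>_bmeas_Suc)
  fix G assume G: "G \<in> bmeas (F i)"
  then have G': "G \<in> bmeas (F (Suc i))" by (rule bmeas_F_mono[rotated]) simp
  have "(\<integral>\<omega>. G \<omega> * d i \<omega> \<partial>M) = (\<integral>\<omega>. G \<omega> * X i \<omega> - G \<omega> * \<mu> i \<omega> \<partial>M)"
    by (simp add: d_def right_diff_distrib)
  also have "\<dots> = (\<integral>\<omega>. G \<omega> * X i \<omega> \<partial>M) - (\<integral>\<omega>. G \<omega> * \<mu> i \<omega> \<partial>M)"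
    using G' X_bmeas \<mu>_bmeas_Suc
    by (intro Bochner_Integration.integral_diff bmeas_F_integrable[of _ "Suc i"] bmeas_mult) auto
  finally show "(\<integral>\<omega>. G \<omega> * d i \<omega> \<partial>M) = 0" using \<mu>[OF G] by (simp add: X_def)
qed

lemma \<kappa>_\<mu>:
  assumes G: "G \<in> bmeas (F i)"
  shows "(\<integral>\<omega>. G \<omega> * (\<kappa> i \<omega> - \<mu> i \<omega>) \<partial>M) = (\<integral>\<omega>. G \<omega> * \<rho> i (Z i \<omega>) \<partial>M)"
proof -
  have G': "G \<in> bmeas (F (Suc i))" using G by (rule bmeas_F_mono[rotated]) simp
  have "integrable M (\<lambda>\<omega>. G \<omega> * \<kappa> i \<omega>)" "integrable M (\<lambda>\<omega>. G \<omega> * \<mu> i \<omega>)"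
    "integrable M (\<lambda>\<omega>. G \<omega> * clip (b (Suc i)) (Z i \<omega>))" "integrable M (\<lambda>\<omega>. G \<omega> * clip (\<gamma> (Suc i)) (Z i \<omega>))"
    using G' \<mu>_bmeas_Suc \<kappa>_bmeas_Suc blip_bmeas[OF blip_X] blip_bmeas[OF blip_\<gamma>]
    by (auto intro!: bmeas_F_integrable[of _ "Suc i"])
  then show ?thesis using \<mu>[OF G] \<kappa>[OF G] by (simp add: \<rho>_def right_diff_distrib)
qed

sublocale r: martingale_differences M F r
proof
  fix i
  show "r i \<in> bmeas (F (Suc i))"
    unfolding r_def[abs_def] by (intro bmeas_diff blip_bmeas[OF blip_\<rho>] \<mu>_bmeas_Suc \<kappa>_bmeas_Suc)
  fix G assume G: "G \<in> bmeas (F i)"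
  then have G': "G \<in> bmeas (F (Suc i))" by (rule bmeas_F_mono[rotated]) simp
  have "(\<integral>\<omega>. G \<omega> * r i \<omega> \<partial>M) = (\<integral>\<omega>. G \<omega> * \<rho> i (Z i \<omega>) - G \<omega> * (\<kappa> i \<omega> - \<mu> i \<omega>) \<partial>M)"
    by (simp add: r_def right_diff_distrib)
  also have "\<dots> = (\<integral>\<omega>. G \<omega> * \<rho> i (Z i \<omega>) \<partial>M) - (\<integral>\<omega>. G \<omega> * (\<kappa> i \<omega> - \<mu> i \<omega>) \<partial>M)"
    using G' blip_bmeas[OF blip_\<rho>] \<mu>_bmeas_Suc \<kappa>_bmeas_Suc
    by (intro Bochner_Integration.integral_diff bmeas_F_integrable[of _ "Suc i"] bmeas_mult bmeas_diff) auto
  finally show "(\<integral>\<omega>. G \<omega> * r i \<omega> \<partial>M) = 0" using \<kappa>_\<mu>[OF G] by simp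
qed

lemma d_variance:
  assumes "G \<in> bmeas (F i)"
  shows "(\<integral>\<omega>. G \<omega> * (d i \<omega>)\<^sup>2 \<partial>M) = (\<integral>\<omega>. G \<omega> * (clip (b (Suc i)) (Z i \<omega>))\<^sup>2 \<partial>M) - (\<integral>\<omega>. G \<omega> * (\<mu> i \<omega>)\<^sup>2 \<partial>M)"
  using conditional_variance[OF X_bmeas \<mu>_bmeas _ assms] \<mu> by (simp add: d_def X_def)

lemma d_sq_le: "d.cond_sq_le i C0"
  unfolding d.cond_sq_le_def
proof (intro ballI impI)
  fix G assume G: "G \<in> bmeas (F i)" "\<forall>\<omega>. 0 \<le> G \<omega>"
  have "0 \<le> (\<integral>\<omega>. G \<omega> * (\<mu> i \<omega>)\<^sup>2 \<partial>M)" using G by simp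
  then have "(\<integral>\<omega>. G \<omega> * (d i \<omega>)\<^sup>2 \<partial>M) \<le> (\<integral>\<omega>. G \<omega> * (clip (b (Suc i)) (Z i \<omega>))\<^sup>2 \<partial>M)"
    using d_variance[OF G(1)] by simp
  also have "\<dots> \<le> U (\<lambda>x. (clip (b (Suc i)) x)\<^sup>2) * (\<integral>\<omega>. G \<omega> \<partial>M)"
    using G b_pos[of i] by (intro weighted_le blip_clip_sq) auto
  also have "\<dots> \<le> C0 * (\<integral>\<omega>. G \<omega> \<partial>M)"
    using C0(2)[of "b (Suc i)"] b_pos[of i] G by (intro mult_right_mono) auto
  finally show "(\<integral>\<omega>. G \<omega> * (d i \<omega>)\<^sup>2 \<partial>M) \<le> C0 * (\<integral>\<omega>. G \<omega> \<partial>M)" .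
qed

text \<open>The truncated second moment is at least \<open>c0\<close> once \<open>b\<close> exceeds
  \<open>c1\<close>. Centring subtracts the square of a conditional mean of size
  \<open>C0 / b\<close>, eventually below \<open>c0 / 2\<close>.\<close>

lemma d_sq_ge: "\<forall>\<^sub>F i in sequentially. d.cond_sq_ge i (c0 / 2)"
proof -
  have "(\<lambda>i. (C0 / b (Suc i))\<^sup>2) \<longlonglongrightarrow> 0\<^sup>2" by (intro tendsto_intros C0_over_b_lim)
  then have "\<forall>\<^sub>F i in sequentially. (C0 / b (Suc i))\<^sup>2 < c0 / 2"
    using order_tendstoD(2)[of _ _ _ "c0 / 2"] c0(1) by fastforce
  moreover have "\<forall>\<^sub>F i in sequentially. c1 \<le> b (Suc i)"
    using filterlim_compose[OF b_lim filterlim_Suc] by (simp add: filterlim_at_top)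
  ultimately show ?thesis
  proof eventually_elim
    case (elim i)
    show ?case
      unfolding d.cond_sq_ge_def
    proof (intro ballI impI)
      fix G assume G: "G \<in> bmeas (F i)" "\<forall>\<omega>. 0 \<le> G \<omega>"
      have I: "0 \<le> (\<integral>\<omega>. G \<omega> \<partial>M)" using G by simp
      have "(\<integral>\<omega>. G \<omega> * - (clip (b (Suc i)) (Z i \<omega>))\<^sup>2 \<partial>M) \<le> U (\<lambda>x. - (clip (b (Suc i)) x)\<^sup>2) * (\<integral>\<omega>. G \<omega> \<partial>M)"
        using G b_pos[of i] by (intro weighted_le blip_uminus blip_clip_sq) auto
      also have "\<dots> \<le> - c0 * (\<integral>\<omega>. G \<omega> \<partial>M)"
        using c0(2)[of "b (Suc i)"] elim I by (intro mult_right_mono) auto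
      finally have 1: "c0 * (\<integral>\<omega>. G \<omega> \<partial>M) \<le> (\<integral>\<omega>. G \<omega> * (clip (b (Suc i)) (Z i \<omega>))\<^sup>2 \<partial>M)" by simp
      have "(\<integral>\<omega>. G \<omega> * (\<mu> i \<omega>)\<^sup>2 \<partial>M) \<le> (\<integral>\<omega>. G \<omega> * (c0 / 2) \<partial>M)"
      proof (intro integral_mono bmeas_F_integrable[of _ i] bmeas_mult bmeas_power \<mu>_bmeas G(1) bmeas_const)
        fix \<omega>
        have "\<bar>\<mu> i \<omega>\<bar>\<^sup>2 \<le> (C0 / b (Suc i))\<^sup>2" using \<mu>_le by (intro power_mono) auto
        then show "G \<omega> * (\<mu> i \<omega>)\<^sup>2 \<le> G \<omega> * (c0 / 2)" using G elim by (intro mult_left_mono) auto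
      qed
      then have "(\<integral>\<omega>. G \<omega> * (\<mu> i \<omega>)\<^sup>2 \<partial>M) \<le> c0 / 2 * (\<integral>\<omega>. G \<omega> \<partial>M)" by (simp add: mult.commute)
      then show "c0 / 2 * (\<integral>\<omega>. G \<omega> \<partial>M) \<le> (\<integral>\<omega>. G \<omega> * (d i \<omega>)\<^sup>2 \<partial>M)"
        using 1 d_variance[OF G(1)] by simp
    qed
  qed
qed

lemma d_le: "\<bar>d i \<omega>\<bar> \<le> \<beta> i"
  using abs_clip_le[of "b (Suc i)" "Z i \<omega>"] b_pos[of i] \<mu>_le[of i \<omega>]
  by (simp add: d_def X_def \<beta>_def)

lemma bounded_d: "\<exists>n0. bounded_martingale_differences M F d \<beta> (c0 / 2) C0 n0"
proof -
  obtain n0 where n0: "\<And>n. n0 \<le> n \<Longrightarrow> d.cond_sq_ge n (c0 / 2)"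
    using d_sq_ge by (auto simp: eventually_sequentially)
  have "bounded_martingale_differences M F d \<beta> (c0 / 2) C0 n0"
    by unfold_locales (use c0(1) n0 d_sq_le d_le \<beta>_small in auto)
  then show ?thesis by blast
qed

lemma eventually_b_large: "\<exists>k0\<ge>1. \<forall>k\<ge>k0. 2 \<le> b (4 ^ k) \<and> 2 ^ k \<le> b (4 ^ k) * \<tau> k ^ 3 \<and> (\<forall>j\<ge>4 ^ k. b j \<le> \<gamma> j)"
proof -
  have "\<forall>\<^sub>F k in sequentially. 2 \<le> b (4 ^ k)"
    using eventually_pow[of "\<lambda>j. 2 \<le> b j" 4] b_lim by (simp add: filterlim_at_top)
  moreover have "\<forall>\<^sub>F k in sequentially. 1 \<le> \<alpha> (4 ^ k) * (\<tau> k)\<^sup>2"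
    using eventually_pow[OF \<alpha>_ge, of 4] by simp
  moreover have "\<forall>\<^sub>F j in sequentially. \<alpha> j < 1"
    using order_tendstoD(2)[OF \<alpha>_lim, of 1] by simp
  then have "\<forall>\<^sub>F k in sequentially. \<forall>j\<ge>4 ^ k. \<alpha> j < 1"
    by (intro eventually_pow[OF eventually_all_ge_at_top]) auto
  ultimately have "\<forall>\<^sub>F k in sequentially. 2 \<le> b (4 ^ k) \<and> 2 ^ k \<le> b (4 ^ k) * \<tau> k ^ 3 \<and> (\<forall>j\<ge>4 ^ k. b j \<le> \<gamma> j)"
  proof eventually_elim
    case (elim k)
    have sq: "sqrt (4 ^ k) = (2::real) ^ k" by (metis real_sqrt_four real_sqrt_power)
    have "b (4 ^ k) * \<tau> k ^ 3 = \<alpha> (4 ^ k) * (\<tau> k)\<^sup>2 * 2 ^ k"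
      using tt_pos[of "4 ^ k"] by (simp add: b sq power2_eq_square power3_eq_cube)
    then have "2 ^ k \<le> b (4 ^ k) * \<tau> k ^ 3"
      using mult_right_mono[OF elim(2), of "2 ^ k"] by simp
    moreover have "b j \<le> \<gamma> j" if "4 ^ k \<le> j" for j
    proof -
      have "0 < j" using that by (metis gr0I le_zero_eq power_not_zero zero_neq_numeral)
      have "b j \<le> 1 * sqrt (real j) / tt j"
        unfolding b using elim(3) that tt_pos[of j] by (intro divide_right_mono mult_right_mono) auto
      also have "\<dots> \<le> sqrt (real j) * tt j"
      proof -
        have "sqrt (real j) * 1 \<le> sqrt (real j) * (tt j * tt j)"
          using tt_ge_1[of j] mult_mono[of 1 "tt j" 1 "tt j"] by (intro mult_left_mono) auto
        then show ?thesis using tt_pos[of j] by (simp add: field_simps)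
      qed
      finally show ?thesis by (simp add: \<gamma>_def)
    qed
    ultimately show ?case using elim by blast
  qed
  then obtain k1 where "\<And>k. k1 \<le> k \<Longrightarrow> 2 \<le> b (4 ^ k) \<and> 2 ^ k \<le> b (4 ^ k) * \<tau> k ^ 3 \<and> (\<forall>j\<ge>4 ^ k. b j \<le> \<gamma> j)"
    by (auto simp: eventually_sequentially)
  then show ?thesis by (intro exI[of _ "max 1 k1"]) auto
qed

lemma \<gamma>_4: "\<gamma> (4 ^ k) = 2 ^ k * \<tau> k"
proof -
  have "sqrt (4 ^ k) = (2::real) ^ k" by (metis real_sqrt_four real_sqrt_power)
  then show ?thesis by (simp add: \<gamma>_def)
qed

text \<open>If \<open>\<rho> i x\<close> is not \<open>0\<close>, then \<open>\<bar>x\<bar>\<close>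
  exceeds \<open>b\<close>, and \<open>z\<close>, the value of \<open>\<bar>x\<bar>\<close> cut at
  \<open>\<gamma>\<close>, has a dyadic size \<open>n\<close> in the band. There
  \<open>ramp n x = 1\<close> and \<open>\<bar>\<rho> i x\<bar> \<le> 2 ^ (n + 2)\<close>, so a
  single term already dominates.\<close>

lemma \<rho>_band:
  assumes k: "k0 \<le> k" "2 \<le> b (4 ^ k)" "\<forall>j\<ge>4 ^ k. b j \<le> \<gamma> j" and i: "4 ^ k \<le> i" "i < 4 ^ Suc k"
  shows "(\<rho> i x)\<^sup>2 \<le> (\<Sum>n\<in>band (\<lambda>k. b (4 ^ k)) k0 k. 4 ^ (n + 2) * ramp n x)"
    "(\<rho> i x) ^ 4 \<le> (\<Sum>n\<in>band (\<lambda>k. b (4 ^ k)) k0 k. 16 ^ (n + 2) * ramp n x)"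
proof -
  let ?B = "band (\<lambda>k. b (4 ^ k)) k0 k"
  have b\<gamma>: "b (Suc i) \<le> \<gamma> (Suc i)" using k(3) i by simp
  have "(\<rho> i x)\<^sup>2 \<le> (\<Sum>n\<in>?B. 4 ^ (n + 2) * ramp n x) \<and> (\<rho> i x) ^ 4 \<le> (\<Sum>n\<in>?B. 16 ^ (n + 2) * ramp n x)"
  proof (cases "\<bar>x\<bar> \<le> b (Suc i)")
    case True
    then have "\<rho> i x = 0" using b\<gamma> by (auto simp: \<rho>_def clip_def)
    then show ?thesis by (auto intro!: sum_nonneg mult_nonneg_nonneg ramp_nonneg)
  next
    case False
    define z where "z = min \<bar>x\<bar> (\<gamma> (Suc i))"
    have "b (4 ^ k) \<le> b (Suc i)" using i by (intro b_le) auto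
    then have bz: "b (4 ^ k) \<le> z" using False b\<gamma> by (simp add: z_def)
    have "z \<le> \<gamma> (4 ^ Suc k)" using \<gamma>_mono[of "Suc i" "4 ^ Suc k"] i by (simp add: z_def)
    then have z\<gamma>: "z \<le> 2 ^ Suc k * \<tau> (Suc k)" by (simp only: \<gamma>_4)
    obtain n where n: "2 ^ Suc n \<le> z" "z < 2 ^ (n + 2)" using dyadic_size[of z] bz k(2) by auto
    have nB: "n \<in> ?B" using n bz z\<gamma> k(1) by (auto simp: band_def)
    have rn: "ramp n x = 1" using n(1) by (intro ramp_eq_1) (simp add: z_def)
    have "\<bar>\<rho> i x\<bar> \<le> z"
      using b_pos[of i] b\<gamma> False by (auto simp: \<rho>_def clip_def z_def)
    then have \<rho>: "\<bar>\<rho> i x\<bar> \<le> 2 ^ (n + 2)" using n by linarith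
    have four: "((2::real) ^ (n + 2)) ^ 4 = 16 ^ (n + 2)"
      by (subst power_mult[symmetric], subst mult.commute, subst power_mult) simp
    have "(\<rho> i x)\<^sup>2 \<le> (2 ^ (n + 2))\<^sup>2" using power_mono[OF \<rho>, of 2] by simp
    also have "\<dots> = 4 ^ (n + 2) * ramp n x" by (simp only: two_power_sq rn mult_1_right)
    also have "\<dots> \<le> (\<Sum>n\<in>?B. 4 ^ (n + 2) * ramp n x)"
      using nB by (intro member_le_sum finite_band mult_nonneg_nonneg ramp_nonneg) auto
    finally have 2: "(\<rho> i x)\<^sup>2 \<le> (\<Sum>n\<in>?B. 4 ^ (n + 2) * ramp n x)" .
    have "(\<rho> i x) ^ 4 \<le> (2 ^ (n + 2)) ^ 4" using power_mono[OF \<rho>, of 4] by simp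
    also have "\<dots> = 16 ^ (n + 2) * ramp n x" by (simp only: four rn mult_1_right)
    also have "\<dots> \<le> (\<Sum>n\<in>?B. 16 ^ (n + 2) * ramp n x)"
      using nB by (intro member_le_sum finite_band mult_nonneg_nonneg ramp_nonneg) auto
    finally show ?thesis using 2 by blast
  qed
  then show "(\<rho> i x)\<^sup>2 \<le> (\<Sum>n\<in>?B. 4 ^ (n + 2) * ramp n x)" "(\<rho> i x) ^ 4 \<le> (\<Sum>n\<in>?B. 16 ^ (n + 2) * ramp n x)"
    by blast+
qed

lemma weighted_ramp_sum_le:
  assumes G: "G \<in> bmeas (F i)" "\<And>\<omega>. 0 \<le> G \<omega>" and f: "f \<in> bmeas (F (Suc i))"
    and le: "\<And>\<omega>. f \<omega> \<le> (\<Sum>n\<in>B. w n * ramp n (Z i \<omega>))" and w: "\<And>n. 0 \<le> w n"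
  shows "(\<integral>\<omega>. G \<omega> * f \<omega> \<partial>M) \<le> (\<Sum>n\<in>B. w n * U (ramp n)) * (\<integral>\<omega>. G \<omega> \<partial>M)"
proof -
  have G': "G \<in> bmeas (F (Suc i))" using G(1) by (rule bmeas_F_mono[rotated]) simp
  have R: "(\<lambda>\<omega>. G \<omega> * ramp n (Z i \<omega>)) \<in> bmeas (F (Suc i))" for n
    using G' blip_bmeas[OF blip_ramp] by (intro bmeas_mult)
  have "(\<integral>\<omega>. G \<omega> * f \<omega> \<partial>M) \<le> (\<integral>\<omega>. (\<Sum>n\<in>B. w n * (G \<omega> * ramp n (Z i \<omega>))) \<partial>M)"
  proof (rule integral_mono)
    show "integrable M (\<lambda>\<omega>. G \<omega> * f \<omega>)" using G' f by (intro bmeas_F_integrable[of _ "Suc i"] bmeas_mult)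
    show "integrable M (\<lambda>\<omega>. \<Sum>n\<in>B. w n * (G \<omega> * ramp n (Z i \<omega>)))"
      using R by (intro bmeas_F_integrable[of _ "Suc i"] bmeas_sum bmeas_cmult)
    fix \<omega>
    show "G \<omega> * f \<omega> \<le> (\<Sum>n\<in>B. w n * (G \<omega> * ramp n (Z i \<omega>)))"
      using mult_left_mono[OF le[of \<omega>] G(2)[of \<omega>]] by (simp add: sum_distrib_left mult_ac)
  qed
  also have "\<dots> = (\<Sum>n\<in>B. w n * (\<integral>\<omega>. G \<omega> * ramp n (Z i \<omega>) \<partial>M))"
    using bmeas_F_integrable[OF R] by simp
  also have "\<dots> \<le> (\<Sum>n\<in>B. w n * (U (ramp n) * (\<integral>\<omega>. G \<omega> \<partial>M)))"
    using G w by (intro sum_mono mult_left_mono weighted_le blip_ramp) auto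
  finally show ?thesis by (simp add: sum_distrib_right mult.assoc)
qed

lemma r_negligible:
  assumes \<epsilon>: "0 < \<epsilon>"
  shows "AE \<omega> in M. \<forall>\<^sub>F n in sequentially. \<bar>\<Sum>i<n. r i \<omega>\<bar> \<le> \<epsilon> * (sqrt (real n) * tt n)"
proof -
  obtain k0 where k0: "1 \<le> k0" "\<And>k. k0 \<le> k \<Longrightarrow> 2 \<le> b (4 ^ k)" "\<And>k. k0 \<le> k \<Longrightarrow> 2 ^ k \<le> b (4 ^ k) * \<tau> k ^ 3"
    "\<And>k. k0 \<le> k \<Longrightarrow> \<forall>j\<ge>4 ^ k. b j \<le> \<gamma> j"
    using eventually_b_large by blast
  let ?B = "band (\<lambda>k. b (4 ^ k)) k0"
  define v where "v k = (\<Sum>n\<in>?B k. 4 ^ (n + 2) * U (ramp n))" for k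
  define w where "w k = (\<Sum>n\<in>?B k. 16 ^ (n + 2) * U (ramp n))" for k
  have v0: "0 \<le> v k" "0 \<le> w k" for k
    unfolding v_def w_def using ramp(1) by (auto intro!: sum_nonneg)
  \<comment> \<open>\<open>v k\<close> becomes summable only after division by
    \<open>\<tau> k ^ 4\<close> and need not be bounded in \<open>k\<close>. Capping it with the
    variance bound supplies the uniform constant that \<open>negligible_sum\<close> asks for; the
    factor \<open>16\<close> at \<open>w\<close> is the price of centring.\<close>
  have "AE \<omega> in M. \<forall>\<^sub>F n in sequentially. \<bar>r.D n \<omega>\<bar> \<le> \<epsilon> * (sqrt (real n) * tt n)"
  proof (rule r.negligible_sum[where v = "\<lambda>k. min (v k) (4 * C0)" and w = "\<lambda>k. 16 * w k" and C = "4 * C0" and K = k0])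
    show "summable (\<lambda>k. min (v k) (4 * C0) / \<tau> k ^ 4)"
    proof (rule summable_comparison_test)
      show "summable (\<lambda>k. v k / \<tau> k ^ 4)"
        unfolding v_def by (rule band_second_moment[OF _ ramp]) (rule k0(3))
      show "\<exists>N. \<forall>k\<ge>N. norm (min (v k) (4 * C0) / \<tau> k ^ 4) \<le> v k / \<tau> k ^ 4"
        using v0 C0(1) tt_pos by (auto intro!: divide_right_mono simp: less_imp_le min_def)
    qed
    have "summable (\<lambda>k. 16 * (w k / (4 ^ k * \<tau> k ^ 4)))"
      unfolding w_def by (intro summable_mult band_fourth_moment[OF ramp])
    then show "summable (\<lambda>k. 16 * w k / (4 ^ k * \<tau> k ^ 4))" by simp
    show "0 \<le> min (v k) (4 * C0)" for k using v0 C0(1) by simp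
    show "min (v k) (4 * C0) \<le> 4 * C0" for k by simp
    fix k i :: nat assume k: "k0 \<le> k" and i: "4 ^ k \<le> i" "i < 4 ^ Suc k"
    note band = \<rho>_band[OF k k0(2,4)[OF k] i]
    have \<rho>Z: "(\<lambda>\<omega>. \<rho> i (Z i \<omega>)) \<in> bmeas (F (Suc i))" by (rule blip_bmeas[OF blip_\<rho>])
    have \<kappa>\<mu>: "(\<lambda>\<omega>. \<kappa> i \<omega> - \<mu> i \<omega>) \<in> bmeas (F i)" by (intro bmeas_diff \<kappa>_bmeas \<mu>_bmeas)
    show "r.cond_sq_le i (min (v k) (4 * C0))"
      unfolding r.cond_sq_le_def
    proof (intro ballI impI)
      fix G assume G: "G \<in> bmeas (F i)" "\<forall>\<omega>. 0 \<le> G \<omega>"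
      have G': "G \<in> bmeas (F (Suc i))" using G(1) by (rule bmeas_F_mono[rotated]) simp
      have I: "0 \<le> (\<integral>\<omega>. G \<omega> \<partial>M)" using G by simp
      have "0 \<le> (\<integral>\<omega>. G \<omega> * (\<kappa> i \<omega> - \<mu> i \<omega>)\<^sup>2 \<partial>M)" using G by simp
      then have le: "(\<integral>\<omega>. G \<omega> * (r i \<omega>)\<^sup>2 \<partial>M) \<le> (\<integral>\<omega>. G \<omega> * (\<rho> i (Z i \<omega>))\<^sup>2 \<partial>M)"
        using conditional_variance[OF \<rho>Z \<kappa>\<mu> \<kappa>_\<mu> G(1)] by (simp add: r_def)
      have "(\<integral>\<omega>. G \<omega> * (\<rho> i (Z i \<omega>))\<^sup>2 \<partial>M) \<le> v k * (\<integral>\<omega>. G \<omega> \<partial>M)"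
        unfolding v_def using G band(1) \<rho>Z by (intro weighted_ramp_sum_le bmeas_power) auto
      moreover have "(\<integral>\<omega>. G \<omega> * (\<rho> i (Z i \<omega>))\<^sup>2 \<partial>M) \<le> 4 * C0 * (\<integral>\<omega>. G \<omega> \<partial>M)"
      proof -
        have bl: "blip (\<lambda>x. (clip (\<gamma> (Suc i)) x)\<^sup>2)" using \<gamma>_pos[of i] by (intro blip_clip_sq) auto
        have "(\<integral>\<omega>. G \<omega> * (\<rho> i (Z i \<omega>))\<^sup>2 \<partial>M) \<le> (\<integral>\<omega>. G \<omega> * (clip (\<gamma> (Suc i)) (Z i \<omega>))\<^sup>2 \<partial>M)"
        proof (rule integral_mono)
          show "integrable M (\<lambda>\<omega>. G \<omega> * (\<rho> i (Z i \<omega>))\<^sup>2)"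
            using G' \<rho>Z by (intro bmeas_F_integrable[of _ "Suc i"] bmeas_mult bmeas_power)
          show "integrable M (\<lambda>\<omega>. G \<omega> * (clip (\<gamma> (Suc i)) (Z i \<omega>))\<^sup>2)"
            using G' blip_bmeas[OF bl] by (intro bmeas_F_integrable[of _ "Suc i"] bmeas_mult)
          fix \<omega>
          have "b (Suc i) \<le> \<gamma> (Suc i)" using k0(4)[OF k] i by simp
          then have "\<bar>\<rho> i (Z i \<omega>)\<bar> \<le> \<bar>clip (\<gamma> (Suc i)) (Z i \<omega>)\<bar>"
            using b_pos[of i] by (auto simp: \<rho>_def clip_def)
          then have "(\<rho> i (Z i \<omega>))\<^sup>2 \<le> (clip (\<gamma> (Suc i)) (Z i \<omega>))\<^sup>2" by (simp add: abs_le_square_iff)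
          then show "G \<omega> * (\<rho> i (Z i \<omega>))\<^sup>2 \<le> G \<omega> * (clip (\<gamma> (Suc i)) (Z i \<omega>))\<^sup>2"
            using G by (intro mult_left_mono) auto
        qed
        also have "\<dots> \<le> U (\<lambda>x. (clip (\<gamma> (Suc i)) x)\<^sup>2) * (\<integral>\<omega>. G \<omega> \<partial>M)"
          using G by (intro weighted_le bl) auto
        also have "\<dots> \<le> C0 * (\<integral>\<omega>. G \<omega> \<partial>M)"
          using C0(2)[of "\<gamma> (Suc i)"] \<gamma>_pos[of i] I by (intro mult_right_mono) auto
        also have "\<dots> \<le> 4 * C0 * (\<integral>\<omega>. G \<omega> \<partial>M)" using C0(1) I by (intro mult_right_mono) auto
        finally show ?thesis .
      qed
      ultimately show "(\<integral>\<omega>. G \<omega> * (r i \<omega>)\<^sup>2 \<partial>M) \<le> min (v k) (4 * C0) * (\<integral>\<omega>. G \<omega> \<partial>M)"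
        using le by (auto simp: min_def)
    qed
    have "(\<integral>\<omega>. (r i \<omega>) ^ 4 \<partial>M) \<le> 16 * (\<integral>\<omega>. (\<rho> i (Z i \<omega>)) ^ 4 \<partial>M)"
      unfolding r_def by (rule conditional_fourth_moment[OF \<rho>Z \<kappa>\<mu> \<kappa>_\<mu>])
    also have "(\<integral>\<omega>. (\<rho> i (Z i \<omega>)) ^ 4 \<partial>M) \<le> w k"
    proof -
      have "(\<integral>\<omega>. 1 * (\<rho> i (Z i \<omega>)) ^ 4 \<partial>M) \<le> w k * (\<integral>\<omega>. 1 \<partial>M)"
        unfolding w_def using band(2) \<rho>Z by (intro weighted_ramp_sum_le bmeas_power) auto
      then show ?thesis by (simp add: prob_space)
    qed
    finally show "(\<integral>\<omega>. (r i \<omega>) ^ 4 \<partial>M) \<le> 16 * w k" by simp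
  qed (rule \<epsilon>)
  then show ?thesis by (simp add: r.D_def)
qed

text \<open>A union bound over the \<open>3 * 4 ^ k\<close> indices of a block, each exceedance
  having probability at most \<open>U (ramp n)\<close> with \<open>n\<close> the dyadic size of
  \<open>\<gamma> (4 ^ k)\<close>; \<open>tail_summable\<close> and Borel-Cantelli finish.\<close>

lemma AE_eventually_truncated: "AE \<omega> in M. \<forall>\<^sub>F i in sequentially. clip (\<gamma> (Suc i)) (Z i \<omega>) = Z i \<omega>"
proof -
  define P where "P k \<omega> \<longleftrightarrow> (\<exists>i\<in>{4 ^ k..<4 ^ Suc k}. \<gamma> (Suc i) < \<bar>Z i \<omega>\<bar>)" for k \<omega>
  have Z_M [measurable]: "Z i \<in> borel_measurable M" for i by (rule measurable_F_M[OF Z_meas])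
  define s where "s k = (\<Sum>n\<in>tail_index k. U (ramp n))" for k
  have s0: "0 \<le> s k" for k unfolding s_def using ramp(1) by (intro sum_nonneg)
  have "AE \<omega> in M. \<forall>\<^sub>F k in sequentially. \<not> P k \<omega>"
  proof (rule AE_eventually_of_summable)
    show "{\<omega> \<in> space M. P k \<omega>} \<in> events" for k unfolding P_def by measurable
    show "summable (\<lambda>k. 3 * (4 ^ k * s k))"
      unfolding s_def by (intro summable_mult tail_summable[OF ramp])
    show "\<forall>\<^sub>F k in sequentially. prob {\<omega> \<in> space M. P k \<omega>} \<le> 3 * (4 ^ k * s k)"
      using eventually_ge_at_top[of 1]
    proof eventually_elim
      case (elim k)
      have "(2::real) ^ 1 \<le> 2 ^ k" using elim by (intro power_increasing) auto
      then have "2 * 1 \<le> 2 ^ k * \<tau> k" using tt_ge_1[of "4 ^ k"] by (intro mult_mono) auto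
      then obtain n where n: "2 ^ Suc n \<le> 2 ^ k * \<tau> k" "2 ^ k * \<tau> k < 2 ^ (n + 2)"
        using dyadic_size[of "2 ^ k * \<tau> k"] by auto
      then have nK: "n \<in> tail_index k" by (simp add: tail_index_def)
      have "prob {\<omega> \<in> space M. \<gamma> (Suc i) < \<bar>Z i \<omega>\<bar>} \<le> s k" if i: "i \<in> {4 ^ k..<4 ^ Suc k}" for i
      proof -
        have "\<gamma> (4 ^ k) \<le> \<gamma> (Suc i)" using i by (intro \<gamma>_mono) auto
        then have g: "2 ^ Suc n \<le> \<gamma> (Suc i)" using n by (simp add: \<gamma>_4)
        have "prob {\<omega> \<in> space M. \<gamma> (Suc i) < \<bar>Z i \<omega>\<bar>} \<le> (\<integral>\<omega>. ramp n (Z i \<omega>) \<partial>M) / 1"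
        proof (rule markov_bmeas)
          show "(\<lambda>\<omega>. ramp n (Z i \<omega>)) \<in> bmeas M" by (rule bmeas_F_M[OF blip_bmeas[OF blip_ramp]])
          fix \<omega> assume "\<omega> \<in> {\<omega> \<in> space M. \<gamma> (Suc i) < \<bar>Z i \<omega>\<bar>}"
          then show "1 \<le> ramp n (Z i \<omega>)" using g ramp_eq_1[of n "Z i \<omega>"] by simp
        qed (auto simp: ramp_nonneg)
        also have "\<dots> \<le> U (ramp n)"
          using weighted_le[OF blip_ramp[of n], of "\<lambda>_. 1" i] by (simp add: prob_space)
        also have "\<dots> \<le> s k" unfolding s_def using nK ramp(1) by (intro member_le_sum finite_tail_index) auto
        finally show ?thesis .
      qed
      then have "(\<Sum>i\<in>{4 ^ k..<4 ^ Suc k}. prob {\<omega> \<in> space M. \<gamma> (Suc i) < \<bar>Z i \<omega>\<bar>})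
          \<le> (\<Sum>i\<in>{(4::nat) ^ k..<4 ^ Suc k}. s k)"
        by (rule sum_mono)
      also have "\<dots> = 3 * (4 ^ k * s k)" by (simp add: of_nat_diff)
      finally have le: "(\<Sum>i\<in>{4 ^ k..<4 ^ Suc k}. prob {\<omega> \<in> space M. \<gamma> (Suc i) < \<bar>Z i \<omega>\<bar>}) \<le> 3 * (4 ^ k * s k)" .
      have "{\<omega> \<in> space M. P k \<omega>} = (\<Union>i\<in>{4 ^ k..<4 ^ Suc k}. {\<omega> \<in> space M. \<gamma> (Suc i) < \<bar>Z i \<omega>\<bar>})"
        by (auto simp: P_def)
      then have "prob {\<omega> \<in> space M. P k \<omega>} \<le> (\<Sum>i\<in>{4 ^ k..<4 ^ Suc k}. prob {\<omega> \<in> space M. \<gamma> (Suc i) < \<bar>Z i \<omega>\<bar>})"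
        by (simp only:) (intro finite_measure_subadditive_finite, auto)
      then show ?case using le by linarith
    qed
  qed
  then show ?thesis
  proof eventually_elim
    case (elim \<omega>)
    show ?case
    proof (rule eventually_between_powers[of 4])
      show "\<forall>\<^sub>F k in sequentially. \<forall>i. 4 ^ k \<le> i \<longrightarrow> i < 4 ^ Suc k \<longrightarrow> clip (\<gamma> (Suc i)) (Z i \<omega>) = Z i \<omega>"
        using elim
      proof eventually_elim
        case (elim k)
        show ?case
        proof (intro allI impI)
          fix i :: nat assume "4 ^ k \<le> i" "i < 4 ^ Suc k"
          then have "\<bar>Z i \<omega>\<bar> \<le> \<gamma> (Suc i)" using elim unfolding P_def by (meson atLeastLessThan_iff not_le)
          then show "clip (\<gamma> (Suc i)) (Z i \<omega>) = Z i \<omega>" by (auto simp: clip_def)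
        qed
      qed
    qed simp
  qed
qed

end

section \<open>The cluster set under a representing measure\<close>

lemma tendsto_zeroI:
  fixes f :: "nat \<Rightarrow> real"
  assumes "\<And>e. 0 < e \<Longrightarrow> \<forall>\<^sub>F n in sequentially. \<bar>f n\<bar> \<le> e"
  shows "f \<longlonglongrightarrow> 0"
proof (rule tendstoI)
  fix e :: real assume "0 < e"
  then show "\<forall>\<^sub>F n in sequentially. dist (f n) 0 < e"
    using assms[of "e / 2"] by (auto elim!: eventually_mono)
qed

lemma tendsto_zeroD:
  fixes f :: "nat \<Rightarrow> real"
  assumes "f \<longlonglongrightarrow> 0" "0 < e"
  shows "\<forall>\<^sub>F n in sequentially. \<bar>f n\<bar> < e"
  using tendstoD[OF assms] by simp

lemma tt_ratio: "(\<lambda>n. tt n / tt (Suc n)) \<longlonglongrightarrow> 1"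
proof -
  have "(\<lambda>n. LL (real n) / LL (real (Suc n))) \<longlonglongrightarrow> 1"
  proof (rule tendsto_sandwich)
    show "(\<lambda>n. real n / real (Suc n)) \<longlonglongrightarrow> 1" by real_asymp
    show "\<forall>\<^sub>F n in sequentially. real n / real (Suc n) \<le> LL (real n) / LL (real (Suc n))"
      using eventually_gt_at_top[of 0]
    proof eventually_elim
      case (elim n)
      then have "LL (real (Suc n)) \<le> real (Suc n) / real n * LL (real n)" by (intro LL_ratio) auto
      then show ?case using elim LL_pos[of "real (Suc n)"] by (simp add: field_simps)
    qed
    show "\<forall>\<^sub>F n in sequentially. LL (real n) / LL (real (Suc n)) \<le> 1"
      using LL_mono[of "real _" "real (Suc _)"] LL_pos by (intro always_eventually allI) simp
  qed (rule tendsto_const)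
  then have "(\<lambda>n. sqrt (LL (real n) / LL (real (Suc n)))) \<longlonglongrightarrow> sqrt 1" by (intro tendsto_intros)
  moreover have "sqrt (LL (real n) / LL (real (Suc n))) = tt n / tt (Suc n)" for n
    by (simp add: tt_def real_sqrt_divide real_sqrt_mult)
  ultimately show ?thesis by simp
qed

text \<open>A deterministic transfer from \<open>y = D / (q * tt)\<close> to
  \<open>x = S / (w * tt)\<close>: the sequences differ by a null sequence because \<open>y\<close>
  is bounded and both \<open>q\<close> and \<open>w\<close> are at least of order
  \<open>sqrt n\<close>. Increments of \<open>y\<close> vanish since those of \<open>D\<close> do
  relative to \<open>q\<close>, which by \<open>q_Suc\<close> also forces
  \<open>q n / q (Suc n)\<close> to tend to \<open>1\<close>.\<close>

lemma self_normalized_cluster_set: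
  fixes S D q w :: "nat \<Rightarrow> real"
  assumes c: "0 < c" "\<forall>\<^sub>F n in sequentially. c * sqrt (real n) \<le> q n"
    and SD: "\<And>\<epsilon>. 0 < \<epsilon> \<Longrightarrow> \<forall>\<^sub>F n in sequentially. \<bar>S n - D n\<bar> \<le> \<epsilon> * (sqrt (real n) * tt n)"
    and wq: "\<And>\<epsilon>. 0 < \<epsilon> \<Longrightarrow> \<forall>\<^sub>F n in sequentially. \<bar>w n - q n\<bar> \<le> \<epsilon> * sqrt (real n)"
    and step: "\<And>\<epsilon>. 0 < \<epsilon> \<Longrightarrow> \<forall>\<^sub>F n in sequentially. \<bar>D (Suc n) - D n\<bar> \<le> \<epsilon> * sqrt (real n)"
    and q_Suc: "\<And>n. (q (Suc n))\<^sup>2 = (q n)\<^sup>2 + (D (Suc n) - D n)\<^sup>2" and q_nonneg: "\<And>n. 0 \<le> q n"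
    and up: "\<And>\<epsilon>. 0 < \<epsilon> \<Longrightarrow> \<forall>\<^sub>F n in sequentially. \<bar>D n\<bar> \<le> (1 + \<epsilon>) * tt n * q n"
    and hi: "\<And>\<epsilon>. 0 < \<epsilon> \<Longrightarrow> \<exists>\<^sub>\<infinity>n. (1 - \<epsilon>) * tt n * q n \<le> D n"
    and lo: "\<And>\<epsilon>. 0 < \<epsilon> \<Longrightarrow> \<exists>\<^sub>\<infinity>n. D n \<le> - ((1 - \<epsilon>) * tt n * q n)"
  shows "cluster_set (\<lambda>n. S n / (w n * tt n)) = {-1..1}"
proof -
  define x where "x n = S n / (w n * tt n)" for n
  define y where "y n = D n / (q n * tt n)" for n
  have q_pos: "\<forall>\<^sub>F n in sequentially. 0 < sqrt (real n) \<and> 0 < q n \<and> c * sqrt (real n) \<le> q n"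
    using c(2) eventually_gt_at_top[of 0]
  proof eventually_elim
    case (elim n)
    then have "0 < c * sqrt (real n)" using c(1) by simp
    then show ?case using elim by auto
  qed
  have w_ge: "\<forall>\<^sub>F n in sequentially. c / 2 * sqrt (real n) \<le> w n"
  proof -
    have "0 < c / 2" using c(1) by simp
    from wq[OF this] q_pos show ?thesis
    proof eventually_elim
      case (elim n)
      have "c * sqrt (real n) = 2 * (c / 2 * sqrt (real n))" by simp
      then show ?case using elim by linarith
    qed
  qed
  have y_up: "\<forall>\<^sub>F n in sequentially. \<bar>y n\<bar> \<le> 1 + e" if "0 < e" for e
    using q_pos up[OF that]
  proof eventually_elim
    case (elim n)
    then show ?case using tt_pos[of n] by (simp add: y_def abs_mult field_simps)
  qed
  have y_bdd: "Bfun y sequentially"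
    using y_up[of 1] by (intro BfunI[of _ 2]) auto
  have xy: "(\<lambda>n. x n - y n) \<longlonglongrightarrow> 0"
  proof -
    have 1: "(\<lambda>n. (S n - D n) / (w n * tt n)) \<longlonglongrightarrow> 0"
    proof (rule tendsto_zeroI)
      fix e :: real assume "0 < e"
      then have "0 < e * (c / 2)" using c by simp
      from SD[OF this] w_ge q_pos show "\<forall>\<^sub>F n in sequentially. \<bar>(S n - D n) / (w n * tt n)\<bar> \<le> e"
      proof eventually_elim
        case (elim n)
        have "0 < c / 2 * sqrt (real n)" using elim c by simp
        then have w0: "0 < w n" using elim by linarith
        have "\<bar>S n - D n\<bar> \<le> e * (c / 2 * sqrt (real n) * tt n)" using elim by (simp add: mult_ac)
        also have "\<dots> \<le> e * (w n * tt n)"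
          using elim \<open>0 < e\<close> tt_pos[of n] by (intro mult_left_mono mult_right_mono) auto
        finally show ?case using w0 tt_pos[of n] by (simp add: abs_mult field_simps)
      qed
    qed
    have 2: "(\<lambda>n. (q n - w n) / w n) \<longlonglongrightarrow> 0"
    proof (rule tendsto_zeroI)
      fix e :: real assume "0 < e"
      then have "0 < e * (c / 2)" using c by simp
      from wq[OF this] w_ge q_pos show "\<forall>\<^sub>F n in sequentially. \<bar>(q n - w n) / w n\<bar> \<le> e"
      proof eventually_elim
        case (elim n)
        have "0 < c / 2 * sqrt (real n)" using elim c by simp
        then have w0: "0 < w n" using elim by linarith
        have "\<bar>q n - w n\<bar> \<le> e * (c / 2 * sqrt (real n))" using elim by (simp add: abs_minus_commute mult_ac)
        also have "\<dots> \<le> e * w n" using elim \<open>0 < e\<close> by (intro mult_left_mono) auto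
        finally show ?case using w0 by (simp add: field_simps)
      qed
    qed
    have "Zfun (\<lambda>n. (q n - w n) / w n * y n) sequentially"
      using 2 y_bdd by (intro bounded_bilinear.Zfun_prod_Bfun[OF bounded_bilinear_mult]) (simp_all add: tendsto_Zfun_iff)
    then have "(\<lambda>n. (q n - w n) / w n * y n) \<longlonglongrightarrow> 0" by (simp add: tendsto_Zfun_iff)
    from tendsto_add[OF 1 this] have "(\<lambda>n. (S n - D n) / (w n * tt n) + (q n - w n) / w n * y n) \<longlonglongrightarrow> 0" by simp
    then show ?thesis
    proof (rule Lim_transform_eventually)
      show "\<forall>\<^sub>F n in sequentially. (S n - D n) / (w n * tt n) + (q n - w n) / w n * y n = x n - y n"
        using w_ge q_pos
      proof eventually_elim
        case (elim n)
        have "0 < c / 2 * sqrt (real n)" using elim c by simp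
        then have "w n \<noteq> 0" "q n \<noteq> 0" "tt n \<noteq> 0" using elim tt_pos[of n] by auto
        then show ?case by (simp add: x_def y_def field_simps)
      qed
    qed
  qed
  have d_lim: "(\<lambda>n. (D (Suc n) - D n) / q (Suc n)) \<longlonglongrightarrow> 0"
  proof (rule tendsto_zeroI)
    fix e :: real assume "0 < e"
    then have "0 < e * c" using c by simp
    from step[OF this] q_pos show "\<forall>\<^sub>F n in sequentially. \<bar>(D (Suc n) - D n) / q (Suc n)\<bar> \<le> e"
    proof eventually_elim
      case (elim n)
      have "q n \<le> q (Suc n)" by (rule power2_le_imp_le) (use q_Suc[of n] q_nonneg in auto)
      then have "c * sqrt (real n) \<le> q (Suc n)" "0 < q (Suc n)" using elim by auto
      then have "\<bar>D (Suc n) - D n\<bar> \<le> e * q (Suc n)"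
      proof -
        have "e * (c * sqrt (real n)) \<le> e * q (Suc n)"
          using \<open>c * sqrt (real n) \<le> q (Suc n)\<close> \<open>0 < e\<close> by (intro mult_left_mono) auto
        then show ?thesis using elim(1) by (simp add: mult.assoc)
      qed
      then show ?case using \<open>0 < q (Suc n)\<close> by (simp add: field_simps)
    qed
  qed
  have ratio: "(\<lambda>n. q n / q (Suc n)) \<longlonglongrightarrow> 1"
  proof -
    have "(\<lambda>n. sqrt (1 - ((D (Suc n) - D n) / q (Suc n))\<^sup>2)) \<longlonglongrightarrow> sqrt (1 - 0\<^sup>2)"
      by (intro tendsto_intros d_lim)
    then have "(\<lambda>n. sqrt (1 - ((D (Suc n) - D n) / q (Suc n))\<^sup>2)) \<longlonglongrightarrow> 1" by simp
    then show ?thesis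
    proof (rule Lim_transform_eventually)
      show "\<forall>\<^sub>F n in sequentially. sqrt (1 - ((D (Suc n) - D n) / q (Suc n))\<^sup>2) = q n / q (Suc n)"
        using q_pos
      proof eventually_elim
        case (elim n)
        have "q n \<le> q (Suc n)" by (rule power2_le_imp_le) (use q_Suc[of n] q_nonneg in auto)
        then have pos: "0 < q (Suc n)" using elim by auto
        have "1 - ((D (Suc n) - D n) / q (Suc n))\<^sup>2 = (q n / q (Suc n))\<^sup>2"
        proof -
          have "(q (Suc n))\<^sup>2 \<noteq> 0" using pos by simp
          moreover have "(q n)\<^sup>2 = (q (Suc n))\<^sup>2 - (D (Suc n) - D n)\<^sup>2" using q_Suc[of n] by simp
          ultimately show ?thesis
            by (simp add: power_divide diff_divide_distrib[of "(q (Suc n))\<^sup>2"] del: power_eq_0_iff)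
        qed
        then show ?case using q_nonneg[of n] pos by simp
      qed
    qed
  qed
  have y_step: "(\<lambda>n. y (Suc n) - y n) \<longlonglongrightarrow> 0"
  proof -
    have "(\<lambda>n. 1 / tt (Suc n)) \<longlonglongrightarrow> 0"
      by (intro tendsto_divide_0[OF tendsto_const] filterlim_at_top_imp_at_infinity
          filterlim_compose[OF tt_at_top filterlim_Suc])
    from tendsto_mult[OF d_lim this]
    have 1: "(\<lambda>n. (D (Suc n) - D n) / q (Suc n) * (1 / tt (Suc n))) \<longlonglongrightarrow> 0" by simp
    have "(\<lambda>n. q n / q (Suc n) * (tt n / tt (Suc n)) - 1) \<longlonglongrightarrow> 1 * 1 - 1"
      by (intro tendsto_intros ratio tt_ratio)
    then have "Zfun (\<lambda>n. (q n / q (Suc n) * (tt n / tt (Suc n)) - 1) * y n) sequentially"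
      using y_bdd by (intro bounded_bilinear.Zfun_prod_Bfun[OF bounded_bilinear_mult]) (simp_all add: tendsto_Zfun_iff)
    then have "(\<lambda>n. (q n / q (Suc n) * (tt n / tt (Suc n)) - 1) * y n) \<longlonglongrightarrow> 0" by (simp add: tendsto_Zfun_iff)
    from tendsto_add[OF 1 this]
    have "(\<lambda>n. (D (Suc n) - D n) / q (Suc n) * (1 / tt (Suc n)) + (q n / q (Suc n) * (tt n / tt (Suc n)) - 1) * y n) \<longlonglongrightarrow> 0"
      by simp
    then show ?thesis
    proof (rule Lim_transform_eventually)
      show "\<forall>\<^sub>F n in sequentially. (D (Suc n) - D n) / q (Suc n) * (1 / tt (Suc n))
          + (q n / q (Suc n) * (tt n / tt (Suc n)) - 1) * y n = y (Suc n) - y n"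
        using q_pos
      proof eventually_elim
        case (elim n)
        have "q n \<le> q (Suc n)" by (rule power2_le_imp_le) (use q_Suc[of n] q_nonneg in auto)
        then have nz: "q (Suc n) \<noteq> 0" "q n \<noteq> 0" "tt n \<noteq> 0" "tt (Suc n) \<noteq> 0"
          using elim tt_pos[of n] tt_pos[of "Suc n"] by auto
        then have "q n / q (Suc n) * (tt n / tt (Suc n)) * y n = D n / (q (Suc n) * tt (Suc n))"
          by (simp add: y_def)
        moreover have "y (Suc n) = D (Suc n) / (q (Suc n) * tt (Suc n))" by (simp add: y_def)
        ultimately show ?case by (simp add: left_diff_distrib diff_divide_distrib)
      qed
    qed
  qed
  have "cluster_set x = {-1..1}"
  proof (rule cluster_set_eq_interval)
    fix e :: real assume e: "0 < e"
    then have e2: "0 < e / 2" by simp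
    have ev: "\<forall>\<^sub>F n in sequentially. \<bar>x n - y n\<bar> < e / 2 \<and> 0 < q n"
      using tendsto_zeroD[OF xy e2] q_pos by (auto elim: eventually_elim2)
    have "\<forall>\<^sub>F n in sequentially. \<bar>x n\<bar> \<le> 1 + e"
      using ev y_up[OF e2] by eventually_elim linarith
    then show "\<forall>\<^sub>\<infinity>n. \<bar>x n\<bar> \<le> 1 + e" by (simp add: cofinite_eq_sequentially)
    have ev': "\<forall>\<^sub>\<infinity>n. \<bar>x n - y n\<bar> < e / 2 \<and> 0 < q n" using ev by (simp add: cofinite_eq_sequentially)
    from INFM_conjI[OF hi[OF e2] ev'] show "\<exists>\<^sub>\<infinity>n. 1 - e \<le> x n"
    proof (rule INFM_mono)
      fix n assume *: "(1 - e / 2) * tt n * q n \<le> D n \<and> \<bar>x n - y n\<bar> < e / 2 \<and> 0 < q n"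
      then have "1 - e / 2 \<le> y n" using tt_pos[of n] by (simp add: y_def field_simps)
      then show "1 - e \<le> x n" using * by linarith
    qed
    from INFM_conjI[OF lo[OF e2] ev'] show "\<exists>\<^sub>\<infinity>n. x n \<le> - 1 + e"
    proof (rule INFM_mono)
      fix n assume *: "D n \<le> - ((1 - e / 2) * tt n * q n) \<and> \<bar>x n - y n\<bar> < e / 2 \<and> 0 < q n"
      then have "y n \<le> - (1 - e / 2)" using tt_pos[of n] by (simp add: y_def field_simps)
      then show "x n \<le> - 1 + e" using * by linarith
    qed
  next
    have "(\<lambda>n. (x (Suc n) - y (Suc n)) + (y (Suc n) - y n) - (x n - y n)) \<longlonglongrightarrow> 0 + 0 - 0"
      by (intro tendsto_intros LIMSEQ_Suc[OF xy] y_step xy)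
    then show "(\<lambda>n. x (Suc n) - x n) \<longlonglongrightarrow> 0" by simp
  qed
  then show ?thesis by (simp add: x_def[abs_def])
qed

text \<open>Telescoping: for consecutive square roots \<open>s\<close> and \<open>t\<close> one has
  \<open>1 / t \<le> 2 * (t - s)\<close>. It shows that the conditional means at level
  \<open>\<gamma>\<close> add up to \<open>O(sqrt n)\<close>, below the order
  \<open>sqrt n * tt n\<close>.\<close>

lemma sum_inverse_sqrt_le: "(\<Sum>i<n. 1 / sqrt (real (Suc i))) \<le> 2 * sqrt (real n)"
proof (induction n)
  case (Suc n)
  let ?s = "sqrt (real n)" and ?t = "sqrt (real (Suc n))"
  have t: "0 < ?t" "?s \<le> ?t" "?t * ?t = ?s * ?s + 1" by auto
  have "0 \<le> (?t - ?s)\<^sup>2" by simp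
  then have "2 * ?s * ?t + 1 \<le> 2 * ?t * ?t"
    using t(3) by (simp add: power2_eq_square algebra_simps)
  then have "2 * ?s + 1 / ?t \<le> 2 * ?t" using t(1) by (simp add: field_simps)
  then show ?case using Suc by simp
qed simp

lemma sum_null_sequence_le:
  fixes f :: "nat \<Rightarrow> real"
  assumes f: "f \<longlonglongrightarrow> 0" and e: "0 < e"
  shows "\<forall>\<^sub>F n in sequentially. (\<Sum>i<n. f i) \<le> e * real n"
proof -
  obtain N where N: "\<And>i. N \<le> i \<Longrightarrow> \<bar>f i\<bar> < e / 2"
    using tendsto_zeroD[OF f, of "e / 2"] e by (auto simp: eventually_sequentially)
  define A where "A = (\<Sum>i<N. \<bar>f i\<bar>)"
  obtain n1 :: nat where n1: "A / (e / 2) \<le> real n1" using real_arch_simple by blast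
  show ?thesis
    unfolding eventually_sequentially
  proof (intro exI allI impI)
    fix n assume n: "max N n1 \<le> n"
    have "(\<Sum>i<n. f i) = (\<Sum>i<N. f i) + (\<Sum>i\<in>{N..<n}. f i)"
      using n by (simp add: lessThan_atLeast0 sum.atLeastLessThan_concat)
    also have "(\<Sum>i<N. f i) \<le> A" unfolding A_def by (intro sum_mono) auto
    also have "(\<Sum>i\<in>{N..<n}. f i) \<le> (\<Sum>i\<in>{N..<n}. e / 2)"
    proof (rule sum_mono)
      fix i assume "i \<in> {N..<n}"
      then have "\<bar>f i\<bar> < e / 2" by (intro N) auto
      then show "f i \<le> e / 2" by linarith
    qed
    also have "\<dots> \<le> e / 2 * real n" using e by (simp add: of_nat_diff mult_left_mono)
    also have "A \<le> e / 2 * real n"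
    proof -
      have "A / (e / 2) \<le> real n" using n1 n by linarith
      then show ?thesis using e by (simp add: field_simps)
    qed
    finally show "(\<Sum>i<n. f i) \<le> e * real n" by simp
  qed
qed

context lil_decomposition
begin

lemma cluster_set_AE:
  "AE \<omega> in M. cluster_set (\<lambda>n. (\<Sum>i<n. Z i \<omega>) / (sqrt (\<Sum>i<n. (X i \<omega>)\<^sup>2) * tt n)) = {-1..1}"
proof -
  obtain n0 where "bounded_martingale_differences M F d \<beta> (c0 / 2) C0 n0" using bounded_d by blast
  then interpret D: bounded_martingale_differences M F d \<beta> "c0 / 2" C0 n0 .
  \<comment> \<open>A countable family of precisions, so that the exceptional null sets can be
    united; all of them lie in the ranges allowed by the upper and the lower half.\<close>
  define \<epsilon> where "\<epsilon> m = 1 / (2 + real m)" for m :: nat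
  have \<epsilon>: "0 < \<epsilon> m" "\<epsilon> m \<le> 1" "\<epsilon> m \<le> 1 / 2" for m
    by (simp_all add: \<epsilon>_def field_simps)
  have small: "\<exists>m. \<epsilon> m \<le> e" if e: "0 < e" for e
  proof -
    obtain m :: nat where "1 / e < real m" using reals_Archimedean2 by blast
    then have "\<epsilon> m \<le> e" using e unfolding \<epsilon>_def
      by (simp add: field_simps)
    then show ?thesis ..
  qed
  have "AE \<omega> in M. \<forall>m. (\<forall>\<^sub>F n in sequentially. \<bar>\<Sum>i<n. r i \<omega>\<bar> \<le> \<epsilon> m * (sqrt (real n) * tt n))"
    unfolding AE_all_countable using r_negligible \<epsilon> by blast
  moreover have "AE \<omega> in M. \<forall>m. (\<forall>\<^sub>F n in sequentially. \<bar>d.D n \<omega>\<bar> \<le> (1 + \<epsilon> m) * tt n * sqrt (d.Q n \<omega>))"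
    unfolding AE_all_countable using D.upper_LIL_abs \<epsilon> by blast
  moreover have "AE \<omega> in M. \<forall>m. (\<exists>\<^sub>\<infinity>n. (1 - \<epsilon> m) * tt n * sqrt (d.Q n \<omega>) \<le> d.D n \<omega>)"
    unfolding AE_all_countable using D.lower_LIL \<epsilon> by blast
  moreover have "AE \<omega> in M. \<forall>m. (\<exists>\<^sub>\<infinity>n. d.D n \<omega> \<le> - ((1 - \<epsilon> m) * tt n * sqrt (d.Q n \<omega>)))"
    unfolding AE_all_countable using D.lower_LIL_neg \<epsilon> by blast
  ultimately show ?thesis
    using D.Q_lower AE_eventually_truncated
  proof eventually_elim
    case (elim \<omega>)
    have lim: "filterlim (\<lambda>n. sqrt (real n) * tt n) at_top sequentially"
      by (intro filterlim_at_top_mult_at_top tt_at_top filterlim_compose[OF sqrt_at_top filterlim_real_sequentially])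
    show ?case
    \<comment> \<open>The constant comes from \<open>Q_lower\<close>, whose \<open>c / 16\<close> is
      \<open>c0 / 32\<close> for the variance bound \<open>c0 / 2\<close>.\<close>
    proof (rule self_normalized_cluster_set[where c = "sqrt (c0 / 32)" and D = "\<lambda>n. d.D n \<omega>" and q = "\<lambda>n. sqrt (d.Q n \<omega>)"])
      show "0 < sqrt (c0 / 32)" using c0(1) by simp
      show "\<forall>\<^sub>F n in sequentially. sqrt (c0 / 32) * sqrt (real n) \<le> sqrt (d.Q n \<omega>)"
        using elim(5) by eventually_elim (simp flip: real_sqrt_mult)
      fix e :: real assume e: "0 < e"
      obtain m where m: "\<epsilon> m \<le> e" using small[OF e] by blast
      show "\<forall>\<^sub>F n in sequentially. \<bar>d.D n \<omega>\<bar> \<le> (1 + e) * tt n * sqrt (d.Q n \<omega>)"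
        using elim(2)[rule_format, of m]
      proof eventually_elim
        case (elim n)
        have "(1 + \<epsilon> m) * tt n * sqrt (d.Q n \<omega>) \<le> (1 + e) * tt n * sqrt (d.Q n \<omega>)"
          using m tt_pos[of n] d.Q_nonneg by (intro mult_right_mono) auto
        then show ?case using elim by linarith
      qed
      have mono: "(1 - e) * tt n * sqrt (d.Q n \<omega>) \<le> (1 - \<epsilon> m) * tt n * sqrt (d.Q n \<omega>)" for n
        using m tt_pos[of n] d.Q_nonneg by (intro mult_right_mono) auto
      show "\<exists>\<^sub>\<infinity>n. (1 - e) * tt n * sqrt (d.Q n \<omega>) \<le> d.D n \<omega>"
        using elim(3)[rule_format, of m] by (rule INFM_mono) (rule order_trans[OF mono])
      show "\<exists>\<^sub>\<infinity>n. d.D n \<omega> \<le> - ((1 - e) * tt n * sqrt (d.Q n \<omega>))"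
        using elim(4)[rule_format, of m]
      proof (rule INFM_mono)
        fix n assume "d.D n \<omega> \<le> - ((1 - \<epsilon> m) * tt n * sqrt (d.Q n \<omega>))"
        then show "d.D n \<omega> \<le> - ((1 - e) * tt n * sqrt (d.Q n \<omega>))" using mono[of n] by linarith
      qed
      show "\<forall>\<^sub>F n in sequentially. \<bar>d.D (Suc n) \<omega> - d.D n \<omega>\<bar> \<le> e * sqrt (real n)"
      proof -
        have "0 < e / 2" using e by simp
        from \<beta>_small[OF this] have "\<forall>\<^sub>F n in sequentially. \<forall>i<Suc n. \<beta> i * tt (Suc n) \<le> e / 2 * sqrt (real (Suc n))"
          by (rule eventually_compose_filterlim[OF _ filterlim_Suc])
        then show ?thesis using eventually_gt_at_top[of 0]
        proof eventually_elim
          case (elim n)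
          have "\<bar>d.D (Suc n) \<omega> - d.D n \<omega>\<bar> \<le> \<beta> n" using d_le[of n \<omega>] by (simp add: d.D_Suc)
          also have "\<dots> \<le> \<beta> n * tt (Suc n)"
            using tt_ge_1[of "Suc n"] d_le[of n \<omega>] by (simp add: mult_le_cancel_left1)
          also have "\<dots> \<le> e / 2 * sqrt (real (Suc n))" using elim by auto
          also have "\<dots> \<le> e / 2 * (2 * sqrt (real n))"
          proof (intro mult_left_mono)
            have "sqrt (real (Suc n)) \<le> sqrt (4 * real n)" using elim by simp
            also have "\<dots> = 2 * sqrt (real n)" by (simp add: real_sqrt_mult)
            finally show "sqrt (real (Suc n)) \<le> 2 * sqrt (real n)" .
          qed (use e in simp)
          finally show ?case by simp
        qed
      qed
      \<comment> \<open>As \<open>X i = d i + \<mu> i\<close>, Minkowski's inequality bounds the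
        difference by the Euclidean norm of the conditional means. These tend to \<open>0\<close>,
        so their squares sum to \<open>o(n)\<close>.\<close>
      show "\<forall>\<^sub>F n in sequentially. \<bar>sqrt (\<Sum>i<n. (X i \<omega>)\<^sup>2) - sqrt (d.Q n \<omega>)\<bar> \<le> e * sqrt (real n)"
      proof -
        have "(\<lambda>i. (C0 / b (Suc i))\<^sup>2) \<longlonglongrightarrow> 0\<^sup>2" by (intro tendsto_intros C0_over_b_lim)
        then have "(\<lambda>i. (C0 / b (Suc i))\<^sup>2) \<longlonglongrightarrow> 0" by simp
        from sum_null_sequence_le[OF this, of "e\<^sup>2"] e
        have "\<forall>\<^sub>F n in sequentially. (\<Sum>i<n. (C0 / b (Suc i))\<^sup>2) \<le> e\<^sup>2 * real n" by simp
        then show ?thesis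
        proof eventually_elim
          case (elim n)
          have "(\<Sum>i<n. (\<mu> i \<omega>)\<^sup>2) \<le> (\<Sum>i<n. (C0 / b (Suc i))\<^sup>2)"
          proof (rule sum_mono)
            fix i
            have "\<bar>\<mu> i \<omega>\<bar>\<^sup>2 \<le> (C0 / b (Suc i))\<^sup>2" using \<mu>_le by (intro power_mono) auto
            then show "(\<mu> i \<omega>)\<^sup>2 \<le> (C0 / b (Suc i))\<^sup>2" by simp
          qed
          then have "sqrt (\<Sum>i<n. (\<mu> i \<omega>)\<^sup>2) \<le> sqrt (e\<^sup>2 * real n)" using elim by (intro real_sqrt_le_mono) linarith
          then have \<mu>L: "L2_set (\<lambda>i. \<mu> i \<omega>) {..<n} \<le> e * sqrt (real n)"
            using e by (simp add: L2_set_def real_sqrt_mult)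
          have "L2_set (\<lambda>i. X i \<omega>) {..<n} \<le> L2_set (\<lambda>i. d i \<omega>) {..<n} + L2_set (\<lambda>i. \<mu> i \<omega>) {..<n}"
            using L2_set_triangle_ineq[of "\<lambda>i. d i \<omega>" "\<lambda>i. \<mu> i \<omega>" "{..<n}"] by (simp add: d_def)
          moreover have "L2_set (\<lambda>i. d i \<omega>) {..<n} \<le> L2_set (\<lambda>i. X i \<omega>) {..<n} + L2_set (\<lambda>i. \<mu> i \<omega>) {..<n}"
            using L2_set_triangle_ineq[of "\<lambda>i. X i \<omega>" "\<lambda>i. - \<mu> i \<omega>" "{..<n}"] by (simp add: d_def L2_set_def)
          ultimately have "\<bar>L2_set (\<lambda>i. X i \<omega>) {..<n} - L2_set (\<lambda>i. d i \<omega>) {..<n}\<bar> \<le> e * sqrt (real n)"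
            using \<mu>L by linarith
          then show ?case by (simp add: L2_set_def d.Q_def)
        qed
      qed
      show "\<forall>\<^sub>F n in sequentially. \<bar>(\<Sum>i<n. Z i \<omega>) - d.D n \<omega>\<bar> \<le> e * (sqrt (real n) * tt n)"
      proof -
        have "0 < e / 3" using e by simp
        then obtain l where l: "\<epsilon> l \<le> e / 3" using small by blast
        obtain N where N: "\<And>i. N \<le> i \<Longrightarrow> clip (\<gamma> (Suc i)) (Z i \<omega>) = Z i \<omega>"
          using elim(6) by (auto simp: eventually_sequentially)
        define A where "A = (\<Sum>i<N. \<bar>Z i \<omega> - clip (\<gamma> (Suc i)) (Z i \<omega>)\<bar>)"
        have "\<forall>\<^sub>F n in sequentially. A / (e / 3) \<le> sqrt (real n) * tt n"
          using lim by (simp add: filterlim_at_top)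
        moreover have "\<forall>\<^sub>F n in sequentially. 2 * C0 / (e / 3) \<le> tt n"
          using tt_at_top by (simp add: filterlim_at_top)
        ultimately show ?thesis
          using elim(1)[rule_format, of l] eventually_ge_at_top[of N]
        proof eventually_elim
          case (elim n)
          \<comment> \<open>The conditional mean \<open>\<mu>\<close> has cancelled between
            \<open>d\<close> and \<open>r\<close>; only \<open>\<kappa>\<close> survives, whose
            bound is smaller and summed explicitly.\<close>
          have "Z i \<omega> = d i \<omega> + r i \<omega> + \<kappa> i \<omega> + (Z i \<omega> - clip (\<gamma> (Suc i)) (Z i \<omega>))" for i
            by (simp add: d_def r_def X_def \<rho>_def)
          then have "(\<Sum>i<n. Z i \<omega>) = (\<Sum>i<n. d i \<omega> + r i \<omega> + \<kappa> i \<omega> + (Z i \<omega> - clip (\<gamma> (Suc i)) (Z i \<omega>)))"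
            by (intro sum.cong refl)
          also have "\<dots> = d.D n \<omega> + (\<Sum>i<n. r i \<omega>) + (\<Sum>i<n. \<kappa> i \<omega>) + (\<Sum>i<n. Z i \<omega> - clip (\<gamma> (Suc i)) (Z i \<omega>))"
            by (simp add: sum.distrib d.D_def)
          finally have eq: "(\<Sum>i<n. Z i \<omega>) - d.D n \<omega>
            = (\<Sum>i<n. r i \<omega>) + (\<Sum>i<n. \<kappa> i \<omega>) + (\<Sum>i<n. Z i \<omega> - clip (\<gamma> (Suc i)) (Z i \<omega>))" by simp
          have T: "0 \<le> sqrt (real n) * tt n" using tt_pos[of n] by simp
          have 1: "\<bar>\<Sum>i<n. r i \<omega>\<bar> \<le> e / 3 * (sqrt (real n) * tt n)"
            using elim(3) mult_right_mono[OF l T] by linarith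
          have "\<bar>\<Sum>i<n. \<kappa> i \<omega>\<bar> \<le> (\<Sum>i<n. \<bar>\<kappa> i \<omega>\<bar>)" by (rule sum_abs)
          also have "\<dots> \<le> (\<Sum>i<n. C0 * (1 / sqrt (real (Suc i))))"
          proof (rule sum_mono)
            fix i
            have "C0 / \<gamma> (Suc i) \<le> C0 / sqrt (real (Suc i))"
              using C0(1) \<gamma>_pos[of i] tt_ge_1[of "Suc i"] unfolding \<gamma>_def
              by (intro divide_left_mono mult_pos_pos) (auto simp: mult_le_cancel_left1)
            then show "\<bar>\<kappa> i \<omega>\<bar> \<le> C0 * (1 / sqrt (real (Suc i)))" using \<kappa>_le[of i \<omega>] by simp
          qed
          also have "\<dots> = C0 * (\<Sum>i<n. 1 / sqrt (real (Suc i)))" by (simp only: sum_distrib_left)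
          also have "\<dots> \<le> C0 * (2 * sqrt (real n))" using C0(1) sum_inverse_sqrt_le by (intro mult_left_mono) auto
          also have "\<dots> \<le> e / 3 * (sqrt (real n) * tt n)"
          proof -
            have "2 * C0 \<le> e / 3 * tt n" using elim(2) e by (simp add: field_simps)
            from mult_right_mono[OF this, of "sqrt (real n)"] show ?thesis by (simp add: mult_ac)
          qed
          finally have 2: "\<bar>\<Sum>i<n. \<kappa> i \<omega>\<bar> \<le> e / 3 * (sqrt (real n) * tt n)" .
          have "(\<Sum>i<n. Z i \<omega> - clip (\<gamma> (Suc i)) (Z i \<omega>)) = (\<Sum>i<N. Z i \<omega> - clip (\<gamma> (Suc i)) (Z i \<omega>))"
            using N elim(4) by (intro sum.mono_neutral_right) auto
          then have "\<bar>\<Sum>i<n. Z i \<omega> - clip (\<gamma> (Suc i)) (Z i \<omega>)\<bar> \<le> A"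
            unfolding A_def by (simp only: sum_abs)
          also have "A \<le> e / 3 * (sqrt (real n) * tt n)" using elim(1) e by (simp add: field_simps)
          finally have 3: "\<bar>\<Sum>i<n. Z i \<omega> - clip (\<gamma> (Suc i)) (Z i \<omega>)\<bar> \<le> e / 3 * (sqrt (real n) * tt n)" .
          show ?case unfolding eq using 1 2 3 by linarith
        qed
      qed
    qed (use d.Q_nonneg in \<open>auto simp: d.Q_def d.D_Suc\<close>)
  qed
qed

end

lemma (in lil_sequence) cluster_set_AE:
  "AE \<omega> in M. cluster_set (\<lambda>n. (\<Sum>i<n. Z i \<omega>) / (sqrt (\<Sum>i<n. (clip (b (Suc i)) (Z i \<omega>))\<^sup>2) * tt n)) = {-1..1}"
proof -
  have *: "\<exists>\<mu>. \<mu> \<in> bmeas (F i) \<and> (\<forall>\<omega>. \<bar>\<mu> \<omega>\<bar> \<le> C0 / c) \<and>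
      (\<forall>G\<in>bmeas (F i). (\<integral>\<omega>. G \<omega> * \<mu> \<omega> \<partial>M) = (\<integral>\<omega>. G \<omega> * clip c (Z i \<omega>) \<partial>M))" if "0 < c" for c i
  proof -
    have "\<exists>\<mu>\<in>bmeas (F i). (\<forall>\<omega>. - (C0 / c) \<le> \<mu> \<omega> \<and> \<mu> \<omega> \<le> C0 / c) \<and>
        (\<forall>G\<in>bmeas (F i). (\<integral>\<omega>. G \<omega> * \<mu> \<omega> \<partial>M) = (\<integral>\<omega>. G \<omega> * clip c (Z i \<omega>) \<partial>M))"
      using mean[OF that] that by (intro conditional_expectation blip_clip) auto
    then obtain \<mu> where \<mu>: "\<mu> \<in> bmeas (F i)" "\<And>\<omega>. - (C0 / c) \<le> \<mu> \<omega>" "\<And>\<omega>. \<mu> \<omega> \<le> C0 / c"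
      "\<And>G. G \<in> bmeas (F i) \<Longrightarrow> (\<integral>\<omega>. G \<omega> * \<mu> \<omega> \<partial>M) = (\<integral>\<omega>. G \<omega> * clip c (Z i \<omega>) \<partial>M)"
      by blast
    have "\<bar>\<mu> \<omega>\<bar> \<le> C0 / c" for \<omega> using \<mu>(2,3)[of \<omega>] by linarith
    then show ?thesis using \<mu>(1,4) by blast
  qed
  have "\<exists>\<mu>. \<forall>i. \<mu> i \<in> bmeas (F i) \<and> (\<forall>\<omega>. \<bar>\<mu> i \<omega>\<bar> \<le> C0 / b (Suc i)) \<and>
      (\<forall>G\<in>bmeas (F i). (\<integral>\<omega>. G \<omega> * \<mu> i \<omega> \<partial>M) = (\<integral>\<omega>. G \<omega> * clip (b (Suc i)) (Z i \<omega>) \<partial>M))"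
    by (rule choice, rule allI, rule *[OF b_pos])
  then obtain \<mu> where \<mu>: "\<And>i. \<mu> i \<in> bmeas (F i) \<and> (\<forall>\<omega>. \<bar>\<mu> i \<omega>\<bar> \<le> C0 / b (Suc i)) \<and>
      (\<forall>G\<in>bmeas (F i). (\<integral>\<omega>. G \<omega> * \<mu> i \<omega> \<partial>M) = (\<integral>\<omega>. G \<omega> * clip (b (Suc i)) (Z i \<omega>) \<partial>M))"
    by blast
  have "\<exists>\<kappa>. \<forall>i. \<kappa> i \<in> bmeas (F i) \<and> (\<forall>\<omega>. \<bar>\<kappa> i \<omega>\<bar> \<le> C0 / \<gamma> (Suc i)) \<and>
      (\<forall>G\<in>bmeas (F i). (\<integral>\<omega>. G \<omega> * \<kappa> i \<omega> \<partial>M) = (\<integral>\<omega>. G \<omega> * clip (\<gamma> (Suc i)) (Z i \<omega>) \<partial>M))"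
    by (rule choice, rule allI, rule *[OF \<gamma>_pos])
  then obtain \<kappa> where \<kappa>: "\<And>i. \<kappa> i \<in> bmeas (F i) \<and> (\<forall>\<omega>. \<bar>\<kappa> i \<omega>\<bar> \<le> C0 / \<gamma> (Suc i)) \<and>
      (\<forall>G\<in>bmeas (F i). (\<integral>\<omega>. G \<omega> * \<kappa> i \<omega> \<partial>M) = (\<integral>\<omega>. G \<omega> * clip (\<gamma> (Suc i)) (Z i \<omega>) \<partial>M))"
    by blast
  interpret lil_decomposition M F Z U C0 c0 c1 S \<alpha> b \<mu> \<kappa>
    by unfold_locales (use \<mu> \<kappa> in blast)+
  show ?thesis using cluster_set_AE unfolding X_def .
qed

text \<open>A description by countable quantifiers, from which measurability of the event follows.
  The second clause says that every rational interval disjoint from \<open>[-1, 1]\<close> is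
  visited finitely often; infinitely many visits would produce a cluster point there by
  compactness.\<close>

lemma cluster_set_eq_interval_iff:
  "cluster_set x = {-1..1} \<longleftrightarrow>
    (\<forall>p::rat. \<bar>real_of_rat p\<bar> \<le> 1 \<longrightarrow> (\<forall>m::nat. \<forall>n0::nat. \<exists>n\<ge>n0. \<bar>x n - real_of_rat p\<bar> < 1 / real (Suc m))) \<and>
    (\<forall>p p'::rat. real_of_rat p' < -1 \<or> 1 < real_of_rat p \<longrightarrow>
      (\<exists>n0::nat. \<forall>n\<ge>n0. \<not> (real_of_rat p \<le> x n \<and> x n \<le> real_of_rat p')))"
  (is "_ \<longleftrightarrow> ?A \<and> ?B")
proof (intro iffI conjI)
  assume eq: "cluster_set x = {-1..1}"
  show ?A
  proof (intro allI impI)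
    fix p :: rat and m n0 :: nat assume "\<bar>real_of_rat p\<bar> \<le> 1"
    then have "- 1 \<le> real_of_rat p" "real_of_rat p \<le> 1" by linarith+
    then have "real_of_rat p \<in> cluster_set x" unfolding eq by (rule atLeastAtMost_iff[THEN iffD2, OF conjI])
    then have "\<exists>\<^sub>\<infinity>n. \<bar>x n - real_of_rat p\<bar> < 1 / real (Suc m)"
      unfolding cluster_set_iff by simp
    then show "\<exists>n\<ge>n0. \<bar>x n - real_of_rat p\<bar> < 1 / real (Suc m)" unfolding INFM_nat_le by blast
  qed
  show ?B
  proof (intro allI impI, rule ccontr)
    fix p p' :: rat
    assume out: "real_of_rat p' < -1 \<or> 1 < real_of_rat p"
    let ?I = "{real_of_rat p..real_of_rat p'}"
    assume "\<not> (\<exists>n0. \<forall>n\<ge>n0. \<not> (real_of_rat p \<le> x n \<and> x n \<le> real_of_rat p'))"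
    then have "\<forall>n0. \<exists>n\<ge>n0. x n \<in> ?I" by auto
    then have inf: "infinite {n. x n \<in> ?I}" unfolding infinite_nat_iff_unbounded_le by auto
    define r where "r = enumerate {n. x n \<in> ?I}"
    have r: "strict_mono r" unfolding r_def using inf by (rule strict_mono_enumerate)
    have "x (r n) \<in> ?I" for n unfolding r_def using enumerate_in_set[OF inf, of n] by simp
    \<comment> \<open>Bolzano-Weierstrass along the visits to the interval; the limit stays in it,
      hence outside \<open>[-1, 1]\<close>.\<close>
    then obtain l s where l: "l \<in> ?I" "strict_mono s" "((x \<circ> r) \<circ> s) \<longlonglongrightarrow> l"
      using compact_Icc[of "real_of_rat p" "real_of_rat p'"] unfolding compact_def
      by (metis comp_apply)
    have "l \<in> cluster_set x"
      unfolding cluster_set_def using l strict_mono_o[OF r l(2)]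
      by (auto intro!: exI[of _ "r \<circ> s"] simp: comp_assoc)
    then have "- 1 \<le> l" "l \<le> 1" unfolding eq by simp_all
    moreover have "real_of_rat p \<le> l" "l \<le> real_of_rat p'" using l(1) by simp_all
    ultimately show False using out by linarith
  qed
next
  assume AB: "?A \<and> ?B"
  show "cluster_set x = {-1..1}"
  proof (intro set_eqI iffI)
    fix l assume l: "l \<in> cluster_set x"
    show "l \<in> {-1..1}"
    proof (rule ccontr)
      assume "l \<notin> {-1..1}"
      then have "l < -1 \<or> 1 < l" by auto
      then obtain p p' :: rat where p: "real_of_rat p < l" "l < real_of_rat p'"
        "real_of_rat p' < -1 \<or> 1 < real_of_rat p"
      proof
        assume "l < -1"
        then obtain p' where "l < real_of_rat p'" "real_of_rat p' < -1" using of_rat_dense by blast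
        moreover obtain p where "real_of_rat p < l" using of_rat_dense[of "l - 1" l] by auto
        ultimately show thesis using that by blast
      next
        assume "1 < l"
        then obtain p where "1 < real_of_rat p" "real_of_rat p < l" using of_rat_dense by blast
        moreover obtain p' where "l < real_of_rat p'" using of_rat_dense[of l "l + 1"] by auto
        ultimately show thesis using that by blast
      qed
      define e where "e = min (l - real_of_rat p) (real_of_rat p' - l)"
      have "0 < e" using p by (simp add: e_def)
      then have freq: "\<exists>\<^sub>\<infinity>n. \<bar>x n - l\<bar> < e" using l unfolding cluster_set_iff by blast
      obtain n0 where n0: "\<forall>n\<ge>n0. \<not> (real_of_rat p \<le> x n \<and> x n \<le> real_of_rat p')" using AB p(3) by blast
      obtain n where "n0 \<le> n" "\<bar>x n - l\<bar> < e" using freq unfolding INFM_nat_le by blast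
      then have "real_of_rat p \<le> x n \<and> x n \<le> real_of_rat p'" unfolding e_def by linarith
      then show False using n0 \<open>n0 \<le> n\<close> by blast
    qed
  next
    fix l :: real assume l: "l \<in> {-1..1}"
    show "l \<in> cluster_set x"
      unfolding cluster_set_iff INFM_nat_le
    proof (intro allI impI)
      fix e :: real and n0 :: nat assume e: "0 < e"
      have "max (-1) (l - e / 2) < min 1 (l + e / 2)" using l e by auto
      then obtain p where p: "max (-1) (l - e / 2) < real_of_rat p" "real_of_rat p < min 1 (l + e / 2)"
        using of_rat_dense by blast
      obtain m where m: "1 / real (Suc m) < e / 2"
        using reals_Archimedean[of "e / 2"] e by (auto simp: inverse_eq_divide)
      have "\<bar>real_of_rat p\<bar> \<le> 1" using p by linarith
      then obtain n where "n0 \<le> n" "\<bar>x n - real_of_rat p\<bar> < 1 / real (Suc m)" using AB by blast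
      moreover have "\<bar>real_of_rat p - l\<bar> < e / 2" using p by linarith
      ultimately have "n0 \<le> n" "\<bar>x n - l\<bar> < e" using m by linarith+
      then show "\<exists>n\<ge>n0. \<bar>x n - l\<bar> < e" by blast
    qed
  qed
qed

lemma sets_cluster_set_eq_interval:
  assumes [measurable]: "\<And>n. x n \<in> borel_measurable N"
  shows "{\<omega> \<in> space N. cluster_set (\<lambda>n. x n \<omega>) = {-1..1}} \<in> sets N"
  unfolding cluster_set_eq_interval_iff by measurable

lemma (in sublinear_expectation_space) cluster_set_AE:
  assumes rep: "represents_on_bounded M H E \<P>" and P: "P \<in> \<P>" and iid: "iid_sequence H E Y"
    and cap: "associated_capacity M H E V"
    and choquet: "choquet_integral M V (\<lambda>\<omega>. (Y 1 \<omega>)\<^sup>2 / log_e (log_e \<bar>Y 1 \<omega>\<bar>)) < \<infinity>"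
    and mean: "has_breve_expectation E (Y 1) 0" "has_breve_expectation E (\<lambda>\<omega>. - Y 1 \<omega>) 0"
    and var: "lower_variance E (Y 1) > 0" "upper_variance E (Y 1) < \<infinity>"
    and b: "\<And>j. b j = \<alpha> j * sqrt (real j) / tt j" and \<alpha>_pos: "\<And>j. 1 \<le> j \<Longrightarrow> 0 < \<alpha> j"
    and \<alpha>_lim: "\<alpha> \<longlonglongrightarrow> 0" and b_mono: "mono_on {1..} b" and b_lim: "filterlim b at_top sequentially"
    and \<alpha>_ge: "\<forall>\<^sub>F j in sequentially. 1 \<le> \<alpha> j * (tt j)\<^sup>2"
  shows "AE \<omega> in P. cluster_set (\<lambda>n. (\<Sum>i<n. Y (Suc i) \<omega>) /
    (sqrt (\<Sum>i<n. (clip (b (Suc i)) (Y (Suc i) \<omega>))\<^sup>2) * tt n)) = {-1..1}"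
proof -
  have Y1: "Y 1 \<in> H" using iid by (simp add: iid_sequence_def)
  obtain C0 where C0: "0 < C0" "\<And>c. 0 \<le> c \<Longrightarrow> upper (Y 1) (\<lambda>x. (clip c x)\<^sup>2) \<le> C0"
    using upper_variance_bound[OF Y1 var(2)] by blast
  obtain c0 c1 where c0: "0 < c0" "\<And>c. c1 \<le> c \<Longrightarrow> c0 \<le> - upper (Y 1) (\<lambda>x. - (clip c x)\<^sup>2)"
    using lower_variance_bound[OF Y1 var(1)] by blast
  obtain S where S: "\<And>n. (\<Sum>i<n. upper (Y 1) (ramp i) * level i) \<le> S"
    using choquet_level_sum[OF Y1 cap choquet] by blast
  interpret F: filtered_prob_space P "history M Y" by (rule filtered_P[OF rep P iid])
  interpret lil_sequence P "history M Y" "\<lambda>i. Y (Suc i)" "upper (Y 1)" C0 c0 c1 S \<alpha> b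
  proof
    show "Y (Suc i) \<in> borel_measurable (history M Y (Suc i))" for i
      by (rule history_coordinate) simp
    show "(\<integral>\<omega>. indicator A \<omega> * \<phi> (Y (Suc i) \<omega>) \<partial>P) \<le> upper (Y 1) \<phi> * measure P A"
      if "blip \<phi>" "A \<in> sets (history M Y i)" for \<phi> i A
      using that by (rule conditional_upper[OF rep P iid])
    show "upper (Y 1) (clip c) \<le> C0 / c" "upper (Y 1) (\<lambda>x. - clip c x) \<le> C0 / c" if "0 < c" for c
      using upper_clip_le[OF Y1 mean C0(2) that] by blast+
    show "0 \<le> upper (Y 1) (ramp i)" for i
      by (rule upper_nonneg[OF Y1 blip_ramp ramp_nonneg])
  qed (fact C0 c0 S b \<alpha>_pos \<alpha>_lim b_mono b_lim \<alpha>_ge)+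
  show ?thesis by (rule cluster_set_AE)
qed

theorem proposition3p1:
  fixes M :: "'a measure"
    and H :: "('a \<Rightarrow> real) set"
    and E :: "('a \<Rightarrow> real) \<Rightarrow> ereal"
    and V :: "'a set \<Rightarrow> real"
    and \<P> :: "'a measure set"
    and Y :: "nat \<Rightarrow> 'a \<Rightarrow> real"
    and p :: real
    and t \<alpha> b :: "nat \<Rightarrow> real"
    and W :: "nat \<Rightarrow> 'a \<Rightarrow> real"
  assumes space: "sublinear_expectation_space M H E"
    and capacity: "associated_capacity M H E V"
    and iid: "iid_sequence H E Y"
    and p: "p > 2"
    and t: "\<And>j. t j = sqrt (2 * log_e (log_e (real j)))"
    and b: "\<And>j. b j = \<alpha> j * sqrt (real j) / sqrt (2 * log_e (log_e (real j)))"
    and alpha_pos: "\<And>j. j \<ge> 1 \<Longrightarrow> \<alpha> j > 0"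
    and alpha_lim: "\<alpha> \<longlonglongrightarrow> 0"
    and b_mono: "mono_on {1..} b"
    and b_lim: "filterlim b at_top sequentially"
    and alpha_t: "(\<lambda>j. \<alpha> j powr (1 - p) * t j powr (- 2)) \<longlonglongrightarrow> 0"
    and W: "\<And>n \<omega>. W n \<omega> = sqrt (\<Sum>j=1..n. min ((Y j \<omega>)\<^sup>2) ((b j)\<^sup>2))"
    and representation: "represents_on_bounded M H E \<P>"
    and choquet: "choquet_integral M V (\<lambda>\<omega>. (Y 1 \<omega>)\<^sup>2 / log_e (log_e \<bar>Y 1 \<omega>\<bar>)) < \<infinity>"
    and mean_upper: "has_breve_expectation E (Y 1) 0"
    and mean_lower: "has_breve_expectation E (\<lambda>\<omega>. - Y 1 \<omega>) 0"
    and var_lower: "lower_variance E (Y 1) > 0"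
    and var_upper: "upper_variance E (Y 1) < \<infinity>"
  shows "lower_capacity \<P>
           {\<omega> \<in> space M.
              cluster_set (\<lambda>n. (\<Sum>i=1..n. Y i \<omega>) / (W n \<omega> * sqrt (2 * log_e (log_e (real n))))) = {-1..1}} = 1"
proof -
  interpret sublinear_expectation_space M H E by (rule space)
  have t_eq: "t = tt" by (intro ext) (simp add: t tt_def)
  have b_eq: "b j = \<alpha> j * sqrt (real j) / tt j" for j by (simp add: b tt_def)
  have b_pos: "0 < b (Suc i)" for i using alpha_pos[of "Suc i"] tt_pos[of "Suc i"] by (simp add: b_eq)
  \<comment> \<open>Once \<open>\<alpha> j < 1\<close>, the condition \<open>p > 2\<close> gives
    \<open>1 / \<alpha> j \<le> \<alpha> j powr (1 - p)\<close>, so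
    \<open>1 / (\<alpha> j * (tt j)\<^sup>2)\<close> is eventually below \<open>1\<close>.\<close>
  have \<alpha>_ge: "\<forall>\<^sub>F j in sequentially. 1 \<le> \<alpha> j * (tt j)\<^sup>2"
    using order_tendstoD(2)[OF alpha_t zero_less_one] order_tendstoD(2)[OF alpha_lim zero_less_one]
      eventually_ge_at_top[of 1]
  proof eventually_elim
    case (elim j)
    have a: "0 < \<alpha> j" using alpha_pos elim by simp
    have "\<alpha> j powr (- 1) \<le> \<alpha> j powr (1 - p)" using elim a p by (intro powr_mono') auto
    then have "inverse (\<alpha> j) \<le> \<alpha> j powr (1 - p)" using a by (simp add: powr_minus)
    moreover have "tt j powr (- 2) = inverse ((tt j)\<^sup>2)"
      using tt_pos[of j] by (simp add: powr_minus)
    ultimately have "inverse (\<alpha> j) * inverse ((tt j)\<^sup>2) \<le> \<alpha> j powr (1 - p) * t j powr (- 2)"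
      unfolding t_eq by (intro mult_mono) auto
    then have "inverse (\<alpha> j * (tt j)\<^sup>2) \<le> 1" using elim by simp
    moreover have "0 < \<alpha> j * (tt j)\<^sup>2" using a tt_pos[of j] by simp
    ultimately show ?case unfolding inverse_le_1_iff by linarith
  qed
  define x where "x n \<omega> = (\<Sum>i=1..n. Y i \<omega>) / (W n \<omega> * sqrt (2 * LL (real n)))" for n \<omega>
  \<comment> \<open>Passes to indices from \<open>0\<close> and writes the truncated squares as
    squares of truncations, which is possible because \<open>b\<close> is positive.\<close>
  have x_eq: "x n \<omega> = (\<Sum>i<n. Y (Suc i) \<omega>) / (sqrt (\<Sum>i<n. (clip (b (Suc i)) (Y (Suc i) \<omega>))\<^sup>2) * tt n)" for n \<omega>
    using b_pos by (simp add: x_def W tt_def sum.atLeast1_atMost_eq clip_sq less_imp_le)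
  define A where "A = {\<omega> \<in> space M. cluster_set (\<lambda>n. x n \<omega>) = {-1..1}}"
  have one: "measure P A = 1" if P: "P \<in> \<P>" for P
  proof -
    note ctx = representation P iid
    interpret P: prob_space P by (rule prob_space_P[OF ctx])
    have [measurable]: "Y (Suc i) \<in> borel_measurable P" for i by (rule Y_measurable[OF ctx])
    have "x n \<in> borel_measurable P" for n
      unfolding x_eq[abs_def] clip_def by measurable
    from sets_cluster_set_eq_interval[OF this] have "A \<in> sets P"
      by (simp add: A_def space_P[OF ctx])
    moreover have "AE \<omega> in P. \<omega> \<in> A"
    proof -
      have "AE \<omega> in P. cluster_set (\<lambda>n. x n \<omega>) = {-1..1}"
        unfolding x_eq
        by (rule cluster_set_AE[OF ctx capacity choquet mean_upper mean_lower var_lower var_upper b_eq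
              _ alpha_lim b_mono b_lim \<alpha>_ge]) (rule alpha_pos)
      then show ?thesis
        using AE_space by eventually_elim (simp add: A_def space_P[OF ctx])
    qed
    ultimately show ?thesis by (simp add: P.prob_eq_1)
  qed
  \<comment> \<open>The infimum of an empty set of reals has no meaningful value. Over an empty
    family the supremum representing \<open>E 0\<close> would be \<open>- \<infinity>\<close>,
    whereas \<open>E 0 = 0\<close>.\<close>
  have "\<P> \<noteq> {}"
  proof
    assume "\<P> = {}"
    moreover have "E (\<lambda>\<omega>. 0) = (SUP P\<in>\<P>. ereal (\<integral>\<omega>. 0 \<partial>P))"
      using representation H_zero unfolding represents_on_bounded_def by fastforce
    ultimately show False by (simp add: E_const bot_ereal_def)
  qed
  then have "lower_capacity \<P> A = 1" by (simp add: lower_capacity_def one)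
  then show ?thesis by (simp add: A_def x_def)
qed

end
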